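(* For all constants $c_0,c_1>1$, $K_0\ge1$ and $K_1>0$ there exists a constant $H>1$, depending only on $c_0,c_1,K_0,K_1$, such that the following holds. Let $(S,\Omega)$ be a relative Sierpiński carpet with quasiball constant $K_0$ and fatness constant $K_1$. If $u:S\to\mathbb R$ is a non-negative (normalized) carpet-harmonic function, then $$\sup_{z\in S\cap B_0}u(z)\le H\inf_{z\in S\cap B_0}u(z)$$ for all balls $B_0\subset\Omega$ with the property that there exists a ball $B_1\subset\Omega$ such that $$\bigcup_{i:Q_i\cap c_0B_0\ne\emptyset}Q_i\subset B_1\subset c_1B_1\subset\subset\Omega.$$
   Context: Relative Sierpiński carpets. Let $\Omega\subset\mathbb C$ be a connected open set and $\{Q_i\}_{i\in\mathbb N}$ open Jordan regions compactly contained in $\Omega$, with pairwise disjoint closures, such that $S:=\Omega\setminus\bigcup_iQ_i$ has empty interior and is locally connected. Then $(S,\Omega)$ is a relative Sierpiński carpet with peripheral disks $Q_i$. Standing assumptions on every relative Sierpiński carpet: (i) $\mathcal H^2(S)=0$; (ii) there is a quasiball constant $K_0\ge1$ such that for each $i$ there are concentric balls $B(x,r)\subset Q_i\subset B(x,R)$ with $R/r\le K_0$; (iii) there is a fatness constant $K_1>0$ such that $\mathcal H^2(B(x,r)\cap Q_i)\ge K_1r^2$ for all $i$, $x\in Q_i$, $0<r<\operatorname{diam}(Q_i)$. $\mathcal H^m$ is Hausdorff measure normalized to agree with Lebesgue measure. Notation. For $B=B(x,r)$, $cB=B(x,cr)$. $\widehat{\mathbb R}=\mathbb R\cup\{\pm\infty\}$.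 $V\subset\subset\Omega$: $\overline V$ is compact and contained in $\Omega$. $I_V=\{i:Q_i\cap V\ne\emptyset\}$. $S^\circ$: points of $S$ on no $\partial Q_i$. A path is a continuous map from a bounded interval to $\mathbb C$ with a continuous extension to the closed interval (also its image); it is open if the interval is open; subpaths are restrictions to subintervals. For $g:S\to\widehat{\mathbb R}$: $M_{Q_i}(g)=\sup_{\partial Q_i}g$, $m_{Q_i}(g)=\inf_{\partial Q_i}g$, $\operatorname{osc}_{Q_i}(g)=M_{Q_i}(g)-m_{Q_i}(g)$. Moduli of a path family $\Gamma$ in $\Omega$. $\mathrm{mod}_2(\Gamma)=\inf\int\lambda^2d\mathcal H^2$ over Borel $\lambda\ge0$ with $\int_\gamma\lambda\,ds\ge1$ for all $\gamma\in\Gamma$ (with $\int_\gamma\lambda\,ds:=\infty$ if $\gamma$ is not locally rectifiable). Weak modulus $\mathrm{mod}_w(\Gamma)=\inf\sum_i\rho(Q_i)^2$ over non-negative sequences for which there is $\Gamma_0\subset\Gamma$ with $\mathrm{mod}_2(\Gamma_0)=0$ and $\sum_{i:Q_i\cap\gamma\ne\emptyset}\rho(Q_i)\ge1$ for $\gamma\in\Gamma\setminus\Gamma_0$. Strong modulus $\mathrm{mod}_s(\Gamma)$: the same infimum over sequences satisfying this inequality for all $\gamma\in\Gamma$ with $\mathcal H^1(\gamma\cap S)=0$. Sobolev spaces. $\{\rho(Q_i)\}$ is a weak (strong) upper gradient of $g:S\to\widehat{\mathbb R}$ if there is $\Gamma_0$ with $\mathrm{mod}_w(\Gamma_0)=0$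 ($\mathrm{mod}_s(\Gamma_0)=0$) such that for all paths $\gamma\subset\Omega$, $\gamma\notin\Gamma_0$, and $x,y\in\gamma\cap S$: $g(x),g(y)\neq\pm\infty$ and $|g(x)-g(y)|\le\sum_{i:Q_i\cap\gamma\ne\emptyset}\rho(Q_i)$. $g\in\mathcal W^{1,2}_{\mathrm{loc}}(S)$ if $M_{Q_i}(g),m_{Q_i}(g)$ are finite for all $i$, $\sum_{i\in I_B}M_{Q_i}(g)^2\operatorname{diam}(Q_i)^2<\infty$ and $\sum_{i\in I_B}\operatorname{osc}_{Q_i}(g)^2<\infty$ for every ball $B\subset\subset\Omega$, and $\{\operatorname{osc}_{Q_i}(g)\}$ is an upper gradient of $g$; $g\in\mathcal W^{1,2}(S)$ if moreover the sums over all $i\in\mathbb N$ are finite. There is a weak and a strong version; the statement holds for each, with one version fixed throughout. Dirichlet energy: $D_V(g)=\sum_{i\in I_V}\operatorname{osc}_{Q_i}(g)^2$. $u\in\mathcal W^{1,2}_{\mathrm{loc}}(S)$ is carpet-harmonic if $D_V(u)\le D_V(u+\zeta)$ for every open $V\subset\subset\Omega$ and $\zeta\in\mathcal W^{1,2}(S)$ with $\zeta|_{S\setminus V}\equiv0$. Normalized functions. For $g\in\mathcal W^{1,2}_{\mathrm{loc}}(S)$ let $\hat g(Q_i)=M_{Q_i}(g)$. Let $\mathcal G_{\hat g}$ be the family of non-constant paths $\gamma\subset\Omega$ with: $\mathcal H^1(\gamma\cap S)=0$; for every subpath $\gamma'$ of $\gamma$ and $Q_{i_1},Q_{i_2}$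 meeting $\gamma'$, $|\hat g(Q_{i_1})-\hat g(Q_{i_2})|\le\sum_{i:Q_i\cap\gamma'\neq\emptyset}\operatorname{osc}_{Q_i}(g)$; $\sum_{i:Q_i\cap\gamma'\ne\emptyset}\operatorname{osc}_{Q_i}(g)<\infty$ for subpaths $\gamma'\subset\subset\Omega$; and, if $\sum_{i\in\mathbb N}\operatorname{osc}_{Q_i}(g)^2<\infty$, also $\sum_{i:Q_i\cap\gamma\ne\emptyset}\operatorname{osc}_{Q_i}(g)<\infty$. A point $x\in S$ is accessible by $\gamma_0$ if $x\in\gamma_0\cap S^\circ$ (put $\gamma=\gamma_0$), or there is an open subpath $\gamma$ of $\gamma_0$ with $x\in\overline\gamma\setminus\gamma$ and $\gamma\cap Q_{i_0}=\emptyset$ whenever $x\in\partial Q_{i_0}$. The normalized version $\tilde g$ of $g$ is: $\tilde g(x)=\liminf_{Q_i\to x,\,Q_i\cap\gamma\ne\emptyset}\hat g(Q_i)$ if $x$ is accessible by a path $\gamma_0\in\mathcal G_{\hat g}$, where $\gamma=\gamma_0$ if $x\in\gamma_0\cap S^\circ$, and otherwise $\gamma$ is an open subpath of $\gamma_0$ with $x\in\overline\gamma\setminus\gamma$ and $\gamma\cap Q_{i_0}=\emptyset$ whenever $x\in\partial Q_{i_0}$ (the value is independent of $\gamma$); for non-accessible $x\in\partial Q_{i_0}$, $\tilde g(x)=\liminf\tilde g(y)$ as $y\to x$ through accessible $y\in\partial Q_{i_0}$; for all other $x$, $\tilde g(x)=\liminf\tilde g(y)$ as $y\to x$ through accessible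 $y$. A function is normalized if it equals the normalized version of some function in the Sobolev space. Standing convention: carpet-harmonic functions are normalized. *)

theory Defs
  imports "HOL-Analysis.Analysis"
begin

section \<open>Relative Sierpinski carpets\<close>

definition compactly_in :: "complex set \<Rightarrow> complex set \<Rightarrow> bool" where
  "compactly_in V \<Omega> \<longleftrightarrow> compact (closure V) \<and> closure V \<subseteq> \<Omega>"

definition open_Jordan_region :: "complex set \<Rightarrow> bool" where
  "open_Jordan_region U \<longleftrightarrow>
     (\<exists>c. simple_path c \<and> pathfinish c = pathstart c \<and> U = inside (path_image c))"

definition carpet :: "complex set \<Rightarrow> (nat \<Rightarrow> complex set) \<Rightarrow> complex set" where
  "carpet \<Omega> Q = \<Omega> - (\<Union>i. Q i)"

definition relative_carpet :: "complex set \<Rightarrow> (nat \<Rightarrow> complex set) \<Rightarrow> bool" where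
  "relative_carpet \<Omega> Q \<longleftrightarrow>
     open \<Omega> \<and> connected \<Omega> \<and>
     (\<forall>i. open_Jordan_region (Q i) \<and> compactly_in (Q i) \<Omega>) \<and>
     (\<forall>i j. i \<noteq> j \<longrightarrow> closure (Q i) \<inter> closure (Q j) = {}) \<and>
     interior (carpet \<Omega> Q) = {} \<and> locally connected (carpet \<Omega> Q)"

text \<open>Two-dimensional Hausdorff measure is normalized so as to be Lebesgue measure; it is written
  \<^term>\<open>lborel\<close> throughout.\<close>

definition quasiballs :: "real \<Rightarrow> (nat \<Rightarrow> complex set) \<Rightarrow> bool" where
  "quasiballs K0 Q \<longleftrightarrow>
     (\<forall>i. \<exists>x r R. 0 < r \<and> ball x r \<subseteq> Q i \<and> Q i \<subseteq> ball x R \<and> R / r \<le> K0)"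

definition fat :: "real \<Rightarrow> (nat \<Rightarrow> complex set) \<Rightarrow> bool" where
  "fat K1 Q \<longleftrightarrow>
     (\<forall>i. \<forall>x\<in>Q i. \<forall>r. 0 < r \<and> r < diameter (Q i) \<longrightarrow>
        ennreal (K1 * r\<^sup>2) \<le> emeasure lborel (ball x r \<inter> Q i))"

definition standing_carpet ::
    "real \<Rightarrow> real \<Rightarrow> complex set \<Rightarrow> (nat \<Rightarrow> complex set) \<Rightarrow> bool" where
  "standing_carpet K0 K1 \<Omega> Q \<longleftrightarrow>
     relative_carpet \<Omega> Q \<and> emeasure lborel (carpet \<Omega> Q) = 0 \<and> quasiballs K0 Q \<and> fat K1 Q"

definition meeting :: "(nat \<Rightarrow> complex set) \<Rightarrow> complex set \<Rightarrow> nat set" where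
  "meeting Q V = {i. Q i \<inter> V \<noteq> {}}"

definition carpet_core :: "complex set \<Rightarrow> (nat \<Rightarrow> complex set) \<Rightarrow> complex set" where
  "carpet_core \<Omega> Q = carpet \<Omega> Q - (\<Union>i. frontier (Q i))"


section \<open>Paths, length, line integrals\<close>

text \<open>A pair \<open>(I, c)\<close> stands for the path \<open>c\<close> restricted to \<open>I\<close>; on the endpoints of \<open>I\<close> that do not
  belong to \<open>I\<close>, \<open>c\<close> carries the continuous extension. Values of \<open>c\<close> outside the closure of \<open>I\<close> are
  irrelevant to every notion below.\<close>

type_synonym cpath = "real set \<times> (real \<Rightarrow> complex)"

definition is_cpath :: "cpath \<Rightarrow> bool" where
  "is_cpath \<gamma> \<longleftrightarrow> is_interval (fst \<gamma>) \<and> bounded (fst \<gamma>) \<and> fst \<gamma> \<noteq> {} \<and>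
     continuous_on (closure (fst \<gamma>)) (snd \<gamma>)"

definition trace :: "cpath \<Rightarrow> complex set" where
  "trace \<gamma> = snd \<gamma> ` fst \<gamma>"

definition paths_in :: "complex set \<Rightarrow> cpath set" where
  "paths_in \<Omega> = {\<gamma>. is_cpath \<gamma> \<and> trace \<gamma> \<subseteq> \<Omega>}"

definition subpaths :: "cpath \<Rightarrow> cpath set" where
  "subpaths \<gamma> = {(J, snd \<gamma>) | J. J \<subseteq> fst \<gamma> \<and> is_interval J \<and> J \<noteq> {}}"

definition open_subpaths :: "cpath \<Rightarrow> cpath set" where
  "open_subpaths \<gamma> = {\<gamma>' \<in> subpaths \<gamma>. open (fst \<gamma>')}"

definition nonconstant :: "cpath \<Rightarrow> bool" where
  "nonconstant \<gamma> \<longleftrightarrow> (\<exists>s\<in>fst \<gamma>. \<exists>t\<in>fst \<gamma>. snd \<gamma> s \<noteq> snd \<gamma> t)"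

definition arc_length :: "(real \<Rightarrow> complex) \<Rightarrow> real \<Rightarrow> real \<Rightarrow> ennreal" where
  "arc_length c a b =
     (SUP (n, t) \<in> {(n :: nat, t :: nat \<Rightarrow> real). mono_on {..n} t \<and> t ` {..n} \<subseteq> {a..b}}.
        \<Sum>k<n. ennreal (dist (c (t k)) (c (t (Suc k)))))"

definition locally_rectifiable :: "cpath \<Rightarrow> bool" where
  "locally_rectifiable \<gamma> \<longleftrightarrow>
     (\<forall>a\<in>fst \<gamma>. \<forall>b\<in>fst \<gamma>. a \<le> b \<longrightarrow> arc_length (snd \<gamma>) a b < \<infinity>)"

text \<open>The arc length parametrization of \<open>c\<close> on \<open>{a..b}\<close>; the value does not depend on the parameter
  chosen, because \<open>c\<close> is constant between two parameters of equal arc length.\<close>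

definition arc_param :: "(real \<Rightarrow> complex) \<Rightarrow> real \<Rightarrow> real \<Rightarrow> real \<Rightarrow> complex" where
  "arc_param c a b s = c (SOME t. t \<in> {a..b} \<and> arc_length c a t = ennreal s)"

definition compact_line_integral ::
    "(real \<Rightarrow> complex) \<Rightarrow> real \<Rightarrow> real \<Rightarrow> (complex \<Rightarrow> ennreal) \<Rightarrow> ennreal" where
  "compact_line_integral c a b \<sigma> =
     (\<integral>\<^sup>+ s \<in> {0..enn2real (arc_length c a b)}. \<sigma> (arc_param c a b s) \<partial>lborel)"

definition line_integral :: "cpath \<Rightarrow> (complex \<Rightarrow> ennreal) \<Rightarrow> ennreal" where
  "line_integral \<gamma> \<sigma> =
     (if locally_rectifiable \<gamma>
      then SUP (a, b) \<in> {(a, b). a \<in> fst \<gamma> \<and> b \<in> fst \<gamma> \<and> a \<le> b}.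
             compact_line_integral (snd \<gamma>) a b \<sigma>
      else \<infinity>)"

text \<open>One-dimensional Hausdorff (outer) measure; in dimension one the normalizing constant is 1.
  Boundedness is required because \<^const>\<open>diameter\<close> of an unbounded set is 0.\<close>

definition hausdorff1 :: "complex set \<Rightarrow> ennreal" where
  "hausdorff1 E =
     (SUP \<delta> \<in> {0<..}.
        INF U \<in> {U :: nat \<Rightarrow> complex set.
                  E \<subseteq> (\<Union>j. U j) \<and> (\<forall>j. bounded (U j) \<and> diameter (U j) \<le> \<delta>)}.
          \<Sum>j. ennreal (diameter (U j)))"


section \<open>Moduli of path families\<close>

definition mod2 :: "cpath set \<Rightarrow> ennreal" where
  "mod2 \<Gamma> =
     (INF \<sigma> \<in> {\<sigma> :: complex \<Rightarrow> ennreal. \<sigma> \<in> borel_measurable borel \<and>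
                (\<forall>\<gamma>\<in>\<Gamma>. 1 \<le> line_integral \<gamma> \<sigma>)}.
        \<integral>\<^sup>+ z. (\<sigma> z)\<^sup>2 \<partial>lborel)"

definition sum_along :: "(nat \<Rightarrow> complex set) \<Rightarrow> (nat \<Rightarrow> ennreal) \<Rightarrow> complex set \<Rightarrow> ennreal" where
  "sum_along Q \<rho> V = (\<Sum>\<^sub>\<infinity>i\<in>meeting Q V. \<rho> i)"

text \<open>Sequences with an infinite entry have infinite energy, so allowing the value
  \<^term>\<open>\<infinity> :: ennreal\<close> does not affect the following two infima.\<close>

definition mod_weak :: "(nat \<Rightarrow> complex set) \<Rightarrow> cpath set \<Rightarrow> ennreal" where
  "mod_weak Q \<Gamma> =
     (INF \<rho> \<in> {\<rho> :: nat \<Rightarrow> ennreal. \<exists>\<Gamma>0\<subseteq>\<Gamma>. mod2 \<Gamma>0 = 0 \<and>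
                (\<forall>\<gamma>\<in>\<Gamma> - \<Gamma>0. 1 \<le> sum_along Q \<rho> (trace \<gamma>))}.
        \<Sum>i. (\<rho> i)\<^sup>2)"

definition mod_strong ::
    "complex set \<Rightarrow> (nat \<Rightarrow> complex set) \<Rightarrow> cpath set \<Rightarrow> ennreal" where
  "mod_strong \<Omega> Q \<Gamma> =
     (INF \<rho> \<in> {\<rho> :: nat \<Rightarrow> ennreal. \<forall>\<gamma>\<in>\<Gamma>. hausdorff1 (trace \<gamma> \<inter> carpet \<Omega> Q) = 0 \<longrightarrow>
                1 \<le> sum_along Q \<rho> (trace \<gamma>)}.
        \<Sum>i. (\<rho> i)\<^sup>2)"

datatype version = Weak | Strong

definition carpet_mod ::
    "version \<Rightarrow> complex set \<Rightarrow> (nat \<Rightarrow> complex set) \<Rightarrow> cpath set \<Rightarrow> ennreal" where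
  "carpet_mod v \<Omega> Q \<Gamma> = (case v of Weak \<Rightarrow> mod_weak Q \<Gamma> | Strong \<Rightarrow> mod_strong \<Omega> Q \<Gamma>)"


section \<open>Sobolev spaces and carpet-harmonic functions\<close>

text \<open>Functions on the carpet are total functions of which only the values on the carpet matter.\<close>

definition Mx :: "(nat \<Rightarrow> complex set) \<Rightarrow> (complex \<Rightarrow> ereal) \<Rightarrow> nat \<Rightarrow> ereal" where
  "Mx Q g i = (SUP z\<in>frontier (Q i). g z)"

definition mn :: "(nat \<Rightarrow> complex set) \<Rightarrow> (complex \<Rightarrow> ereal) \<Rightarrow> nat \<Rightarrow> ereal" where
  "mn Q g i = (INF z\<in>frontier (Q i). g z)"

definition osc :: "(nat \<Rightarrow> complex set) \<Rightarrow> (complex \<Rightarrow> ereal) \<Rightarrow> nat \<Rightarrow> ennreal" where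
  "osc Q g i = e2ennreal (Mx Q g i - mn Q g i)"

definition upper_gradient ::
    "version \<Rightarrow> complex set \<Rightarrow> (nat \<Rightarrow> complex set) \<Rightarrow> (complex \<Rightarrow> ereal) \<Rightarrow> (nat \<Rightarrow> ennreal) \<Rightarrow> bool"
  where
  "upper_gradient v \<Omega> Q g \<rho> \<longleftrightarrow>
     (\<exists>\<Gamma>0 \<subseteq> paths_in \<Omega>. carpet_mod v \<Omega> Q \<Gamma>0 = 0 \<and>
        (\<forall>\<gamma> \<in> paths_in \<Omega> - \<Gamma>0. \<forall>x \<in> trace \<gamma> \<inter> carpet \<Omega> Q. \<forall>y \<in> trace \<gamma> \<inter> carpet \<Omega> Q.
           \<bar>g x\<bar> \<noteq> \<infinity> \<and> \<bar>g y\<bar> \<noteq> \<infinity> \<and>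
           \<bar>g x - g y\<bar> \<le> enn2ereal (sum_along Q \<rho> (trace \<gamma>))))"

definition Mx_diam_sq :: "(nat \<Rightarrow> complex set) \<Rightarrow> (complex \<Rightarrow> ereal) \<Rightarrow> nat \<Rightarrow> ennreal" where
  "Mx_diam_sq Q g i = e2ennreal ((Mx Q g i)\<^sup>2) * (ennreal (diameter (Q i)))\<^sup>2"

definition W12_loc ::
    "version \<Rightarrow> complex set \<Rightarrow> (nat \<Rightarrow> complex set) \<Rightarrow> (complex \<Rightarrow> ereal) set" where
  "W12_loc v \<Omega> Q = {g.
     (\<forall>i. \<bar>Mx Q g i\<bar> \<noteq> \<infinity> \<and> \<bar>mn Q g i\<bar> \<noteq> \<infinity>) \<and>
     (\<forall>x r. 0 < r \<and> compactly_in (ball x r) \<Omega> \<longrightarrow>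
        sum_along Q (Mx_diam_sq Q g) (ball x r) < \<infinity> \<and>
        sum_along Q (\<lambda>i. (osc Q g i)\<^sup>2) (ball x r) < \<infinity>) \<and>
     upper_gradient v \<Omega> Q g (osc Q g)}"

definition W12 ::
    "version \<Rightarrow> complex set \<Rightarrow> (nat \<Rightarrow> complex set) \<Rightarrow> (complex \<Rightarrow> ereal) set" where
  "W12 v \<Omega> Q = {g \<in> W12_loc v \<Omega> Q.
     (\<Sum>i. Mx_diam_sq Q g i) < \<infinity> \<and> (\<Sum>i. (osc Q g i)\<^sup>2) < \<infinity>}"

definition Dirichlet ::
    "(nat \<Rightarrow> complex set) \<Rightarrow> complex set \<Rightarrow> (complex \<Rightarrow> ereal) \<Rightarrow> ennreal" where
  "Dirichlet Q V g = sum_along Q (\<lambda>i. (osc Q g i)\<^sup>2) V"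

definition carpet_harmonic ::
    "version \<Rightarrow> complex set \<Rightarrow> (nat \<Rightarrow> complex set) \<Rightarrow> (complex \<Rightarrow> ereal) \<Rightarrow> bool" where
  "carpet_harmonic v \<Omega> Q u \<longleftrightarrow>
     u \<in> W12_loc v \<Omega> Q \<and>
     (\<forall>V. open V \<and> compactly_in V \<Omega> \<longrightarrow>
        (\<forall>\<zeta> \<in> W12 v \<Omega> Q. (\<forall>z \<in> carpet \<Omega> Q - V. \<zeta> z = 0) \<longrightarrow>
           Dirichlet Q V u \<le> Dirichlet Q V (\<lambda>z. u z + \<zeta> z)))"


section \<open>Normalized functions\<close>

text \<open>The family of good paths of \<open>g\<close>; the discrete function attached to \<open>g\<close> is \<^term>\<open>Mx Q g\<close>.\<close>

definition good_paths ::
    "complex set \<Rightarrow> (nat \<Rightarrow> complex set) \<Rightarrow> (complex \<Rightarrow> ereal) \<Rightarrow> cpath set" where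
  "good_paths \<Omega> Q g = {\<gamma> \<in> paths_in \<Omega>. nonconstant \<gamma> \<and>
     hausdorff1 (trace \<gamma> \<inter> carpet \<Omega> Q) = 0 \<and>
     (\<forall>\<gamma>' \<in> subpaths \<gamma>. \<forall>i1 \<in> meeting Q (trace \<gamma>'). \<forall>i2 \<in> meeting Q (trace \<gamma>').
        \<bar>Mx Q g i1 - Mx Q g i2\<bar> \<le> enn2ereal (sum_along Q (osc Q g) (trace \<gamma>'))) \<and>
     (\<forall>\<gamma>' \<in> subpaths \<gamma>. compactly_in (trace \<gamma>') \<Omega> \<longrightarrow>
        sum_along Q (osc Q g) (trace \<gamma>') < \<infinity>) \<and>
     ((\<Sum>i. (osc Q g i)\<^sup>2) < \<infinity> \<longrightarrow> sum_along Q (osc Q g) (trace \<gamma>) < \<infinity>)}"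

text \<open>\<open>access_via \<Omega> Q x \<gamma>0 \<gamma>\<close>: the point \<open>x\<close> is accessible by \<open>\<gamma>0\<close>, and \<open>\<gamma>\<close> is an admissible choice of
  path along which to take the limit at \<open>x\<close>.\<close>

definition access_via ::
    "complex set \<Rightarrow> (nat \<Rightarrow> complex set) \<Rightarrow> complex \<Rightarrow> cpath \<Rightarrow> cpath \<Rightarrow> bool" where
  "access_via \<Omega> Q x \<gamma>0 \<gamma> \<longleftrightarrow>
     (if x \<in> trace \<gamma>0 \<inter> carpet_core \<Omega> Q then \<gamma> = \<gamma>0
      else \<gamma> \<in> open_subpaths \<gamma>0 \<and> x \<in> closure (trace \<gamma>) - trace \<gamma> \<and>
           (\<forall>i. x \<in> frontier (Q i) \<longrightarrow> trace \<gamma> \<inter> Q i = {}))"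

definition accessible ::
    "complex set \<Rightarrow> (nat \<Rightarrow> complex set) \<Rightarrow> (complex \<Rightarrow> ereal) \<Rightarrow> complex \<Rightarrow> bool" where
  "accessible \<Omega> Q g x \<longleftrightarrow>
     x \<in> carpet \<Omega> Q \<and> (\<exists>\<gamma>0 \<in> good_paths \<Omega> Q g. \<exists>\<gamma>. access_via \<Omega> Q x \<gamma>0 \<gamma>)"

definition liminf_along ::
    "(nat \<Rightarrow> complex set) \<Rightarrow> (complex \<Rightarrow> ereal) \<Rightarrow> cpath \<Rightarrow> complex \<Rightarrow> ereal" where
  "liminf_along Q g \<gamma> x =
     (SUP \<epsilon> \<in> {0<..}. INF i \<in> {i. Q i \<inter> trace \<gamma> \<noteq> {} \<and> Q i \<subseteq> ball x \<epsilon>}. Mx Q g i)"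

text \<open>For \<open>g\<close> in the Sobolev space the limit at an accessible point does not depend on the path
  chosen.\<close>

definition access_value ::
    "complex set \<Rightarrow> (nat \<Rightarrow> complex set) \<Rightarrow> (complex \<Rightarrow> ereal) \<Rightarrow> complex \<Rightarrow> ereal" where
  "access_value \<Omega> Q g x =
     liminf_along Q g (SOME \<gamma>. \<exists>\<gamma>0 \<in> good_paths \<Omega> Q g. access_via \<Omega> Q x \<gamma>0 \<gamma>) x"

definition normalized_version ::
    "complex set \<Rightarrow> (nat \<Rightarrow> complex set) \<Rightarrow> (complex \<Rightarrow> ereal) \<Rightarrow> complex \<Rightarrow> ereal" where
  "normalized_version \<Omega> Q g x =
     (if accessible \<Omega> Q g x then access_value \<Omega> Q g x
      else if \<exists>i. x \<in> frontier (Q i)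
      then Liminf (at x within {y. accessible \<Omega> Q g y \<and>
                                   (\<exists>i. x \<in> frontier (Q i) \<and> y \<in> frontier (Q i))})
             (access_value \<Omega> Q g)
      else Liminf (at x within {y. accessible \<Omega> Q g y}) (access_value \<Omega> Q g))"

definition normalized ::
    "version \<Rightarrow> complex set \<Rightarrow> (nat \<Rightarrow> complex set) \<Rightarrow> (complex \<Rightarrow> ereal) \<Rightarrow> bool" where
  "normalized v \<Omega> Q u \<longleftrightarrow>
     (\<exists>g \<in> W12_loc v \<Omega> Q. \<forall>x \<in> carpet \<Omega> Q. u x = normalized_version \<Omega> Q g x)"

end

theory Submission
  imports Defs
begin

text \<open>For \<open>\<epsilon> > 0\<close>, testing the minimality of \<open>u\<close> with multiples of \<open>\<eta>\<^sup>2 / (u + \<epsilon>)\<close>, where \<open>\<eta>\<close> is a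
  Lipschitz cutoff, bounds the energy of \<open>ln (u + \<epsilon>)\<close> on the peripheral disks inside \<open>B1\<close> independently of \<open>\<epsilon>\<close>
  and \<open>u\<close>. By Fubini and the fatness of the peripheral disks, around each point of \<open>B0\<close> there is a
  frame of four segments, of size comparable to the radius of \<open>B0\<close>, along which the oscillations of
  \<open>ln (u + \<epsilon>)\<close> have a bounded sum. The maximum principle carries the resulting bounds into the square,
  first to the peripheral circles and then, because \<open>u\<close> is normalized, to all points of the carpet.
  Finitely many such squares, their number depending only on \<open>c0\<close>, connect any two points of \<open>B0\<close>, and
  \<open>\<epsilon>\<close> tends to zero.\<close>

section \<open>Length measure and Lebesgue measure\<close>

text \<open>Functions carry no values inside peripheral disks, and an upper gradient counts a disk
  once however long a path stays in it. Two devices deal with this. \<open>ext\<close> assigns to a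
  disk the maximum over its boundary, so that segments crossing inside a disk can be compared there.
  \<open>ug_osc\<close> turns any locally square summable upper gradient into the oscillation, which
  \<open>W12_loc\<close> prescribes; this is how quotients and truncations become admissible test
  functions. The logarithm comes from the test function: the first variation of the energy contains
  \<open>(M - m)\<^sup>2 / (M * m)\<close> on a disk where \<open>u + \<epsilon>\<close> ranges from
  \<open>m\<close> to \<open>M\<close>, and this dominates the squared oscillation of
  \<open>ln (u + \<epsilon>)\<close>. Adding \<open>\<epsilon>\<close> keeps the quotient bounded.
  Normalization ties \<open>u\<close> to the maxima of some Sobolev function \<open>g\<close>, not
  to its own. The two are compared at accessible boundary points, with an error that is a multiple
  of the oscillation of \<open>g\<close> on the disk and so vanishes along shrinking disks. The
  exponent of the final constant is the number of squares times the bound for one square.\<close>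

text \<open>The flag selects a coordinate direction: \<open>x\<close> runs along it and \<open>y\<close> across it.\<close>

definition sg :: "bool \<Rightarrow> real \<Rightarrow> real \<Rightarrow> complex" where
  "sg h x y = (if h then Complex x y else Complex y x)"

lemma sg_measurable [measurable]:
  assumes [measurable]: "f \<in> borel_measurable M" "g \<in> borel_measurable M"
  shows "(\<lambda>x. sg h (f x) (g x)) \<in> borel_measurable M"
proof -
  have eq: "(\<lambda>x. sg h (f x) (g x)) =
      (\<lambda>x. if h then of_real (f x) + \<i> * of_real (g x) else of_real (g x) + \<i> * of_real (f x))"
    by (auto simp: sg_def complex_eq_iff)
  show ?thesis unfolding eq by measurable
qed

text \<open>Both sides agree on boxes, which determines Lebesgue measure. The flag \<open>h\<close>
  decides which coordinate is integrated inside, so that horizontal and vertical lines share one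
  Fubini formula.\<close>

lemma lborel_complex_eq:
  "(lborel :: complex measure) = distr (lborel \<Otimes>\<^sub>M lborel) borel (\<lambda>(y, x). sg h x y)"
proof (rule lborel_eqI)
  fix l u :: complex
  assume lu: "\<And>b. b \<in> Basis \<Longrightarrow> l \<bullet> b \<le> u \<bullet> b"
  have le: "Re l \<le> Re u" "Im l \<le> Im u"
    using lu[of 1] lu[of \<i>] by (auto simp: inner_complex_def)
  have eq: "(\<lambda>(y, x). sg h x y) -` box l u \<inter> space (lborel \<Otimes>\<^sub>M lborel) =
      (if h then {Im l<..<Im u} \<times> {Re l<..<Re u} else {Re l<..<Re u} \<times> {Im l<..<Im u})"
    by (auto simp: box_def Basis_complex_def inner_complex_def sg_def space_pair_measure)
  have "emeasure (distr (lborel \<Otimes>\<^sub>M lborel) borel (\<lambda>(y, x). sg h x y)) (box l u) =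
      emeasure (lborel \<Otimes>\<^sub>M lborel) (if h then {Im l<..<Im u} \<times> {Re l<..<Re u} else {Re l<..<Re u} \<times> {Im l<..<Im u})"
    by (subst emeasure_distr) (simp_all add: eq)
  also have "\<dots> = ennreal ((Re u - Re l) * (Im u - Im l))"
    using le by (auto simp: lborel.emeasure_pair_measure_Times ennreal_mult mult.commute)
  also have "(Re u - Re l) * (Im u - Im l) = (\<Prod>b\<in>Basis. (u - l) \<bullet> b)"
    by (simp add: Basis_complex_def inner_complex_def)
  finally show "emeasure (distr (lborel \<Otimes>\<^sub>M lborel) borel (\<lambda>(y, x). sg h x y)) (box l u) =
      ennreal (\<Prod>b\<in>Basis. (u - l) \<bullet> b)" .
qed simp

lemma nn_integral_complex_sg:
  assumes [measurable]: "f \<in> borel_measurable borel"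
  shows "(\<integral>\<^sup>+z. f z \<partial>lborel) = (\<integral>\<^sup>+y. \<integral>\<^sup>+x. f (sg h x y) \<partial>lborel \<partial>lborel)"
proof -
  have "(\<integral>\<^sup>+z. f z \<partial>lborel) = (\<integral>\<^sup>+p. f (case p of (y, x) \<Rightarrow> sg h x y) \<partial>(lborel \<Otimes>\<^sub>M lborel))"
    by (subst lborel_complex_eq[of h], subst nn_integral_distr) simp_all
  also have "\<dots> = (\<integral>\<^sup>+y. \<integral>\<^sup>+x. f (sg h x y) \<partial>lborel \<partial>lborel)"
    by (subst lborel.nn_integral_fst[symmetric]) simp_all
  finally show ?thesis .
qed

text \<open>The exceptional set need not be measurable; it lies in the intersection of Borel sets of
  measure at most \<open>1 / Suc n\<close>.\<close>

lemma AE_lborel_small: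
  fixes P :: "real \<Rightarrow> bool"
  assumes "\<And>e. e > 0 \<Longrightarrow> \<exists>B\<in>sets borel. {x. \<not> P x} \<subseteq> B \<and> emeasure lborel B \<le> ennreal e"
  shows "AE x in lborel. P x"
proof -
  obtain B where B: "\<And>n::nat. B n \<in> sets borel" "\<And>n. {x. \<not> P x} \<subseteq> B n"
      "\<And>n. emeasure lborel (B n) \<le> ennreal (1 / Suc n)"
    using assms[of "1 / Suc n" for n] by (metis of_nat_0_less_iff zero_less_Suc zero_less_divide_1_iff)
  have null: "emeasure lborel (\<Inter>n. B n) = 0"
  proof -
    have "emeasure lborel (\<Inter>n. B n) \<le> ennreal (1 / Suc n)" for n
      using B by (intro order_trans[OF emeasure_mono B(3)[of n]]) auto
    moreover have "(\<lambda>n. ennreal (1 / Suc n)) \<longlonglongrightarrow> ennreal 0"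
      by (intro tendsto_ennrealI LIMSEQ_Suc[OF lim_1_over_n])
    ultimately have "emeasure lborel (\<Inter>n. B n) \<le> ennreal 0"
      by (intro LIMSEQ_le_const) auto
    then show ?thesis by simp
  qed
  show ?thesis
    by (rule AE_I[where N = "\<Inter>n. B n"]) (use B null in auto)
qed

text \<open>Outer regularity gives an open superset of small measure; its components are intervals,
  and a grid of mesh \<open>d\<close> cuts them into disjoint pieces. Intervals are wanted because
  their length bounds the distance of any two of their points.\<close>

lemma null_set_interval_cover:
  fixes A :: "real set"
  assumes A: "A \<in> null_sets lebesgue" and e: "0 < e" and d: "0 < d"
  shows "\<exists>P :: nat \<Rightarrow> real set. A \<subseteq> (\<Union>j. P j) \<and> (\<Sum>j. emeasure lborel (P j)) \<le> ennreal e \<and>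
           (\<forall>j. is_interval (P j) \<and> P j \<in> sets borel) \<and> (\<forall>j. \<forall>x\<in>P j. \<forall>y\<in>P j. \<bar>x - y\<bar> \<le> d)"
proof -
  obtain U where U: "open U" "A \<subseteq> U" "emeasure lebesgue (U - A) < ennreal e"
    using sets_lebesgue_outer_open[of A e] A e by (metis null_setsD2)
  have "emeasure lebesgue U = emeasure lebesgue (U - A)"
    using A U by (subst emeasure_Diff_null_set) auto
  then have mU: "emeasure lborel U \<le> ennreal e"
    using U by simp
  define I where "I k = {of_int k * d..<(of_int k + 1) * d}" for k :: int
  define D where "D = {C \<inter> I k | C k. C \<in> components U}"
  have compU: "open C" "is_interval C" if "C \<in> components U" for C
    using that U(1) open_components in_components_connected is_interval_connected_1 by blast+
  have disjI: "I k \<inter> I l = {}" if "k \<noteq> l" for k l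
  proof -
    have "\<lfloor>x / d\<rfloor> = k" if "x \<in> I k" for x k
      using that d by (auto simp: I_def floor_eq_iff field_simps)
    then show ?thesis using that by blast
  qed
  have "countable (components U)"
    using pairwise_disjoint_components[of U] compU(1)
    by (intro countable_disjoint_open_subsets) (auto simp: pairwise_def disjnt_def)
  then have "countable ((\<lambda>(C, k). C \<inter> I k) ` (components U \<times> UNIV))"
    by (intro countable_image countable_SIGMA) auto
  moreover have "D = (\<lambda>(C, k). C \<inter> I k) ` (components U \<times> UNIV)"
    by (auto simp: D_def)
  ultimately have cD: "countable D" by simp
  have intD: "is_interval K \<and> K \<in> sets borel" if "K \<in> D" for K
  proof -
    obtain C k where K: "K = C \<inter> I k" "C \<in> components U" using \<open>K \<in> D\<close> by (auto simp: D_def)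
    have "is_interval (I k)" "I k \<in> sets borel" by (auto simp: I_def is_interval_1)
    then show ?thesis using K compU[OF K(2)] by (auto intro!: is_interval_Int)
  qed
  have disjD: "K \<inter> L = {}" if "K \<in> D" "L \<in> D" "K \<noteq> L" for K L
  proof -
    from that obtain C k C' l where *: "K = C \<inter> I k" "L = C' \<inter> I l" "C \<in> components U" "C' \<in> components U"
      by (auto simp: D_def)
    then show ?thesis
      using components_nonoverlap[of C U C'] disjI[of k l] that(3) by (cases "k = l") auto
  qed
  have unD: "\<Union>D = U"
  proof -
    have xI: "x \<in> I \<lfloor>x / d\<rfloor>" for x
    proof -
      have "of_int \<lfloor>x / d\<rfloor> \<le> x / d" "x / d < of_int \<lfloor>x / d\<rfloor> + 1" by linarith+
      then have "of_int \<lfloor>x / d\<rfloor> * d \<le> x" "x < (of_int \<lfloor>x / d\<rfloor> + 1) * d"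
        unfolding pos_le_divide_eq[OF d] pos_divide_less_eq[OF d] .
      then show ?thesis by (simp add: I_def)
    qed
    show ?thesis
    proof (intro equalityI subsetI)
      fix x assume "x \<in> U"
      then obtain C where "C \<in> components U" "x \<in> C" using Union_components[of U] by blast
      then show "x \<in> \<Union>D" using xI[of x] unfolding D_def by blast
    next
      fix x assume "x \<in> \<Union>D"
      then show "x \<in> U" using Union_components[of U] unfolding D_def by blast
    qed
  qed
  define P where "P j = (if j \<in> to_nat_on D ` D then from_nat_into D j else {})" for j
  have PD: "P j \<in> D \<or> P j = {}" for j
    using cD by (auto simp: P_def)
  have "disjoint_family P"
    unfolding disjoint_family_on_def
  proof (intro ballI impI)
    fix i j :: nat assume "i \<noteq> j"
    then show "P i \<inter> P j = {}"
    proof (cases "i \<in> to_nat_on D ` D \<and> j \<in> to_nat_on D ` D")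
      case True
      then obtain K L where "K \<in> D" "L \<in> D" "i = to_nat_on D K" "j = to_nat_on D L" by auto
      then show ?thesis using disjD[of K L] cD \<open>i \<noteq> j\<close> by (auto simp: P_def)
    qed (auto simp: P_def)
  qed
  moreover have PU: "(\<Union>j. P j) = U"
  proof -
    have "K \<subseteq> (\<Union>j. P j)" if "K \<in> D" for K
    proof -
      have "P (to_nat_on D K) = K" using that cD by (simp add: P_def)
      then show ?thesis by blast
    qed
    moreover have "P j \<subseteq> \<Union>D" for j using PD[of j] by auto
    ultimately show ?thesis unfolding unD[symmetric] by blast
  qed
  ultimately have "(\<Sum>j. emeasure lborel (P j)) = emeasure lborel U"
  proof (subst suminf_emeasure)
    show "range P \<subseteq> sets lborel"
    proof
      fix K assume "K \<in> range P"
      then show "K \<in> sets lborel" using PD intD by (metis imageE sets.empty_sets sets_lborel)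
    qed
  qed auto
  moreover have "\<bar>x - y\<bar> \<le> d" if "x \<in> P j" "y \<in> P j" for x y j
  proof -
    obtain C k where "P j = C \<inter> I k" using PD[of j] that by (auto simp: D_def)
    then show ?thesis using that by (auto simp: I_def algebra_simps)
  qed
  moreover have "is_interval (P j)" "P j \<in> sets borel" for j
    using PD[of j] intD[of "P j"] by auto
  ultimately show ?thesis
    using mU PU U(2) by (intro exI[of _ P]) auto
qed

section \<open>Null sets of one-dimensional Hausdorff measure\<close>

lemma hausdorff1_eq_0_iff:
  "hausdorff1 E = 0 \<longleftrightarrow>
     (\<forall>d>0. \<forall>e>0. \<exists>U :: nat \<Rightarrow> complex set. E \<subseteq> (\<Union>j. U j) \<and>
        (\<forall>j. bounded (U j) \<and> diameter (U j) \<le> d) \<and> (\<Sum>j. ennreal (diameter (U j))) < ennreal e)"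
  (is "?L \<longleftrightarrow> ?R")
proof
  assume L: ?L
  show ?R
  proof (intro allI impI)
    fix d e :: real assume "d > 0" "e > 0"
    have "(INF U \<in> {U :: nat \<Rightarrow> complex set.
              E \<subseteq> (\<Union>j. U j) \<and> (\<forall>j. bounded (U j) \<and> diameter (U j) \<le> d)}.
          \<Sum>j. ennreal (diameter (U j))) \<le> hausdorff1 E"
      unfolding hausdorff1_def using \<open>d > 0\<close> by (intro SUP_upper) auto
    also have "\<dots> < ennreal e" using L \<open>e > 0\<close> by simp
    finally show "\<exists>U :: nat \<Rightarrow> complex set. E \<subseteq> (\<Union>j. U j) \<and>
        (\<forall>j. bounded (U j) \<and> diameter (U j) \<le> d) \<and> (\<Sum>j. ennreal (diameter (U j))) < ennreal e"
      unfolding INF_less_iff by auto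
  qed
next
  assume R: ?R
  have that_e: "\<exists>e>0. ennreal e \<le> x" if "0 < x" for x :: ennreal
  proof (cases x)
    case (real r)
    then show ?thesis using that by auto
  next
    case top
    then show ?thesis by (intro exI[of _ 1]) auto
  qed
  have "(INF U \<in> {U :: nat \<Rightarrow> complex set.
              E \<subseteq> (\<Union>j. U j) \<and> (\<forall>j. bounded (U j) \<and> diameter (U j) \<le> d)}.
          \<Sum>j. ennreal (diameter (U j))) = 0" (is "?I = 0") if "d > 0" for d
  proof (rule ccontr)
    assume "?I \<noteq> 0"
    then have "0 < ?I" by (simp add: zero_less_iff_neq_zero)
    then obtain e where e: "0 < e" "ennreal e \<le> ?I"
      using that_e[OF \<open>0 < ?I\<close>] by blast
    from R[rule_format, OF that e(1)] have "?I < ennreal e"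
      unfolding INF_less_iff by auto
    with e show False by simp
  qed
  then show ?L unfolding hausdorff1_def by simp
qed

lemma hausdorff1_mono: "E \<subseteq> F \<Longrightarrow> hausdorff1 E \<le> hausdorff1 F"
  unfolding hausdorff1_def by (intro SUP_mono' INF_superset_mono) auto

lemma hausdorff1_null_mono: "hausdorff1 F = 0 \<Longrightarrow> E \<subseteq> F \<Longrightarrow> hausdorff1 E = 0"
  using hausdorff1_mono[of E F] by simp

lemma hausdorff1_null_UN:
  fixes E :: "nat \<Rightarrow> complex set"
  assumes "\<And>n. hausdorff1 (E n) = 0"
  shows "hausdorff1 (\<Union>n. E n) = 0"
  unfolding hausdorff1_eq_0_iff
proof (intro allI impI)
  fix d e :: real assume de: "d > 0" "e > 0"
  \<comment> \<open>The geometric budgets add up to \<open>e / 2\<close> rather than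
    \<open>e\<close>, since the characterization asks for a strict inequality.\<close>
  have "\<exists>U :: nat \<Rightarrow> complex set. E n \<subseteq> (\<Union>j. U j) \<and> (\<forall>j. bounded (U j) \<and> diameter (U j) \<le> d) \<and>
      (\<Sum>j. ennreal (diameter (U j))) < ennreal (e / 2 * (1/2) ^ Suc n)" for n
    using assms[of n] de unfolding hausdorff1_eq_0_iff by simp
  then obtain U :: "nat \<Rightarrow> nat \<Rightarrow> complex set" where U: "\<And>n. E n \<subseteq> (\<Union>j. U n j)"
      "\<And>n j. bounded (U n j)" "\<And>n j. diameter (U n j) \<le> d"
      "\<And>n. (\<Sum>j. ennreal (diameter (U n j))) < ennreal (e / 2 * (1/2) ^ Suc n)"
    by metis
  define V where "V m = (case prod_decode m of (n, j) \<Rightarrow> U n j)" for m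
  have "(\<Sum>m. ennreal (diameter (V m))) = (\<Sum>n. \<Sum>j. ennreal (diameter (U n j)))"
    unfolding V_def
    using suminf_ennreal_2dimen[where f = "\<lambda>(n, j). ennreal (diameter (U n j))"
        and g = "\<lambda>n. \<Sum>j. ennreal (diameter (U n j))"]
    by (simp add: case_prod_unfold)
  also have "\<dots> \<le> (\<Sum>n. ennreal (e / 2 * (1/2) ^ Suc n))"
    using U(4) by (intro suminf_le) (auto intro: less_imp_le)
  also have "\<dots> = ennreal (e / 2)"
  proof (rule suminf_ennreal_eq)
    show "(\<lambda>n. e / 2 * (1/2) ^ Suc n) sums (e / 2)"
      using sums_mult[OF power_half_series, of "e / 2"] by simp
  qed (use de in auto)
  also have "\<dots> < ennreal e" using de by (simp add: ennreal_lessI)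
  finally have "(\<Sum>m. ennreal (diameter (V m))) < ennreal e" .
  moreover have "(\<Union>n. E n) \<subseteq> (\<Union>m. V m)"
  proof
    fix z assume "z \<in> (\<Union>n. E n)"
    then obtain n j where "z \<in> U n j" using U(1) by blast
    then have "z \<in> V (prod_encode (n, j))" by (simp add: V_def)
    then show "z \<in> (\<Union>m. V m)" by blast
  qed
  ultimately show "\<exists>U :: nat \<Rightarrow> complex set. (\<Union>n. E n) \<subseteq> (\<Union>j. U j) \<and>
        (\<forall>j. bounded (U j) \<and> diameter (U j) \<le> d) \<and> (\<Sum>j. ennreal (diameter (U j))) < ennreal e"
    using U by (intro exI[of _ V]) (auto simp: V_def split: prod.splits)
qed

text \<open>The part of \<open>A\<close> in an interval \<open>P j\<close> has an image of diameter
  at most the length of \<open>P j\<close>, so a cover of \<open>A\<close> by intervals becomes a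
  cover of the image of no larger total size.\<close>

lemma hausdorff1_lipschitz_image_null:
  fixes \<phi> :: "real \<Rightarrow> complex"
  assumes A: "A \<in> null_sets lebesgue"
    and lip: "\<And>x y. x \<in> A \<Longrightarrow> y \<in> A \<Longrightarrow> dist (\<phi> x) (\<phi> y) \<le> \<bar>x - y\<bar>"
  shows "hausdorff1 (\<phi> ` A) = 0"
  unfolding hausdorff1_eq_0_iff
proof (intro allI impI)
  fix d e :: real assume de: "d > 0" "e > 0"
  obtain P :: "nat \<Rightarrow> real set" where P: "A \<subseteq> (\<Union>j. P j)" "(\<Sum>j. emeasure lborel (P j)) \<le> ennreal (e/2)"
      "\<And>j. is_interval (P j)" "\<And>j. P j \<in> sets borel" "\<And>j x y. x\<in>P j \<Longrightarrow> y\<in>P j \<Longrightarrow> \<bar>x - y\<bar> \<le> d"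
    using null_set_interval_cover[OF A, of "e/2" d] de by auto
  define V where "V j = \<phi> ` (A \<inter> P j)" for j
  have Vd: "dist z w \<le> d" "ennreal (dist z w) \<le> emeasure lborel (P j)" if zw: "z \<in> V j" "w \<in> V j" for z w j
  proof -
    obtain x y where xy: "x \<in> A \<inter> P j" "y \<in> A \<inter> P j" "z = \<phi> x" "w = \<phi> y"
      using zw by (auto simp: V_def)
    then have dl: "dist z w \<le> \<bar>x - y\<bar>" using lip by auto
    with P(5)[of x j y] xy show "dist z w \<le> d" by auto
    have "{min x y..max x y} \<subseteq> P j"
      using P(3)[of j] xy unfolding is_interval_1 by (auto simp: min_def max_def split: if_splits)
    then have "emeasure lborel {min x y..max x y} \<le> emeasure lborel (P j)"
      using P(4) by (intro emeasure_mono) auto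
    moreover have "emeasure lborel {min x y..max x y} = ennreal \<bar>x - y\<bar>"
      by (simp add: min_def max_def abs_real_def)
    ultimately show "ennreal (dist z w) \<le> emeasure lborel (P j)"
      using dl by (metis ennreal_leI order_trans)
  qed
  have bV: "bounded (V j)" for j
    using Vd(1)[of _ j] unfolding bounded_two_points by blast
  have dV: "diameter (V j) \<le> d" for j
    using Vd(1) de by (intro diameter_le) (auto simp: dist_norm)
  have "ennreal (diameter (V j)) \<le> emeasure lborel (P j)" for j
  proof (cases "emeasure lborel (P j) = top")
    case False
    then obtain r where r: "emeasure lborel (P j) = ennreal r" "r \<ge> 0" by (cases "emeasure lborel (P j)") auto
    then have "diameter (V j) \<le> r"
      using Vd(2)[of _ j] by (intro diameter_le) (auto simp: dist_norm)
    then show ?thesis using r by (simp add: ennreal_leI)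
  qed auto
  then have "(\<Sum>j. ennreal (diameter (V j))) \<le> ennreal (e/2)"
    by (intro order_trans[OF suminf_le P(2)]) auto
  also have "\<dots> < ennreal e" using de by (simp add: ennreal_lessI)
  finally show "\<exists>U :: nat \<Rightarrow> complex set. \<phi> ` A \<subseteq> (\<Union>j. U j) \<and>
        (\<forall>j. bounded (U j) \<and> diameter (U j) \<le> d) \<and> (\<Sum>j. ennreal (diameter (U j))) < ennreal e"
    using bV dV P(1) by (intro exI[of _ V]) (fastforce simp: V_def)
qed

text \<open>Each covering set \<open>U j\<close> projects into an interval of radius
  \<open>diameter (U j)\<close> about the image of a chosen point. Its length is twice the diameter,
  which the choice of \<open>e / 2\<close> compensates.\<close>

lemma null_projection_of_hausdorff1_null:
  fixes \<phi> :: "complex \<Rightarrow> real"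
  assumes E: "hausdorff1 E = 0" and lip: "\<And>z w. \<bar>\<phi> z - \<phi> w\<bar> \<le> dist z w"
  shows "\<phi> ` E \<in> null_sets lebesgue"
proof -
  have "\<exists>B\<in>sets borel. \<phi> ` E \<subseteq> B \<and> emeasure lborel B \<le> ennreal e" if e: "e > 0" for e
  proof -
    obtain U :: "nat \<Rightarrow> complex set" where U: "E \<subseteq> (\<Union>j. U j)" "\<And>j. bounded (U j)"
        "(\<Sum>j. ennreal (diameter (U j))) < ennreal (e / 2)"
      using E[unfolded hausdorff1_eq_0_iff, rule_format, of 1 "e/2"] e by auto
    define p where "p j = (SOME z. z \<in> U j)" for j
    define B where "B j = (if U j = {} then {} else {\<phi> (p j) - diameter (U j)..\<phi> (p j) + diameter (U j)})" for j
    have sub: "\<phi> ` U j \<subseteq> B j" for j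
    proof (cases "U j = {}")
      case False
      then have p: "p j \<in> U j" by (simp add: p_def some_in_eq)
      have "\<bar>\<phi> z - \<phi> (p j)\<bar> \<le> diameter (U j)" if "z \<in> U j" for z
        using lip[of z "p j"] diameter_bounded_bound[OF U(2) that p] by linarith
      then show ?thesis using False by (force simp: B_def)
    qed simp
    have mB: "emeasure lborel (B j) \<le> 2 * ennreal (diameter (U j))" for j
    proof -
      have "diameter (U j) \<ge> 0" by (rule diameter_ge_0[OF U(2)])
      then have "2 * ennreal (diameter (U j)) = ennreal (2 * diameter (U j))"
        by (simp add: ennreal_mult)
      with \<open>diameter (U j) \<ge> 0\<close> show ?thesis
        by (auto simp: B_def)
    qed
    have "emeasure lborel (\<Union>j. B j) \<le> (\<Sum>j. emeasure lborel (B j))"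
      by (intro emeasure_subadditive_countably) (auto simp: B_def)
    also have "\<dots> \<le> (\<Sum>j. 2 * ennreal (diameter (U j)))"
      by (intro suminf_le mB) auto
    also have "\<dots> = 2 * (\<Sum>j. ennreal (diameter (U j)))" by simp
    also have "\<dots> \<le> 2 * ennreal (e / 2)"
      using U(3) by (intro mult_left_mono) auto
    also have "\<dots> = ennreal (2 * (e / 2))" using e by (subst ennreal_mult) auto
    also have "\<dots> = ennreal e" by simp
    finally have "emeasure lborel (\<Union>j. B j) \<le> ennreal e" .
    moreover have "\<phi> ` E \<subseteq> (\<Union>j. B j)" using U(1) sub by blast
    moreover have "(\<Union>j. B j) \<in> sets borel" by (auto simp: B_def)
    ultimately show ?thesis by blast
  qed
  then have "AE x in lborel. x \<notin> \<phi> ` E"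
    by (intro AE_lborel_small) simp
  then obtain N where "{x. x \<in> \<phi> ` E} \<subseteq> N" "N \<in> null_sets lborel"
    by (auto simp: eventually_ae_filter)
  then show ?thesis
    by (metis Collect_mem_eq null_sets_completion_subset null_sets_completionI)
qed

section \<open>Sums along sets and conformal modulus\<close>

lemma ennreal_INF_eq_0_iff:
  fixes f :: "'a \<Rightarrow> ennreal"
  shows "(INF x\<in>X. f x) = 0 \<longleftrightarrow> (\<forall>e>0. \<exists>x\<in>X. f x \<le> ennreal e)" (is "?L \<longleftrightarrow> ?R")
proof
  assume L: ?L
  show ?R
  proof (intro allI impI)
    fix e :: real assume "e > 0"
    then have "(INF x\<in>X. f x) < ennreal e" using L by simp
    then show "\<exists>x\<in>X. f x \<le> ennreal e" unfolding INF_less_iff by (auto intro: less_imp_le)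
  qed
next
  assume R: ?R
  have "(INF x\<in>X. f x) \<le> 0 + ennreal e" if e: "e > 0" for e
  proof -
    from R e obtain x where "x \<in> X" "f x \<le> ennreal e" by blast
    then show ?thesis by (auto intro: INF_lower2)
  qed
  then have "(INF x\<in>X. f x) \<le> 0" by (rule ennreal_le_epsilon)
  then show ?L by simp
qed

text \<open>The unordered sum becomes a series with an indicator, so that the lemmas on series in
  \<open>ennreal\<close> apply to it.\<close>

lemma sum_along_eq: "sum_along Q \<rho> V = (\<Sum>i. \<rho> i * indicator (meeting Q V) i)"
proof -
  have "sum_along Q \<rho> V = (\<Sum>\<^sub>\<infinity>i\<in>UNIV. \<rho> i * indicator (meeting Q V) i)"
    unfolding sum_along_def by (intro infsum_cong_neutral) (auto simp: indicator_def)
  moreover have "((\<lambda>i. \<rho> i * indicator (meeting Q V) i) has_sum (\<Sum>\<^sub>\<infinity>i\<in>UNIV. \<rho> i * indicator (meeting Q V) i)) UNIV"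
    by (intro has_sum_infsum nonneg_summable_on_complete) auto
  ultimately show ?thesis
    using has_sum_imp_sums sums_unique by metis
qed

lemma meeting_mono: "V \<subseteq> W \<Longrightarrow> meeting Q V \<subseteq> meeting Q W"
  by (auto simp: meeting_def)

lemma sum_along_mono:
  assumes "V \<subseteq> W" "\<And>i. i \<in> meeting Q V \<Longrightarrow> \<rho> i \<le> \<rho>' i"
  shows "sum_along Q \<rho> V \<le> sum_along Q \<rho>' W"
  unfolding sum_along_eq
  using assms meeting_mono[OF assms(1), of Q] by (intro suminf_le) (auto simp: indicator_def)

lemma sum_along_le_suminf: "sum_along Q \<rho> V \<le> (\<Sum>i. \<rho> i)"
  unfolding sum_along_eq by (intro suminf_le) (auto simp: indicator_def)

lemma sum_along_add: "sum_along Q (\<lambda>i. \<rho> i + \<rho>' i) V = sum_along Q \<rho> V + sum_along Q \<rho>' V"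
  unfolding sum_along_eq distrib_right by (rule suminf_add[symmetric]) auto

lemma sum_along_cmult: "sum_along Q (\<lambda>i. c * \<rho> i) V = c * sum_along Q \<rho> V"
  unfolding sum_along_eq by (simp add: mult.assoc)

lemma sum_along_ge_sum:
  assumes "finite F" "F \<subseteq> meeting Q V"
  shows "(\<Sum>i\<in>F. \<rho> i) \<le> sum_along Q \<rho> V"
proof -
  have "(\<Sum>i\<in>F. \<rho> i) = (\<Sum>i\<in>F. \<rho> i * indicator (meeting Q V) i)"
    using assms by (intro sum.cong) auto
  also have "\<dots> \<le> sum_along Q \<rho> V"
    unfolding sum_along_eq using assms by (intro sum_le_suminf) auto
  finally show ?thesis .
qed

lemma sum_along_ge_term: "i \<in> meeting Q V \<Longrightarrow> \<rho> i \<le> sum_along Q \<rho> V"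
  using sum_along_ge_sum[of "{i}" Q V \<rho>] by simp

lemma finite_of_suminf_finite:
  fixes f :: "nat \<Rightarrow> ennreal"
  assumes "(\<Sum>i. f i) < \<infinity>" "c > 0"
  shows "finite {i. ennreal c \<le> f i}"
proof (rule ccontr)
  assume inf: "infinite {i. ennreal c \<le> f i}"
  obtain s where s: "(\<Sum>i. f i) = ennreal s" "s \<ge> 0" using assms(1) by (cases "\<Sum>i. f i") auto
  obtain n :: nat where n: "s < n * c" using assms(2) reals_Archimedean3 by blast
  obtain F where F: "F \<subseteq> {i. ennreal c \<le> f i}" "finite F" "card F = n"
    using infinite_arbitrarily_large[OF inf, of n] by blast
  have "ennreal (n * c) = (\<Sum>i\<in>F. ennreal c)"
    using F assms(2) by (simp add: ennreal_mult ennreal_of_nat_eq_real_of_nat)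
  also have "\<dots> \<le> (\<Sum>i\<in>F. f i)" using F by (intro sum_mono) auto
  also have "\<dots> \<le> ennreal s" unfolding s(1)[symmetric] using F by (intro sum_le_suminf) auto
  finally show False using n s assms by (simp add: ennreal_le_iff)
qed

text \<open>Weighted inequality between product and squares, without the factor 1/2: depending on
  which of \<open>b\<close> and \<open>c * a\<close> is larger, one of the two terms alone suffices.
  This argument tolerates infinite values.\<close>

lemma ennreal_mult_le_squares:
  fixes a b :: ennreal and c :: real
  assumes "c > 0"
  shows "a * b \<le> ennreal c * a\<^sup>2 + b\<^sup>2 * ennreal (1 / c)"
proof (cases "b \<le> ennreal c * a")
  case True
  then have "a * b \<le> a * (ennreal c * a)" by (intro mult_left_mono) auto
  also have "\<dots> = ennreal c * a\<^sup>2" by (simp add: power2_eq_square algebra_simps)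
  finally show ?thesis by (meson le_iff_add order_trans)
next
  case False
  then have "ennreal (1/c) * (ennreal c * a) \<le> ennreal (1/c) * b" by (intro mult_left_mono) auto
  moreover have "ennreal (1/c) * (ennreal c * a) = a"
    using assms by (simp flip: mult.assoc ennreal_mult)
  ultimately have "a * b \<le> (ennreal (1/c) * b) * b" by (intro mult_right_mono) auto
  also have "\<dots> = b\<^sup>2 * ennreal (1 / c)" by (simp add: power2_eq_square algebra_simps)
  finally show ?thesis by (metis add.commute le_iff_add order_trans)
qed

text \<open>The pointwise supremum of countably many admissible densities is admissible for the
  union of the families, and this bound on its energy makes negligible families stable under
  countable unions.\<close>

lemma SUP_power2_le_suminf:
  fixes f :: "nat \<Rightarrow> ennreal"
  shows "(SUP n. f n)\<^sup>2 \<le> (\<Sum>n. (f n)\<^sup>2)"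
proof (cases "(\<Sum>n. (f n)\<^sup>2)")
  case (real t)
  have "f n \<le> ennreal (sqrt t)" for n
  proof -
    have "(f n)\<^sup>2 \<le> ennreal t" using sum_le_suminf[of "\<lambda>n. (f n)\<^sup>2" "{n}"] real by auto
    then show ?thesis
    proof (cases "f n")
      case (real r)
      then show ?thesis using \<open>(f n)\<^sup>2 \<le> ennreal t\<close> \<open>0 \<le> t\<close>
        by (auto simp: ennreal_power real_le_rsqrt intro!: ennreal_leI)
    qed (auto simp: ennreal_top_eq_mult_iff top_unique)
  qed
  then have "(SUP n. f n) \<le> ennreal (sqrt t)" by (intro SUP_least) auto
  then have "(SUP n. f n)\<^sup>2 \<le> (ennreal (sqrt t))\<^sup>2" by (intro power_mono) auto
  also have "\<dots> = ennreal t" using real by (simp add: ennreal_power)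
  finally show ?thesis using real by simp
qed simp

lemma suminf_half_powers: "e > 0 \<Longrightarrow> (\<Sum>n. ennreal (e * (1/2) ^ Suc n)) = ennreal e"
  using sums_mult[OF power_half_series, of e] by (intro suminf_ennreal_eq) auto

lemma locally_rectifiable_subpath:
  "\<gamma>' \<in> subpaths \<gamma> \<Longrightarrow> locally_rectifiable \<gamma> \<Longrightarrow> locally_rectifiable \<gamma>'"
  unfolding subpaths_def locally_rectifiable_def by (clarsimp simp: subset_iff)

lemma line_integral_subpath:
  "\<gamma>' \<in> subpaths \<gamma> \<Longrightarrow> line_integral \<gamma>' \<sigma> \<le> line_integral \<gamma> \<sigma>"
  using locally_rectifiable_subpath[of \<gamma>' \<gamma>]
  by (auto simp: line_integral_def subpaths_def intro!: SUP_subset_mono)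

lemma trace_subpath: "\<gamma>' \<in> subpaths \<gamma> \<Longrightarrow> trace \<gamma>' \<subseteq> trace \<gamma>"
  by (auto simp: trace_def subpaths_def)

lemma line_integral_mono:
  assumes "\<And>z. \<sigma> z \<le> \<sigma>' z"
  shows "line_integral \<gamma> \<sigma> \<le> line_integral \<gamma> \<sigma>'"
  unfolding line_integral_def compact_line_integral_def
  by (auto intro!: SUP_mono' nn_integral_mono mult_right_mono assms)

lemma mod2_eq_0_iff:
  "mod2 \<Gamma> = 0 \<longleftrightarrow> (\<forall>e>0. \<exists>\<sigma> \<in> borel_measurable borel. (\<forall>\<gamma>\<in>\<Gamma>. 1 \<le> line_integral \<gamma> \<sigma>) \<and>
      (\<integral>\<^sup>+ z. (\<sigma> z)\<^sup>2 \<partial>lborel) \<le> ennreal e)"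
  unfolding mod2_def ennreal_INF_eq_0_iff by auto

lemma mod2_null_mono: "mod2 \<Gamma>' = 0 \<Longrightarrow> \<Gamma> \<subseteq> \<Gamma>' \<Longrightarrow> mod2 \<Gamma> = 0"
  unfolding mod2_eq_0_iff by (meson subset_iff)

text \<open>A density admissible for a subpath is admissible for the whole path, since line
  integrals grow with the path.\<close>

lemma mod2_null_superpaths:
  "mod2 \<Gamma> = 0 \<Longrightarrow> mod2 {\<gamma>. \<exists>\<gamma>'\<in>subpaths \<gamma>. \<gamma>' \<in> \<Gamma>} = 0"
  unfolding mod2_eq_0_iff using line_integral_subpath
  by (smt (verit, best) mem_Collect_eq order_trans)

lemma mod2_null_UN:
  fixes \<Gamma> :: "nat \<Rightarrow> cpath set"
  assumes "\<And>n. mod2 (\<Gamma> n) = 0"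
  shows "mod2 (\<Union>n. \<Gamma> n) = 0"
  unfolding mod2_eq_0_iff
proof (intro allI impI)
  fix e :: real assume e: "e > 0"
  have "\<exists>\<sigma> \<in> borel_measurable borel. (\<forall>\<gamma>\<in>\<Gamma> n. 1 \<le> line_integral \<gamma> \<sigma>) \<and>
      (\<integral>\<^sup>+ z. (\<sigma> z)\<^sup>2 \<partial>lborel) \<le> ennreal (e * (1/2) ^ Suc n)" for n
    using assms[of n] e unfolding mod2_eq_0_iff by simp
  then obtain \<sigma> :: "nat \<Rightarrow> complex \<Rightarrow> ennreal" where [measurable]: "\<And>n. \<sigma> n \<in> borel_measurable borel"
     and \<sigma>: "\<And>n \<gamma>. \<gamma> \<in> \<Gamma> n \<Longrightarrow> 1 \<le> line_integral \<gamma> (\<sigma> n)"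
       "\<And>n. (\<integral>\<^sup>+ z. (\<sigma> n z)\<^sup>2 \<partial>lborel) \<le> ennreal (e * (1/2) ^ Suc n)"
    by metis
  have "(\<integral>\<^sup>+ z. (SUP n. \<sigma> n z)\<^sup>2 \<partial>lborel) \<le> (\<integral>\<^sup>+ z. (\<Sum>n. (\<sigma> n z)\<^sup>2) \<partial>lborel)"
    by (intro nn_integral_mono SUP_power2_le_suminf)
  also have "\<dots> = (\<Sum>n. \<integral>\<^sup>+ z. (\<sigma> n z)\<^sup>2 \<partial>lborel)"
    by (intro nn_integral_suminf) simp
  also have "\<dots> \<le> (\<Sum>n. ennreal (e * (1/2) ^ Suc n))"
    by (intro suminf_le \<sigma>) auto
  also have "\<dots> = ennreal e" using e by (rule suminf_half_powers)
  finally have "(\<integral>\<^sup>+ z. (SUP n. \<sigma> n z)\<^sup>2 \<partial>lborel) \<le> ennreal e" .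
  moreover have "1 \<le> line_integral \<gamma> (\<lambda>z. SUP n. \<sigma> n z)" if "\<gamma> \<in> \<Gamma> n" for \<gamma> n
    using \<sigma>(1)[OF that] by (rule order_trans) (intro line_integral_mono SUP_upper, simp)
  ultimately show "\<exists>\<sigma> \<in> borel_measurable borel. (\<forall>\<gamma>\<in>\<Union>n. \<Gamma> n. 1 \<le> line_integral \<gamma> \<sigma>) \<and>
      (\<integral>\<^sup>+ z. (\<sigma> z)\<^sup>2 \<partial>lborel) \<le> ennreal e"
    by (intro bexI[of _ "\<lambda>z. SUP n. \<sigma> n z"]) auto
qed

section \<open>Segments parallel to the axes\<close>

definition seg :: "bool \<Rightarrow> real \<Rightarrow> real \<Rightarrow> real \<Rightarrow> cpath" where
  "seg h l r y = ({l..r}, \<lambda>x. sg h x y)"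

lemma trace_seg: "trace (seg h l r y) = (\<lambda>x. sg h x y) ` {l..r}"
  by (simp add: trace_def seg_def)

lemma dist_sg: "dist (sg h x y) (sg h x' y) = \<bar>x - x'\<bar>" "dist (sg h x y) (sg h x y') = \<bar>y - y'\<bar>"
  by (auto simp: sg_def dist_norm cmod_def)

lemma dist_sg_ge: "\<bar>x - x'\<bar> \<le> dist (sg h x y) (sg h x' y')" "\<bar>y - y'\<bar> \<le> dist (sg h x y) (sg h x' y')"
  using abs_Re_le_cmod[of "sg h x y - sg h x' y'"] abs_Im_le_cmod[of "sg h x y - sg h x' y'"]
  by (auto simp: sg_def dist_complex_def split: if_splits)

lemma dist_sg_le: "dist (sg h x y) (sg h x' y') \<le> \<bar>x - x'\<bar> + \<bar>y - y'\<bar>"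
  using cmod_le[of "sg h x y - sg h x' y'"] by (auto simp: sg_def dist_complex_def split: if_splits)

lemma continuous_on_sg: "continuous_on A (\<lambda>x. sg h x y)"
  unfolding continuous_on_iff using dist_sg(1) by (metis dist_real_def)

lemma arc_length_isometry:
  assumes "\<And>s t. dist (c s) (c t) = \<bar>s - t\<bar>" "a \<le> b"
  shows "arc_length c a b = ennreal (b - a)"
proof (rule antisym)
  show "arc_length c a b \<le> ennreal (b - a)"
    unfolding arc_length_def
  proof (intro SUP_least, clarify)
    fix n :: nat and t :: "nat \<Rightarrow> real"
    assume t: "mono_on {..n} t" "t ` {..n} \<subseteq> {a..b}"
    have "(\<Sum>k<n. ennreal (dist (c (t k)) (c (t (Suc k))))) = (\<Sum>k<n. ennreal (t (Suc k) - t k))"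
      using mono_onD[OF t(1)] by (intro sum.cong) (auto simp: assms)
    also have "\<dots> = ennreal (\<Sum>k<n. t (Suc k) - t k)"
      using mono_onD[OF t(1)] by (intro sum_ennreal) auto
    also have "(\<Sum>k<n. t (Suc k) - t k) = t n - t 0" by (rule sum_lessThan_telescope)
    also have "ennreal (t n - t 0) \<le> ennreal (b - a)"
      using t(2) by (intro ennreal_leI) (auto simp: image_subset_iff intro!: diff_mono)
    finally show "(\<Sum>k<n. ennreal (dist (c (t k)) (c (t (Suc k))))) \<le> ennreal (b - a)" .
  qed
  \<comment> \<open>Two vertices suffice for the lower bound: \<open>c\<close> is an isometry, so
    the chord from \<open>c a\<close> to \<open>c b\<close> already has the full length.\<close>
  define t where "t k = (if k = 0 then a else b)" for k :: nat
  have "ennreal (b - a) = (\<Sum>k<1. ennreal (dist (c (t k)) (c (t (Suc k)))))"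
    using assms by (simp add: t_def)
  also have "\<dots> \<le> arc_length c a b"
    unfolding arc_length_def using assms
    by (intro SUP_upper2[of "(1, t)"]) (auto simp: t_def mono_on_def)
  finally show "ennreal (b - a) \<le> arc_length c a b" .
qed

text \<open>The parameter of a segment is its arc length up to a shift, so \<open>arc_param\<close>
  on \<open>{a..b}\<close> is translation by \<open>a\<close> followed by the segment.\<close>

lemma line_integral_seg_le:
  assumes [measurable]: "\<sigma> \<in> borel_measurable borel"
  shows "line_integral (seg h l r y) \<sigma> \<le> (\<integral>\<^sup>+x\<in>{l..r}. \<sigma> (sg h x y) \<partial>lborel)"
proof -
  let ?c = "\<lambda>x. sg h x y"
  have len: "arc_length ?c a b = ennreal (b - a)" if "a \<le> b" for a b
    using that by (intro arc_length_isometry) (auto simp: dist_sg)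
  have "compact_line_integral ?c a b \<sigma> \<le> (\<integral>\<^sup>+x\<in>{l..r}. \<sigma> (sg h x y) \<partial>lborel)"
    if ab: "l \<le> a" "a \<le> b" "b \<le> r" for a b
  proof -
    have par: "arc_param ?c a b s = ?c (a + s)" if "s \<in> {0..b - a}" for s
    proof -
      have "(SOME t. t \<in> {a..b} \<and> arc_length ?c a t = ennreal s) = a + s"
        by (rule some_equality) (use that len in \<open>auto simp: len\<close>)
      then show ?thesis by (simp add: arc_param_def)
    qed
    have "compact_line_integral ?c a b \<sigma> = (\<integral>\<^sup>+s\<in>{0..b - a}. \<sigma> (?c (a + s)) \<partial>lborel)"
      unfolding compact_line_integral_def using ab
      by (intro nn_integral_cong) (auto simp: len par indicator_def)
    also have "\<dots> = (\<integral>\<^sup>+s. \<sigma> (?c (a + 1 * s)) * indicator {a..b} (a + 1 * s) \<partial>lborel)"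
      by (intro nn_integral_cong) (auto simp: indicator_def)
    also have "\<dots> = (\<integral>\<^sup>+x. \<sigma> (?c x) * indicator {a..b} x \<partial>lborel)"
      by (subst nn_integral_real_affine[where c = 1 and t = a and f = "\<lambda>x. \<sigma> (?c x) * indicator {a..b} x"])
         simp_all
    also have "\<dots> \<le> (\<integral>\<^sup>+x\<in>{l..r}. \<sigma> (sg h x y) \<partial>lborel)"
      using ab by (intro nn_integral_mono) (auto simp: indicator_def)
    finally show ?thesis .
  qed
  moreover have "locally_rectifiable (seg h l r y)"
    by (auto simp: locally_rectifiable_def seg_def len)
  ultimately show ?thesis
    by (auto simp: line_integral_def seg_def intro!: SUP_least)
qed

text \<open>By Fubini, the heights whose line integral is at least 1 form a set of measure at most
  the integral of \<sigma> over the rectangle, and this is controlled by the energy of \<sigma> and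
  the area.\<close>

lemma AE_seg_of_mod2_null:
  assumes "mod2 \<Gamma> = 0"
  shows "AE y in lborel. y \<in> {y1..y2} \<longrightarrow> seg h l r y \<notin> \<Gamma>"
proof (rule AE_lborel_small)
  fix e :: real assume e: "e > 0"
  \<comment> \<open>An upper bound for the area of the rectangle, kept at least 1 so that
    \<open>c\<close> is positive. With \<open>c\<close> as below, the energy
    \<open>e / (2 * c)\<close> and the area each contribute at most \<open>e / 2\<close>.\<close>
  define A where "A = max 1 (\<bar>r - l\<bar> * \<bar>y2 - y1\<bar>)"
  have A: "A \<ge> 1" "\<bar>r - l\<bar> * \<bar>y2 - y1\<bar> \<le> A" by (auto simp: A_def)
  define c where "c = 2 * A / e"
  have c: "c > 0" using e A by (simp add: c_def)
  obtain \<sigma> where [measurable]: "\<sigma> \<in> borel_measurable borel"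
    and \<sigma>: "\<And>\<gamma>. \<gamma> \<in> \<Gamma> \<Longrightarrow> 1 \<le> line_integral \<gamma> \<sigma>" "(\<integral>\<^sup>+ z. (\<sigma> z)\<^sup>2 \<partial>lborel) \<le> ennreal (e / (2 * c))"
    using assms[unfolded mod2_eq_0_iff, rule_format, of "e / (2 * c)"] e c by auto
  define F where "F y = (\<integral>\<^sup>+x\<in>{l..r}. \<sigma> (sg h x y) \<partial>lborel)" for y
  have [measurable]: "F \<in> borel_measurable borel"
    unfolding F_def by measurable
  define B where "B = {y\<in>space lborel. 1 \<le> F y * indicator {y1..y2} y}"
  have "emeasure lborel B = (\<integral>\<^sup>+y. indicator B y \<partial>lborel)"
    by (simp add: B_def)
  also have "\<dots> \<le> (\<integral>\<^sup>+y\<in>{y1..y2}. F y \<partial>lborel)"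
    by (intro nn_integral_mono) (auto simp: B_def indicator_def)
  also have "\<dots> = (\<integral>\<^sup>+y. \<integral>\<^sup>+x. \<sigma> (sg h x y) * (indicator {l..r} x * indicator {y1..y2} y) \<partial>lborel \<partial>lborel)"
    unfolding F_def by (subst nn_integral_multc[symmetric]) (auto simp: mult.assoc)
  also have "\<dots> \<le> (\<integral>\<^sup>+y. \<integral>\<^sup>+x. ennreal c * (\<sigma> (sg h x y))\<^sup>2 +
      ennreal (1/c) * (indicator {l..r} x * indicator {y1..y2} y) \<partial>lborel \<partial>lborel)"
  proof (intro nn_integral_mono)
    fix y x :: real
    show "\<sigma> (sg h x y) * (indicator {l..r} x * indicator {y1..y2} y) \<le> ennreal c * (\<sigma> (sg h x y))\<^sup>2 +
      ennreal (1/c) * (indicator {l..r} x * indicator {y1..y2} y)"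
      using ennreal_mult_le_squares[OF c, of "\<sigma> (sg h x y)" "indicator {l..r} x * indicator {y1..y2} y"]
      by (auto simp: indicator_def)
  qed
  also have "\<dots> = ennreal c * (\<integral>\<^sup>+y. \<integral>\<^sup>+x. (\<sigma> (sg h x y))\<^sup>2 \<partial>lborel \<partial>lborel) +
      ennreal (1/c) * (\<integral>\<^sup>+y. \<integral>\<^sup>+x. indicator {l..r} x * indicator {y1..y2} y \<partial>lborel \<partial>lborel)"
    by (simp add: nn_integral_add nn_integral_cmult)
  also have "(\<integral>\<^sup>+y. \<integral>\<^sup>+x. (\<sigma> (sg h x y))\<^sup>2 \<partial>lborel \<partial>lborel) = (\<integral>\<^sup>+ z. (\<sigma> z)\<^sup>2 \<partial>lborel)"
    by (subst nn_integral_complex_sg[of "\<lambda>z. (\<sigma> z)\<^sup>2" h]) auto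
  also have "(\<integral>\<^sup>+y. \<integral>\<^sup>+x. indicator {l..r} x * indicator {y1..y2} y \<partial>lborel \<partial>lborel) \<le> ennreal A"
  proof -
    have "(\<integral>\<^sup>+y. \<integral>\<^sup>+x. indicator {l..r} x * indicator {y1..y2} y \<partial>lborel \<partial>lborel) =
        emeasure lborel {l..r} * emeasure lborel {y1..y2}"
      by (simp add: nn_integral_multc nn_integral_cmult)
    also have "\<dots> \<le> ennreal \<bar>r - l\<bar> * ennreal \<bar>y2 - y1\<bar>"
      by (intro mult_mono) (auto simp: emeasure_lborel_Icc_eq intro!: ennreal_leI)
    also have "\<dots> \<le> ennreal A" using A by (simp flip: ennreal_mult add: ennreal_leI)
    finally show ?thesis .
  qed
  also have "ennreal c * (\<integral>\<^sup>+ z. (\<sigma> z)\<^sup>2 \<partial>lborel) + ennreal (1/c) * ennreal A \<le>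
      ennreal c * ennreal (e / (2 * c)) + ennreal (1/c) * ennreal A"
    by (intro add_mono mult_left_mono \<sigma>) auto
  also have "\<dots> = ennreal (e / 2 + e / 2)"
    using e c A by (simp add: c_def field_simps flip: ennreal_mult ennreal_plus)
  finally have "emeasure lborel B \<le> ennreal e"
    by (simp add: add_left_mono mult_left_mono)
  moreover have "{y. \<not> (y \<in> {y1..y2} \<longrightarrow> seg h l r y \<notin> \<Gamma>)} \<subseteq> B"
  proof clarsimp
    fix y assume "y1 \<le> y" "y \<le> y2" "seg h l r y \<in> \<Gamma>"
    then show "y \<in> B"
      using \<sigma>(1)[of "seg h l r y"] line_integral_seg_le[of \<sigma> h l r y]
      unfolding B_def F_def by (auto intro: order_trans)
  qed
  moreover have "B \<in> sets borel" unfolding B_def by simp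
  ultimately show "\<exists>B\<in>sets borel. {y. \<not> (y \<in> {y1..y2} \<longrightarrow> seg h l r y \<notin> \<Gamma>)} \<subseteq> B \<and> emeasure lborel B \<le> ennreal e"
    by blast
qed

text \<open>By Fubini almost every line meets \<open>S\<close> in a set of linear measure zero, and
  a segment is an isometric image of its parameter interval.\<close>

lemma AE_seg_hausdorff1_null:
  assumes S: "S \<in> sets borel" "emeasure lborel S = 0"
  shows "AE y in lborel. hausdorff1 (trace (seg h l r y) \<inter> S) = 0"
proof -
  have [measurable]: "S \<in> sets borel" by (rule S)
  have "(\<integral>\<^sup>+y. \<integral>\<^sup>+x. indicator S (sg h x y) \<partial>lborel \<partial>lborel) = 0"
    using S by (subst nn_integral_complex_sg[of "indicator S" h, symmetric]) auto
  then have "AE y in lborel. (\<integral>\<^sup>+x. indicator S (sg h x y) \<partial>lborel) = 0"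
    by (subst (asm) nn_integral_0_iff_AE) auto
  then show ?thesis
  proof (rule AE_mp, intro AE_I2 impI)
    fix y assume "(\<integral>\<^sup>+x. indicator S (sg h x y) \<partial>lborel) = 0"
    moreover have "(\<integral>\<^sup>+x. indicator S (sg h x y) \<partial>lborel) = (\<integral>\<^sup>+x. indicator {x. sg h x y \<in> S} x \<partial>lborel)"
      by (intro nn_integral_cong) (auto simp: indicator_def)
    moreover have [measurable]: "{x. sg h x y \<in> S} \<in> sets borel"
      by measurable
    ultimately have "{x. sg h x y \<in> S} \<in> null_sets lborel"
      by (simp add: null_sets_def)
    then have "{x. sg h x y \<in> S} \<in> null_sets lebesgue" by (rule null_sets_completionI)
    then have "hausdorff1 ((\<lambda>x. sg h x y) ` {x. sg h x y \<in> S}) = 0"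
      by (rule hausdorff1_lipschitz_image_null) (simp add: dist_sg)
    then show "hausdorff1 (trace (seg h l r y) \<inter> S) = 0"
      by (rule hausdorff1_null_mono) (auto simp: trace_seg)
  qed
qed

section \<open>Arc length\<close>

definition polygon_sum :: "(real \<Rightarrow> complex) \<Rightarrow> nat \<Rightarrow> (nat \<Rightarrow> real) \<Rightarrow> real" where
  "polygon_sum c n t = (\<Sum>k<n. dist (c (t k)) (c (t (Suc k))))"

lemma arc_length_eq:
  "arc_length c a b = (SUP (n, t) \<in> {(n, t). mono_on {..n} t \<and> t ` {..n} \<subseteq> {a..b}}. ennreal (polygon_sum c n t))"
  unfolding arc_length_def polygon_sum_def
  by (intro SUP_cong) (auto simp: sum_ennreal)

lemma polygon_sum_le_arc_length:
  assumes "mono_on {..n} t" "t ` {..n} \<subseteq> {a..b}"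
  shows "ennreal (polygon_sum c n t) \<le> arc_length c a b"
  unfolding arc_length_eq using assms by (intro SUP_upper2[of "(n, t)"]) auto

lemma dist_le_arc_length:
  assumes "s \<le> t"
  shows "ennreal (dist (c s) (c t)) \<le> arc_length c s t"
proof -
  have "ennreal (polygon_sum c 1 (\<lambda>k. if k = 0 then s else t)) \<le> arc_length c s t"
    using assms by (intro polygon_sum_le_arc_length) (auto simp: mono_on_def)
  then show ?thesis by (simp add: polygon_sum_def)
qed

lemma sum_lessThan_add: "(\<Sum>k<n + m. f k) = (\<Sum>k<n. f k) + (\<Sum>k<m. f (n + k))"
  for f :: "nat \<Rightarrow> 'a :: comm_monoid_add"
  by (induction m) (auto simp: algebra_simps)

text \<open>Replacing the vertices by their truncations below and above \<open>s\<close> splits a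
  polygon at \<open>s\<close> without renumbering; an edge that jumps over \<open>s\<close> is
  broken at \<open>c s\<close>, which the triangle inequality permits.\<close>

lemma polygon_sum_split:
  "polygon_sum c n t \<le> polygon_sum c n (\<lambda>k. min (t k) s) + polygon_sum c n (\<lambda>k. max (t k) s)"
proof -
  have "dist (c x) (c y) \<le> dist (c (min x s)) (c (min y s)) + dist (c (max x s)) (c (max y s))" for x y
    using dist_triangle[of "c x" "c y" "c s"]
    by (auto simp: min_def max_def dist_commute add.commute)
  then show ?thesis
    unfolding polygon_sum_def sum.distrib[symmetric] by (intro sum_mono)
qed

lemma ennreal_SUP_add_le:
  fixes f :: "'a \<Rightarrow> ennreal" and g :: "'b \<Rightarrow> ennreal"
  assumes "I \<noteq> {}" "J \<noteq> {}" "\<And>i j. i \<in> I \<Longrightarrow> j \<in> J \<Longrightarrow> f i + g j \<le> C"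
  shows "(SUP i\<in>I. f i) + (SUP j\<in>J. g j) \<le> C"
proof -
  have "(SUP i\<in>I. f i) + (SUP j\<in>J. g j) = (SUP i\<in>I. f i + (SUP j\<in>J. g j))"
    using assms(1) by (rule ennreal_SUP_add_left[symmetric])
  also have "\<dots> = (SUP i\<in>I. SUP j\<in>J. f i + g j)"
    using ennreal_SUP_add_left[OF assms(2), of g] by (simp add: add.commute)
  also have "\<dots> \<le> C" using assms(3) by (intro SUP_least) auto
  finally show ?thesis .
qed

lemma arc_length_superadditive:
  assumes "a \<le> s" "s \<le> b"
  shows "arc_length c a s + arc_length c s b \<le> arc_length c a b"
proof -
  have "ennreal (polygon_sum c n p) + ennreal (polygon_sum c m q) \<le> arc_length c a b"
    if p: "mono_on {..n} p" "p ` {..n} \<subseteq> {a..s}" and q: "mono_on {..m} q" "q ` {..m} \<subseteq> {s..b}" for n p m q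
  proof -
    \<comment> \<open>Concatenation of the two partitions: index \<open>Suc n + k\<close> carries
      \<open>q k\<close>. The edge joining \<open>p n\<close> to \<open>q 0\<close> is the
      additional one counted by \<open>n + Suc m\<close>, and it only adds length.\<close>
    define r where "r k = (if k \<le> n then p k else q (k - Suc n))" for k
    have pb: "a \<le> p k" "p k \<le> s" if "k \<le> n" for k using p(2) that by auto
    have qb: "s \<le> q k" "q k \<le> b" if "k \<le> m" for k using q(2) that by auto
    have "mono_on {..n + Suc m} r"
    proof (rule mono_onI)
      fix i j assume ij: "i \<in> {..n + Suc m}" "j \<in> {..n + Suc m}" "i \<le> j"
      consider "j \<le> n" | "i \<le> n" "n < j" | "n < i" using ij by linarith
      then show "r i \<le> r j"
      proof cases
        case 1 then show ?thesis using ij p(1) by (auto simp: r_def intro: mono_onD)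
      next
        case 2
        then have "p i \<le> s" "s \<le> q (j - Suc n)"
          using ij pb(2)[of i] by (auto intro!: qb(1))
        then show ?thesis using 2 by (simp add: r_def)
      next
        case 3 then show ?thesis using ij by (auto simp: r_def intro!: mono_onD[OF q(1)])
      qed
    qed
    moreover have "r ` {..n + Suc m} \<subseteq> {a..b}"
    proof clarify
      fix k assume "k \<le> n + Suc m"
      then show "r k \<in> {a..b}"
        using assms pb[of k] qb[of "k - Suc n"]
        by (cases "k \<le> n") (force simp: r_def)+
    qed
    ultimately have "ennreal (polygon_sum c (n + Suc m) r) \<le> arc_length c a b"
      by (rule polygon_sum_le_arc_length)
    moreover have "polygon_sum c n p + polygon_sum c m q \<le> polygon_sum c (n + Suc m) r"
    proof -
      have "(\<Sum>k<n. dist (c (r k)) (c (r (Suc k)))) = polygon_sum c n p"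
        unfolding polygon_sum_def by (intro sum.cong) (auto simp: r_def)
      moreover have "polygon_sum c m q \<le> (\<Sum>k<Suc m. dist (c (r (n + k))) (c (r (Suc (n + k)))))"
        unfolding polygon_sum_def sum.lessThan_Suc_shift by (auto simp: r_def)
      ultimately show ?thesis
        unfolding polygon_sum_def[of c "n + Suc m"] sum_lessThan_add by simp
    qed
    moreover have "ennreal (polygon_sum c n p) + ennreal (polygon_sum c m q) =
        ennreal (polygon_sum c n p + polygon_sum c m q)"
      by (simp add: polygon_sum_def sum_nonneg)
    ultimately show ?thesis
      by (metis ennreal_leI order_trans)
  qed
  then show ?thesis
    unfolding arc_length_eq[of c a s] arc_length_eq[of c s b]
    using assms by (intro ennreal_SUP_add_le) (auto simp: mono_on_def intro!: exI[of _ 0] exI[of _ "\<lambda>_. s"])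
qed

text \<open>Take a polygon that misses the total length by less than \<open>e / 2\<close>. By
  uniform continuity its part over a short parameter interval has length at most
  \<open>e / 2\<close>, so the parts outside already exceed \<open>L - e\<close>, and
  superadditivity leaves at most \<open>e\<close> for the interval.\<close>

lemma arc_length_uniformly_small:
  assumes c: "continuous_on {a..b} c" and fin: "arc_length c a b < \<infinity>" and e: "0 < e"
  shows "\<exists>d>0. \<forall>s t. a \<le> s \<and> s \<le> t \<and> t \<le> b \<and> t - s < d \<longrightarrow> arc_length c s t \<le> ennreal e"
proof (cases "a \<le> b")
  case True
  obtain L where L: "arc_length c a b = ennreal L" "L \<ge> 0" using fin by (cases "arc_length c a b") auto
  show ?thesis
  proof (cases "L < e")
    case True
    have "arc_length c s t \<le> ennreal e" if "a \<le> s" "s \<le> t" "t \<le> b" for s t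
    proof -
      have "arc_length c s t \<le> arc_length c a b"
        using arc_length_superadditive[of a s b c] arc_length_superadditive[of s t b c] that
        by (metis add_increasing add_increasing2 le_iff_add order_trans zero_le)
      also have "\<dots> \<le> ennreal e" using True L by (simp add: ennreal_leI)
      finally show ?thesis .
    qed
    then show ?thesis using e by (intro exI[of _ 1]) auto
  next
    case False
    have "ennreal (L - e / 2) < arc_length c a b" using L e False by (simp add: ennreal_lessI)
    then obtain n t where t: "mono_on {..n} t" "t ` {..n} \<subseteq> {a..b}" "ennreal (L - e / 2) < ennreal (polygon_sum c n t)"
      unfolding arc_length_eq less_SUP_iff by auto
    have pol: "L - e / 2 < polygon_sum c n t"
      using t(3) by (meson ennreal_leI leD not_le_imp_less)
    have "uniformly_continuous_on {a..b} c"
      by (rule compact_uniformly_continuous[OF c]) simp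
    then obtain d where d: "d > 0" "\<And>x y. x \<in> {a..b} \<Longrightarrow> y \<in> {a..b} \<Longrightarrow> dist y x < d \<Longrightarrow> dist (c y) (c x) < e / (2 * Suc n)"
      unfolding uniformly_continuous_on_def using e
      by (elim allE[of _ "e / (2 * Suc n)"]) auto
    have "arc_length c u v \<le> ennreal e" if uv: "a \<le> u" "u \<le> v" "v \<le> b" "v - u < d" for u v
    proof -
      \<comment> \<open>The polygon is truncated to the parameters below \<open>u\<close>, between
        \<open>u\<close> and \<open>v\<close>, and above \<open>v\<close>.\<close>
      define t1 t2 t3 where "t1 k = min (t k) u" and "t2 k = min (max (t k) u) v" and "t3 k = max (max (t k) u) v" for k
      have tk: "a \<le> t k" "t k \<le> b" if "k \<le> n" for k using t(2) that by auto
      have "polygon_sum c n t \<le> polygon_sum c n t1 + (polygon_sum c n t2 + polygon_sum c n t3)"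
        unfolding t1_def t2_def t3_def
        using polygon_sum_split[of c n t u] polygon_sum_split[of c n "\<lambda>k. max (t k) u" v] by linarith
      moreover have "polygon_sum c n t2 \<le> e / 2"
      proof -
        have "polygon_sum c n t2 \<le> (\<Sum>k<n. e / (2 * Suc n))"
          unfolding polygon_sum_def
        proof (intro sum_mono less_imp_le d(2))
          fix k assume "k \<in> {..<n}"
          then show "t2 (Suc k) \<in> {a..b}" "t2 k \<in> {a..b}" "dist (t2 k) (t2 (Suc k)) < d"
            using uv by (auto simp: t2_def dist_real_def)
        qed
        also have "\<dots> \<le> e / 2" using e by (simp add: field_simps)
        finally show ?thesis .
      qed
      ultimately have "L - e < polygon_sum c n t1 + polygon_sum c n t3" using pol by linarith
      moreover have "mono_on {..n} t1" "mono_on {..n} t3"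
        using mono_onD[OF t(1)] unfolding t1_def t3_def
        by (auto intro!: mono_onI min.mono max.mono)
      moreover have "t1 ` {..n} \<subseteq> {a..u}" "t3 ` {..n} \<subseteq> {v..b}"
        using tk uv by (auto simp: t1_def t3_def)
      ultimately have *: "L - e < polygon_sum c n t1 + polygon_sum c n t3"
        "ennreal (polygon_sum c n t1) \<le> arc_length c a u" "ennreal (polygon_sum c n t3) \<le> arc_length c v b"
        by (auto intro: polygon_sum_le_arc_length)
      have add: "arc_length c a u + (arc_length c u v + arc_length c v b) \<le> ennreal L"
        using arc_length_superadditive[of a u b c] arc_length_superadditive[of u v b c] uv L
        by (metis add_left_mono order_trans)
      then have "arc_length c a u < \<infinity>" "arc_length c u v < \<infinity>" "arc_length c v b < \<infinity>"
        by (auto simp: less_top[symmetric] top_unique)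
      then obtain x y z where xyz: "arc_length c a u = ennreal x" "x \<ge> 0" "arc_length c u v = ennreal y" "y \<ge> 0"
          "arc_length c v b = ennreal z" "z \<ge> 0"
        by (metis ennreal_cases infinity_ennreal_def order_less_irrefl)
      have "x + (y + z) \<le> L" using add xyz L by (simp flip: ennreal_plus)
      moreover have "polygon_sum c n t1 \<le> x" "polygon_sum c n t3 \<le> z"
        using * xyz by auto
      ultimately show ?thesis using * xyz by (simp add: ennreal_leI)
    qed
    then show ?thesis using d(1) by blast
  qed
qed (use e in \<open>auto intro!: exI[of _ 1]\<close>)

lemma arc_length_subadditive:
  assumes "a \<le> s" "s \<le> b"
  shows "arc_length c a b \<le> arc_length c a s + arc_length c s b"
  unfolding arc_length_eq[of c a b]
proof (intro SUP_least, clarify)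
  fix n :: nat and t :: "nat \<Rightarrow> real" assume t: "mono_on {..n} t" "t ` {..n} \<subseteq> {a..b}"
  have tk: "a \<le> t k" "t k \<le> b" if "k \<le> n" for k using t(2) that by auto
  have "ennreal (polygon_sum c n t) \<le> ennreal (polygon_sum c n (\<lambda>k. min (t k) s) + polygon_sum c n (\<lambda>k. max (t k) s))"
    by (intro ennreal_leI polygon_sum_split)
  also have "\<dots> = ennreal (polygon_sum c n (\<lambda>k. min (t k) s)) + ennreal (polygon_sum c n (\<lambda>k. max (t k) s))"
    by (simp add: polygon_sum_def sum_nonneg)
  also have "\<dots> \<le> arc_length c a s + arc_length c s b"
    using mono_onD[OF t(1)] tk assms
    by (intro add_mono polygon_sum_le_arc_length)
       (auto intro!: mono_onI min.mono max.mono intro: order_trans simp: min.coboundedI1 max.coboundedI1)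
  finally show "ennreal (polygon_sum c n t) \<le> arc_length c a s + arc_length c s b" .
qed

lemma arc_length_additive:
  "a \<le> s \<Longrightarrow> s \<le> b \<Longrightarrow> arc_length c a b = arc_length c a s + arc_length c s b"
  by (intro antisym arc_length_subadditive arc_length_superadditive)

text \<open>The length function \<open>l\<close> is continuous by
  \<open>arc_length_uniformly_small\<close>, so the intermediate value theorem makes it onto, and
  its increments dominate chords. These facts make the arc length parametrization a 1-Lipschitz
  curve through the same points.\<close>

lemma arc_length_attained:
  assumes c: "continuous_on {a..b} c" and ab: "a \<le> b" and L: "arc_length c a b = ennreal L" "L \<ge> 0"
  shows "\<exists>l. continuous_on {a..b} l \<and> (\<forall>t\<in>{a..b}. arc_length c a t = ennreal (l t) \<and> 0 \<le> l t \<and> l t \<le> L) \<and>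
     (\<forall>s t. a \<le> s \<and> s \<le> t \<and> t \<le> b \<longrightarrow> dist (c s) (c t) \<le> l t - l s) \<and>
     (\<forall>s\<in>{0..L}. \<exists>t\<in>{a..b}. l t = s)"
proof -
  define l where "l t = enn2real (arc_length c a t)" for t
  have fin: "arc_length c s t < \<infinity>" if "a \<le> s" "s \<le> t" "t \<le> b" for s t
  proof -
    have "arc_length c a b = arc_length c a s + (arc_length c s t + arc_length c t b)"
      using arc_length_additive[of a s b c] arc_length_additive[of s t b c] that by simp
    then show ?thesis using L by (auto simp: less_top[symmetric] top_unique)
  qed
  have l: "arc_length c a t = ennreal (l t)" "0 \<le> l t" if "t \<in> {a..b}" for t
    using fin[of a t] that by (auto simp: l_def ennreal_enn2real)
  have inc: "arc_length c s t = ennreal (l t - l s)" "l s \<le> l t" if "a \<le> s" "s \<le> t" "t \<le> b" for s t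
  proof -
    have "arc_length c s t < \<infinity>" using that by (rule fin)
    then obtain r where r: "arc_length c s t = ennreal r" "r \<ge> 0" by (cases "arc_length c s t") auto
    have "ennreal (l t) = ennreal (l s + r)"
      using arc_length_additive[of a s t c] that l[of s] l[of t] r by simp
    moreover have "0 \<le> l t" "0 \<le> l s + r" using l[of s] l[of t] r that by auto
    ultimately have "l t = l s + r" using ennreal_inj by blast
    then show "arc_length c s t = ennreal (l t - l s)" "l s \<le> l t" using r by auto
  qed
  have lL: "l b = L" using l[of b] L ab by (auto simp: ennreal_inj)
  have la: "l a = 0" using inc(1)[of a a] ab l(1)[of a] arc_length_additive[of a a a c]
    by (metis add_cancel_right_left atLeastAtMost_iff diff_self ennreal_0 enn2real_0 l_def order_refl)
  have cont: "continuous_on {a..b} l"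
    unfolding continuous_on_iff
  proof (intro ballI allI impI)
    fix x and e :: real assume x: "x \<in> {a..b}" and e: "e > 0"
    obtain d where d: "d > 0" "\<And>s t. a \<le> s \<and> s \<le> t \<and> t \<le> b \<and> t - s < d \<Longrightarrow> arc_length c s t \<le> ennreal (e / 2)"
      using arc_length_uniformly_small[OF c, of "e/2"] L e by auto
    have small: "l t - l s \<le> e / 2" if "a \<le> s" "s \<le> t" "t \<le> b" "t - s < d" for s t
      using d(2)[of s t] inc[of s t] that e by (simp add: ennreal_le_iff)
    show "\<exists>d>0. \<forall>x'\<in>{a..b}. dist x' x < d \<longrightarrow> dist (l x') (l x) < e"
    proof (intro exI conjI ballI impI)
      fix y assume y: "y \<in> {a..b}" "dist y x < d"
      show "dist (l y) (l x) < e"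
      proof (cases "x \<le> y")
        case True
        then show ?thesis using small[of x y] inc(2)[of x y] x y e by (auto simp: dist_real_def)
      next
        case False
        then show ?thesis using small[of y x] inc(2)[of y x] x y e by (auto simp: dist_real_def)
      qed
    qed (rule d(1))
  qed
  have "\<exists>t\<in>{a..b}. l t = s" if "s \<in> {0..L}" for s
    using IVT'[of l a s b] that la lL ab cont by auto
  moreover have "dist (c s) (c t) \<le> l t - l s" if "a \<le> s" "s \<le> t" "t \<le> b" for s t
    using dist_le_arc_length[of s t c] inc[OF that] that by simp
  moreover have "l t \<le> L" if "t \<in> {a..b}" for t using inc(2)[of t b] that lL by simp
  ultimately show ?thesis using l cont by blast
qed

text \<open>In arc length parametrization the path is 1-Lipschitz, so if the parameters mapped into
  \<open>S\<close> had measure zero, the part of the trace in \<open>S\<close> would have length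
  zero. The infinite density is therefore integrated over a set of positive measure.\<close>

lemma compact_line_integral_infinite:
  assumes c: "continuous_on {a..b} c" and ab: "a \<le> b" and fin: "arc_length c a b < \<infinity>"
    and S: "S \<in> sets borel" and H: "hausdorff1 (c ` {a..b} \<inter> S) \<noteq> 0"
  shows "1 \<le> compact_line_integral c a b (\<lambda>z. \<infinity> * indicator S z)"
proof -
  obtain L where L: "arc_length c a b = ennreal L" "L \<ge> 0" using fin by (cases "arc_length c a b") auto
  obtain l where l: "continuous_on {a..b} l" "\<And>t. t\<in>{a..b} \<Longrightarrow> arc_length c a t = ennreal (l t) \<and> 0 \<le> l t \<and> l t \<le> L"
     "\<And>s t. a \<le> s \<Longrightarrow> s \<le> t \<Longrightarrow> t \<le> b \<Longrightarrow> dist (c s) (c t) \<le> l t - l s"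
     "\<And>s. s\<in>{0..L} \<Longrightarrow> \<exists>t\<in>{a..b}. l t = s"
    using arc_length_attained[OF c ab L] by blast
  let ?g = "arc_param c a b"
  have dl: "dist (c s) (c t) \<le> \<bar>l s - l t\<bar>" if "s \<in> {a..b}" "t \<in> {a..b}" for s t
  proof (cases "s \<le> t")
    case True
    then show ?thesis using l(3)[of s t] that by auto
  next
    case False
    then show ?thesis using l(3)[of t s] that by (auto simp: dist_commute)
  qed
  have par: "\<exists>t\<in>{a..b}. l t = s \<and> ?g s = c t" if s: "s \<in> {0..L}" for s
  proof -
    have "\<exists>t. t \<in> {a..b} \<and> arc_length c a t = ennreal s" using l(2) l(4)[OF s] by blast
    from someI_ex[OF this] obtain t where t: "t \<in> {a..b}" "arc_length c a t = ennreal s" "?g s = c t"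
      unfolding arc_param_def by blast
    then have "l t = s" using l(2)[of t] s by (auto simp: ennreal_inj)
    then show ?thesis using t by blast
  qed
  have lip: "dist (?g s) (?g s') \<le> \<bar>s - s'\<bar>" if "s \<in> {0..L}" "s' \<in> {0..L}" for s s'
    using par[OF that(1)] par[OF that(2)] dl by metis
  have cg: "continuous_on {0..L} ?g"
    unfolding continuous_on_iff using lip by (metis dist_real_def le_less_trans)
  define A where "A = {s \<in> {0..L}. ?g s \<in> S}"
  have Aeq: "A = (\<lambda>s. if s \<in> {0..L} then ?g s else 0) -` S \<inter> space borel \<inter> {0..L}"
    by (auto simp: A_def)
  have mg: "(\<lambda>s. if s \<in> {0..L} then ?g s else 0) \<in> borel_measurable borel"
    by (rule borel_measurable_continuous_on_if) (use cg in auto)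
  have mA [measurable]: "A \<in> sets borel"
    unfolding Aeq using measurable_sets[OF mg S] by auto
  have "c ` {a..b} \<inter> S \<subseteq> ?g ` A"
  proof
    fix z assume "z \<in> c ` {a..b} \<inter> S"
    then obtain t where t: "t \<in> {a..b}" "z = c t" "z \<in> S" by blast
    have lt: "l t \<in> {0..L}" using l(2)[OF t(1)] by auto
    obtain t' where t': "t' \<in> {a..b}" "l t' = l t" "?g (l t) = c t'" using par[OF lt] by blast
    then have "c t' = c t" using dl[OF t(1) t'(1)] by auto
    then show "z \<in> ?g ` A" using t t' lt by (intro image_eqI[of _ _ "l t"]) (auto simp: A_def)
  qed
  have "A \<notin> null_sets lebesgue"
  proof
    assume "A \<in> null_sets lebesgue"
    then have "hausdorff1 (?g ` A) = 0"
      by (rule hausdorff1_lipschitz_image_null) (auto simp: A_def intro: lip)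
    then show False using H hausdorff1_null_mono[OF _ \<open>c ` {a..b} \<inter> S \<subseteq> ?g ` A\<close>] by blast
  qed
  then have "emeasure lborel A \<noteq> 0"
    using mA null_sets_completionI[of A lborel] by (auto simp: null_sets_def)
  have "compact_line_integral c a b (\<lambda>z. \<infinity> * indicator S z) = (\<integral>\<^sup>+s. \<infinity> * indicator A s \<partial>lborel)"
    unfolding compact_line_integral_def using L
    by (intro nn_integral_cong) (auto simp: A_def indicator_def)
  also have "\<dots> = \<infinity> * emeasure lborel A"
    by (subst nn_integral_cmult_indicator) auto
  also have "\<dots> = \<infinity>" using \<open>emeasure lborel A \<noteq> 0\<close> by (simp add: ennreal_top_mult)
  finally show ?thesis by simp
qed

text \<open>The rational points of the interval, together with its least and greatest elements where
  they exist. They exhaust a path by countably many compact pieces, over which null sets can be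
  united.\<close>

lemma interval_countable_cofinal:
  fixes I :: "real set"
  assumes "is_interval I"
  shows "\<exists>D. countable D \<and> D \<subseteq> I \<and> (\<forall>t\<in>I. \<exists>p\<in>D. \<exists>q\<in>D. p \<le> t \<and> t \<le> q)"
proof -
  define D where "D = (I \<inter> \<rat>) \<union> {t\<in>I. \<forall>s\<in>I. t \<le> s} \<union> {t\<in>I. \<forall>s\<in>I. s \<le> t}"
  have "\<exists>p\<in>D. p \<le> t" if t: "t \<in> I" for t
  proof (cases "\<forall>s\<in>I. t \<le> s")
    case False
    then obtain s where "s \<in> I" "s < t" by force
    moreover then obtain q where q: "q \<in> \<rat>" "s < q" "q < t" using Rats_dense_in_real by blast
    ultimately have "q \<in> I" using mem_is_interval_1_I[OF assms, of s t q] t by simp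
    then show ?thesis using q by (intro bexI[of _ q]) (auto simp: D_def)
  qed (use t in \<open>auto simp: D_def\<close>)
  moreover have "\<exists>p\<in>D. t \<le> p" if t: "t \<in> I" for t
  proof (cases "\<forall>s\<in>I. s \<le> t")
    case False
    then obtain s where "s \<in> I" "t < s" by force
    moreover then obtain q where q: "q \<in> \<rat>" "t < q" "q < s" using Rats_dense_in_real by blast
    ultimately have "q \<in> I" using mem_is_interval_1_I[OF assms, of t s q] t by simp
    then show ?thesis using q by (intro bexI[of _ q]) (auto simp: D_def)
  qed (use t in \<open>auto simp: D_def\<close>)
  moreover have "countable D"
  proof -
    have "{t\<in>I. \<forall>s\<in>I. t \<le> s} \<subseteq> {Inf I}" "{t\<in>I. \<forall>s\<in>I. s \<le> t} \<subseteq> {Sup I}"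
      using cInf_eq_minimum[of _ I] cSup_eq_maximum[of _ I] by auto
    then have "countable {t\<in>I. \<forall>s\<in>I. t \<le> s}" "countable {t\<in>I. \<forall>s\<in>I. s \<le> t}"
      by (auto intro: countable_subset)
    moreover have "countable (I \<inter> \<rat>)" using countable_rat by blast
    ultimately show ?thesis unfolding D_def by blast
  qed
  moreover have "D \<subseteq> I" by (auto simp: D_def)
  ultimately show ?thesis by (intro exI[of _ D]) blast
qed

lemma hausdorff1_null_countable_UN:
  assumes "countable A" "\<And>x. x \<in> A \<Longrightarrow> hausdorff1 (E x) = 0"
  shows "hausdorff1 (\<Union>x\<in>A. E x) = 0"
proof (cases "A = {}")
  case True
  have "hausdorff1 {} = 0"
    by (rule hausdorff1_null_mono[OF hausdorff1_lipschitz_image_null[of "{}" "\<lambda>_. 0"]]) auto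
  then show ?thesis using True by simp
next
  case False
  then have "(\<Union>x\<in>A. E x) = (\<Union>n. E (from_nat_into A n))"
    using assms(1) range_from_nat_into[of A] by (metis image_image)
  then show ?thesis
    using assms(2) from_nat_into[OF False] by (simp add: hausdorff1_null_UN)
qed

text \<open>The density that is infinite on \<open>S\<close> and zero elsewhere costs nothing,
  because \<open>S\<close> has area zero. Paths that are not locally rectifiable have infinite line
  integral by convention; on the others some compact piece meets \<open>S\<close> in positive
  length.\<close>

lemma mod2_null_of_hausdorff1:
  assumes S: "S \<in> sets borel" "emeasure lborel S = 0"
  shows "mod2 {\<gamma>. is_cpath \<gamma> \<and> hausdorff1 (trace \<gamma> \<inter> S) \<noteq> 0} = 0"
  unfolding mod2_eq_0_iff
proof (intro allI impI bexI conjI ballI)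
  fix e :: real assume "e > 0"
  have "(\<integral>\<^sup>+ z. (\<infinity> * indicator S z)\<^sup>2 \<partial>lborel) = (\<integral>\<^sup>+ z. \<infinity> * indicator S z \<partial>lborel)"
    by (intro nn_integral_cong) (auto simp: indicator_def)
  also have "\<dots> = 0" using S by (subst nn_integral_cmult_indicator) auto
  finally show "(\<integral>\<^sup>+ z. (\<infinity> * indicator S z)\<^sup>2 \<partial>lborel) \<le> ennreal e" by simp
  show "(\<lambda>z. \<infinity> * indicator S z :: ennreal) \<in> borel_measurable borel"
    using S(1) by measurable
  fix \<gamma> assume "\<gamma> \<in> {\<gamma>. is_cpath \<gamma> \<and> hausdorff1 (trace \<gamma> \<inter> S) \<noteq> 0}"
  then have g: "is_cpath \<gamma>" "hausdorff1 (trace \<gamma> \<inter> S) \<noteq> 0" by auto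
  show "1 \<le> line_integral \<gamma> (\<lambda>z. \<infinity> * indicator S z)"
  proof (cases "locally_rectifiable \<gamma>")
    case True
    obtain D where D: "countable D" "D \<subseteq> fst \<gamma>" "\<And>t. t\<in>fst \<gamma> \<Longrightarrow> \<exists>p\<in>D. \<exists>q\<in>D. p \<le> t \<and> t \<le> q"
      using interval_countable_cofinal[of "fst \<gamma>"] g(1) unfolding is_cpath_def by blast
    have "trace \<gamma> \<inter> S \<subseteq> (\<Union>(p, q)\<in>D \<times> D. snd \<gamma> ` {p..q} \<inter> S)"
      using D(3) unfolding trace_def by fastforce
    then have "hausdorff1 (\<Union>(p, q)\<in>D \<times> D. snd \<gamma> ` {p..q} \<inter> S) \<noteq> 0"
      using g(2) hausdorff1_null_mono by blast
    then obtain p q where pq: "p \<in> D" "q \<in> D" "hausdorff1 (snd \<gamma> ` {p..q} \<inter> S) \<noteq> 0"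
    proof -
      have "\<not> (\<forall>x\<in>D \<times> D. hausdorff1 ((\<lambda>(p, q). snd \<gamma> ` {p..q} \<inter> S) x) = 0)"
        using hausdorff1_null_countable_UN[of "D \<times> D" "\<lambda>(p, q). snd \<gamma> ` {p..q} \<inter> S"] D(1)
          \<open>hausdorff1 (\<Union>(p, q)\<in>D \<times> D. snd \<gamma> ` {p..q} \<inter> S) \<noteq> 0\<close> by (meson countable_SIGMA)
      then show ?thesis using that by auto
    qed
    have "p \<le> q"
    proof (rule ccontr)
      assume "\<not> p \<le> q"
      then show False using pq(3) hausdorff1_null_countable_UN[of "{}" "\<lambda>_. {}"] by simp
    qed
    have pqI: "p \<in> fst \<gamma>" "q \<in> fst \<gamma>" using pq D(2) by auto
    have sub: "{p..q} \<subseteq> fst \<gamma>"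
      using g(1) pqI mem_is_interval_1_I[of "fst \<gamma>" p q] unfolding is_cpath_def by auto
    have "1 \<le> compact_line_integral (snd \<gamma>) p q (\<lambda>z. \<infinity> * indicator S z)"
    proof (rule compact_line_integral_infinite)
      show "continuous_on {p..q} (snd \<gamma>)"
        using g(1) sub closure_subset[of "fst \<gamma>"] unfolding is_cpath_def
        by (intro continuous_on_subset[of "closure (fst \<gamma>)" "snd \<gamma>" "{p..q}"]) blast+
      show "arc_length (snd \<gamma>) p q < \<infinity>"
        using True pqI \<open>p \<le> q\<close> unfolding locally_rectifiable_def by blast
    qed (use pq \<open>p \<le> q\<close> S in auto)
    also have "\<dots> \<le> line_integral \<gamma> (\<lambda>z. \<infinity> * indicator S z)"
      unfolding line_integral_def using True pqI \<open>p \<le> q\<close>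
      by (auto intro!: SUP_upper2[of "(p, q)"])
    finally show ?thesis .
  qed (simp add: line_integral_def)
qed

section \<open>Packing of peripheral disks\<close>

lemma emeasure_le_of_separation:
  fixes T :: "real set"
  assumes T: "T \<in> sets borel" and d: "\<And>x y. x \<in> T \<Longrightarrow> y \<in> T \<Longrightarrow> \<bar>x - y\<bar> \<le> d"
  shows "emeasure lborel T \<le> ennreal d"
proof (cases "T = {}")
  case False
  then obtain t where t: "t \<in> T" by blast
  have bd: "bdd_above T" "bdd_below T"
    using d[OF _ t] by (auto intro!: bdd_aboveI[of _ "t + d"] bdd_belowI[of _ "t - d"] simp: abs_le_iff algebra_simps)
  have "Sup T - Inf T \<le> d"
  proof -
    have "x \<le> Inf T + d" if "x \<in> T" for x
    proof -
      have "x - d \<le> Inf T" using False d[OF that] by (intro cInf_greatest) (auto simp: abs_le_iff algebra_simps)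
      then show ?thesis by simp
    qed
    then have "Sup T \<le> Inf T + d" using False by (intro cSup_least) auto
    then show ?thesis by simp
  qed
  have "emeasure lborel T \<le> emeasure lborel {Inf T..Sup T}"
    using bd T by (intro emeasure_mono) (auto intro: cInf_lower cSup_upper)
  also have "\<dots> = ennreal (Sup T - Inf T)"
    using bd t by (simp add: cInf_le_cSup False)
  also have "\<dots> \<le> ennreal d" using \<open>Sup T - Inf T \<le> d\<close> by (rule ennreal_leI)
  finally show ?thesis .
qed simp

locale sierpinski =
  fixes v :: version and K1 :: real and \<Omega> :: "complex set" and Q :: "nat \<Rightarrow> complex set"
  assumes K1: "K1 > 0"
    and open_Omega: "open \<Omega>"
    and Q_open: "\<And>i. open (Q i)" and Q_connected: "\<And>i. connected (Q i)"
    and Q_bounded: "\<And>i. bounded (Q i)" and Q_nonempty: "\<And>i. Q i \<noteq> {}"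
    and Q_closure: "\<And>i. closure (Q i) \<subseteq> \<Omega>"
    and Q_disjoint: "\<And>i j. i \<noteq> j \<Longrightarrow> closure (Q i) \<inter> closure (Q j) = {}"
    and carpet_interior: "interior (carpet \<Omega> Q) = {}"
    and carpet_null: "emeasure lborel (carpet \<Omega> Q) = 0"
    and Q_fat: "fat K1 Q"
begin

abbreviation "S \<equiv> carpet \<Omega> Q"
abbreviation "dm i \<equiv> diameter (Q i)"

lemma frontier_carpet: "frontier (Q i) \<subseteq> S"
proof
  fix z assume z: "z \<in> frontier (Q i)"
  then have "z \<in> closure (Q i)" "z \<notin> Q i"
    using Q_open by (auto simp: frontier_def interior_open)
  moreover have "z \<notin> Q j" if "j \<noteq> i" for j
    using Q_disjoint[OF that] closure_subset[of "Q j"] \<open>z \<in> closure (Q i)\<close> by blast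
  ultimately show "z \<in> S"
    using Q_closure[of i] by (auto simp: carpet_def) (metis)
qed

lemma frontier_nonempty: "frontier (Q i) \<noteq> {}"
  using frontier_eq_empty[of "Q i"] Q_nonempty Q_bounded not_bounded_UNIV by metis

lemma Q_unique: "z \<in> Q i \<Longrightarrow> z \<in> Q j \<Longrightarrow> i = j"
  using Q_disjoint[of i j] closure_subset by blast

lemma closure_unique: "z \<in> closure (Q i) \<Longrightarrow> z \<in> closure (Q j) \<Longrightarrow> i = j"
  using Q_disjoint[of i j] by blast

lemma carpet_not_Q: "z \<in> S \<Longrightarrow> z \<notin> Q i"
  by (auto simp: carpet_def)

lemma not_carpet: "z \<in> \<Omega> \<Longrightarrow> z \<notin> S \<Longrightarrow> \<exists>i. z \<in> Q i"
  by (auto simp: carpet_def)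

lemma frontier_not_Q: "z \<in> frontier (Q i) \<Longrightarrow> z \<notin> Q j"
  using frontier_carpet carpet_not_Q by blast

lemma closure_frontier: "closure (Q i) = Q i \<union> frontier (Q i)"
  by (simp add: closure_Un_frontier)

lemma meets_frontier:
  assumes "connected T" "z \<in> T" "z \<in> Q i" "w \<in> T" "w \<notin> Q i"
  shows "T \<inter> frontier (Q i) \<noteq> {}"
  using connected_Int_frontier[of T "Q i"] assms by blast

lemma S_sets [measurable]: "S \<in> sets borel"
  unfolding carpet_def using open_Omega Q_open by auto

lemma dm_pos: "0 < dm i"
proof -
  obtain z where "z \<in> Q i" using Q_nonempty by blast
  then obtain e where e: "e > 0" "ball z e \<subseteq> Q i" using Q_open openE by blast
  have "dist z (z + of_real (e/2)) \<le> dm i"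
    using e by (intro diameter_bounded_bound[OF Q_bounded] subsetD[OF e(2)]) (auto simp: dist_norm)
  then show ?thesis using e by (simp add: dist_norm)
qed

lemma dist_closure_le: "z \<in> closure (Q i) \<Longrightarrow> w \<in> closure (Q i) \<Longrightarrow> dist z w \<le> dm i"
  using diameter_bounded_bound[of "closure (Q i)" z w] diameter_closure[OF Q_bounded] Q_bounded
  by auto

text \<open>Fatness puts into each disk a piece of area at least
  \<open>K1 * (\<rho> i)\<^sup>2\<close>; these pieces are disjoint and lie in a square of side
  \<open>4 * r\<close>. Truncating the diameter at \<open>r\<close> admits disks that are much
  larger than the ball.\<close>

lemma packing:
  assumes r: "r > 0"
  shows "sum_along Q (\<lambda>i. (ennreal (min (dm i) r))\<^sup>2) (ball x r) \<le> ennreal (64 / K1 * r\<^sup>2)"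
proof -
  let ?M = "meeting Q (ball x r)"
  \<comment> \<open>Half of the truncated diameter: fatness demands a radius strictly below the
    diameter, and the pieces must stay within \<open>2 * r\<close> of \<open>x\<close>. The halving
    costs a factor 4, whence 64 = 4 * 16 in the bound.\<close>
  define \<rho> where "\<rho> i = min (dm i) r / 2" for i
  have \<rho>: "0 < \<rho> i" "\<rho> i < dm i" "\<rho> i \<le> r / 2" for i using dm_pos[of i] r by (auto simp: \<rho>_def min_def)
  define p where "p i = (SOME z. z \<in> Q i \<inter> ball x r)" for i
  have p: "p i \<in> Q i" "p i \<in> ball x r" if "i \<in> ?M" for i
  proof -
    have "\<exists>z. z \<in> Q i \<inter> ball x r" using that by (auto simp: meeting_def)
    then have "p i \<in> Q i \<inter> ball x r" unfolding p_def by (rule someI_ex)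
    then show "p i \<in> Q i" "p i \<in> ball x r" by auto
  qed
  define E where "E i = (if i \<in> ?M then ball (p i) (\<rho> i) \<inter> Q i else {})" for i
  have Em: "E i \<in> sets borel" for i using Q_open by (auto simp: E_def)
  have "disjoint_family E"
    unfolding disjoint_family_on_def E_def using Q_unique by auto
  let ?B = "box (x - Complex (2*r) (2*r)) (x + Complex (2*r) (2*r))"
  have "E i \<subseteq> ?B" for i
  proof
    fix z assume "z \<in> E i"
    then have i: "i \<in> ?M" "dist (p i) z < \<rho> i" by (auto simp: E_def split: if_splits)
    then have "dist x z < 2 * r"
      using p(2)[OF i(1)] \<rho>(3)[of i] dist_triangle[of x z "p i"] r unfolding mem_ball by linarith
    then have "cmod (x - z) < 2 * r" by (simp add: dist_norm)
    then have "\<bar>Re (x - z)\<bar> < 2 * r" "\<bar>Im (x - z)\<bar> < 2 * r"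
      using abs_Re_le_cmod[of "x - z"] abs_Im_le_cmod[of "x - z"] by linarith+
    then show "z \<in> ?B"
      by (auto simp: mem_box Basis_complex_def inner_complex_def)
  qed
  then have UB: "(\<Union>i. E i) \<subseteq> ?B" by blast
  have "ennreal (K1 / 4) * sum_along Q (\<lambda>i. (ennreal (min (dm i) r))\<^sup>2) (ball x r) =
      (\<Sum>i. ennreal (K1 / 4) * ((ennreal (min (dm i) r))\<^sup>2 * indicator ?M i))"
    unfolding sum_along_eq by simp
  also have "\<dots> \<le> (\<Sum>i. emeasure lborel (E i))"
  proof (intro suminf_le)
    fix i
    show "ennreal (K1 / 4) * ((ennreal (min (dm i) r))\<^sup>2 * indicator ?M i) \<le> emeasure lborel (E i)"
    proof (cases "i \<in> ?M")
      case True
      have "ennreal (K1 / 4) * (ennreal (min (dm i) r))\<^sup>2 = ennreal (K1 * (\<rho> i)\<^sup>2)"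
        using K1 dm_pos[of i] r
        by (simp add: ennreal_power \<rho>_def power_divide flip: ennreal_mult)
      also have "\<dots> \<le> emeasure lborel (E i)"
        using Q_fat p[OF True] \<rho>[of i] True unfolding fat_def E_def by auto
      finally show ?thesis using True by simp
    qed simp
  qed auto
  also have "\<dots> = emeasure lborel (\<Union>i. E i)"
    using Em \<open>disjoint_family E\<close> by (intro suminf_emeasure) auto
  also have "\<dots> \<le> emeasure lborel ?B"
    using UB by (intro emeasure_mono) auto
  also have "\<dots> = ennreal (16 * r\<^sup>2)"
    using r by (subst emeasure_lborel_box) (auto simp: Basis_complex_def inner_complex_def power2_eq_square)
  finally have le: "ennreal (K1 / 4) * sum_along Q (\<lambda>i. (ennreal (min (dm i) r))\<^sup>2) (ball x r) \<le> ennreal (16 * r\<^sup>2)" .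
  have "sum_along Q (\<lambda>i. (ennreal (min (dm i) r))\<^sup>2) (ball x r) =
      ennreal (4 / K1) * (ennreal (K1 / 4) * sum_along Q (\<lambda>i. (ennreal (min (dm i) r))\<^sup>2) (ball x r))"
    using K1 by (simp flip: mult.assoc ennreal_mult)
  also have "\<dots> \<le> ennreal (4 / K1) * ennreal (16 * r\<^sup>2)" by (intro mult_left_mono le) auto
  also have "\<dots> = ennreal (64 / K1 * r\<^sup>2)" using K1 by (simp flip: ennreal_mult)
  finally show ?thesis .
qed

lemma finite_large:
  assumes "bounded V" "\<delta> > 0"
  shows "finite {i \<in> meeting Q V. \<delta> \<le> dm i}"
proof -
  obtain r x where r: "r > 0" "V \<subseteq> ball x r"
    using assms(1) bounded_subset_ballD by blast
  let ?f = "\<lambda>i. (ennreal (min (dm i) r))\<^sup>2 * indicator (meeting Q (ball x r)) i"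
  have "(\<Sum>i. ?f i) \<le> ennreal (64 / K1 * r\<^sup>2)"
    using packing[OF r(1), of x] unfolding sum_along_eq .
  then have "(\<Sum>i. ?f i) < \<infinity>" by (simp add: le_less_trans)
  then have "finite {i. ennreal ((min \<delta> r)\<^sup>2) \<le> ?f i}"
    using assms r by (intro finite_of_suminf_finite) auto
  moreover have "{i \<in> meeting Q V. \<delta> \<le> dm i} \<subseteq> {i. ennreal ((min \<delta> r)\<^sup>2) \<le> ?f i}"
    using meeting_mono[OF r(2), of Q] assms(2) r(1)
    by (auto simp: ennreal_power intro!: ennreal_leI power_mono)
  ultimately show ?thesis by (rule finite_subset[rotated])
qed

text \<open>Disks of diameter below \<open>r\<close> are controlled by \<open>packing\<close>, and
  only finitely many are larger.\<close>

lemma sum_diam_square_finite: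
  assumes "bounded V"
  shows "sum_along Q (\<lambda>i. (ennreal (dm i))\<^sup>2) V < \<infinity>"
proof -
  obtain r x where r: "r > 0" "V \<subseteq> ball x r"
    using assms(1) bounded_subset_ballD by blast
  let ?L = "{i \<in> meeting Q V. r \<le> dm i}"
  have fin: "finite ?L" by (rule finite_large[OF assms r(1)])
  have "sum_along Q (\<lambda>i. (ennreal (dm i))\<^sup>2) V \<le>
      sum_along Q (\<lambda>i. (ennreal (min (dm i) r))\<^sup>2 + (ennreal (dm i))\<^sup>2 * indicator ?L i) V"
    by (intro sum_along_mono) (auto simp: min_def indicator_def)
  also have "\<dots> = sum_along Q (\<lambda>i. (ennreal (min (dm i) r))\<^sup>2) V + sum_along Q (\<lambda>i. (ennreal (dm i))\<^sup>2 * indicator ?L i) V"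
    by (rule sum_along_add)
  also have "\<dots> \<le> ennreal (64 / K1 * r\<^sup>2) + (\<Sum>i\<in>?L. (ennreal (dm i))\<^sup>2)"
  proof (intro add_mono)
    show "sum_along Q (\<lambda>i. (ennreal (min (dm i) r))\<^sup>2) V \<le> ennreal (64 / K1 * r\<^sup>2)"
      using sum_along_mono[OF r(2)] packing[OF r(1), of x] order_trans by blast
    have "sum_along Q (\<lambda>i. (ennreal (dm i))\<^sup>2 * indicator ?L i) V \<le> (\<Sum>i. (ennreal (dm i))\<^sup>2 * indicator ?L i)"
      by (rule sum_along_le_suminf)
    also have "\<dots> = (\<Sum>i\<in>?L. (ennreal (dm i))\<^sup>2 * indicator ?L i)"
      by (rule suminf_finite[OF fin]) auto
    also have "\<dots> = (\<Sum>i\<in>?L. (ennreal (dm i))\<^sup>2)" by (intro sum.cong) auto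
    finally show "sum_along Q (\<lambda>i. (ennreal (dm i))\<^sup>2 * indicator ?L i) V \<le> (\<Sum>i\<in>?L. (ennreal (dm i))\<^sup>2)" .
  qed
  also have "\<dots> < \<infinity>"
    using fin diameter_ge_0[OF Q_bounded] by (simp add: ennreal_power less_top[symmetric])
  finally show ?thesis .
qed

section \<open>Sums over disks, averaged over parallel segments\<close>

lemma seg_sum_measurable [measurable]:
  "(\<lambda>y. sum_along Q a (trace (seg h l r y))) \<in> borel_measurable borel"
proof -
  have "{y. i \<in> meeting Q (trace (seg h l r y))} \<in> sets borel" for i
  proof -
    \<comment> \<open>The set is open: for each \<open>x\<close>, the heights at which the point of
      the segment lies in the open disk form an open set.\<close>
    have "{y. i \<in> meeting Q (trace (seg h l r y))} = (\<Union>x\<in>{l..r}. (\<lambda>y. sg h x y) -` Q i)"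
      by (auto simp: meeting_def trace_seg)
    moreover have "open ((\<lambda>y. sg h x y) -` Q i)" for x
    proof (rule continuous_open_vimage[OF Q_open])
      show "\<And>y. isCont (\<lambda>y. sg h x y) y"
        unfolding continuous_at_eps_delta by (auto simp: dist_sg dist_real_def)
    qed
    ultimately show ?thesis by (simp add: borel_open open_UN)
  qed
  then have [measurable]: "Measurable.pred borel (\<lambda>y. i \<in> meeting Q (trace (seg h l r y)))" for i
    by (simp add: pred_def)
  have "(\<lambda>y. sum_along Q a (trace (seg h l r y))) =
      (\<lambda>y. \<Sum>i. a i * (if i \<in> meeting Q (trace (seg h l r y)) then 1 else 0))"
    by (auto simp: sum_along_eq indicator_def fun_eq_iff intro!: suminf_cong)
  then show ?thesis by simp
qed

text \<open>By Tonelli, since the parameters of the segments meeting \<open>Q i\<close> form a set of measure at most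
  \<open>dm i\<close>; the products \<open>a i * dm i\<close> are split with weight \<open>k\<close>, and the diameters are summed by packing.\<close>

lemma seg_sum_integral:
  assumes k: "k > 0" and R: "R > 0" "y2 - y1 \<le> R"
    and sub: "\<And>y. y \<in> {y1..y2} \<Longrightarrow> trace (seg h l r y) \<subseteq> ball x R"
  shows "(\<integral>\<^sup>+y\<in>{y1..y2}. sum_along Q a (trace (seg h l r y)) \<partial>lborel) \<le>
     ennreal R * (ennreal k * sum_along Q (\<lambda>i. (a i)\<^sup>2) (ball x R) + ennreal (64 / K1 / k))"
proof -
  let ?M = "meeting Q (ball x R)"
  define T where "T i = {y \<in> {y1..y2}. i \<in> meeting Q (trace (seg h l r y))}" for i
  have mT [measurable]: "T i \<in> sets borel" for i
  proof -
    \<comment> \<open>Measurability is obtained from \<open>seg_sum_measurable\<close>, applied to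
      the sequence that is 1 at the index \<open>i\<close> and 0 elsewhere.\<close>
    have "T i = {y1..y2} \<inter> {y\<in>space borel. sum_along Q (\<lambda>j. if j = i then 1 else 0) (trace (seg h l r y)) \<noteq> 0}"
    proof -
      have "sum_along Q (\<lambda>j. if j = i then 1 else 0) W \<noteq> 0 \<longleftrightarrow> i \<in> meeting Q W" for W
      proof -
        have "sum_along Q (\<lambda>j. if j = i then 1 else 0) W = (\<Sum>j\<in>{i}. (if j = i then 1 else 0) * indicator (meeting Q W) j)"
          unfolding sum_along_eq by (rule suminf_finite) auto
        then show ?thesis by (simp add: indicator_eq_0_iff)
      qed
      then show ?thesis by (auto simp: T_def)
    qed
    then show ?thesis by simp
  qed
  have TM: "emeasure lborel (T i) \<le> ennreal (min (dm i) R) * indicator ?M i" for i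
  proof (cases "i \<in> ?M")
    case True
    have "emeasure lborel (T i) \<le> ennreal (min (dm i) R)"
    proof (rule emeasure_le_of_separation)
      fix y y' assume yy: "y \<in> T i" "y' \<in> T i"
      then obtain s s' where "sg h s y \<in> Q i" "sg h s' y' \<in> Q i"
        by (auto simp: T_def meeting_def trace_seg)
      then have "dist (sg h s y) (sg h s' y') \<le> dm i"
        by (intro diameter_bounded_bound[OF Q_bounded])
      then have "\<bar>y - y'\<bar> \<le> dm i" using dist_sg_ge(2) order_trans by blast
      moreover have "\<bar>y - y'\<bar> \<le> R" using yy R by (auto simp: T_def)
      ultimately show "\<bar>y - y'\<bar> \<le> min (dm i) R" by simp
    qed (rule mT)
    then show ?thesis using True by simp
  next
    case False
    then have "i \<notin> meeting Q (trace (seg h l r y))" if "y \<in> {y1..y2}" for y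
      using meeting_mono[OF sub[OF that], of Q] by blast
    then have "T i = {}" unfolding T_def by blast
    then show ?thesis by simp
  qed
  have "(\<integral>\<^sup>+y\<in>{y1..y2}. sum_along Q a (trace (seg h l r y)) \<partial>lborel) =
      (\<integral>\<^sup>+y. (\<Sum>i. a i * indicator (T i) y) \<partial>lborel)"
    unfolding sum_along_eq ennreal_suminf_multc[symmetric]
    by (intro nn_integral_cong suminf_cong) (auto simp: T_def indicator_def)
  also have "\<dots> = (\<Sum>i. \<integral>\<^sup>+y. a i * indicator (T i) y \<partial>lborel)"
    by (intro nn_integral_suminf) simp
  also have "\<dots> = (\<Sum>i. a i * emeasure lborel (T i))"
    by (intro suminf_cong nn_integral_cmult_indicator) simp
  \<comment> \<open>The weight is \<open>R * k\<close>, so that the factor \<open>R\<^sup>2\<close>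
    from \<open>packing\<close> is reduced to \<open>R\<close> and the whole bound is proportional
    to \<open>R\<close>.\<close>
  also have "\<dots> \<le> (\<Sum>i. (ennreal (R * k) * (a i)\<^sup>2 + (ennreal (min (dm i) R))\<^sup>2 * ennreal (1 / (R * k))) * indicator ?M i)"
  proof (intro suminf_le)
    fix i
    have "a i * emeasure lborel (T i) \<le> (a i * ennreal (min (dm i) R)) * indicator ?M i"
      using mult_left_mono[OF TM[of i], of "a i"] by (simp add: mult.assoc)
    also have "\<dots> \<le> (ennreal (R * k) * (a i)\<^sup>2 + (ennreal (min (dm i) R))\<^sup>2 * ennreal (1 / (R * k))) * indicator ?M i"
      using R k by (intro mult_right_mono ennreal_mult_le_squares) auto
    finally show "a i * emeasure lborel (T i) \<le> (ennreal (R * k) * (a i)\<^sup>2 + (ennreal (min (dm i) R))\<^sup>2 * ennreal (1 / (R * k))) * indicator ?M i" .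
  qed auto
  also have "\<dots> = sum_along Q (\<lambda>i. ennreal (R * k) * (a i)\<^sup>2 + ennreal (1 / (R * k)) * (ennreal (min (dm i) R))\<^sup>2) (ball x R)"
    unfolding sum_along_eq by (simp add: mult.commute)
  also have "\<dots> = ennreal (R * k) * sum_along Q (\<lambda>i. (a i)\<^sup>2) (ball x R) +
      ennreal (1 / (R * k)) * sum_along Q (\<lambda>i. (ennreal (min (dm i) R))\<^sup>2) (ball x R)"
    by (simp add: sum_along_add sum_along_cmult)
  also have "\<dots> \<le> ennreal (R * k) * sum_along Q (\<lambda>i. (a i)\<^sup>2) (ball x R) + ennreal (1 / (R * k)) * ennreal (64 / K1 * R\<^sup>2)"
    by (intro add_mono mult_left_mono packing R) auto
  also have "ennreal (1 / (R * k)) * ennreal (64 / K1 * R\<^sup>2) = ennreal R * ennreal (64 / K1 / k)"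
    using R k K1 by (simp add: power2_eq_square mult.commute flip: ennreal_mult)
  also have "ennreal (R * k) * sum_along Q (\<lambda>i. (a i)\<^sup>2) (ball x R) + ennreal R * ennreal (64 / K1 / k) =
      ennreal R * (ennreal k * sum_along Q (\<lambda>i. (a i)\<^sup>2) (ball x R) + ennreal (64 / K1 / k))"
    using R k by (simp add: distrib_left ennreal_mult mult.assoc)
  finally show ?thesis .
qed

end

section \<open>Negligible path families\<close>

lemma AE_lborel_affine:
  fixes P :: "real \<Rightarrow> bool"
  assumes "AE y in lborel. P y" "c \<noteq> 0"
  shows "AE t in lborel. P (b + c * t)"
proof -
  obtain N where N: "{y. \<not> P y} \<subseteq> N" "N \<in> null_sets lborel"
    using assms(1) by (auto simp: eventually_ae_filter)
  have [measurable]: "N \<in> sets borel" using N by auto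
  have "AE t in lborel. b + c * t \<notin> N"
    using N by (intro AE_borel_affine assms) (auto intro: AE_not_in)
  then show ?thesis by (rule AE_mp) (use N in \<open>auto intro!: AE_I2\<close>)
qed

context sierpinski begin

text \<open>The paths for which the admissibility inequality of \<open>carpet_mod\<close> may fail.\<close>

definition exc :: "cpath set \<Rightarrow> bool" where
  "exc \<Gamma> \<longleftrightarrow> (case v of Weak \<Rightarrow> mod2 \<Gamma> = 0 | Strong \<Rightarrow> \<forall>\<gamma>\<in>\<Gamma>. hausdorff1 (trace \<gamma> \<inter> S) \<noteq> 0)"

definition null :: "cpath set \<Rightarrow> bool" where
  "null \<Gamma> \<longleftrightarrow> carpet_mod v \<Omega> Q \<Gamma> = 0"

lemma exc_mono: "exc \<Gamma>' \<Longrightarrow> \<Gamma> \<subseteq> \<Gamma>' \<Longrightarrow> exc \<Gamma>"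
  by (auto simp: exc_def intro: mod2_null_mono split: version.splits)

lemma exc_UN: "(\<And>n::nat. exc (\<Gamma> n)) \<Longrightarrow> exc (\<Union>n. \<Gamma> n)"
  by (auto simp: exc_def intro: mod2_null_UN split: version.splits)

lemma exc_superpaths: "exc \<Gamma> \<Longrightarrow> exc {\<gamma>. \<exists>\<gamma>'\<in>subpaths \<gamma>. \<gamma>' \<in> \<Gamma>}"
proof -
  assume "exc \<Gamma>"
  moreover have "hausdorff1 (trace \<gamma>' \<inter> S) = 0" if "hausdorff1 (trace \<gamma> \<inter> S) = 0" "\<gamma>' \<in> subpaths \<gamma>" for \<gamma> \<gamma>'
    using trace_subpath[OF that(2)] by (intro hausdorff1_null_mono[OF that(1)]) auto
  ultimately show ?thesis
    by (auto simp: exc_def intro: mod2_null_superpaths split: version.splits)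
qed

lemma exc_Weak: "v = Weak \<Longrightarrow> exc \<Gamma> \<longleftrightarrow> mod2 \<Gamma> = 0"
  unfolding exc_def by simp

lemma exc_Strong: "v = Strong \<Longrightarrow> exc \<Gamma> \<longleftrightarrow> (\<forall>\<gamma>\<in>\<Gamma>. hausdorff1 (trace \<gamma> \<inter> S) \<noteq> 0)"
  unfolding exc_def by simp

lemma null_Weak: "v = Weak \<Longrightarrow> null \<Gamma> \<longleftrightarrow> mod_weak Q \<Gamma> = 0"
  unfolding null_def carpet_mod_def by simp

lemma null_Strong: "v = Strong \<Longrightarrow> null \<Gamma> \<longleftrightarrow> mod_strong \<Omega> Q \<Gamma> = 0"
  unfolding null_def carpet_mod_def by simp

text \<open>One description serves both versions: small energy, with admissibility required outside
  an exceptional subfamily. In the strong version that subfamily is taken to be all paths of the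
  family that meet the carpet in positive length, which the definition exempts.\<close>

lemma null_iff:
  "null \<Gamma> \<longleftrightarrow> (\<forall>e>0. \<exists>\<rho> \<Gamma>0. \<Gamma>0 \<subseteq> \<Gamma> \<and> exc \<Gamma>0 \<and>
      (\<forall>\<gamma>\<in>\<Gamma> - \<Gamma>0. 1 \<le> sum_along Q \<rho> (trace \<gamma>)) \<and> (\<Sum>i. (\<rho> i)\<^sup>2) \<le> ennreal e)"
proof (cases v)
  case Weak
  have "mod_weak Q \<Gamma> = 0 \<longleftrightarrow> (\<forall>e>0. \<exists>\<rho>. (\<exists>\<Gamma>0\<subseteq>\<Gamma>. mod2 \<Gamma>0 = 0 \<and>
      (\<forall>\<gamma>\<in>\<Gamma> - \<Gamma>0. 1 \<le> sum_along Q \<rho> (trace \<gamma>))) \<and> (\<Sum>i. (\<rho> i)\<^sup>2) \<le> ennreal e)"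
    unfolding mod_weak_def ennreal_INF_eq_0_iff Bex_def mem_Collect_eq ..
  also have "\<dots> \<longleftrightarrow> (\<forall>e>0. \<exists>\<rho> \<Gamma>0. \<Gamma>0 \<subseteq> \<Gamma> \<and> exc \<Gamma>0 \<and>
      (\<forall>\<gamma>\<in>\<Gamma> - \<Gamma>0. 1 \<le> sum_along Q \<rho> (trace \<gamma>)) \<and> (\<Sum>i. (\<rho> i)\<^sup>2) \<le> ennreal e)"
    by (simp only: exc_Weak[OF Weak] conj_assoc[symmetric] ex_simps)
  finally show ?thesis unfolding null_Weak[OF Weak] .
next
  case Strong
  have ks: "(\<forall>\<gamma>\<in>\<Gamma>. hausdorff1 (trace \<gamma> \<inter> S) = 0 \<longrightarrow> 1 \<le> sum_along Q \<rho> (trace \<gamma>)) \<longleftrightarrow>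
     (\<exists>\<Gamma>0. \<Gamma>0 \<subseteq> \<Gamma> \<and> exc \<Gamma>0 \<and> (\<forall>\<gamma>\<in>\<Gamma> - \<Gamma>0. 1 \<le> sum_along Q \<rho> (trace \<gamma>)))" (is "?L \<longleftrightarrow> ?R") for \<rho>
  proof
    assume ?L
    then show ?R
      unfolding exc_Strong[OF Strong]
      by (intro exI[of _ "{\<gamma>\<in>\<Gamma>. hausdorff1 (trace \<gamma> \<inter> S) \<noteq> 0}"]) auto
  qed (auto simp: exc_Strong[OF Strong])
  have "mod_strong \<Omega> Q \<Gamma> = 0 \<longleftrightarrow> (\<forall>e>0. \<exists>\<rho> \<Gamma>0. \<Gamma>0 \<subseteq> \<Gamma> \<and> exc \<Gamma>0 \<and>
      (\<forall>\<gamma>\<in>\<Gamma> - \<Gamma>0. 1 \<le> sum_along Q \<rho> (trace \<gamma>)) \<and> (\<Sum>i. (\<rho> i)\<^sup>2) \<le> ennreal e)"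
    unfolding mod_strong_def ennreal_INF_eq_0_iff Bex_def mem_Collect_eq
    by (simp only: ks conj_assoc[symmetric] ex_simps)
  then show ?thesis unfolding null_Strong[OF Strong] .
qed

lemma null_exc: "exc \<Gamma> \<Longrightarrow> null \<Gamma>"
  unfolding null_iff by (intro allI impI exI[of _ "\<lambda>_. 0"] exI[of _ \<Gamma>]) auto

lemma null_mono: "null \<Gamma>' \<Longrightarrow> \<Gamma> \<subseteq> \<Gamma>' \<Longrightarrow> null \<Gamma>"
  unfolding null_iff
proof (intro allI impI)
  fix e :: real
  assume *: "\<forall>e>0. \<exists>\<rho> \<Gamma>0. \<Gamma>0 \<subseteq> \<Gamma>' \<and> exc \<Gamma>0 \<and>
      (\<forall>\<gamma>\<in>\<Gamma>' - \<Gamma>0. 1 \<le> sum_along Q \<rho> (trace \<gamma>)) \<and> (\<Sum>i. (\<rho> i)\<^sup>2) \<le> ennreal e" "\<Gamma> \<subseteq> \<Gamma>'" "0 < e"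
  then obtain \<rho> \<Gamma>0 where "\<Gamma>0 \<subseteq> \<Gamma>'" "exc \<Gamma>0"
      "\<forall>\<gamma>\<in>\<Gamma>' - \<Gamma>0. 1 \<le> sum_along Q \<rho> (trace \<gamma>)" "(\<Sum>i. (\<rho> i)\<^sup>2) \<le> ennreal e" by blast
  then show "\<exists>\<rho> \<Gamma>0. \<Gamma>0 \<subseteq> \<Gamma> \<and> exc \<Gamma>0 \<and>
      (\<forall>\<gamma>\<in>\<Gamma> - \<Gamma>0. 1 \<le> sum_along Q \<rho> (trace \<gamma>)) \<and> (\<Sum>i. (\<rho> i)\<^sup>2) \<le> ennreal e"
    using exc_mono[of \<Gamma>0 "\<Gamma>0 \<inter> \<Gamma>"] *(2) by (intro exI[of _ \<rho>] exI[of _ "\<Gamma>0 \<inter> \<Gamma>"]) auto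
qed

lemma null_UN:
  fixes \<Gamma> :: "nat \<Rightarrow> cpath set"
  assumes "\<And>n. null (\<Gamma> n)"
  shows "null (\<Union>n. \<Gamma> n)"
  unfolding null_iff
proof (intro allI impI)
  fix e :: real assume e: "e > 0"
  have "\<exists>\<rho> \<Gamma>0. \<Gamma>0 \<subseteq> \<Gamma> n \<and> exc \<Gamma>0 \<and> (\<forall>\<gamma>\<in>\<Gamma> n - \<Gamma>0. 1 \<le> sum_along Q \<rho> (trace \<gamma>)) \<and>
      (\<Sum>i. (\<rho> i)\<^sup>2) \<le> ennreal (e * (1/2) ^ Suc n)" for n
    using assms[of n] e unfolding null_iff by simp
  then obtain \<rho> \<Gamma>0 where *: "\<And>n. \<Gamma>0 n \<subseteq> \<Gamma> n" "\<And>n. exc (\<Gamma>0 n)"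
      "\<And>n \<gamma>. \<gamma> \<in> \<Gamma> n - \<Gamma>0 n \<Longrightarrow> 1 \<le> sum_along Q (\<rho> n) (trace \<gamma>)"
      "\<And>n. (\<Sum>i. (\<rho> n i)\<^sup>2) \<le> ennreal (e * (1/2) ^ Suc n)" by metis
  define \<sigma> where "\<sigma> i = (SUP n. \<rho> n i)" for i
  have "(\<Sum>i. (\<sigma> i)\<^sup>2) \<le> (\<Sum>i. \<Sum>n. (\<rho> n i)\<^sup>2)"
    unfolding \<sigma>_def by (intro suminf_le SUP_power2_le_suminf) auto
  \<comment> \<open>The double series is interchanged by Tonelli for counting measure.\<close>
  also have "\<dots> = (\<integral>\<^sup>+i. (\<Sum>n. (\<rho> n i)\<^sup>2) \<partial>count_space UNIV)"
    by (simp add: nn_integral_count_space_nat)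
  also have "\<dots> = (\<Sum>n. \<integral>\<^sup>+i. (\<rho> n i)\<^sup>2 \<partial>count_space UNIV)"
    by (intro nn_integral_suminf) simp
  also have "\<dots> = (\<Sum>n. \<Sum>i. (\<rho> n i)\<^sup>2)"
    by (simp add: nn_integral_count_space_nat)
  also have "\<dots> \<le> (\<Sum>n. ennreal (e * (1/2) ^ Suc n))"
    by (intro suminf_le *(4)) auto
  also have "\<dots> = ennreal e" using e by (rule suminf_half_powers)
  finally have "(\<Sum>i. (\<sigma> i)\<^sup>2) \<le> ennreal e" .
  moreover have "1 \<le> sum_along Q \<sigma> (trace \<gamma>)" if "\<gamma> \<in> \<Gamma> n" "\<gamma> \<notin> \<Gamma>0 n" for \<gamma> n
  proof -
    have "1 \<le> sum_along Q (\<rho> n) (trace \<gamma>)" using that *(3) by blast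
    also have "\<dots> \<le> sum_along Q \<sigma> (trace \<gamma>)"
      unfolding \<sigma>_def by (intro sum_along_mono order_refl SUP_upper) auto
    finally show ?thesis .
  qed
  ultimately show "\<exists>\<rho> \<Gamma>0. \<Gamma>0 \<subseteq> (\<Union>n. \<Gamma> n) \<and> exc \<Gamma>0 \<and>
      (\<forall>\<gamma>\<in>(\<Union>n. \<Gamma> n) - \<Gamma>0. 1 \<le> sum_along Q \<rho> (trace \<gamma>)) \<and> (\<Sum>i. (\<rho> i)\<^sup>2) \<le> ennreal e"
    using *(1,2) exc_UN[of \<Gamma>0] by (intro exI[of _ \<sigma>] exI[of _ "\<Union>n. \<Gamma>0 n"]) blast
qed

lemma null_Un: "null \<Gamma> \<Longrightarrow> null \<Gamma>' \<Longrightarrow> null (\<Gamma> \<union> \<Gamma>')"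
  using null_UN[of "\<lambda>n. if n = 0 then \<Gamma> else \<Gamma>'"]
  by (rule null_mono) (auto split: if_splits intro!: exI[of _ "0::nat"] exI[of _ "1::nat"])

text \<open>A longer path meets more disks, so a sequence admissible for its subpath remains
  admissible. Thus almost every path is good together with all its subpaths.\<close>

lemma null_superpaths:
  assumes "null \<Gamma>"
  shows "null {\<gamma>. \<exists>\<gamma>'\<in>subpaths \<gamma>. \<gamma>' \<in> \<Gamma>}"
  unfolding null_iff
proof (intro allI impI)
  fix e :: real assume "e > 0"
  then obtain \<rho> \<Gamma>0 where *: "\<Gamma>0 \<subseteq> \<Gamma>" "exc \<Gamma>0"
      "\<forall>\<gamma>\<in>\<Gamma> - \<Gamma>0. 1 \<le> sum_along Q \<rho> (trace \<gamma>)" "(\<Sum>i. (\<rho> i)\<^sup>2) \<le> ennreal e"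
    using assms unfolding null_iff by blast
  let ?\<Gamma>1 = "{\<gamma>. \<exists>\<gamma>'\<in>subpaths \<gamma>. \<gamma>' \<in> \<Gamma>0}"
  have "1 \<le> sum_along Q \<rho> (trace \<gamma>)" if \<gamma>: "\<gamma>' \<in> subpaths \<gamma>" "\<gamma>' \<in> \<Gamma>" "\<gamma> \<notin> ?\<Gamma>1" for \<gamma> \<gamma>'
  proof -
    have "1 \<le> sum_along Q \<rho> (trace \<gamma>')" using \<gamma> *(3) by blast
    also have "\<dots> \<le> sum_along Q \<rho> (trace \<gamma>)"
      using trace_subpath[OF \<gamma>(1)] by (rule sum_along_mono) simp
    finally show ?thesis .
  qed
  then show "\<exists>\<rho> \<Gamma>0. \<Gamma>0 \<subseteq> {\<gamma>. \<exists>\<gamma>'\<in>subpaths \<gamma>. \<gamma>' \<in> \<Gamma>} \<and> exc \<Gamma>0 \<and>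
      (\<forall>\<gamma>\<in>{\<gamma>. \<exists>\<gamma>'\<in>subpaths \<gamma>. \<gamma>' \<in> \<Gamma>} - \<Gamma>0. 1 \<le> sum_along Q \<rho> (trace \<gamma>)) \<and> (\<Sum>i. (\<rho> i)\<^sup>2) \<le> ennreal e"
    using *(1,4) exc_superpaths[OF *(2)] by (intro exI[of _ \<rho>] exI[of _ ?\<Gamma>1]) blast
qed

text \<open>Such paths are exceptional in both versions: by definition in the strong one, and
  because the carpet has area zero in the weak one.\<close>

lemma null_hausdorff1: "null {\<gamma> \<in> paths_in \<Omega>. hausdorff1 (trace \<gamma> \<inter> S) \<noteq> 0}"
  using mod2_null_mono[OF mod2_null_of_hausdorff1[OF S_sets carpet_null],
      of "{\<gamma> \<in> paths_in \<Omega>. hausdorff1 (trace \<gamma> \<inter> S) \<noteq> 0}"]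
  by (intro null_exc) (auto simp: exc_def paths_in_def split: version.splits)

text \<open>Every positive multiple of \<rho> is admissible for paths with an infinite sum, and
  multiples can have arbitrarily small energy.\<close>

lemma null_infinite_sum:
  assumes "(\<Sum>i. (\<rho> i)\<^sup>2) < \<infinity>"
  shows "null {\<gamma>. sum_along Q \<rho> (trace \<gamma>) = \<infinity>}"
  unfolding null_iff
proof (intro allI impI)
  fix e :: real assume e: "e > 0"
  obtain s where s: "(\<Sum>i. (\<rho> i)\<^sup>2) = ennreal s" "s \<ge> 0" using assms by (cases "\<Sum>i. (\<rho> i)\<^sup>2") auto
  \<comment> \<open>The summand 1 in the denominator covers the case \<open>s = 0\<close>.\<close>
  define c where "c = sqrt (e / (s + 1))"
  have c: "c > 0" "c\<^sup>2 = e / (s + 1)" using e s by (auto simp: c_def)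
  have "(\<Sum>i. (ennreal c * \<rho> i)\<^sup>2) = ennreal (c\<^sup>2) * (\<Sum>i. (\<rho> i)\<^sup>2)"
    using c by (simp add: power_mult_distrib ennreal_power)
  also have "\<dots> \<le> ennreal e"
  proof -
    have "e / (s + 1) * s \<le> e" using e s by (simp add: field_simps)
    then show ?thesis using e s unfolding c(2) s(1) by (simp add: ennreal_leI flip: ennreal_mult)
  qed
  finally have "(\<Sum>i. (ennreal c * \<rho> i)\<^sup>2) \<le> ennreal e" .
  moreover have "1 \<le> sum_along Q (\<lambda>i. ennreal c * \<rho> i) (trace \<gamma>)" if "sum_along Q \<rho> (trace \<gamma>) = \<infinity>" for \<gamma>
    using that c by (simp add: sum_along_cmult ennreal_mult_top)
  ultimately show "\<exists>\<rho>' \<Gamma>0. \<Gamma>0 \<subseteq> {\<gamma>. sum_along Q \<rho> (trace \<gamma>) = \<infinity>} \<and> exc \<Gamma>0 \<and>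
     (\<forall>\<gamma>\<in>{\<gamma>. sum_along Q \<rho> (trace \<gamma>) = \<infinity>} - \<Gamma>0. 1 \<le> sum_along Q \<rho>' (trace \<gamma>)) \<and> (\<Sum>i. (\<rho>' i)\<^sup>2) \<le> ennreal e"
    by (intro exI[of _ "\<lambda>i. ennreal c * \<rho> i"] exI[of _ "{}"])
       (auto simp: exc_def mod2_eq_0_iff intro!: bexI[of _ "\<lambda>_. 0"] split: version.splits)
qed

definition loc_l2 :: "(nat \<Rightarrow> ennreal) \<Rightarrow> bool" where
  "loc_l2 \<rho> \<longleftrightarrow> (\<forall>x r. 0 < r \<and> compactly_in (ball x r) \<Omega> \<longrightarrow> sum_along Q (\<lambda>i. (\<rho> i)\<^sup>2) (ball x r) < \<infinity>)"

lemma loc_l2_compact: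
  assumes \<rho>: "loc_l2 \<rho>" and K: "compact K" "K \<subseteq> \<Omega>"
  shows "sum_along Q (\<lambda>i. (\<rho> i)\<^sup>2) K < \<infinity>"
proof -
  have "\<exists>r>0. compactly_in (ball x r) \<Omega>" if "x \<in> K" for x
  proof -
    obtain r where r: "r > 0" "cball x r \<subseteq> \<Omega>"
      using open_Omega[unfolded open_contains_cball] subsetD[OF K(2) \<open>x \<in> K\<close>] by blast
    have "closure (ball x r) \<subseteq> cball x r" by (simp add: closure_minimal ball_subset_cball)
    then have "compactly_in (ball x r) \<Omega>" using r(2) unfolding compactly_in_def by auto
    then show ?thesis using r by blast
  qed
  then obtain r where r: "\<And>x. x \<in> K \<Longrightarrow> r x > 0 \<and> compactly_in (ball x (r x)) \<Omega>" by metis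
  have "K \<subseteq> (\<Union>x\<in>K. ball x (r x))" using r by force
  then obtain F where F: "F \<subseteq> K" "finite F" "K \<subseteq> (\<Union>x\<in>F. ball x (r x))"
    using compactE_image[OF K(1), of K "\<lambda>x. ball x (r x)"] by auto
  have "sum_along Q (\<lambda>i. (\<rho> i)\<^sup>2) K \<le> (\<Sum>x\<in>F. sum_along Q (\<lambda>i. (\<rho> i)\<^sup>2) (ball x (r x)))"
  proof -
    have "sum_along Q (\<lambda>i. (\<rho> i)\<^sup>2) K \<le> (\<Sum>i. \<Sum>x\<in>F. (\<rho> i)\<^sup>2 * indicator (meeting Q (ball x (r x))) i)"
      unfolding sum_along_eq
    proof (intro suminf_le)
      fix i
      show "(\<rho> i)\<^sup>2 * indicator (meeting Q K) i \<le> (\<Sum>x\<in>F. (\<rho> i)\<^sup>2 * indicator (meeting Q (ball x (r x))) i)"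
      proof (cases "i \<in> meeting Q K")
        case True
        then obtain x where x: "x \<in> F" "i \<in> meeting Q (ball x (r x))"
          using F(3) unfolding meeting_def by blast
        then have "(\<rho> i)\<^sup>2 * indicator (meeting Q K) i \<le> (\<rho> i)\<^sup>2 * indicator (meeting Q (ball x (r x))) i"
          by (simp add: indicator_def)
        also have "\<dots> \<le> (\<Sum>x\<in>F. (\<rho> i)\<^sup>2 * indicator (meeting Q (ball x (r x))) i)"
          by (rule member_le_sum[OF x(1)]) (use F in auto)
        finally show ?thesis .
      qed simp
    qed auto
    also have "\<dots> = (\<Sum>x\<in>F. sum_along Q (\<lambda>i. (\<rho> i)\<^sup>2) (ball x (r x)))"
      unfolding sum_along_eq by (intro suminf_sum) auto
    finally show ?thesis .
  qed
  also have "\<dots> < \<infinity>"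
    using \<rho> r F unfolding loc_l2_def by (auto simp: less_top[symmetric] F(2) subset_iff)
  finally show ?thesis .
qed

text \<open>A compact trace lies in one member of a compact exhaustion of \<Omega>, and restricting
  \<rho> to the disks meeting that member makes it square summable.\<close>

lemma null_locally_infinite_sum:
  assumes "loc_l2 \<rho>"
  shows "null {\<gamma>. \<exists>\<gamma>'\<in>subpaths \<gamma>. compact (trace \<gamma>') \<and> trace \<gamma>' \<subseteq> \<Omega> \<and> sum_along Q \<rho> (trace \<gamma>') = \<infinity>}"
proof -
  obtain C where C: "\<And>n. compact (C n)" "\<And>n. C n \<subseteq> \<Omega>"
     "\<And>K. compact K \<Longrightarrow> K \<subseteq> \<Omega> \<Longrightarrow> \<exists>N::nat. \<forall>n\<ge>N. K \<subseteq> C n"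
    using open_Union_compact_subsets[OF open_Omega] by metis
  define \<rho>' where "\<rho>' n i = \<rho> i * indicator (meeting Q (C n)) i" for n i
  have "(\<Sum>i. (\<rho>' n i)\<^sup>2) < \<infinity>" for n
  proof -
    have "(\<Sum>i. (\<rho>' n i)\<^sup>2) = sum_along Q (\<lambda>i. (\<rho> i)\<^sup>2) (C n)"
      unfolding sum_along_eq \<rho>'_def by (intro suminf_cong) (auto simp: indicator_def)
    then show ?thesis using loc_l2_compact[OF assms C(1,2)] by simp
  qed
  then have "null (\<Union>n. {\<gamma>. sum_along Q (\<rho>' n) (trace \<gamma>) = \<infinity>})"
    by (intro null_UN null_infinite_sum)
  then have "null {\<gamma>. \<exists>\<gamma>'\<in>subpaths \<gamma>. \<gamma>' \<in> (\<Union>n. {\<gamma>. sum_along Q (\<rho>' n) (trace \<gamma>) = \<infinity>})}"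
    by (rule null_superpaths)
  then show ?thesis
  proof (rule null_mono, clarify)
    fix \<gamma> \<gamma>' assume g: "\<gamma>' \<in> subpaths \<gamma>" "compact (trace \<gamma>')" "trace \<gamma>' \<subseteq> \<Omega>" "sum_along Q \<rho> (trace \<gamma>') = \<infinity>"
    then obtain n where n: "trace \<gamma>' \<subseteq> C n" using C(3)[of "trace \<gamma>'"] by (meson order_refl)
    have "sum_along Q \<rho> (trace \<gamma>') \<le> sum_along Q (\<rho>' n) (trace \<gamma>')"
      using meeting_mono[OF n, of Q] by (intro sum_along_mono) (auto simp: \<rho>'_def)
    then have "sum_along Q (\<rho>' n) (trace \<gamma>') = \<infinity>" using g(4) by (simp add: top_unique)
    then show "\<exists>\<gamma>'\<in>subpaths \<gamma>. \<gamma>' \<in> (\<Union>n. {\<gamma>. sum_along Q (\<rho>' n) (trace \<gamma>) = \<infinity>})"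
      using g(1) by blast
  qed
qed

text \<open>After averaging the sums along parallel segments, Chebyshev's inequality bounds the
  measure of the heights at which a sequence of small energy is admissible. This is the passage from
  negligible families to concrete paths.\<close>

lemma AE_seg_not_null:
  assumes "null \<Gamma>"
  shows "AE y in lborel. y \<in> {y1..y2} \<longrightarrow> seg h l r y \<notin> \<Gamma>"
proof -
  define R where "R = \<bar>l\<bar> + \<bar>r\<bar> + \<bar>y1\<bar> + \<bar>y2\<bar> + 1"
  have R: "R > 0" "y2 - y1 \<le> R" by (auto simp: R_def)
  have sub: "trace (seg h l r y) \<subseteq> ball 0 R" if "y \<in> {y1..y2}" for y
  proof -
    have "dist 0 (sg h x y) < R" if "x \<in> {l..r}" for x
    proof -
      have "dist (sg h 0 0) (sg h x y) \<le> \<bar>0 - x\<bar> + \<bar>0 - y\<bar>" by (rule dist_sg_le)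
      moreover have "sg h 0 0 = 0" by (simp add: sg_def complex_eq_iff)
      ultimately show ?thesis using that \<open>y \<in> {y1..y2}\<close> by (auto simp: R_def)
    qed
    then show ?thesis by (auto simp: trace_seg)
  qed
  define C where "C = 64 / K1"
  have C: "C > 0" using K1 by (simp add: C_def)
  \<comment> \<open>The energy bound \<open>(1 / Suc n)\<^sup>2\<close> is matched with the weight
    \<open>k = Suc n\<close> in \<open>seg_sum_integral\<close>; both terms are then of order
    \<open>1 / Suc n\<close>.\<close>
  have "\<exists>\<rho> \<Gamma>0. \<Gamma>0 \<subseteq> \<Gamma> \<and> exc \<Gamma>0 \<and> (\<forall>\<gamma>\<in>\<Gamma> - \<Gamma>0. 1 \<le> sum_along Q \<rho> (trace \<gamma>)) \<and>
      (\<Sum>i. (\<rho> i)\<^sup>2) \<le> ennreal ((1 / Suc n)\<^sup>2)" for n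
    using assms unfolding null_iff by simp
  then obtain \<rho> \<Gamma>0 where *: "\<And>n. exc (\<Gamma>0 n)"
      "\<And>n \<gamma>. \<gamma> \<in> \<Gamma> - \<Gamma>0 n \<Longrightarrow> 1 \<le> sum_along Q (\<rho> n) (trace \<gamma>)"
      "\<And>n. (\<Sum>i. (\<rho> n i)\<^sup>2) \<le> ennreal ((1 / Suc n)\<^sup>2)" by metis
  have "AE y in lborel. y \<in> {y1..y2} \<longrightarrow> seg h l r y \<notin> \<Gamma>0 n" for n
  proof (cases v)
    case Weak
    then have "mod2 (\<Gamma>0 n) = 0" using *(1)[of n] unfolding exc_def by simp
    then show ?thesis by (rule AE_seg_of_mod2_null)
  next
    case Strong
    then have H: "\<gamma> \<notin> \<Gamma>0 n" if "hausdorff1 (trace \<gamma> \<inter> S) = 0" for \<gamma>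
      using *(1)[of n] that unfolding exc_def by auto
    from AE_seg_hausdorff1_null[OF S_sets carpet_null, of h l r] show ?thesis
      by eventually_elim (use H in blast)
  qed
  then have AE1: "AE y in lborel. \<forall>n. y \<in> {y1..y2} \<longrightarrow> seg h l r y \<notin> \<Gamma>0 n"
    by (subst AE_all_countable) blast
  define B where "B n = {y\<in>space lborel. 1 \<le> sum_along Q (\<rho> n) (trace (seg h l r y)) * indicator {y1..y2} y}" for n
  have [measurable]: "B n \<in> sets borel" for n unfolding B_def by simp
  have eB: "emeasure lborel (B n) \<le> ennreal (R * (1 + C) / Suc n)" for n
  proof -
    have "emeasure lborel (B n) = (\<integral>\<^sup>+y. indicator (B n) y \<partial>lborel)" by simp
    also have "\<dots> \<le> (\<integral>\<^sup>+y\<in>{y1..y2}. sum_along Q (\<rho> n) (trace (seg h l r y)) \<partial>lborel)"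
      by (intro nn_integral_mono) (auto simp: B_def indicator_def)
    also have "\<dots> \<le> ennreal R * (ennreal (Suc n) * sum_along Q (\<lambda>i. (\<rho> n i)\<^sup>2) (ball 0 R) + ennreal (64 / K1 / Suc n))"
      by (rule seg_sum_integral[OF _ R sub]) auto
    also have "\<dots> \<le> ennreal R * (ennreal (Suc n) * ennreal ((1 / Suc n)\<^sup>2) + ennreal (C / Suc n))"
      using order_trans[OF sum_along_le_suminf *(3)[of n]] unfolding C_def
      by (intro mult_left_mono add_mono) auto
    also have "\<dots> = ennreal (R * (Suc n * (1 / Suc n)\<^sup>2 + C / Suc n))"
      using R C by (simp flip: ennreal_mult ennreal_plus)
    also have "R * (Suc n * (1 / Suc n)\<^sup>2 + C / Suc n) = R * (1 + C) / Suc n"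
    proof -
      have "Suc n * (1 / Suc n)\<^sup>2 = 1 / Suc n" by (simp add: power2_eq_square)
      then show ?thesis by (simp only: add_divide_distrib[symmetric]) simp
    qed
    finally show ?thesis .
  qed
  \<comment> \<open>A height in \<open>{y1..y2}\<close> whose segment belongs to \<Gamma> but to no
    \<open>\<Gamma>0 n\<close> would lie in every \<open>B n\<close>.\<close>
  have "AE y in lborel. \<not> (\<forall>n. y \<in> B n)"
  proof (rule AE_lborel_small)
    fix e :: real assume e: "e > 0"
    obtain n :: nat where n: "R * (1 + C) / e < n" using reals_Archimedean2 by blast
    then have "R * (1 + C) < n * e" using e by (simp add: pos_divide_less_eq)
    also have "\<dots> \<le> Suc n * e" using e by simp
    finally have "R * (1 + C) / Suc n \<le> e" by (simp add: pos_divide_le_eq mult.commute)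
    then have "emeasure lborel (B n) \<le> ennreal e"
      using order_trans[OF eB[of n] ennreal_leI] by blast
    then show "\<exists>B'\<in>sets borel. {y. \<not> \<not> (\<forall>n. y \<in> B n)} \<subseteq> B' \<and> emeasure lborel B' \<le> ennreal e"
      by (intro bexI[of _ "B n"]) auto
  qed
  with AE1 show ?thesis
  proof eventually_elim
    case (elim y)
    then show ?case using *(2)[of "seg h l r y"] by (auto simp: B_def)
  qed
qed

end

section \<open>Upper gradients\<close>

lemma ennreal_suminf_tail:
  fixes f :: "nat \<Rightarrow> ennreal"
  assumes "(\<Sum>i. f i) < \<infinity>" "e > 0"
  shows "\<exists>N. (\<Sum>i. if i < N then 0 else f i) \<le> ennreal e"
proof -
  obtain s where s: "(\<Sum>i. f i) = ennreal s" "s \<ge> 0" using assms(1) by (cases "\<Sum>i. f i") auto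
  have split: "(\<Sum>i. f i) = (\<Sum>i<N. f i) + (\<Sum>i. if i < N then 0 else f i)" for N
  proof -
    have "(\<Sum>i. f i) = (\<Sum>i. (if i < N then f i else 0) + (if i < N then 0 else f i))"
      by (intro suminf_cong) auto
    also have "\<dots> = (\<Sum>i. if i < N then f i else 0) + (\<Sum>i. if i < N then 0 else f i)"
      by (rule suminf_add[symmetric]) auto
    also have "(\<Sum>i. if i < N then f i else 0) = (\<Sum>i<N. if i < N then f i else 0)"
      by (rule suminf_finite) auto
    also have "\<dots> = (\<Sum>i<N. f i)" by (intro sum.cong) auto
    finally show ?thesis .
  qed
  show ?thesis
  proof (cases "s \<le> e")
    case True
    then show ?thesis using s by (intro exI[of _ 0]) (auto intro: ennreal_leI)
  next
    case False
    have "(\<lambda>N. \<Sum>i<N. f i) \<longlonglongrightarrow> (\<Sum>i. f i)" by (rule summable_LIMSEQ) auto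
    moreover have "ennreal (s - e) < (\<Sum>i. f i)" using s False assms by (simp add: ennreal_lessI)
    ultimately have "eventually (\<lambda>N. ennreal (s - e) < (\<Sum>i<N. f i)) sequentially"
      by (rule order_tendstoD(1))
    then obtain N where N: "ennreal (s - e) < (\<Sum>i<N. f i)"
      unfolding eventually_sequentially by blast
    have "(\<Sum>i<N. f i) < \<infinity>" "(\<Sum>i. if i < N then 0 else f i) < \<infinity>"
      using split[of N] assms(1) by (auto simp: less_top[symmetric])
    then obtain x y where xy: "(\<Sum>i<N. f i) = ennreal x" "x \<ge> 0" "(\<Sum>i. if i < N then 0 else f i) = ennreal y" "y \<ge> 0"
      by (metis ennreal_cases infinity_ennreal_def order_less_irrefl)
    have "s = x + y" using split[of N] s xy by (simp flip: ennreal_plus)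
    moreover have "s - e < x" using N xy False by (simp add: ennreal_less_iff)
    ultimately have "y \<le> e" by simp
    then show ?thesis using xy by (intro exI[of _ N]) (simp add: ennreal_leI)
  qed
qed

lemma meeting_imageE:
  assumes "i \<in> meeting Q (c ` T)"
  obtains x where "x \<in> T" "c x \<in> Q i"
  using assms by (auto simp: meeting_def)

context sierpinski begin

text \<open>Counterparts of \<open>Mx\<close>, \<open>mn\<close> and \<open>osc\<close> for real functions, meaningful only under \<open>fb\<close> because
  \<open>Sup\<close> and \<open>Inf\<close> of an unbounded set of reals are arbitrary.\<close>

definition MM :: "(complex \<Rightarrow> real) \<Rightarrow> nat \<Rightarrow> real" where "MM h i = Sup (h ` frontier (Q i))"
definition mm :: "(complex \<Rightarrow> real) \<Rightarrow> nat \<Rightarrow> real" where "mm h i = Inf (h ` frontier (Q i))"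
definition os :: "(complex \<Rightarrow> real) \<Rightarrow> nat \<Rightarrow> real" where "os h i = MM h i - mm h i"
definition fb :: "(complex \<Rightarrow> real) \<Rightarrow> bool" where "fb h \<longleftrightarrow> (\<forall>i. bounded (h ` frontier (Q i)))"

lemma fbD: "fb h \<Longrightarrow> bdd_above (h ` frontier (Q i))" "fb h \<Longrightarrow> bdd_below (h ` frontier (Q i))"
  by (auto simp: fb_def bounded_imp_bdd_above bounded_imp_bdd_below)

lemma fbI: "(\<And>i z. z \<in> frontier (Q i) \<Longrightarrow> \<bar>h z\<bar> \<le> b i) \<Longrightarrow> fb h"
  unfolding fb_def bounded_iff by (metis image_iff real_norm_def)

lemma le_MM: "fb h \<Longrightarrow> z \<in> frontier (Q i) \<Longrightarrow> h z \<le> MM h i"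
  unfolding MM_def by (intro cSUP_upper fbD)

lemma mm_le: "fb h \<Longrightarrow> z \<in> frontier (Q i) \<Longrightarrow> mm h i \<le> h z"
  unfolding mm_def by (intro cINF_lower fbD)

lemma MM_least: "(\<And>z. z \<in> frontier (Q i) \<Longrightarrow> h z \<le> c) \<Longrightarrow> MM h i \<le> c"
  unfolding MM_def by (intro cSUP_least frontier_nonempty)

lemma mm_greatest: "(\<And>z. z \<in> frontier (Q i) \<Longrightarrow> c \<le> h z) \<Longrightarrow> c \<le> mm h i"
  unfolding mm_def by (intro cINF_greatest frontier_nonempty)

lemma mm_le_MM: "fb h \<Longrightarrow> mm h i \<le> MM h i"
  using frontier_nonempty[of i] le_MM[of h _ i] mm_le[of h _ i] by (meson all_not_in_conv order_trans)

lemma os_nonneg: "fb h \<Longrightarrow> 0 \<le> os h i"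
  using mm_le_MM[of h i] by (simp add: os_def)

lemma abs_le_os: "fb h \<Longrightarrow> z \<in> frontier (Q i) \<Longrightarrow> w \<in> frontier (Q i) \<Longrightarrow> \<bar>h z - h w\<bar> \<le> os h i"
  using le_MM[of h z i] le_MM[of h w i] mm_le[of h z i] mm_le[of h w i] by (auto simp: os_def)

lemma os_le:
  assumes "\<And>z w. z \<in> frontier (Q i) \<Longrightarrow> w \<in> frontier (Q i) \<Longrightarrow> h z - h w \<le> c"
  shows "os h i \<le> c"
proof -
  have "MM h i - c \<le> h w" if "w \<in> frontier (Q i)" for w
  proof -
    have "MM h i \<le> h w + c" using assms[OF _ that] by (intro MM_least) (auto simp: algebra_simps)
    then show ?thesis by simp
  qed
  then have "MM h i - c \<le> mm h i" by (rule mm_greatest)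
  then show ?thesis by (simp add: os_def)
qed

lemma Mx_real: "fb h \<Longrightarrow> Mx Q (\<lambda>z. ereal (h z)) i = ereal (MM h i)"
proof -
  assume fb: "fb h"
  obtain w where w: "w \<in> frontier (Q i)" using frontier_nonempty by blast
  have "\<bar>SUP z\<in>frontier (Q i). ereal (h z)\<bar> \<noteq> \<infinity>"
  proof -
    have "(SUP z\<in>frontier (Q i). ereal (h z)) \<le> ereal (MM h i)"
      using le_MM[OF fb] by (intro SUP_least) auto
    moreover have "ereal (h w) \<le> (SUP z\<in>frontier (Q i). ereal (h z))" using w by (rule SUP_upper)
    ultimately show ?thesis by auto
  qed
  then show ?thesis unfolding Mx_def MM_def by (simp add: ereal_SUP)
qed

lemma mn_real: "fb h \<Longrightarrow> mn Q (\<lambda>z. ereal (h z)) i = ereal (mm h i)"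
proof -
  assume fb: "fb h"
  obtain w where w: "w \<in> frontier (Q i)" using frontier_nonempty by blast
  have "\<bar>INF z\<in>frontier (Q i). ereal (h z)\<bar> \<noteq> \<infinity>"
  proof -
    have "ereal (mm h i) \<le> (INF z\<in>frontier (Q i). ereal (h z))"
      using mm_le[OF fb] by (intro INF_greatest) auto
    moreover have "(INF z\<in>frontier (Q i). ereal (h z)) \<le> ereal (h w)" using w by (rule INF_lower)
    ultimately show ?thesis by auto
  qed
  then show ?thesis unfolding mn_def mm_def by (simp add: ereal_INF)
qed

lemma osc_real: "fb h \<Longrightarrow> osc Q (\<lambda>z. ereal (h z)) i = ennreal (os h i)"
  by (simp add: osc_def Mx_real mn_real os_def e2ennreal_ereal)

lemma fb_of_finite:
  assumes "\<And>i. \<bar>Mx Q (\<lambda>z. ereal (h z)) i\<bar> \<noteq> \<infinity>" "\<And>i. \<bar>mn Q (\<lambda>z. ereal (h z)) i\<bar> \<noteq> \<infinity>"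
  shows "fb h"
proof (rule fbI)
  fix i z assume z: "z \<in> frontier (Q i)"
  obtain a b where ab: "Mx Q (\<lambda>z. ereal (h z)) i = ereal a" "mn Q (\<lambda>z. ereal (h z)) i = ereal b"
    using assms[of i] by (cases "Mx Q (\<lambda>z. ereal (h z)) i"; cases "mn Q (\<lambda>z. ereal (h z)) i") auto
  have "ereal (h z) \<le> ereal a" "ereal b \<le> ereal (h z)"
    unfolding ab[symmetric] Mx_def mn_def using z by (auto intro: SUP_upper INF_lower)
  then show "\<bar>h z\<bar> \<le> max \<bar>real_of_ereal (Mx Q (\<lambda>z. ereal (h z)) i)\<bar> \<bar>real_of_ereal (mn Q (\<lambda>z. ereal (h z)) i)\<bar>"
    unfolding ab by auto
qed

definition ugood :: "(complex \<Rightarrow> real) \<Rightarrow> (nat \<Rightarrow> ennreal) \<Rightarrow> cpath \<Rightarrow> bool" where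
  "ugood h \<rho> \<gamma> \<longleftrightarrow> (\<forall>x\<in>trace \<gamma> \<inter> S. \<forall>y\<in>trace \<gamma> \<inter> S. ennreal \<bar>h x - h y\<bar> \<le> sum_along Q \<rho> (trace \<gamma>))"

text \<open>Unlike in \<open>upper_gradient\<close>, the exceptional family may contain anything
  outside \<open>paths_in \<Omega>\<close>, and finiteness of the values is automatic for a real
  function.\<close>

definition ug :: "(complex \<Rightarrow> real) \<Rightarrow> (nat \<Rightarrow> ennreal) \<Rightarrow> bool" where
  "ug h \<rho> \<longleftrightarrow> (\<exists>\<Gamma>0. null \<Gamma>0 \<and> (\<forall>\<gamma>\<in>paths_in \<Omega> - \<Gamma>0. ugood h \<rho> \<gamma>))"

lemma ereal_le_enn2ereal: "ereal r \<le> enn2ereal x \<longleftrightarrow> ennreal r \<le> x" if "r \<ge> 0"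
  using that by (cases x) (auto simp: enn2ereal_ennreal ennreal_le_iff)

lemma ug_iff_upper_gradient: "upper_gradient v \<Omega> Q (\<lambda>z. ereal (h z)) \<rho> \<longleftrightarrow> ug h \<rho>"
proof -
  have eq: "\<bar>ereal (h x) - ereal (h y)\<bar> \<le> enn2ereal X \<longleftrightarrow> ennreal \<bar>h x - h y\<bar> \<le> X" for x y X
    by (simp add: ereal_le_enn2ereal)
  show ?thesis
  proof
    assume "upper_gradient v \<Omega> Q (\<lambda>z. ereal (h z)) \<rho>"
    then show "ug h \<rho>" unfolding upper_gradient_def ug_def ugood_def null_def eq by auto
  next
    assume "ug h \<rho>"
    then obtain \<Gamma>0 where "null \<Gamma>0" "\<forall>\<gamma>\<in>paths_in \<Omega> - \<Gamma>0. ugood h \<rho> \<gamma>" unfolding ug_def by blast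
    then show "upper_gradient v \<Omega> Q (\<lambda>z. ereal (h z)) \<rho>"
      using null_mono[of \<Gamma>0 "\<Gamma>0 \<inter> paths_in \<Omega>"]
      unfolding upper_gradient_def ugood_def eq null_def by (intro exI[of _ "\<Gamma>0 \<inter> paths_in \<Omega>"]) auto
  qed
qed

text \<open>Infinitely many disks could spoil closedness, but at scale \<open>1 / Suc n\<close> only
  finitely many have a larger diameter, and two points on a common smaller disk are close to each
  other. In the limit such pairs have equal images, which is why equality of images is part of the
  relation.\<close>

lemma touching_closed:
  fixes c :: "real \<Rightarrow> complex"
  assumes c: "continuous_on {a..b} c" and T1: "T1 \<subseteq> {a..b}" "compact T1" and T2: "T2 \<subseteq> {a..b}" "compact T2"
  shows "compact {(s, t) \<in> T1 \<times> T2. c s = c t \<or> (\<exists>i\<in>meeting Q (c ` {a..b}). c s \<in> closure (Q i) \<and> c t \<in> closure (Q i))}"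
    (is "compact ?R")
proof -
  let ?A = "meeting Q (c ` {a..b})"
  define F where "F n = {i\<in>?A. 1 / Suc n \<le> dm i}" for n
  have finF: "finite (F n)" for n
    unfolding F_def using compact_continuous_image[OF c]
    by (intro finite_large) (auto intro: compact_imp_bounded)
  define R where "R n = {p \<in> T1 \<times> T2. dist (c (fst p)) (c (snd p)) \<le> 1 / Suc n} \<union>
      (\<Union>i\<in>F n. {s\<in>T1. c s \<in> closure (Q i)} \<times> {t\<in>T2. c t \<in> closure (Q i)})" for n
  have c1: "continuous_on T1 c" and c2: "continuous_on T2 c"
    using c T1 T2 continuous_on_subset by blast+
  have cl: "compact {s\<in>T. c s \<in> closure (Q i)}" if "continuous_on T c" "compact T" for T i
    using continuous_closedin_preimage[OF that(1), of "closure (Q i)"] that(2)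
    by (simp add: closedin_compact_eq vimage_def Int_def)
  have "compact (R n)" for n
  proof -
    have "closedin (top_of_set (T1 \<times> T2)) (T1 \<times> T2 \<inter> (\<lambda>p. dist (c (fst p)) (c (snd p))) -` {..1 / Suc n})"
      by (intro continuous_closedin_preimage continuous_intros continuous_on_compose2[OF c1] continuous_on_compose2[OF c2]) auto
    then have "compact (T1 \<times> T2 \<inter> (\<lambda>p. dist (c (fst p)) (c (snd p))) -` {..1 / Suc n})"
      using T1 T2 by (simp add: closedin_compact_eq compact_Times)
    moreover have "T1 \<times> T2 \<inter> (\<lambda>p. dist (c (fst p)) (c (snd p))) -` {..1 / Suc n} =
       {p \<in> T1 \<times> T2. dist (c (fst p)) (c (snd p)) \<le> 1 / Suc n}" by auto
    ultimately show ?thesis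
      unfolding R_def using finF cl[OF c1 T1(2)] cl[OF c2 T2(2)]
      by (intro compact_Un compact_UN compact_Times) auto
  qed
  then have "compact (\<Inter>n. R n)" by (intro compact_Inter) auto
  moreover have "?R = (\<Inter>n. R n)"
  proof (intro equalityI subsetI)
    fix p assume p: "p \<in> ?R"
    then obtain s t where st: "p = (s, t)" "s \<in> T1" "t \<in> T2" by blast
    show "p \<in> (\<Inter>n. R n)"
    proof
      fix n
      show "p \<in> R n"
      proof (cases "c s = c t")
        case True
        then show ?thesis using st by (auto simp: R_def)
      next
        case False
        then obtain i where i: "i \<in> ?A" "c s \<in> closure (Q i)" "c t \<in> closure (Q i)" using p st by auto
        then show ?thesis using st dist_closure_le[OF i(2,3)] by (cases "i \<in> F n") (auto simp: R_def F_def)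
      qed
    qed
  next
    fix p assume p: "p \<in> (\<Inter>n. R n)"
    then obtain s t where st: "p = (s, t)" "s \<in> T1" "t \<in> T2" by (cases p) (auto simp: R_def)
    show "p \<in> ?R"
    proof (cases "c s = c t")
      case False
      then obtain n :: nat where n: "1 / Suc n < dist (c s) (c t)"
        by (meson nat_approx_posE zero_less_dist_iff)
      moreover have "p \<in> R n" using p by blast
      ultimately have "p \<in> (\<Union>i\<in>F n. {s\<in>T1. c s \<in> closure (Q i)} \<times> {t\<in>T2. c t \<in> closure (Q i)})"
        using st unfolding R_def by force
      then show ?thesis using st by (auto simp: F_def)
    qed (use st in auto)
  qed
  ultimately show ?thesis by simp
qed

text \<open>Two parameters are joined by a jump if they have the same image or lie on the same peripheral
  disk. Jumping from the first possible parameter to the last possible one splits the path into two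
  pieces that meet disjoint sets of peripheral disks, so that no disk is counted twice. Letting the
  finite set \<open>J\<close> grow removes \<open>\<rho>\<close> from the bound.\<close>

lemma chain_bound:
  fixes c :: "real \<Rightarrow> complex"
  assumes c: "continuous_on {A..B} c" "c ` {A..B} \<subseteq> \<Omega>" and fb: "fb h"
    and H: "\<And>s t. A \<le> s \<Longrightarrow> s \<le> t \<Longrightarrow> t \<le> B \<Longrightarrow> c s \<in> S \<Longrightarrow> c t \<in> S \<Longrightarrow>
        ennreal \<bar>h (c s) - h (c t)\<bar> \<le> sum_along Q \<rho> (c ` {s..t})"
    and J: "finite J" and ab: "A \<le> a" "a \<le> b" "b \<le> B" "c a \<in> S" "c b \<in> S"
  shows "ennreal \<bar>h (c a) - h (c b)\<bar> \<le>
     sum_along Q (\<lambda>i. ennreal (os h i) + (if i \<in> J then 0 else \<rho> i)) (c ` {a..b})"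
  using J ab
proof (induction J arbitrary: a b rule: finite_induct)
  case empty
  then have "ennreal \<bar>h (c a) - h (c b)\<bar> \<le> sum_along Q \<rho> (c ` {a..b})" by (intro H)
  also have "\<dots> \<le> sum_along Q (\<lambda>i. ennreal (os h i) + (if i \<in> {} then 0 else \<rho> i)) (c ` {a..b})"
    by (intro sum_along_mono) auto
  finally show ?case .
next
  case (insert j J)
  define w where "w J i = ennreal (os h i) + (if i \<in> J then 0 else \<rho> i)" for J i
  let ?A = "meeting Q (c ` {a..b})"
  have cab: "continuous_on {a..b} c" using c(1) insert.prems by (auto intro: continuous_on_subset)
  show ?case
  proof (cases "j \<in> ?A")
    case False
    have "ennreal \<bar>h (c a) - h (c b)\<bar> \<le> sum_along Q (w J) (c ` {a..b})"
      unfolding w_def by (rule insert.IH[OF insert.prems])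
    also have "\<dots> \<le> sum_along Q (w (insert j J)) (c ` {a..b})"
      using False by (intro sum_along_mono) (auto simp: w_def)
    finally show ?thesis unfolding w_def .
  next
    case True
    \<comment> \<open>\<open>p\<close> and \<open>q\<close> will be the first and last parameters on
      the closed disk \<open>j\<close>. They form a possible jump, so the extremal jump found below
      skips every visit to the disk \<open>j\<close>.\<close>
    define T where "T = {t\<in>{a..b}. c t \<in> closure (Q j)}"
    have "compact T"
      using continuous_closedin_preimage[OF cab, of "closure (Q j)"]
      by (simp add: closedin_compact_eq vimage_def Int_def T_def)
    moreover have "T \<noteq> {}"
      using True closure_subset[of "Q j"] by (auto simp: meeting_def T_def)
    ultimately obtain p q where p: "p \<in> T" "\<And>t. t \<in> T \<Longrightarrow> p \<le> t" and q: "q \<in> T" "\<And>t. t \<in> T \<Longrightarrow> t \<le> q"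
      using compact_attains_inf[of T] compact_attains_sup[of T] by metis
    define R where "R = {(s, t) \<in> {a..p} \<times> {q..b}. c s = c t \<or>
        (\<exists>i\<in>?A. c s \<in> closure (Q i) \<and> c t \<in> closure (Q i))}"
    have pq: "a \<le> p" "p \<le> q" "q \<le> b" using p q by (auto simp: T_def)
    have cR: "compact R"
      unfolding R_def by (rule touching_closed[OF cab]) (use pq in auto)
    have "(p, q) \<in> R" using p q True pq by (auto simp: R_def T_def)
    then have "fst ` R \<noteq> {}" by blast
    then obtain s where s: "s \<in> fst ` R" "\<And>x. x \<in> fst ` R \<Longrightarrow> s \<le> x"
      using compact_attains_inf[of "fst ` R"] compact_continuous_image[OF continuous_on_fst[OF continuous_on_id] cR] by blast
    define R2 where "R2 = snd ` (R \<inter> ({s} \<times> {q..b}))"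
    have "compact (R \<inter> ({s} \<times> {q..b}))" using cR by (intro compact_Int compact_Times) auto
    then have "compact R2"
      unfolding R2_def by (intro compact_continuous_image continuous_intros)
    moreover have "R2 \<noteq> {}"
    proof -
      obtain y where "(s, y) \<in> R" using s(1) by auto
      then have "(s, y) \<in> R \<inter> ({s} \<times> {q..b})" by (auto simp: R_def)
      then show ?thesis unfolding R2_def by blast
    qed
    ultimately obtain t where t: "t \<in> R2" "\<And>x. x \<in> R2 \<Longrightarrow> x \<le> t" using compact_attains_sup by metis
    have stR: "(s, t) \<in> R" using t(1) by (auto simp: R2_def)
    have smin: "s \<le> x" if "(x, y) \<in> R" for x y
    proof (rule s(2))
      show "x \<in> fst ` R" using image_eqI[OF _ that, of x fst] by simp
    qed
    have tmax: "y \<le> t" if "(s, y) \<in> R" for y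
    proof (rule t(2))
      have "(s, y) \<in> R \<inter> ({s} \<times> {q..b})" using that by (auto simp: R_def)
      then show "y \<in> R2" unfolding R2_def by (rule image_eqI[rotated]) simp
    qed
    have st: "a \<le> s" "s \<le> p" "q \<le> t" "t \<le> b" using stR by (auto simp: R_def)
    have RI: "(x, y) \<in> R" if "x \<in> {a..p}" "y \<in> {q..b}" "i \<in> ?A" "c x \<in> closure (Q i)" "c y \<in> closure (Q i)" for x y i
      using that by (auto simp: R_def)
    have Qcl: "z \<in> closure (Q i)" if "z \<in> Q i" for z i using that closure_subset by blast
    have inA: "i \<in> ?A" if "x \<in> {a..b}" "c x \<in> Q i" for x i using that by (auto simp: meeting_def)
    have near: "\<exists>d>0. \<forall>y\<in>{a..b}. \<bar>y - x\<bar> < d \<longrightarrow> c y \<in> Q i" if x: "x \<in> {a..b}" "c x \<in> Q i" for x i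
    proof -
      obtain e where e: "e > 0" "ball (c x) e \<subseteq> Q i" using Q_open x(2) openE by blast
      obtain d where "d > 0" "\<forall>y\<in>{a..b}. dist y x < d \<longrightarrow> dist (c y) (c x) < e"
        using cab x(1) e(1) unfolding continuous_on_iff by blast
      then show ?thesis using e(2) by (intro exI[of _ d]) (auto simp: dist_real_def dist_commute subset_iff)
    qed
    \<comment> \<open>If \<open>c s\<close> lay in an open disk, a slightly earlier parameter would
      lie in the same disk and could jump to \<open>t\<close> as well. Such a parameter exists,
      because \<open>c a\<close> is in the carpet and hence \<open>s\<close> is not
      \<open>a\<close>.\<close>
    have Scs: "c s \<in> S"
    proof (rule ccontr)
      assume "c s \<notin> S"
      moreover have "c s \<in> \<Omega>" using c(2) insert.prems st pq by auto
      ultimately obtain i where i: "c s \<in> Q i" using not_carpet by blast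
      have sI: "s \<in> {a..b}" using st pq by auto
      obtain d where d: "d > 0" "\<forall>y\<in>{a..b}. \<bar>y - s\<bar> < d \<longrightarrow> c y \<in> Q i" using near[OF sI i] by blast
      have "a < s" using i insert.prems carpet_not_Q[of "c a" i] st by (cases "a = s") auto
      define x where "x = max a (s - d / 2)"
      have x: "a \<le> x" "x < s" "\<bar>x - s\<bar> < d" using \<open>a < s\<close> d(1) by (auto simp: x_def)
      then have cx: "c x \<in> Q i" using d(2) sI by auto
      have "c t \<in> closure (Q i)"
      proof (cases "c s = c t")
        case False
        then obtain k where k: "c s \<in> closure (Q k)" "c t \<in> closure (Q k)" using stR by (auto simp: R_def)
        then have "k = i" using closure_unique Qcl[OF i] by blast
        then show ?thesis using k by simp
      qed (use i Qcl in auto)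
      then have "(x, t) \<in> R" using x st cx inA[OF sI i] Qcl by (intro RI[of x t i]) auto
      then show False using smin x by fastforce
    qed
    have Sct: "c t \<in> S"
    proof (rule ccontr)
      assume "c t \<notin> S"
      moreover have "c t \<in> \<Omega>" using c(2) insert.prems st pq by auto
      ultimately obtain i where i: "c t \<in> Q i" using not_carpet by blast
      have tI: "t \<in> {a..b}" using st pq by auto
      obtain d where d: "d > 0" "\<forall>y\<in>{a..b}. \<bar>y - t\<bar> < d \<longrightarrow> c y \<in> Q i" using near[OF tI i] by blast
      have "t < b" using i insert.prems carpet_not_Q[of "c b" i] st by (cases "b = t") auto
      define x where "x = min b (t + d / 2)"
      have x: "x \<le> b" "t < x" "\<bar>x - t\<bar> < d" using \<open>t < b\<close> d(1) by (auto simp: x_def)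
      then have cx: "c x \<in> Q i" using d(2) tI by auto
      have "c s \<in> closure (Q i)"
      proof (cases "c s = c t")
        case False
        then obtain k where k: "c s \<in> closure (Q k)" "c t \<in> closure (Q k)" using stR by (auto simp: R_def)
        then have "k = i" using closure_unique Qcl[OF i] by blast
        then show ?thesis using k by simp
      qed (use i Qcl in auto)
      then have "(s, x) \<in> R" using x st cx inA[OF tI i] Qcl by (intro RI[of s x i]) auto
      then show False using tmax x by fastforce
    qed
    let ?A1 = "meeting Q (c ` {a..s})" and ?A2 = "meeting Q (c ` {t..b})"
    have sub: "?A1 \<subseteq> ?A" "?A2 \<subseteq> ?A" using st pq by (auto intro!: meeting_mono image_mono)
    \<comment> \<open>A disk met by both pieces would allow a jump from a parameter not after
      \<open>s\<close>; minimality makes it \<open>s\<close> itself, whose image is in the carpet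
      and so in no disk.\<close>
    have disj: "?A1 \<inter> ?A2 = {}"
    proof (rule ccontr)
      assume "?A1 \<inter> ?A2 \<noteq> {}"
      then obtain i where i12: "i \<in> ?A1" "i \<in> ?A2" by blast
      obtain x where x: "x \<in> {a..s}" "c x \<in> Q i" using i12(1) by (rule meeting_imageE)
      obtain y where "y \<in> {t..b}" "c y \<in> Q i" using i12(2) by (rule meeting_imageE)
      note i = x this
      then have "(x, y) \<in> R" using st pq Qcl by (intro RI[of x y i] inA[of x]) auto
      then have "x = s" using smin i by fastforce
      then show False using i Scs carpet_not_Q by blast
    qed
    have jA: "j \<notin> ?A1" "j \<notin> ?A2"
    proof -
      show "j \<notin> ?A1"
      proof
        assume "j \<in> ?A1"
        then obtain x where x: "x \<in> {a..s}" "c x \<in> Q j" by (rule meeting_imageE)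
        then have "x \<in> T" using st pq Qcl by (auto simp: T_def)
        then have "x = s" using p(2)[of x] x st by auto
        then show False using x Scs carpet_not_Q by blast
      qed
      show "j \<notin> ?A2"
      proof
        assume "j \<in> ?A2"
        then obtain x where x: "x \<in> {t..b}" "c x \<in> Q j" by (rule meeting_imageE)
        then have "x \<in> T" using st pq Qcl by (auto simp: T_def)
        then have "x = t" using q(2)[of x] x st by auto
        then show False using x Sct carpet_not_Q by blast
      qed
    qed
    \<comment> \<open>\<open>K\<close> is empty or a single disk, which by extremality neither
      remaining piece meets. Since these pieces also avoid \<open>j\<close>, the term
      \<open>\<rho> j\<close> is never charged.\<close>
    have "\<exists>K. ennreal \<bar>h (c s) - h (c t)\<bar> \<le> (\<Sum>i\<in>K. ennreal (os h i)) \<and> finite K \<and> K \<subseteq> ?A - ?A1 - ?A2"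
    proof (cases "c s = c t")
      case True
      then show ?thesis by (intro exI[of _ "{}"]) auto
    next
      case False
      then obtain k where k: "k \<in> ?A" "c s \<in> closure (Q k)" "c t \<in> closure (Q k)" using stR by (auto simp: R_def)
      then have fr: "c s \<in> frontier (Q k)" "c t \<in> frontier (Q k)"
        using Scs Sct carpet_not_Q closure_frontier by blast+
      have "k \<notin> ?A1"
      proof
        assume "k \<in> ?A1"
        then obtain x where x: "x \<in> {a..s}" "c x \<in> Q k" by (rule meeting_imageE)
        then have "(x, t) \<in> R" using st pq Qcl k by (intro RI[of x t k]) auto
        then have "x = s" using smin x by fastforce
        then show False using x Scs carpet_not_Q by blast
      qed
      moreover have "k \<notin> ?A2"
      proof
        assume "k \<in> ?A2"
        then obtain x where x: "x \<in> {t..b}" "c x \<in> Q k" by (rule meeting_imageE)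
        then have "(s, x) \<in> R" using st pq Qcl k by (intro RI[of s x k]) auto
        then have "x = t" using tmax x by fastforce
        then show False using x Sct carpet_not_Q by blast
      qed
      ultimately show ?thesis
        using abs_le_os[OF fb fr] k(1) by (intro exI[of _ "{k}"]) (auto intro: ennreal_leI)
    qed
    then obtain K where K: "ennreal \<bar>h (c s) - h (c t)\<bar> \<le> (\<Sum>i\<in>K. ennreal (os h i))" "finite K" "K \<subseteq> ?A - ?A1 - ?A2"
      by blast
    have "ennreal \<bar>h (c a) - h (c b)\<bar> \<le> ennreal (\<bar>h (c a) - h (c s)\<bar> + (\<bar>h (c s) - h (c t)\<bar> + \<bar>h (c t) - h (c b)\<bar>))"
      by (intro ennreal_leI) auto
    also have "\<dots> = ennreal \<bar>h (c a) - h (c s)\<bar> + (ennreal \<bar>h (c s) - h (c t)\<bar> + ennreal \<bar>h (c t) - h (c b)\<bar>)"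
      by simp
    also have "\<dots> \<le> sum_along Q (w J) (c ` {a..s}) + ((\<Sum>i\<in>K. ennreal (os h i)) + sum_along Q (w J) (c ` {t..b}))"
      unfolding w_def using insert.prems st pq Scs Sct K(1) by (intro add_mono insert.IH) auto
    also have "(\<Sum>i\<in>K. ennreal (os h i)) = (\<Sum>i. ennreal (os h i) * indicator K i)"
    proof -
      have "(\<Sum>i. ennreal (os h i) * indicator K i) = (\<Sum>i\<in>K. ennreal (os h i) * indicator K i)"
        by (rule suminf_finite[OF K(2)]) auto
      then show ?thesis by simp
    qed
    also have "sum_along Q (w J) (c ` {a..s}) + ((\<Sum>i. ennreal (os h i) * indicator K i) + sum_along Q (w J) (c ` {t..b})) =
        (\<Sum>i. w J i * indicator ?A1 i + (ennreal (os h i) * indicator K i + w J i * indicator ?A2 i))"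
      unfolding sum_along_eq by (simp add: suminf_add)
    also have "\<dots> \<le> sum_along Q (w (insert j J)) (c ` {a..b})"
      unfolding sum_along_eq
    proof (intro suminf_le)
      fix i
      show "w J i * indicator ?A1 i + (ennreal (os h i) * indicator K i + w J i * indicator ?A2 i) \<le> w (insert j J) i * indicator ?A i"
        using sub disj jA K(3) by (auto simp: indicator_def w_def)
    qed auto
    finally show ?thesis unfolding w_def .
  qed
qed

text \<open>On almost every path the sum of \<rho> over each compact subpath is finite, so
  \<open>chain_bound\<close> with \<open>J = {..<N}\<close> leaves only a tail that tends to zero.
  Later test functions therefore need no sharp path estimate: an upper gradient of the right
  summability is enough.\<close>

lemma ug_osc:
  assumes fb: "fb h" and ug: "ug h \<rho>" and l2: "loc_l2 \<rho>"
  shows "ug h (\<lambda>i. ennreal (os h i))"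
proof -
  obtain \<Gamma>0 where \<Gamma>0: "null \<Gamma>0" "\<And>\<gamma>. \<gamma> \<in> paths_in \<Omega> - \<Gamma>0 \<Longrightarrow> ugood h \<rho> \<gamma>"
    using ug unfolding ug_def by blast
  let ?\<Gamma>1 = "{\<gamma>. \<exists>\<gamma>'\<in>subpaths \<gamma>. \<gamma>' \<in> \<Gamma>0}"
  let ?\<Gamma>2 = "{\<gamma>. \<exists>\<gamma>'\<in>subpaths \<gamma>. compact (trace \<gamma>') \<and> trace \<gamma>' \<subseteq> \<Omega> \<and> sum_along Q \<rho> (trace \<gamma>') = \<infinity>}"
  have null: "null (?\<Gamma>1 \<union> ?\<Gamma>2)"
    by (intro null_Un null_superpaths null_locally_infinite_sum \<Gamma>0 l2)
  have "ugood h (\<lambda>i. ennreal (os h i)) \<gamma>" if \<gamma>: "\<gamma> \<in> paths_in \<Omega> - (?\<Gamma>1 \<union> ?\<Gamma>2)" for \<gamma>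
  proof -
    obtain I c where gc: "\<gamma> = (I, c)" by (cases \<gamma>)
    have I: "is_interval I" "bounded I" "continuous_on (closure I) c" "c ` I \<subseteq> \<Omega>"
      using \<gamma> by (auto simp: gc paths_in_def is_cpath_def trace_def)
    have main: "ennreal \<bar>h (c a) - h (c b)\<bar> \<le> sum_along Q (\<lambda>i. ennreal (os h i)) (trace \<gamma>)"
      if ab: "a \<in> I" "b \<in> I" "a \<le> b" "c a \<in> S" "c b \<in> S" for a b
    proof -
      have abI: "{a..b} \<subseteq> I" using mem_is_interval_1_I[OF I(1) ab(1,2)] by auto
      have cont: "continuous_on {a..b} c"
        by (rule continuous_on_subset[OF I(3)]) (use abI closure_subset[of I] in auto)
      have subp: "({s..t}, c) \<in> subpaths \<gamma>" "({s..t}, c) \<in> paths_in \<Omega>" if "a \<le> s" "s \<le> t" "t \<le> b" for s t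
      proof -
        have "{s..t} \<subseteq> {a..b}" using that by auto
        then show "({s..t}, c) \<in> subpaths \<gamma>" using abI that by (auto simp: subpaths_def gc is_interval_cc)
        have "c ` {s..t} \<subseteq> \<Omega>" using \<open>{s..t} \<subseteq> {a..b}\<close> abI I(4) by blast
        then show "({s..t}, c) \<in> paths_in \<Omega>"
          using \<open>{s..t} \<subseteq> {a..b}\<close> that cont
          by (auto simp: paths_in_def is_cpath_def trace_def is_interval_cc intro: continuous_on_subset)
      qed
      have H: "ennreal \<bar>h (c s) - h (c t)\<bar> \<le> sum_along Q \<rho> (c ` {s..t})"
        if "a \<le> s" "s \<le> t" "t \<le> b" "c s \<in> S" "c t \<in> S" for s t
      proof -
        have "({s..t}, c) \<notin> \<Gamma>0" using subp(1)[OF that(1-3)] \<gamma> by blast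
        then have "ugood h \<rho> ({s..t}, c)" using \<Gamma>0(2) subp(2)[OF that(1-3)] by blast
        then show ?thesis using that unfolding ugood_def trace_def by auto
      qed
      have fin: "sum_along Q \<rho> (c ` {a..b}) < \<infinity>"
      proof -
        have "compact (c ` {a..b})" by (intro compact_continuous_image cont) auto
        moreover have "c ` {a..b} \<subseteq> \<Omega>" using abI I(4) by blast
        moreover have "({a..b}, c) \<in> subpaths \<gamma>" using subp(1)[of a b] ab by simp
        then have "\<not> (compact (trace ({a..b}, c)) \<and> trace ({a..b}, c) \<subseteq> \<Omega> \<and> sum_along Q \<rho> (trace ({a..b}, c)) = \<infinity>)"
          using \<gamma> by blast
        ultimately show ?thesis by (simp add: trace_def less_top[symmetric])
      qed
      let ?A = "meeting Q (c ` {a..b})"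
      have "ennreal \<bar>h (c a) - h (c b)\<bar> \<le> sum_along Q (\<lambda>i. ennreal (os h i)) (c ` {a..b}) + ennreal e" if e: "e > 0" for e
      proof -
        obtain N where N: "(\<Sum>i. if i < N then 0 else \<rho> i * indicator ?A i) \<le> ennreal e"
          using ennreal_suminf_tail[of "\<lambda>i. \<rho> i * indicator ?A i" e] fin e unfolding sum_along_eq by auto
        have "ennreal \<bar>h (c a) - h (c b)\<bar> \<le>
            sum_along Q (\<lambda>i. ennreal (os h i) + (if i \<in> {..<N} then 0 else \<rho> i)) (c ` {a..b})"
          by (rule chain_bound[OF cont _ fb H]) (use abI I(4) ab in auto)
        also have "\<dots> = sum_along Q (\<lambda>i. ennreal (os h i)) (c ` {a..b}) + sum_along Q (\<lambda>i. if i \<in> {..<N} then 0 else \<rho> i) (c ` {a..b})"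
          by (rule sum_along_add)
        also have "sum_along Q (\<lambda>i. if i \<in> {..<N} then 0 else \<rho> i) (c ` {a..b}) = (\<Sum>i. if i < N then 0 else \<rho> i * indicator ?A i)"
          unfolding sum_along_eq by (intro suminf_cong) auto
        finally show ?thesis using N by (meson add_left_mono order_trans)
      qed
      then have "ennreal \<bar>h (c a) - h (c b)\<bar> \<le> sum_along Q (\<lambda>i. ennreal (os h i)) (c ` {a..b})"
        by (rule ennreal_le_epsilon)
      also have "\<dots> \<le> sum_along Q (\<lambda>i. ennreal (os h i)) (trace \<gamma>)"
        using abI by (intro sum_along_mono) (auto simp: trace_def gc)
      finally show ?thesis .
    qed
    show ?thesis
      unfolding ugood_def
    proof (intro ballI)
      fix x y assume xy: "x \<in> trace \<gamma> \<inter> S" "y \<in> trace \<gamma> \<inter> S"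
      then obtain a b where ab: "a \<in> I" "x = c a" "b \<in> I" "y = c b" by (auto simp: trace_def gc)
      then show "ennreal \<bar>h x - h y\<bar> \<le> sum_along Q (\<lambda>i. ennreal (os h i)) (trace \<gamma>)"
        using main[of a b] main[of b a] xy by (cases "a \<le> b") (auto simp: abs_minus_commute)
    qed
  qed
  then show ?thesis using null unfolding ug_def by blast
qed

section \<open>Square frames\<close>

text \<open>Segments may cross or end inside peripheral disks, where the function carries no value.
  The maximum over the boundary agrees with \<open>Mx\<close>, the discrete function used in the
  normalization.\<close>

definition ext :: "(complex \<Rightarrow> real) \<Rightarrow> complex \<Rightarrow> real" where
  "ext h z = (if \<exists>i. z \<in> Q i then MM h (THE i. z \<in> Q i) else h z)"

lemma ext_Q: "z \<in> Q i \<Longrightarrow> ext h z = MM h i"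
proof -
  assume z: "z \<in> Q i"
  then have "(THE j. z \<in> Q j) = i" using Q_unique by blast
  then show ?thesis using z by (auto simp: ext_def)
qed

lemma ext_S: "z \<in> S \<Longrightarrow> ext h z = h z"
  using carpet_not_Q by (auto simp: ext_def)

text \<open>An endpoint inside a disk is moved to a point where \<open>T\<close> meets the boundary
  of that disk, at the price of one oscillation, unless both endpoints share the disk and the
  difference vanishes.\<close>

lemma ext_diff_le:
  assumes fb: "fb h" and T: "connected T" "T \<subseteq> \<Omega>" "z \<in> T" "w \<in> T"
    and D: "\<And>x y. x \<in> T \<inter> S \<Longrightarrow> y \<in> T \<inter> S \<Longrightarrow> \<bar>h x - h y\<bar> \<le> D" "D \<ge> 0"
    and D': "\<And>i. i \<in> meeting Q T \<Longrightarrow> os h i \<le> D'" "D' \<ge> 0"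
  shows "\<bar>ext h z - ext h w\<bar> \<le> D + 2 * D'"
proof (cases "\<exists>i. z \<in> Q i \<and> w \<in> Q i")
  case True
  then show ?thesis using ext_Q D(2) D'(2) by fastforce
next
  case False
  have *: "\<exists>x\<in>T \<inter> S. \<bar>ext h z - h x\<bar> \<le> D'" if z: "z \<in> T" and w: "w \<in> T" and n: "\<not> (\<exists>i. z \<in> Q i \<and> w \<in> Q i)" for z w
  proof (cases "z \<in> S")
    case True
    then show ?thesis using z D'(2) ext_S by (intro bexI[of _ z]) auto
  next
    case False
    then obtain i where i: "z \<in> Q i" using not_carpet T(2) z by blast
    then have "T \<inter> frontier (Q i) \<noteq> {}" using meets_frontier[OF T(1) z i w] n by blast
    then obtain x where x: "x \<in> T" "x \<in> frontier (Q i)" by blast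
    have "i \<in> meeting Q T" using z i by (auto simp: meeting_def)
    then have "os h i \<le> D'" by (rule D'(1))
    moreover have "\<bar>ext h z - h x\<bar> \<le> os h i"
      using le_MM[OF fb x(2)] mm_le[OF fb x(2)] ext_Q[OF i, of h] by (simp add: os_def)
    ultimately show ?thesis using x frontier_carpet by (intro bexI[of _ x]) auto
  qed
  obtain x where x: "x \<in> T \<inter> S" "\<bar>ext h z - h x\<bar> \<le> D'" using *[OF T(3,4) False] by blast
  obtain y where y: "y \<in> T \<inter> S" "\<bar>ext h w - h y\<bar> \<le> D'" using *[OF T(4,3)] False by blast
  show ?thesis using D(1)[OF x(1) y(1)] x(2) y(2) by linarith
qed

text \<open>The sum along the path bounds both the differences of carpet values and each single
  oscillation met, hence \<open>D + 2 * D\<close>.\<close>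

lemma ext_path_diff:
  assumes fb: "fb h" and g: "\<gamma> \<in> paths_in \<Omega>" "ugood h (\<lambda>i. ennreal (os h i)) \<gamma>"
    and D: "sum_along Q (\<lambda>i. ennreal (os h i)) (trace \<gamma>) \<le> ennreal D" "D \<ge> 0"
    and zw: "z \<in> trace \<gamma>" "w \<in> trace \<gamma>"
  shows "\<bar>ext h z - ext h w\<bar> \<le> 3 * D"
proof -
  have "connected (trace \<gamma>)"
  proof -
    have "continuous_on (fst \<gamma>) (snd \<gamma>)"
      using g(1) closure_subset[of "fst \<gamma>"] by (auto simp: paths_in_def is_cpath_def intro: continuous_on_subset)
    then show ?thesis
      using g(1) by (auto simp: trace_def paths_in_def is_cpath_def is_interval_connected_1 intro: connected_continuous_image)
  qed
  moreover have "os h i \<le> D" if "i \<in> meeting Q (trace \<gamma>)" for i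
    using order_trans[OF sum_along_ge_term[OF that, of "\<lambda>i. ennreal (os h i)"] D(1)] D(2)
    by (simp add: ennreal_le_iff)
  moreover have "\<bar>h x - h y\<bar> \<le> D" if "x \<in> trace \<gamma> \<inter> S" "y \<in> trace \<gamma> \<inter> S" for x y
  proof -
    have "ennreal \<bar>h x - h y\<bar> \<le> ennreal D"
      using g(2) that D(1) order_trans unfolding ugood_def by blast
    then show ?thesis using D(2) by (simp add: ennreal_le_iff)
  qed
  ultimately have "\<bar>ext h z - ext h w\<bar> \<le> D + 2 * D"
    using g(1) by (intro ext_diff_le[OF fb _ _ zw] D(2)) (auto simp: paths_in_def)
  then show ?thesis by simp
qed

definition al :: "bool \<Rightarrow> complex \<Rightarrow> real" where "al d p = (if d then Re p else Im p)"

text \<open>The four segments \<open>hs p s d \<tau>\<close> with \<open>(d, \<tau>)\<close> in \<open>hash t\<close> contain the sides of the square with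
  centre \<open>p\<close> and half-side \<open>t\<close>, prolonged to length \<open>4 * s\<close>.\<close>

definition hs :: "complex \<Rightarrow> real \<Rightarrow> bool \<Rightarrow> real \<Rightarrow> cpath" where
  "hs p s d t = seg d (al d p - 2 * s) (al d p + 2 * s) (al (\<not> d) p + t)"

definition hash :: "real \<Rightarrow> (bool \<times> real) set" where
  "hash t = UNIV \<times> {t, -t}"

definition hash_sum :: "complex \<Rightarrow> real \<Rightarrow> (nat \<Rightarrow> ennreal) \<Rightarrow> real \<Rightarrow> ennreal" where
  "hash_sum p s a t = sum_along Q a (trace (hs p s True t)) + sum_along Q a (trace (hs p s True (-t))) +
     sum_along Q a (trace (hs p s False t)) + sum_along Q a (trace (hs p s False (-t)))"

lemma hash_sum_ge: "(d, \<tau>) \<in> hash t \<Longrightarrow> sum_along Q a (trace (hs p s d \<tau>)) \<le> hash_sum p s a t"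
  unfolding hash_def hash_sum_def by (cases d) (auto simp: add.assoc intro: add_increasing add_increasing2)

lemma sg_al: "sg d (al d p) (al (\<not> d) p) = p"
  by (simp add: sg_def al_def complex_eq_iff)

lemma trace_hs: "z \<in> trace (hs p s d t) \<longleftrightarrow> \<bar>al d z - al d p\<bar> \<le> 2 * s \<and> al (\<not> d) z = al (\<not> d) p + t"
proof
  assume "z \<in> trace (hs p s d t)"
  then show "\<bar>al d z - al d p\<bar> \<le> 2 * s \<and> al (\<not> d) z = al (\<not> d) p + t"
    by (auto simp: hs_def trace_seg sg_def al_def)
next
  assume *: "\<bar>al d z - al d p\<bar> \<le> 2 * s \<and> al (\<not> d) z = al (\<not> d) p + t"
  then have "z = sg d (al d z) (al (\<not> d) p + t)" using sg_al[of d z] by simp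
  then show "z \<in> trace (hs p s d t)"
    unfolding hs_def trace_seg using * by (intro image_eqI[of _ _ "al d z"]) auto
qed

lemma dist_le_al: "dist z w \<le> \<bar>al d z - al d w\<bar> + \<bar>al (\<not> d) z - al (\<not> d) w\<bar>"
  using dist_sg_le[of d "al d z" "al (\<not> d) z" "al d w" "al (\<not> d) w"] by (simp add: sg_al)

lemma abs_al_le_dist: "\<bar>al d z - al d w\<bar> \<le> dist z w"
  using dist_sg_ge(1)[of "al d z" "al d w" d "al (\<not> d) z" "al (\<not> d) w"] by (simp add: sg_al)

lemma trace_hs_ball:
  assumes "\<bar>t\<bar> < 2 * s" shows "trace (hs p s d t) \<subseteq> ball p (4 * s)"
proof
  fix z assume "z \<in> trace (hs p s d t)"
  then have "\<bar>al d p - al d z\<bar> + \<bar>al (\<not> d) p - al (\<not> d) z\<bar> < 4 * s" using assms by (auto simp: trace_hs)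
  then show "z \<in> ball p (4 * s)" using dist_le_al[of p z d] by auto
qed

lemma hs_paths_in:
  assumes "s > 0" "trace (hs p s d t) \<subseteq> \<Omega>" shows "hs p s d t \<in> paths_in \<Omega>"
  using assms continuous_on_sg by (auto simp: paths_in_def is_cpath_def hs_def seg_def is_interval_cc)

text \<open>Each segment contributes at most \<open>3 * D\<close>. Perpendicular segments cross
  because \<open>t < 2 * s\<close>, and two parallel ones are joined through a third, so three
  segments suffice.\<close>

lemma hash_ext:
  assumes fb: "fb h" and s: "0 < s" "0 < t" "t < 2 * s" and sub: "ball p (4 * s) \<subseteq> \<Omega>"
    and g: "\<And>d \<tau>. (d, \<tau>) \<in> hash t \<Longrightarrow> ugood h (\<lambda>i. ennreal (os h i)) (hs p s d \<tau>)"
    and D: "hash_sum p s (\<lambda>i. ennreal (os h i)) t \<le> ennreal D" "D \<ge> 0"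
    and z: "(d, \<tau>) \<in> hash t" "z \<in> trace (hs p s d \<tau>)" and w: "(d', \<tau>') \<in> hash t" "w \<in> trace (hs p s d' \<tau>')"
  shows "\<bar>ext h z - ext h w\<bar> \<le> 9 * D"
proof -
  have one: "\<bar>ext h x - ext h y\<bar> \<le> 3 * D"
    if "(d, \<tau>) \<in> hash t" "x \<in> trace (hs p s d \<tau>)" "y \<in> trace (hs p s d \<tau>)" for d \<tau> x y
  proof (rule ext_path_diff[OF fb _ _ _ D(2)])
    show "ugood h (\<lambda>i. ennreal (os h i)) (hs p s d \<tau>)" by (rule g[OF that(1)])
    show "hs p s d \<tau> \<in> paths_in \<Omega>"
    proof (rule hs_paths_in)
      have "\<bar>\<tau>\<bar> < 2 * s" using that(1) s by (auto simp: hash_def)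
      then show "trace (hs p s d \<tau>) \<subseteq> \<Omega>" using trace_hs_ball sub by blast
    qed (rule s(1))
    show "sum_along Q (\<lambda>i. ennreal (os h i)) (trace (hs p s d \<tau>)) \<le> ennreal D"
      using hash_sum_ge[OF that(1)] D(1) order_trans by blast
  qed (use that in auto)
  have cross: "\<exists>x. x \<in> trace (hs p s d \<tau>) \<and> x \<in> trace (hs p s (\<not> d) \<tau>')"
    if "(d, \<tau>) \<in> hash t" "(\<not> d, \<tau>') \<in> hash t" for d \<tau> \<tau>'
  proof (intro exI conjI)
    let ?x = "sg d (al d p + \<tau>') (al (\<not> d) p + \<tau>)"
    have "al d ?x = al d p + \<tau>'" "al (\<not> d) ?x = al (\<not> d) p + \<tau>" by (auto simp: al_def sg_def)
    then show "?x \<in> trace (hs p s d \<tau>)" "?x \<in> trace (hs p s (\<not> d) \<tau>')"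
      using that s by (auto simp: trace_hs hash_def)
  qed
  show ?thesis
  proof (cases "d' = d")
    case True
    have ht: "(\<not> d, t) \<in> hash t" by (simp add: hash_def)
    obtain x where x: "x \<in> trace (hs p s d \<tau>)" "x \<in> trace (hs p s (\<not> d) t)" using cross[OF z(1) ht] by blast
    obtain y where y: "y \<in> trace (hs p s d \<tau>')" "y \<in> trace (hs p s (\<not> d) t)"
      using cross[of d \<tau>' t] w(1) ht True by blast
    show ?thesis
      using one[OF z(1,2) x(1)] one[OF ht x(2) y(2)] one[of d \<tau>' y w] y w True by auto
  next
    case False
    then have d': "d' = (\<not> d)" by auto
    obtain x where x: "x \<in> trace (hs p s d \<tau>)" "x \<in> trace (hs p s (\<not> d) \<tau>')"
      using cross[OF z(1)] w(1) d' by blast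
    show ?thesis using one[OF z(1,2) x(1)] one[of "\<not> d" \<tau>' x w] x w d' D(2) by auto
  qed
qed

text \<open>The average of the four segment sums over \<open>t\<close> in \<open>{s..2 * s}\<close>
  is at most 16 times the bracket, so values above 32 times the bracket cannot occur almost
  everywhere; the remaining conditions exclude only a null set of \<open>t\<close>.\<close>

lemma good_hash:
  assumes s: "s > 0" and k: "k > 0" and fin: "sum_along Q (\<lambda>i. (a i)\<^sup>2) (ball p (4 * s)) < \<infinity>"
    and N: "null \<Gamma>" and P: "AE t in lborel. P t"
  shows "\<exists>t. s < t \<and> t < 2 * s \<and> P t \<and> (\<forall>(d, \<tau>)\<in>hash t. hs p s d \<tau> \<notin> \<Gamma>) \<and>
     hash_sum p s a t \<le> 32 * (ennreal k * sum_along Q (\<lambda>i. (a i)\<^sup>2) (ball p (4 * s)) + ennreal (64 / K1 / k))"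
proof -
  define X where "X = ennreal k * sum_along Q (\<lambda>i. (a i)\<^sup>2) (ball p (4 * s)) + ennreal (64 / K1 / k)"
  have "X < \<infinity>" using fin by (auto simp: X_def ennreal_mult_less_top)
  then obtain \<xi> where \<xi>: "X = ennreal \<xi>" "\<xi> \<ge> 0" by (cases X) auto
  \<comment> \<open>Strict positivity of the bracket is what makes 32 against 16 a contradiction at
    the end.\<close>
  have "0 < ennreal (64 / K1 / k)" using K1 k by simp
  also have "\<dots> \<le> X" by (simp add: X_def)
  finally have Xpos: "\<xi> > 0" using \<xi> by simp
  define G where "G d y = sum_along Q a (trace (seg d (al d p - 2 * s) (al d p + 2 * s) y))" for d y
  have [measurable]: "G d \<in> borel_measurable borel" for d unfolding G_def by simp
  have hsG: "sum_along Q a (trace (hs p s d t)) = G d (al (\<not> d) p + t)" for d t by (simp add: G_def hs_def)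
  have int: "(\<integral>\<^sup>+t\<in>{s..2 * s}. G d (al (\<not> d) p + \<sigma> * t) \<partial>lborel) \<le> ennreal (4 * s) * X" if \<sigma>: "\<sigma> = 1 \<or> \<sigma> = -1" for d \<sigma>
  proof -
    let ?c = "al (\<not> d) p"
    \<comment> \<open>For either sign the map from \<open>t\<close> to the height carries
      \<open>{s..2 * s}\<close> onto \<open>{y1..y1 + s}\<close>.\<close>
    define y1 where "y1 = (if \<sigma> = 1 then ?c + s else ?c - 2 * s)"
    have "(\<integral>\<^sup>+t\<in>{s..2 * s}. G d (?c + \<sigma> * t) \<partial>lborel) = (\<integral>\<^sup>+t. (G d (?c + \<sigma> * t) * indicator {y1..y1 + s} (?c + \<sigma> * t)) \<partial>lborel)"
      using \<sigma> by (intro nn_integral_cong) (auto simp: indicator_def y1_def)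
    also have "\<dots> = (\<integral>\<^sup>+y\<in>{y1..y1 + s}. G d y \<partial>lborel)"
      using \<sigma> by (subst (2) nn_integral_real_affine[where c = \<sigma> and t = ?c]) auto
    also have "\<dots> \<le> ennreal (4 * s) * X"
      unfolding G_def X_def
    proof (rule seg_sum_integral[OF k])
      fix y assume y: "y \<in> {y1..y1 + s}"
      have "hs p s d (y - ?c) = seg d (al d p - 2 * s) (al d p + 2 * s) y" by (simp add: hs_def)
      moreover have "\<bar>y - ?c\<bar> \<le> 2 * s" using y s \<sigma> by (auto simp: y1_def split: if_splits)
      moreover have "trace (hs p s d (y - ?c)) \<subseteq> ball p (4 * s)"
      \<comment> \<open>\<open>trace_hs_ball\<close> needs a strict inequality because it estimates
        by the sum of the coordinates; at the extreme height the Euclidean distance is still at most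
        \<open>sqrt 8 * s\<close>.\<close>
      proof (cases "\<bar>y - ?c\<bar> < 2 * s")
        case True then show ?thesis by (rule trace_hs_ball)
      next
        case False
        then have e: "\<bar>y - ?c\<bar> = 2 * s" using \<open>\<bar>y - ?c\<bar> \<le> 2 * s\<close> by simp
        show ?thesis
        proof
          fix z assume "z \<in> trace (hs p s d (y - ?c))"
          then have z: "\<bar>al d z - al d p\<bar> \<le> 2 * s" "\<bar>al (\<not> d) z - al (\<not> d) p\<bar> = 2 * s" using e by (auto simp: trace_hs)
          have "(dist p z)\<^sup>2 = (al d z - al d p)\<^sup>2 + (al (\<not> d) z - al (\<not> d) p)\<^sup>2"
            by (auto simp: dist_norm cmod_def al_def power2_commute)
          also have "\<dots> \<le> (2 * s)\<^sup>2 + (2 * s)\<^sup>2"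
            using z s by (intro add_mono iffD1[OF abs_le_square_iff]) auto
          also have "\<dots> < (4 * s)\<^sup>2" using s by (simp add: power2_eq_square)
          finally have "dist p z < 4 * s" by (rule power2_less_imp_less) (use s in auto)
          then show "z \<in> ball p (4 * s)" by simp
        qed
      qed
      ultimately show "trace (seg d (al d p - 2 * s) (al d p + 2 * s) y) \<subseteq> ball p (4 * s)" by simp
    qed (use s in auto)
    finally show ?thesis .
  qed
  have G1: "hash_sum p s a t = G True (al False p + 1 * t) + G True (al False p + (-1) * t) +
      G False (al True p + 1 * t) + G False (al True p + (-1) * t)" for t
    unfolding hash_sum_def hsG by simp
  have [measurable]: "hash_sum p s a \<in> borel_measurable borel"
    unfolding G1[abs_def] by measurable
  have "(\<integral>\<^sup>+t\<in>{s..2 * s}. hash_sum p s a t \<partial>lborel) =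
      (\<integral>\<^sup>+t\<in>{s..2 * s}. G True (al False p + 1 * t) \<partial>lborel) + (\<integral>\<^sup>+t\<in>{s..2 * s}. G True (al False p + (-1) * t) \<partial>lborel) +
      (\<integral>\<^sup>+t\<in>{s..2 * s}. G False (al True p + 1 * t) \<partial>lborel) + (\<integral>\<^sup>+t\<in>{s..2 * s}. G False (al True p + (-1) * t) \<partial>lborel)"
    unfolding G1 by (simp add: distrib_right nn_integral_add)
  also have "\<dots> \<le> ennreal (4 * s) * X + ennreal (4 * s) * X + ennreal (4 * s) * X + ennreal (4 * s) * X"
    using int[of 1 True] int[of "-1" True] int[of 1 False] int[of "-1" False] by (intro add_mono) auto
  also have "\<dots> = ennreal (16 * s * \<xi>)"
    using s \<xi> by (simp flip: ennreal_mult ennreal_plus)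
  finally have I: "(\<integral>\<^sup>+t\<in>{s..2 * s}. hash_sum p s a t \<partial>lborel) \<le> ennreal (16 * s * \<xi>)" .
  have good1: "AE t in lborel. t \<in> {s..2 * s} \<longrightarrow> hs p s d (\<sigma> * t) \<notin> \<Gamma>" if \<sigma>: "\<sigma> = 1 \<or> \<sigma> = -1" for d \<sigma>
  proof -
    let ?c = "al (\<not> d) p"
    have "AE y in lborel. y \<in> {?c - 2 * s..?c + 2 * s} \<longrightarrow> seg d (al d p - 2 * s) (al d p + 2 * s) y \<notin> \<Gamma>"
      by (rule AE_seg_not_null[OF N])
    then have "AE t in lborel. ?c + \<sigma> * t \<in> {?c - 2 * s..?c + 2 * s} \<longrightarrow> seg d (al d p - 2 * s) (al d p + 2 * s) (?c + \<sigma> * t) \<notin> \<Gamma>"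
      by (rule AE_lborel_affine) (use \<sigma> in auto)
    then show ?thesis by (rule AE_mp) (use \<sigma> s in \<open>auto intro!: AE_I2 simp: hs_def\<close>)
  qed
  have AE: "AE t in lborel. t \<noteq> s \<and> t \<noteq> 2 * s \<and> P t \<and> (t \<in> {s..2 * s} \<longrightarrow> (\<forall>(d, \<tau>)\<in>hash t. hs p s d \<tau> \<notin> \<Gamma>))"
    using P good1[OF disjI1[OF refl], of True] good1[OF disjI2[OF refl], of True]
      good1[OF disjI1[OF refl], of False] good1[OF disjI2[OF refl], of False]
      AE_lborel_singleton[of s] AE_lborel_singleton[of "2 * s"]
  proof eventually_elim
    case (elim t)
    have "hs p s d \<tau> \<notin> \<Gamma>" if "t \<in> {s..2 * s}" "(d, \<tau>) \<in> hash t" for d \<tau>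
      using elim that by (cases d) (auto simp: hash_def)
    then show ?case using elim by auto
  qed
  show ?thesis
  proof (rule ccontr)
    assume no: "\<not> ?thesis"
    have "AE t in lborel. ennreal (32 * \<xi>) * indicator {s..2 * s} t \<le> hash_sum p s a t * indicator {s..2 * s} t"
      using AE
    proof eventually_elim
      case (elim t)
      show ?case
      proof (cases "t \<in> {s..2 * s}")
        case True
        then have t: "s < t" "t < 2 * s" "P t" "\<forall>(d, \<tau>)\<in>hash t. hs p s d \<tau> \<notin> \<Gamma>" using elim by auto
        have "\<not> hash_sum p s a t \<le> 32 * X" using no t unfolding X_def by blast
        then have "32 * X \<le> hash_sum p s a t" by simp
        moreover have "32 * X = ennreal (32 * \<xi>)" using \<xi> by (simp add: ennreal_mult)
        ultimately show ?thesis using True by simp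
      qed simp
    qed
    then have "(\<integral>\<^sup>+t. ennreal (32 * \<xi>) * indicator {s..2 * s} t \<partial>lborel) \<le> (\<integral>\<^sup>+t\<in>{s..2 * s}. hash_sum p s a t \<partial>lborel)"
      by (rule nn_integral_mono_AE)
    also have "(\<integral>\<^sup>+t. ennreal (32 * \<xi>) * indicator {s..2 * s} t \<partial>lborel) = ennreal (32 * \<xi> * s)"
      using s Xpos by (subst nn_integral_cmult_indicator) (auto simp flip: ennreal_mult)
    finally have "ennreal (32 * \<xi> * s) \<le> ennreal (16 * s * \<xi>)" using I by (rule order_trans)
    then show False using s Xpos by (simp add: ennreal_le_iff)
  qed
qed

end

section \<open>The Caccioppoli inequality\<close>

text \<open>With \<open>y = sqrt x\<close> the right-hand side is the square of
  \<open>y - 1 / y\<close>, and the claim reduces to \<open>2 * ln y \<le> y - 1 / y\<close>, where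
  the difference has the derivative \<open>(1 - 1 / y)\<^sup>2\<close>. It is applied with
  \<open>x\<close> the ratio of maximum to minimum on a disk.\<close>

lemma ln_square_le:
  fixes x :: real
  assumes "x \<ge> 1"
  shows "(ln x)\<^sup>2 \<le> (x - 1)\<^sup>2 / x"
proof -
  define y where "y = sqrt x"
  have y: "y \<ge> 1" "y\<^sup>2 = x" using assms by (auto simp: y_def)
  have "2 * ln y \<le> y - 1 / y"
  proof -
    have "(\<lambda>y. y - 1 / y - 2 * ln y) 1 \<le> (\<lambda>y. y - 1 / y - 2 * ln y) y"
    proof (rule DERIV_nonneg_imp_nondecreasing[OF y(1)])
      fix t :: real assume t: "1 \<le> t" "t \<le> y"
      have "((\<lambda>y. y - 1 / y - 2 * ln y) has_real_derivative (1 + 1 / t\<^sup>2 - 2 / t)) (at t)"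
        using t by (auto intro!: derivative_eq_intros simp: power2_eq_square)
      moreover have "1 + 1 / t\<^sup>2 - 2 / t = (1 - 1 / t)\<^sup>2"
        using t by (simp add: power2_eq_square field_simps)
      ultimately show "\<exists>d. ((\<lambda>y. y - 1 / y - 2 * ln y) has_real_derivative d) (at t) \<and> 0 \<le> d"
        by (metis zero_le_power2)
    qed
    then show ?thesis by simp
  qed
  moreover have "0 \<le> ln y" using y by simp
  moreover have "ln x = 2 * ln y" using y by (simp flip: y(2) add: ln_realpow)
  ultimately have "(ln x)\<^sup>2 \<le> (y - 1 / y)\<^sup>2" by (intro power_mono) auto
  also have "\<dots> = (x - 1)\<^sup>2 / x"
    using y assms by (simp flip: y(2) add: power2_eq_square field_simps)
  finally show ?thesis .
qed

text \<open>The pointwise form of the Caccioppoli estimate: the left-hand side is the first variation of the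
  energy of a peripheral disk on which the function ranges from \<open>m\<close> to \<open>M\<close> and the cutoff from
  \<open>h\<close> to \<open>H\<close>.\<close>

lemma caccioppoli_term:
  fixes m M h H :: real
  assumes "0 < m" "m \<le> M" "0 \<le> h" "h \<le> H"
  shows "(M - m) * (H\<^sup>2 / M - h\<^sup>2 / m) \<le> - (1/2) * ((M - m)\<^sup>2 / (M * m)) * h\<^sup>2 + 3 * (H - h)\<^sup>2"
proof -
  define q where "q = (M - m) / M"
  define A where "A = (M - m)\<^sup>2 / (M * m)"
  have M: "M > 0" using assms by linarith
  have q: "0 \<le> q" "q \<le> 1" using assms M by (auto simp: q_def field_simps)
  have "q\<^sup>2 = (M - m)\<^sup>2 / (M * M)" by (simp add: q_def power2_eq_square)
  also have "\<dots> \<le> A" unfolding A_def using assms M by (intro divide_left_mono mult_left_mono) auto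
  finally have qA: "q\<^sup>2 \<le> A" .
  have "(M - m) * (H\<^sup>2 / M - h\<^sup>2 / m) = - A * h\<^sup>2 + q * ((H - h) * (2 * h + (H - h)))"
    using assms M by (simp add: q_def A_def power2_eq_square field_simps)
  also have "q * ((H - h) * (2 * h + (H - h))) = 2 * (q * h) * (H - h) + q * (H - h)\<^sup>2"
    by (simp add: power2_eq_square algebra_simps)
  \<comment> \<open>Young's inequality with this weight gives up only half of the good term
    \<open>A * h\<^sup>2\<close>, as \<open>q\<^sup>2 \<le> A\<close>; the error coefficients 2 and
    1 add up to the constant 3.\<close>
  also have "\<dots> \<le> (1/2) * (q * h)\<^sup>2 + 2 * (H - h)\<^sup>2 + 1 * (H - h)\<^sup>2"
  proof (intro add_mono mult_right_mono)
    have "0 \<le> (q * h - 2 * (H - h))\<^sup>2" by simp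
    then show "2 * (q * h) * (H - h) \<le> (1/2) * (q * h)\<^sup>2 + 2 * (H - h)\<^sup>2"
      by (simp add: power2_eq_square algebra_simps)
  qed (use q in auto)
  also have "(q * h)\<^sup>2 \<le> A * h\<^sup>2" unfolding power_mult_distrib by (intro mult_right_mono qA) auto
  finally show ?thesis unfolding A_def[symmetric] by (simp add: algebra_simps)
qed

lemma summable_of_ennreal_finite:
  assumes "\<And>i. 0 \<le> f i" "(\<Sum>i. ennreal (f i)) < \<infinity>"
  shows "summable f" "(\<Sum>i. ennreal (f i)) = ennreal (\<Sum>i. f i)"
  using assms by (auto intro!: summable_suminf_not_top suminf_ennreal simp: less_top)

context sierpinski begin

lemma W12_locD:
  assumes "(\<lambda>z. ereal (h z)) \<in> W12_loc v \<Omega> Q"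
  shows "fb h" "ug h (\<lambda>i. ennreal (os h i))" "loc_l2 (\<lambda>i. ennreal (os h i))"
    "\<And>x r. 0 < r \<Longrightarrow> compactly_in (ball x r) \<Omega> \<Longrightarrow> sum_along Q (\<lambda>i. ennreal ((MM h i * dm i)\<^sup>2)) (ball x r) < \<infinity>"
proof -
  show fb: "fb h" using assms by (intro fb_of_finite) (auto simp: W12_loc_def)
  have osc: "osc Q (\<lambda>z. ereal (h z)) = (\<lambda>i. ennreal (os h i))" using osc_real[OF fb] by auto
  show "ug h (\<lambda>i. ennreal (os h i))" "loc_l2 (\<lambda>i. ennreal (os h i))"
    using assms unfolding W12_loc_def mem_Collect_eq osc ug_iff_upper_gradient loc_l2_def by blast+
  have "Mx_diam_sq Q (\<lambda>z. ereal (h z)) = (\<lambda>i. ennreal ((MM h i * dm i)\<^sup>2))"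
    using dm_pos by (auto simp: Mx_diam_sq_def Mx_real[OF fb] e2ennreal_ereal ennreal_power power_mult_distrib
        less_imp_le simp flip: ennreal_mult)
  then show "\<And>x r. 0 < r \<Longrightarrow> compactly_in (ball x r) \<Omega> \<Longrightarrow> sum_along Q (\<lambda>i. ennreal ((MM h i * dm i)\<^sup>2)) (ball x r) < \<infinity>"
    using assms unfolding W12_loc_def mem_Collect_eq by (metis (no_types, lifting))
qed

text \<open>The prescribed upper gradient is the oscillation, but by \<open>ug_osc\<close> any
  locally square summable one will do.\<close>

lemma W12I:
  assumes fb: "fb h" and ug: "ug h \<rho>" "loc_l2 \<rho>" and e: "(\<Sum>i. (ennreal (os h i))\<^sup>2) < \<infinity>"
    and m: "(\<Sum>i. ennreal ((MM h i * dm i)\<^sup>2)) < \<infinity>"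
  shows "(\<lambda>z. ereal (h z)) \<in> W12 v \<Omega> Q"
proof -
  have osc: "osc Q (\<lambda>z. ereal (h z)) = (\<lambda>i. ennreal (os h i))" using osc_real[OF fb] by auto
  have md: "Mx_diam_sq Q (\<lambda>z. ereal (h z)) = (\<lambda>i. ennreal ((MM h i * dm i)\<^sup>2))"
    using dm_pos by (auto simp: Mx_diam_sq_def Mx_real[OF fb] e2ennreal_ereal ennreal_power power_mult_distrib
        less_imp_le simp flip: ennreal_mult)
  have "sum_along Q \<sigma> V < \<infinity>" if "(\<Sum>i. \<sigma> i) < \<infinity>" for \<sigma> V
    using sum_along_le_suminf[of Q \<sigma> V] that by (rule le_less_trans)
  then show ?thesis
    unfolding W12_def W12_loc_def mem_Collect_eq md osc ug_iff_upper_gradient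
    using ug_osc[OF fb ug] e m by (simp add: Mx_real[OF fb] mn_real[OF fb])
qed

lemma loc_l2_add:
  assumes "loc_l2 \<rho>" "loc_l2 \<rho>'" shows "loc_l2 (\<lambda>i. \<rho> i + \<rho>' i)"
proof -
  have sq: "(a + b)\<^sup>2 \<le> 2 * a\<^sup>2 + 2 * b\<^sup>2" for a b :: ennreal
  proof (cases "a = top \<or> b = top")
    case True
    then show ?thesis by (auto simp: ennreal_mult_top)
  next
    case False
    then obtain x y where xy: "a = ennreal x" "b = ennreal y" "x \<ge> 0" "y \<ge> 0"
      by (metis ennreal_cases)
    have "(x + y)\<^sup>2 \<le> 2 * x\<^sup>2 + 2 * y\<^sup>2"
      using zero_le_power2[of "x - y"] by (simp add: power2_eq_square algebra_simps)
    then have "ennreal ((x + y)\<^sup>2) \<le> ennreal (2 * x\<^sup>2 + 2 * y\<^sup>2)" by (rule ennreal_leI)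
    moreover have "ennreal ((x + y)\<^sup>2) = (a + b)\<^sup>2"
      using xy by (simp add: ennreal_power flip: ennreal_plus)
    moreover have "ennreal (2 * x\<^sup>2 + 2 * y\<^sup>2) = 2 * a\<^sup>2 + 2 * b\<^sup>2"
      using xy by (simp add: ennreal_power ennreal_mult)
    ultimately show ?thesis by simp
  qed
  show ?thesis
    unfolding loc_l2_def
  proof (intro allI impI)
    fix x r assume "0 < r \<and> compactly_in (ball x r) \<Omega>"
    then have fin: "sum_along Q (\<lambda>i. (\<rho> i)\<^sup>2) (ball x r) < \<infinity>" "sum_along Q (\<lambda>i. (\<rho>' i)\<^sup>2) (ball x r) < \<infinity>"
      using assms unfolding loc_l2_def by auto
    have "sum_along Q (\<lambda>i. (\<rho> i + \<rho>' i)\<^sup>2) (ball x r) \<le> sum_along Q (\<lambda>i. 2 * (\<rho> i)\<^sup>2 + 2 * (\<rho>' i)\<^sup>2) (ball x r)"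
      by (intro sum_along_mono order_refl sq)
    also have "\<dots> < \<infinity>" unfolding sum_along_add sum_along_cmult
      using fin by (auto simp: ennreal_mult_less_top)
    finally show "sum_along Q (\<lambda>i. (\<rho> i + \<rho>' i)\<^sup>2) (ball x r) < \<infinity>" .
  qed
qed

lemma loc_l2_cmult:
  assumes "loc_l2 \<rho>" shows "loc_l2 (\<lambda>i. ennreal c * \<rho> i)"
  using assms unfolding loc_l2_def power_mult_distrib sum_along_cmult
  by (auto simp: ennreal_mult_less_top power2_eq_square)

lemma loc_l2_dm: "loc_l2 (\<lambda>i. ennreal (dm i))"
  unfolding loc_l2_def using sum_diam_square_finite[OF bounded_ball] by blast

section \<open>Lipschitz functions and the calculus of upper gradients\<close>

lemma connected_trace: "\<gamma> \<in> paths_in \<Omega> \<Longrightarrow> connected (trace \<gamma>)"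
proof -
  assume g: "\<gamma> \<in> paths_in \<Omega>"
  have "continuous_on (fst \<gamma>) (snd \<gamma>)"
    using g closure_subset[of "fst \<gamma>"] by (auto simp: paths_in_def is_cpath_def intro: continuous_on_subset)
  then show ?thesis
    using g by (auto simp: trace_def paths_in_def is_cpath_def is_interval_connected_1 intro: connected_continuous_image)
qed

text \<open>The projection of the trace is an interval. Its part coming from the carpet has measure
  zero, so the rest must be covered by the projections of the disks, each contained in an interval
  of length \<open>2 * dm i\<close>.\<close>

lemma projection_le_sum_diam:
  fixes \<phi> :: "complex \<Rightarrow> real"
  assumes g: "\<gamma> \<in> paths_in \<Omega>" "hausdorff1 (trace \<gamma> \<inter> S) = 0"
    and lip: "\<And>z w. \<bar>\<phi> z - \<phi> w\<bar> \<le> dist z w"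
    and xy: "x \<in> trace \<gamma>" "y \<in> trace \<gamma>" "\<phi> x \<le> \<phi> y"
  shows "ennreal (\<phi> y - \<phi> x) \<le> 2 * sum_along Q (\<lambda>i. ennreal (dm i)) (trace \<gamma>)"
proof -
  let ?A = "meeting Q (trace \<gamma>)"
  define p where "p i = (SOME z. z \<in> Q i)" for i
  have p: "p i \<in> Q i" for i unfolding p_def using Q_nonempty[of i] by (simp add: some_in_eq)
  define B where "B i = (if i \<in> ?A then {\<phi> (p i) - dm i..\<phi> (p i) + dm i} else {})" for i
  have N: "\<phi> ` (trace \<gamma> \<inter> S) \<in> null_sets lebesgue"
    by (rule null_projection_of_hausdorff1_null[OF g(2) lip])
  have "continuous_on (trace \<gamma>) \<phi>"
    unfolding continuous_on_iff using lip by (metis dist_real_def le_less_trans)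
  then have "connected (\<phi> ` trace \<gamma>)" by (intro connected_continuous_image connected_trace g)
  then have "{\<phi> x..\<phi> y} \<subseteq> \<phi> ` trace \<gamma>"
    using xy by (intro connected_contains_Icc) auto
  also have "\<dots> \<subseteq> \<phi> ` (trace \<gamma> \<inter> S) \<union> (\<Union>i. B i)"
  proof clarify
    fix z assume z: "z \<in> trace \<gamma>" "\<phi> z \<notin> (\<Union>i. B i)"
    show "\<phi> z \<in> \<phi> ` (trace \<gamma> \<inter> S)"
    proof (cases "z \<in> S")
      case False
      then obtain i where i: "z \<in> Q i" using not_carpet z(1) g(1) by (auto simp: paths_in_def)
      then have "i \<in> ?A" using z by (auto simp: meeting_def)
      moreover have "\<bar>\<phi> z - \<phi> (p i)\<bar> \<le> dm i"
        using lip[of z "p i"] diameter_bounded_bound[OF Q_bounded i p] by linarith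
      ultimately have "\<phi> z \<in> B i" by (auto simp: B_def)
      then show ?thesis using z by blast
    qed (use z in auto)
  qed
  finally have sub: "{\<phi> x..\<phi> y} \<subseteq> \<phi> ` (trace \<gamma> \<inter> S) \<union> (\<Union>i. B i)" .
  have Bm: "B i \<in> sets lebesgue" for i by (auto simp: B_def)
  have "ennreal (\<phi> y - \<phi> x) = emeasure lebesgue {\<phi> x..\<phi> y}" using xy by simp
  also have "\<dots> \<le> emeasure lebesgue (\<phi> ` (trace \<gamma> \<inter> S) \<union> (\<Union>i. B i))"
    using sub N Bm by (intro emeasure_mono) auto
  also have "\<dots> = emeasure lebesgue (\<Union>i. B i)"
    using N Bm emeasure_Un_null_set[of "\<Union>i. B i" lebesgue "\<phi> ` (trace \<gamma> \<inter> S)"] by (auto simp: Un_commute)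
  also have "\<dots> \<le> (\<Sum>i. emeasure lebesgue (B i))"
    using Bm by (intro emeasure_subadditive_countably) auto
  also have "\<dots> \<le> (\<Sum>i. 2 * (ennreal (dm i) * indicator ?A i))"
  proof (intro suminf_le)
    fix i show "emeasure lebesgue (B i) \<le> 2 * (ennreal (dm i) * indicator ?A i)"
      using dm_pos[of i] by (auto simp: B_def ennreal_mult)
  qed auto
  also have "\<dots> = 2 * sum_along Q (\<lambda>i. ennreal (dm i)) (trace \<gamma>)"
    unfolding sum_along_eq by simp
  finally show ?thesis .
qed

lemma dist_le_sum_diam:
  assumes g: "\<gamma> \<in> paths_in \<Omega>" "hausdorff1 (trace \<gamma> \<inter> S) = 0" and xy: "x \<in> trace \<gamma>" "y \<in> trace \<gamma>"
  shows "ennreal (dist x y) \<le> 4 * sum_along Q (\<lambda>i. ennreal (dm i)) (trace \<gamma>)"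
proof -
  have *: "ennreal \<bar>al d x - al d y\<bar> \<le> 2 * sum_along Q (\<lambda>i. ennreal (dm i)) (trace \<gamma>)" for d
    using projection_le_sum_diam[OF g abs_al_le_dist[of d] xy] projection_le_sum_diam[OF g abs_al_le_dist[of d] xy(2,1)]
    by (cases "al d x \<le> al d y") (auto simp: abs_real_def)
  have "ennreal (dist x y) \<le> ennreal (\<bar>al True x - al True y\<bar> + \<bar>al False x - al False y\<bar>)"
    using dist_le_al[of x y True] by (intro ennreal_leI) auto
  also have "\<dots> = ennreal \<bar>al True x - al True y\<bar> + ennreal \<bar>al False x - al False y\<bar>" by simp
  also have "\<dots> \<le> 2 * sum_along Q (\<lambda>i. ennreal (dm i)) (trace \<gamma>) + 2 * sum_along Q (\<lambda>i. ennreal (dm i)) (trace \<gamma>)"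
    by (intro add_mono *)
  also have "\<dots> = 4 * sum_along Q (\<lambda>i. ennreal (dm i)) (trace \<gamma>)"
    by (simp flip: distrib_right)
  finally show ?thesis .
qed

text \<open>Almost every path meets the carpet in length zero, and then the distance of two of its
  points is at most four times the sum of the diameters met: a factor 2 for each coordinate.\<close>

lemma ug_lipschitz:
  assumes "\<And>x y. \<bar>\<eta> x - \<eta> y\<bar> \<le> L * dist x y" "L \<ge> 0"
  shows "ug \<eta> (\<lambda>i. ennreal (4 * L) * ennreal (dm i))"
  unfolding ug_def
proof (intro exI conjI ballI)
  show "null {\<gamma> \<in> paths_in \<Omega>. hausdorff1 (trace \<gamma> \<inter> S) \<noteq> 0}" by (rule null_hausdorff1)
  fix \<gamma> assume g: "\<gamma> \<in> paths_in \<Omega> - {\<gamma> \<in> paths_in \<Omega>. hausdorff1 (trace \<gamma> \<inter> S) \<noteq> 0}"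
  show "ugood \<eta> (\<lambda>i. ennreal (4 * L) * ennreal (dm i)) \<gamma>"
    unfolding ugood_def
  proof (intro ballI)
    fix x y assume xy: "x \<in> trace \<gamma> \<inter> S" "y \<in> trace \<gamma> \<inter> S"
    have "ennreal \<bar>\<eta> x - \<eta> y\<bar> \<le> ennreal (L * dist x y)" by (intro ennreal_leI assms)
    also have "\<dots> = ennreal L * ennreal (dist x y)" using assms by (intro ennreal_mult) auto
    also have "\<dots> \<le> ennreal L * (4 * sum_along Q (\<lambda>i. ennreal (dm i)) (trace \<gamma>))"
      using g xy by (intro mult_left_mono dist_le_sum_diam) auto
    also have "\<dots> = sum_along Q (\<lambda>i. ennreal (4 * L) * ennreal (dm i)) (trace \<gamma>)"
      unfolding sum_along_cmult using assms(2) by (simp add: ennreal_mult mult_ac)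
    finally show "ennreal \<bar>\<eta> x - \<eta> y\<bar> \<le> sum_along Q (\<lambda>i. ennreal (4 * L) * ennreal (dm i)) (trace \<gamma>)" .
  qed
qed

text \<open>Serves as product, quotient and chain rule: whatever the formula for \<open>f\<close>,
  only a pointwise bound on its increments on the carpet enters.\<close>

lemma ug_combine:
  assumes "ug g \<rho>" "ug h \<rho>'" "a \<ge> 0" "b \<ge> 0"
    and f: "\<And>x y. x \<in> S \<Longrightarrow> y \<in> S \<Longrightarrow> \<bar>f x - f y\<bar> \<le> a * \<bar>g x - g y\<bar> + b * \<bar>h x - h y\<bar>"
  shows "ug f (\<lambda>i. ennreal a * \<rho> i + ennreal b * \<rho>' i)"
proof -
  obtain \<Gamma>1 \<Gamma>2 where n: "null \<Gamma>1" "null \<Gamma>2" and G: "\<And>\<gamma>. \<gamma> \<in> paths_in \<Omega> - \<Gamma>1 \<Longrightarrow> ugood g \<rho> \<gamma>"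
    "\<And>\<gamma>. \<gamma> \<in> paths_in \<Omega> - \<Gamma>2 \<Longrightarrow> ugood h \<rho>' \<gamma>"
    using assms(1,2) unfolding ug_def by blast
  have "ugood f (\<lambda>i. ennreal a * \<rho> i + ennreal b * \<rho>' i) \<gamma>" if "\<gamma> \<in> paths_in \<Omega> - (\<Gamma>1 \<union> \<Gamma>2)" for \<gamma>
    unfolding ugood_def
  proof (intro ballI)
    fix x y assume xy: "x \<in> trace \<gamma> \<inter> S" "y \<in> trace \<gamma> \<inter> S"
    have "ennreal \<bar>f x - f y\<bar> \<le> ennreal (a * \<bar>g x - g y\<bar> + b * \<bar>h x - h y\<bar>)"
      using xy by (intro ennreal_leI f) auto
    also have "\<dots> = ennreal a * ennreal \<bar>g x - g y\<bar> + ennreal b * ennreal \<bar>h x - h y\<bar>"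
      using assms(3,4) by (simp add: ennreal_mult)
    also have "\<dots> \<le> ennreal a * sum_along Q \<rho> (trace \<gamma>) + ennreal b * sum_along Q \<rho>' (trace \<gamma>)"
      using G[of \<gamma>] that xy unfolding ugood_def by (intro add_mono mult_left_mono) auto
    finally show "ennreal \<bar>f x - f y\<bar> \<le> sum_along Q (\<lambda>i. ennreal a * \<rho> i + ennreal b * \<rho>' i) (trace \<gamma>)"
      unfolding sum_along_add sum_along_cmult .
  qed
  then show ?thesis using null_Un[OF n] unfolding ug_def by blast
qed

lemma ug_compose:
  assumes "ug g \<rho>" "a \<ge> 0" and f: "\<And>x y. x \<in> S \<Longrightarrow> y \<in> S \<Longrightarrow> \<bar>f x - f y\<bar> \<le> a * \<bar>g x - g y\<bar>"
  shows "ug f (\<lambda>i. ennreal a * \<rho> i)"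
  using ug_combine[OF assms(1,1,2) order_refl, of f] f by simp

lemma Dirichlet_real: "fb h \<Longrightarrow> Dirichlet Q V (\<lambda>z. ereal (h z)) = sum_along Q (\<lambda>i. (ennreal (os h i))\<^sup>2) V"
  unfolding Dirichlet_def using osc_real by simp

lemma harmonicD:
  assumes u: "carpet_harmonic v \<Omega> Q (\<lambda>z. ereal (u z))" and V: "open V" "compactly_in V \<Omega>"
    and z: "(\<lambda>z. ereal (\<zeta> z)) \<in> W12 v \<Omega> Q" "\<And>z. z \<in> S - V \<Longrightarrow> \<zeta> z = 0"
    and fb: "fb u" "fb (\<lambda>z. u z + \<zeta> z)"
  shows "sum_along Q (\<lambda>i. (ennreal (os u i))\<^sup>2) V \<le> sum_along Q (\<lambda>i. (ennreal (os (\<lambda>z. u z + \<zeta> z) i))\<^sup>2) V"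
proof -
  have "Dirichlet Q V (\<lambda>z. ereal (u z)) \<le> Dirichlet Q V (\<lambda>z. ereal (u z) + ereal (\<zeta> z))"
    using conjunct2[OF u[unfolded carpet_harmonic_def], rule_format, OF conjI[OF V] z(1)] z(2)
    by (simp add: zero_ereal_def)
  then show ?thesis using Dirichlet_real[OF fb(1)] Dirichlet_real[OF fb(2)] by simp
qed

lemma meeting_of_frontier:
  assumes "open V" "z \<in> frontier (Q i)" "z \<in> V"
  shows "i \<in> meeting Q V"
proof -
  have "z \<in> closure (Q i)" using assms closure_frontier by blast
  then show ?thesis using open_Int_closure_eq_empty[OF assms(1), of "Q i"] assms(3) by (auto simp: meeting_def)
qed

lemma sum_along_real_summable:
  assumes "\<And>i. 0 \<le> f i" "sum_along Q (\<lambda>i. ennreal (f i)) V < \<infinity>"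
  shows "summable (\<lambda>i. f i * indicator (meeting Q V) i)"
    "sum_along Q (\<lambda>i. ennreal (f i)) V = ennreal (\<Sum>i. f i * indicator (meeting Q V) i)"
proof -
  have eq: "sum_along Q (\<lambda>i. ennreal (f i)) V = (\<Sum>i. ennreal (f i * indicator (meeting Q V) i))"
    unfolding sum_along_eq by (intro suminf_cong) (auto simp: indicator_def)
  have nn: "0 \<le> f i * indicator (meeting Q V) i" for i
    using assms(1)[of i] by (simp add: indicator_def)
  have fin: "(\<Sum>i. ennreal (f i * indicator (meeting Q V) i)) < \<infinity>"
    using assms(2) unfolding eq .
  show "summable (\<lambda>i. f i * indicator (meeting Q V) i)"
    by (rule summable_of_ennreal_finite(1)[OF nn fin])
  show "sum_along Q (\<lambda>i. ennreal (f i)) V = ennreal (\<Sum>i. f i * indicator (meeting Q V) i)"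
    unfolding eq by (rule summable_of_ennreal_finite(2)[OF nn fin])
qed

text \<open>The test function is \<open>t * \<eta>\<^sup>2 / (u + \<epsilon>)\<close> with a cutoff \<open>\<eta>\<close>. For \<open>t \<le> \<epsilon>\<^sup>2\<close> the map \<open>a \<mapsto> a + t * y\<^sup>2 / a\<close>
  is increasing on \<open>{\<epsilon>..}\<close>, so the oscillation of the perturbed function on a peripheral circle is at
  most its value with \<open>u\<close> and \<open>\<eta>\<close> replaced by their maxima minus that with their minima.\<close>

lemma caccioppoli:
  assumes u: "carpet_harmonic v \<Omega> Q (\<lambda>z. ereal (u z))" and u0: "\<And>z. z \<in> S \<Longrightarrow> 0 \<le> u z"
    and \<epsilon>: "0 < \<epsilon>" and r1: "0 < r1" and c1: "1 < c1" and cpt: "compactly_in (ball x1 (c1 * r1)) \<Omega>"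
  shows "fb (\<lambda>z. ln (u z + \<epsilon>))"
    "(\<Sum>i. (ennreal (os (\<lambda>z. ln (u z + \<epsilon>)) i))\<^sup>2 * indicator {i. Q i \<subseteq> ball x1 r1} i) \<le>
      ennreal (384 / K1 * (c1 / (c1 - 1))\<^sup>2)"
proof -
  define R d where "R = c1 * r1" and "d = R - r1"
  have Rd: "R > 0" "d > 0" "r1 < R" "d \<le> R" using r1 c1 by (auto simp: R_def d_def)
  \<comment> \<open>Equal to 1 on the smaller ball, 0 outside the larger one, and of slope
    \<open>1 / d\<close> in between.\<close>
  define \<eta> where "\<eta> z = max 0 (min 1 ((R - dist x1 z) / d))" for z
  have \<eta>01: "0 \<le> \<eta> z" "\<eta> z \<le> 1" for z by (auto simp: \<eta>_def)
  have \<eta>lip: "\<bar>\<eta> z - \<eta> w\<bar> \<le> 1 / d * dist z w" for z w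
  proof -
    have "\<bar>\<eta> z - \<eta> w\<bar> \<le> \<bar>(R - dist x1 z) / d - (R - dist x1 w) / d\<bar>"
      unfolding \<eta>_def by (auto simp: max_def min_def abs_real_def)
    also have "(R - dist x1 z) / d - (R - dist x1 w) / d = (dist x1 w - dist x1 z) / d"
      by (simp add: diff_divide_distrib)
    also have "\<bar>\<dots>\<bar> = \<bar>dist x1 w - dist x1 z\<bar> / d" using Rd by simp
    also have "\<dots> \<le> dist z w / d"
      using Rd abs_dist_diff_le[of w x1 z] by (intro divide_right_mono) (auto simp: dist_commute)
    finally show ?thesis by simp
  qed
  have \<eta>1: "\<eta> z = 1" if "dist x1 z \<le> r1" for z
    using that Rd by (simp add: \<eta>_def d_def)
  have \<eta>0: "\<eta> z = 0" if "z \<notin> ball x1 R" for z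
    using that Rd by (simp add: \<eta>_def divide_nonpos_pos)
  let ?V = "ball x1 R"
  have V: "open ?V" "compactly_in ?V \<Omega>" using cpt by (auto simp: R_def)
  have uW: "(\<lambda>z. ereal (u z)) \<in> W12_loc v \<Omega> Q" using u by (simp add: carpet_harmonic_def)
  note uD = W12_locD[OF uW]
  have fbu: "fb u" by (rule uD(1))
  have fb\<eta>: "fb \<eta>" by (rule fbI[of _ "\<lambda>_. 1"]) (use \<eta>01 in auto)
  define w where "w z = u z + \<epsilon>" for z
  have w: "\<epsilon> \<le> w z" "0 < w z" if "z \<in> S" for z using u0[OF that] \<epsilon> by (auto simp: w_def)
  define WM wm where "WM i = MM u i + \<epsilon>" and "wm i = mm u i + \<epsilon>" for i
  define eM em where "eM i = MM \<eta> i" and "em i = mm \<eta> i" for i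
  have wb: "wm i \<le> w z" "w z \<le> WM i" if "z \<in> frontier (Q i)" for z i
    using le_MM[OF fbu that] mm_le[OF fbu that] by (auto simp: w_def WM_def wm_def)
  have wm: "\<epsilon> \<le> wm i" "wm i \<le> WM i" for i
    using mm_le_MM[OF fbu, of i] mm_greatest[of i 0 u] u0 frontier_carpet[of i]
    by (auto simp: WM_def wm_def)
  have wpos: "0 < wm i" "0 < WM i" for i using wm[of i] \<epsilon> by auto
  have eb: "em i \<le> \<eta> z" "\<eta> z \<le> eM i" if "z \<in> frontier (Q i)" for z i
    using le_MM[OF fb\<eta> that] mm_le[OF fb\<eta> that] by (auto simp: eM_def em_def)
  have em: "0 \<le> em i" "em i \<le> eM i" "eM i \<le> 1" for i
    using mm_le_MM[OF fb\<eta>, of i] mm_greatest[of i 0 \<eta>] MM_least[of i \<eta> 1] \<eta>01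
    by (auto simp: eM_def em_def)
  define o' where "o' i = os u i" for i
  have o': "0 \<le> o' i" "o' i = WM i - wm i" for i
    using os_nonneg[OF fbu, of i] by (auto simp: o'_def os_def WM_def wm_def)
  define e where "e i = eM i - em i" for i
  have e: "0 \<le> e i" "e i \<le> 1" "e i \<le> dm i / d" for i
  proof -
    show "0 \<le> e i" "e i \<le> 1" using em[of i] by (auto simp: e_def)
    have "os \<eta> i \<le> dm i / d"
    proof (rule os_le)
      fix z y assume zy: "z \<in> frontier (Q i)" "y \<in> frontier (Q i)"
      then have "dist z y \<le> dm i" using closure_frontier by (intro dist_closure_le) auto
      then have "1 / d * dist z y \<le> dm i / d" using Rd by (simp add: divide_right_mono)
      then show "\<eta> z - \<eta> y \<le> dm i / d" using \<eta>lip[of z y] by linarith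
    qed
    then show "e i \<le> dm i / d" by (simp add: e_def eM_def em_def os_def)
  qed
  \<comment> \<open>The increment of \<open>\<eta>\<^sup>2 / w\<close> between the extreme values,
    hence the coefficient of \<open>t\<close> in the bound for the perturbed oscillation.\<close>
  define \<delta> where "\<delta> i = (eM i)\<^sup>2 / WM i - (em i)\<^sup>2 / wm i" for i
  define \<zeta> where "\<zeta> t z = t * (\<eta> z)\<^sup>2 / w z" for t z
  have mono: "a + t * y\<^sup>2 / a \<le> b + t * y\<^sup>2 / b"
    if t: "0 < t" "t \<le> \<epsilon>\<^sup>2" and ab: "\<epsilon> \<le> a" "a \<le> b" and y: "0 \<le> y" "y \<le> 1" for a b t y :: real
  proof -
    have a: "0 < a" "0 < b" using ab \<epsilon> by auto
    have "\<epsilon> * \<epsilon> \<le> a * b" using ab \<epsilon> by (intro mult_mono) auto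
    moreover have "t * y\<^sup>2 \<le> \<epsilon>\<^sup>2 * 1" using t y by (intro mult_mono power_le_one) auto
    ultimately have "t * y\<^sup>2 \<le> a * b" by (simp add: power2_eq_square)
    then have "0 \<le> (b - a) * (1 - t * y\<^sup>2 / (a * b))"
      using ab a by (intro mult_nonneg_nonneg) auto
    also have "\<dots> = (b + t * y\<^sup>2 / b) - (a + t * y\<^sup>2 / a)"
      using a by (simp add: field_simps)
    finally show ?thesis by simp
  qed
  have os_pert: "os (\<lambda>z. u z + \<zeta> t z) i \<le> o' i + t * \<delta> i" if t: "0 < t" "t \<le> \<epsilon>\<^sup>2" for t i
  proof (rule os_le)
    fix z y assume zy: "z \<in> frontier (Q i)" "y \<in> frontier (Q i)"
    then have S: "z \<in> S" "y \<in> S" using frontier_carpet by auto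
    have "w z + t * (\<eta> z)\<^sup>2 / w z \<le> WM i + t * (\<eta> z)\<^sup>2 / WM i"
      using wb[OF zy(1)] w[OF S(1)] \<eta>01 by (intro mono t) auto
    also have "t * (\<eta> z)\<^sup>2 / WM i \<le> t * (eM i)\<^sup>2 / WM i"
      using eb[OF zy(1)] \<eta>01[of z] t wpos[of i] by (intro divide_right_mono mult_left_mono power_mono) auto
    finally have 1: "w z + t * (\<eta> z)\<^sup>2 / w z \<le> WM i + t * (eM i)\<^sup>2 / WM i" by simp
    have "wm i + t * (em i)\<^sup>2 / wm i \<le> wm i + t * (\<eta> y)\<^sup>2 / wm i"
      using eb[OF zy(2)] em[of i] t wpos[of i] by (intro add_left_mono divide_right_mono mult_left_mono power_mono) auto
    also have "\<dots> \<le> w y + t * (\<eta> y)\<^sup>2 / w y"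
      using wb[OF zy(2)] wm[of i] \<eta>01 by (intro mono t) auto
    finally have 2: "wm i + t * (em i)\<^sup>2 / wm i \<le> w y + t * (\<eta> y)\<^sup>2 / w y" .
    show "u z + \<zeta> t z - (u y + \<zeta> t y) \<le> o' i + t * \<delta> i"
      using 1 2 by (simp add: \<zeta>_def w_def o'(2) \<delta>_def algebra_simps)
  qed
  have \<zeta>b: "0 \<le> \<zeta> t z" "\<zeta> t z \<le> \<epsilon>" if t: "0 < t" "t \<le> \<epsilon>\<^sup>2" and z: "z \<in> S" for t z
  proof -
    show "0 \<le> \<zeta> t z" using t w[OF z] by (simp add: \<zeta>_def)
    have "t * (\<eta> z)\<^sup>2 \<le> \<epsilon>\<^sup>2 * 1" using t \<eta>01[of z] by (intro mult_mono power_le_one) auto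
    also have "\<dots> \<le> \<epsilon> * w z" using w[OF z] \<epsilon> mult_left_mono[of \<epsilon> "w z" \<epsilon>] by (simp add: power2_eq_square)
    finally have "t * (\<eta> z)\<^sup>2 \<le> \<epsilon> * w z" .
    then show "\<zeta> t z \<le> \<epsilon>" using w[OF z] by (simp add: \<zeta>_def pos_divide_le_eq)
  qed
  have fb\<zeta>: "fb (\<zeta> t)" if t: "0 < t" "t \<le> \<epsilon>\<^sup>2" for t
    by (rule fbI[of _ "\<lambda>_. \<epsilon>"]) (use \<zeta>b[OF t] frontier_carpet in \<open>auto simp: abs_le_iff subset_iff\<close>)
  have fbu\<zeta>: "fb (\<lambda>z. u z + \<zeta> t z)" if t: "0 < t" "t \<le> \<epsilon>\<^sup>2" for t
  proof (rule fbI)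
    fix i z assume z: "z \<in> frontier (Q i)"
    then have "z \<in> S" using frontier_carpet by auto
    then have "0 \<le> u z + \<zeta> t z" "u z + \<zeta> t z \<le> MM u i + \<epsilon>"
      using \<zeta>b[OF t] u0[of z] le_MM[OF fbu z] by (auto intro: add_mono)
    then show "\<bar>u z + \<zeta> t z\<bar> \<le> MM u i + \<epsilon>" by simp
  qed
  have Vsum: "sum_along Q (\<lambda>i. ennreal ((o' i)\<^sup>2)) ?V < \<infinity>" "sum_along Q (\<lambda>i. ennreal ((dm i)\<^sup>2)) ?V < \<infinity>"
  proof -
    show "sum_along Q (\<lambda>i. ennreal ((o' i)\<^sup>2)) ?V < \<infinity>"
      using uD(3) V Rd o'(1) unfolding loc_l2_def o'_def by (simp add: ennreal_power)
    show "sum_along Q (\<lambda>i. ennreal ((dm i)\<^sup>2)) ?V < \<infinity>"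
      using sum_diam_square_finite[OF bounded_ball, of x1 R] dm_pos by (simp add: ennreal_power less_imp_le)
  qed
  let ?I = "indicator (meeting Q ?V) :: nat \<Rightarrow> real"
  define O' \<Delta> where "O' i = o' i * ?I i" and "\<Delta> i = \<delta> i * ?I i" for i
  have Isq: "(x * ?I i)\<^sup>2 = x\<^sup>2 * ?I i" for x i by (simp add: indicator_def)
  have sO: "summable (\<lambda>i. (O' i)\<^sup>2)"
    using sum_along_real_summable(1)[OF _ Vsum(1)] unfolding O'_def Isq by auto
  have sdm: "summable (\<lambda>i. (dm i)\<^sup>2 * ?I i)"
    using sum_along_real_summable(1)[OF _ Vsum(2)] by auto
  have se: "summable (\<lambda>i. (e i)\<^sup>2 * ?I i)"
  proof (rule summable_comparison_test'[OF summable_mult[OF sdm, of "1 / d\<^sup>2"]])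
    fix i :: nat
    have "(e i)\<^sup>2 \<le> (dm i / d)\<^sup>2" using e[of i] by (intro power_mono) auto
    then show "norm ((e i)\<^sup>2 * ?I i) \<le> 1 / d\<^sup>2 * ((dm i)\<^sup>2 * ?I i)"
      by (auto simp: indicator_def power_divide)
  qed
  \<comment> \<open>The constants depend on \<open>\<epsilon>\<close>, which is harmless: this bound
    only serves to make series converge.\<close>
  have \<delta>b: "\<bar>\<delta> i\<bar> \<le> 2 / \<epsilon> * e i + o' i / \<epsilon>\<^sup>2" for i
  proof -
    have "\<delta> i = ((eM i)\<^sup>2 - (em i)\<^sup>2) / WM i - (em i)\<^sup>2 * o' i / (WM i * wm i)"
      using wpos[of i] by (simp add: \<delta>_def o'(2) field_simps)
    moreover have "0 \<le> ((eM i)\<^sup>2 - (em i)\<^sup>2) / WM i" "((eM i)\<^sup>2 - (em i)\<^sup>2) / WM i \<le> 2 / \<epsilon> * e i"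
    proof -
      have sq: "(eM i)\<^sup>2 - (em i)\<^sup>2 = e i * (eM i + em i)" by (simp add: e_def power2_eq_square algebra_simps)
      have "0 \<le> e i * (eM i + em i)" using e[of i] em[of i] by (intro mult_nonneg_nonneg) auto
      then show "0 \<le> ((eM i)\<^sup>2 - (em i)\<^sup>2) / WM i" using sq wpos[of i] by simp
      have "e i * (eM i + em i) / WM i \<le> e i * 2 / \<epsilon>"
        using e[of i] em[of i] wm[of i] \<epsilon> by (intro frac_le mult_left_mono) auto
      then show "((eM i)\<^sup>2 - (em i)\<^sup>2) / WM i \<le> 2 / \<epsilon> * e i" using sq by (simp add: mult.commute)
    qed
    moreover have "0 \<le> (em i)\<^sup>2 * o' i / (WM i * wm i)"
      using wpos[of i] o'(1)[of i] by simp
    moreover have "(em i)\<^sup>2 * o' i / (WM i * wm i) \<le> 1 * o' i / \<epsilon>\<^sup>2"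
      unfolding power2_eq_square[of \<epsilon>]
      using em[of i] o'(1)[of i] wm[of i] \<epsilon> by (intro frac_le mult_right_mono mult_mono power_le_one) auto
    ultimately show ?thesis using e(1)[of i] o'(1)[of i] \<epsilon> by (auto simp: abs_le_iff intro: add_increasing add_increasing2)
  qed
  have s\<Delta>: "summable (\<lambda>i. (\<Delta> i)\<^sup>2)"
  proof (rule summable_comparison_test')
    show "summable (\<lambda>i. 2 * (2 / \<epsilon>)\<^sup>2 * ((e i)\<^sup>2 * ?I i) + 2 * (1 / \<epsilon>\<^sup>2)\<^sup>2 * (O' i)\<^sup>2)"
      by (intro summable_add summable_mult se sO)
    fix i :: nat
    have "(\<delta> i)\<^sup>2 \<le> (2 / \<epsilon> * e i + o' i / \<epsilon>\<^sup>2)\<^sup>2"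
      using \<delta>b[of i] by (intro iffD1[OF abs_le_square_iff]) auto
    also have "\<dots> \<le> 2 * (2 / \<epsilon> * e i)\<^sup>2 + 2 * (o' i / \<epsilon>\<^sup>2)\<^sup>2"
      using sum_squares_bound[of "2 / \<epsilon> * e i" "o' i / \<epsilon>\<^sup>2"] by (simp only: power2_sum)
    finally have "(\<delta> i)\<^sup>2 \<le> 2 * (2 / \<epsilon>)\<^sup>2 * (e i)\<^sup>2 + 2 * (1 / \<epsilon>\<^sup>2)\<^sup>2 * (o' i)\<^sup>2"
      by (simp add: power_mult_distrib power_divide)
    then show "norm ((\<Delta> i)\<^sup>2) \<le> 2 * (2 / \<epsilon>)\<^sup>2 * ((e i)\<^sup>2 * ?I i) + 2 * (1 / \<epsilon>\<^sup>2)\<^sup>2 * (O' i)\<^sup>2"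
      unfolding \<Delta>_def O'_def Isq by (auto simp: indicator_def)
  qed
  have sO\<Delta>: "summable (\<lambda>i. O' i * \<Delta> i)"
  proof (rule summable_comparison_test')
    show "summable (\<lambda>i. (O' i)\<^sup>2 + (\<Delta> i)\<^sup>2)" by (intro summable_add sO s\<Delta>)
    fix i :: nat
    have "2 * \<bar>O' i * \<Delta> i\<bar> \<le> (O' i)\<^sup>2 + (\<Delta> i)\<^sup>2"
      using sum_squares_bound[of "\<bar>O' i\<bar>" "\<bar>\<Delta> i\<bar>"] by (simp add: abs_mult mult.assoc)
    then show "norm (O' i * \<Delta> i) \<le> (O' i)\<^sup>2 + (\<Delta> i)\<^sup>2" by simp
  qed
  have ug\<zeta>: "\<exists>\<rho>. ug (\<zeta> t) \<rho> \<and> loc_l2 \<rho>" if t: "0 < t" "t \<le> \<epsilon>\<^sup>2" for t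
  proof (intro exI conjI)
    show "ug (\<zeta> t) (\<lambda>i. ennreal (t / \<epsilon>\<^sup>2) * ennreal (os u i) + ennreal (2 * t / \<epsilon>) * (ennreal (4 * (1 / d)) * ennreal (dm i)))"
    \<comment> \<open>Quotient rule: the lower bound \<open>\<epsilon>\<close> for \<open>w\<close>
      and the upper bound 1 for \<open>\<eta>\<close> give the two coefficients.\<close>
    proof (rule ug_combine[OF uD(2) ug_lipschitz[OF \<eta>lip]])
      fix x y assume xy: "x \<in> S" "y \<in> S"
      have "\<zeta> t x - \<zeta> t y = t * ((\<eta> x)\<^sup>2 * (w y - w x) / (w x * w y) + ((\<eta> x)\<^sup>2 - (\<eta> y)\<^sup>2) / w y)"
        using w[OF xy(1)] w[OF xy(2)] by (simp add: \<zeta>_def field_simps)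
      then have "\<bar>\<zeta> t x - \<zeta> t y\<bar> = t * \<bar>(\<eta> x)\<^sup>2 * (w y - w x) / (w x * w y) + ((\<eta> x)\<^sup>2 - (\<eta> y)\<^sup>2) / w y\<bar>"
        using t by (simp add: abs_mult)
      also have "\<dots> \<le> t * (\<bar>u x - u y\<bar> / \<epsilon>\<^sup>2 + 2 * \<bar>\<eta> x - \<eta> y\<bar> / \<epsilon>)"
      proof (intro mult_left_mono order_trans[OF abs_triangle_ineq] add_mono)
        have "\<bar>(\<eta> x)\<^sup>2 * (w y - w x) / (w x * w y)\<bar> = (\<eta> x)\<^sup>2 * \<bar>u x - u y\<bar> / (w x * w y)"
          using w[OF xy(1)] w[OF xy(2)] by (simp add: abs_mult w_def abs_minus_commute)
        also have "\<dots> \<le> 1 * \<bar>u x - u y\<bar> / (\<epsilon> * \<epsilon>)"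
          using w[OF xy(1)] w[OF xy(2)] \<eta>01[of x] \<epsilon> by (intro frac_le mult_right_mono mult_mono power_le_one) auto
        finally show "\<bar>(\<eta> x)\<^sup>2 * (w y - w x) / (w x * w y)\<bar> \<le> \<bar>u x - u y\<bar> / \<epsilon>\<^sup>2" by (simp add: power2_eq_square)
        have "(\<eta> x)\<^sup>2 - (\<eta> y)\<^sup>2 = (\<eta> x - \<eta> y) * (\<eta> x + \<eta> y)" by (simp add: power2_eq_square algebra_simps)
        then have "\<bar>((\<eta> x)\<^sup>2 - (\<eta> y)\<^sup>2) / w y\<bar> = \<bar>\<eta> x - \<eta> y\<bar> * (\<eta> x + \<eta> y) / w y"
          using w[OF xy(2)] \<eta>01[of x] \<eta>01[of y] by (simp add: abs_mult)
        also have "\<dots> \<le> \<bar>\<eta> x - \<eta> y\<bar> * 2 / \<epsilon>"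
          using w[OF xy(2)] \<eta>01[of x] \<eta>01[of y] \<epsilon> by (intro frac_le mult_left_mono) auto
        finally show "\<bar>((\<eta> x)\<^sup>2 - (\<eta> y)\<^sup>2) / w y\<bar> \<le> 2 * \<bar>\<eta> x - \<eta> y\<bar> / \<epsilon>" by (simp add: mult.commute)
      qed (use t in auto)
      also have "\<dots> = t / \<epsilon>\<^sup>2 * \<bar>u x - u y\<bar> + 2 * t / \<epsilon> * \<bar>\<eta> x - \<eta> y\<bar>" by (simp add: distrib_left)
      finally show "\<bar>\<zeta> t x - \<zeta> t y\<bar> \<le> t / \<epsilon>\<^sup>2 * \<bar>u x - u y\<bar> + 2 * t / \<epsilon> * \<bar>\<eta> x - \<eta> y\<bar>" .
    qed (use t \<epsilon> Rd in auto)
    show "loc_l2 (\<lambda>i. ennreal (t / \<epsilon>\<^sup>2) * ennreal (os u i) + ennreal (2 * t / \<epsilon>) * (ennreal (4 * (1 / d)) * ennreal (dm i)))"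
      by (intro loc_l2_add loc_l2_cmult uD(3) loc_l2_dm)
  qed
  have \<zeta>out: "\<zeta> t z = 0" if "z \<notin> ?V" for t z using \<eta>0[OF that] by (simp add: \<zeta>_def)
  have W: "(\<lambda>z. ereal (\<zeta> t z)) \<in> W12 v \<Omega> Q" if t: "0 < t" "t \<le> \<epsilon>\<^sup>2" for t
  proof -
    obtain \<rho> where \<rho>: "ug (\<zeta> t) \<rho>" "loc_l2 \<rho>" using ug\<zeta>[OF t] by blast
    have out: "os (\<zeta> t) i = 0 \<and> MM (\<zeta> t) i = 0" if i: "i \<notin> meeting Q ?V" for i
    proof -
      have z: "\<zeta> t z = 0" if "z \<in> frontier (Q i)" for z
        using meeting_of_frontier[OF V(1) that] i \<zeta>out by blast
      have "os (\<zeta> t) i \<le> 0" using z by (intro os_le) auto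
      moreover have "MM (\<zeta> t) i = 0"
        unfolding MM_def using z frontier_nonempty[of i] by (simp add: image_constant_conv cong: image_cong_simp)
      ultimately show ?thesis using os_nonneg[OF fb\<zeta>[OF t], of i] by auto
    qed
    \<comment> \<open>\<open>\<zeta> t\<close> is the difference of \<open>u + \<zeta> t\<close> and
      \<open>u\<close>, and both oscillations are already bounded.\<close>
    have osb: "os (\<zeta> t) i \<le> 2 * o' i + t * \<bar>\<delta> i\<bar>" for i
    proof (rule os_le)
      fix z y assume zy: "z \<in> frontier (Q i)" "y \<in> frontier (Q i)"
      have "u z + \<zeta> t z - (u y + \<zeta> t y) \<le> o' i + t * \<delta> i"
        using abs_le_os[OF fbu\<zeta>[OF t] zy] os_pert[OF t, of i] by linarith
      moreover have "\<bar>u z - u y\<bar> \<le> o' i" using abs_le_os[OF fbu zy] by (simp add: o'_def)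
      moreover have "t * \<delta> i \<le> t * \<bar>\<delta> i\<bar>" using t by (intro mult_left_mono) auto
      ultimately show "\<zeta> t z - \<zeta> t y \<le> 2 * o' i + t * \<bar>\<delta> i\<bar>" by linarith
    qed
    have sq: "(os (\<zeta> t) i)\<^sup>2 \<le> 8 * (O' i)\<^sup>2 + 2 * t\<^sup>2 * (\<Delta> i)\<^sup>2" for i
    proof (cases "i \<in> meeting Q ?V")
      case True
      have "(os (\<zeta> t) i)\<^sup>2 \<le> (2 * o' i + t * \<bar>\<delta> i\<bar>)\<^sup>2"
        using osb[of i] os_nonneg[OF fb\<zeta>[OF t], of i] by (intro power_mono) auto
      also have "\<dots> \<le> 2 * (2 * o' i)\<^sup>2 + 2 * (t * \<bar>\<delta> i\<bar>)\<^sup>2"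
        using zero_le_power2[of "2 * o' i - t * \<bar>\<delta> i\<bar>"] by (simp add: power2_eq_square algebra_simps)
      finally show ?thesis using True by (simp add: O'_def \<Delta>_def power_mult_distrib)
    qed (simp add: out)
    have "summable (\<lambda>i. (os (\<zeta> t) i)\<^sup>2)"
      by (rule summable_comparison_test'[of "\<lambda>i. 8 * (O' i)\<^sup>2 + 2 * t\<^sup>2 * (\<Delta> i)\<^sup>2"])
         (use sq in \<open>auto intro!: summable_add summable_mult sO s\<Delta>\<close>)
    then have "(\<Sum>i. (ennreal (os (\<zeta> t) i))\<^sup>2) = ennreal (\<Sum>i. (os (\<zeta> t) i)\<^sup>2)"
      using os_nonneg[OF fb\<zeta>[OF t]] by (simp add: ennreal_power suminf_ennreal2)
    then have 1: "(\<Sum>i. (ennreal (os (\<zeta> t) i))\<^sup>2) < \<infinity>" by simp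
    have "(MM (\<zeta> t) i * dm i)\<^sup>2 \<le> \<epsilon>\<^sup>2 * ((dm i)\<^sup>2 * ?I i)" for i
    proof (cases "i \<in> meeting Q ?V")
      case True
      obtain z where z: "z \<in> frontier (Q i)" using frontier_nonempty by blast
      have "0 \<le> MM (\<zeta> t) i"
        using \<zeta>b(1)[OF t, of z] z frontier_carpet le_MM[OF fb\<zeta>[OF t] z] by (meson order_trans subsetD)
      moreover have "MM (\<zeta> t) i \<le> \<epsilon>" using \<zeta>b(2)[OF t] frontier_carpet by (intro MM_least) blast
      ultimately have "(MM (\<zeta> t) i)\<^sup>2 \<le> \<epsilon>\<^sup>2" by (rule power_mono[rotated])
      then show ?thesis using True by (simp add: power_mult_distrib mult_right_mono)
    qed (simp add: out)
    then have "summable (\<lambda>i. (MM (\<zeta> t) i * dm i)\<^sup>2)"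
      by (intro summable_comparison_test'[OF summable_mult[OF sdm, of "\<epsilon>\<^sup>2"]]) simp
    then have "(\<Sum>i. ennreal ((MM (\<zeta> t) i * dm i)\<^sup>2)) = ennreal (\<Sum>i. (MM (\<zeta> t) i * dm i)\<^sup>2)"
      by (simp add: suminf_ennreal2)
    then have 2: "(\<Sum>i. ennreal ((MM (\<zeta> t) i * dm i)\<^sup>2)) < \<infinity>" by simp
    show ?thesis by (rule W12I[OF fb\<zeta>[OF t] \<rho> 1 2])
  qed
  \<comment> \<open>Expanding the square in the energy of the perturbed function and dividing by
    \<open>t\<close> leaves the first variation plus a term of order \<open>t\<close>.\<close>
  have var: "0 \<le> 2 * (\<Sum>i. O' i * \<Delta> i) + t * (\<Sum>i. (\<Delta> i)\<^sup>2)" if t: "0 < t" "t \<le> \<epsilon>\<^sup>2" for t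
  proof -
    have "sum_along Q (\<lambda>i. ennreal ((o' i)\<^sup>2)) ?V \<le> sum_along Q (\<lambda>i. (ennreal (os (\<lambda>z. u z + \<zeta> t z) i))\<^sup>2) ?V"
      using harmonicD[OF u V W[OF t] _ fbu fbu\<zeta>[OF t]] \<zeta>out o'(1) by (auto simp: o'_def ennreal_power)
    also have "\<dots> \<le> sum_along Q (\<lambda>i. ennreal ((o' i + t * \<delta> i)\<^sup>2)) ?V"
    proof (intro sum_along_mono order_refl)
      fix i
      have "(os (\<lambda>z. u z + \<zeta> t z) i)\<^sup>2 \<le> (o' i + t * \<delta> i)\<^sup>2"
        using os_pert[OF t, of i] os_nonneg[OF fbu\<zeta>[OF t], of i] by (rule power_mono)
      then show "(ennreal (os (\<lambda>z. u z + \<zeta> t z) i))\<^sup>2 \<le> ennreal ((o' i + t * \<delta> i)\<^sup>2)"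
        using os_nonneg[OF fbu\<zeta>[OF t], of i] by (simp add: ennreal_power ennreal_leI)
    qed
    finally have le: "sum_along Q (\<lambda>i. ennreal ((o' i)\<^sup>2)) ?V \<le> sum_along Q (\<lambda>i. ennreal ((o' i + t * \<delta> i)\<^sup>2)) ?V" .
    have "(o' i + t * \<delta> i)\<^sup>2 * ?I i = (O' i)\<^sup>2 + 2 * t * (O' i * \<Delta> i) + t\<^sup>2 * (\<Delta> i)\<^sup>2" for i
      unfolding O'_def \<Delta>_def by (simp add: indicator_def power2_eq_square algebra_simps)
    moreover have "(\<lambda>i. (O' i)\<^sup>2 + 2 * t * (O' i * \<Delta> i) + t\<^sup>2 * (\<Delta> i)\<^sup>2) sums
        ((\<Sum>i. (O' i)\<^sup>2) + 2 * t * (\<Sum>i. O' i * \<Delta> i) + t\<^sup>2 * (\<Sum>i. (\<Delta> i)\<^sup>2))"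
      by (intro sums_add sums_mult summable_sums sO s\<Delta> sO\<Delta>)
    ultimately have sums: "(\<lambda>i. (o' i + t * \<delta> i)\<^sup>2 * ?I i) sums
        ((\<Sum>i. (O' i)\<^sup>2) + 2 * t * (\<Sum>i. O' i * \<Delta> i) + t\<^sup>2 * (\<Sum>i. (\<Delta> i)\<^sup>2))" (is "_ sums ?X") by simp
    have "sum_along Q (\<lambda>i. ennreal ((o' i + t * \<delta> i)\<^sup>2)) ?V = (\<Sum>i. ennreal ((o' i + t * \<delta> i)\<^sup>2 * ?I i))"
      unfolding sum_along_eq by (intro suminf_cong) (auto simp: indicator_def)
    also have "\<dots> = ennreal ?X" using sums by (intro suminf_ennreal_eq) auto
    finally have "sum_along Q (\<lambda>i. ennreal ((o' i + t * \<delta> i)\<^sup>2)) ?V = ennreal ?X" .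
    moreover have "sum_along Q (\<lambda>i. ennreal ((o' i)\<^sup>2)) ?V = ennreal (\<Sum>i. (O' i)\<^sup>2)"
      using sum_along_real_summable(2)[OF _ Vsum(1)] unfolding O'_def Isq by auto
    moreover have "0 \<le> ?X" using sums by (rule sums_le[OF _ sums_zero, rotated]) auto
    ultimately have "(\<Sum>i. (O' i)\<^sup>2) \<le> ?X" using le by (simp add: ennreal_le_iff)
    then have "0 \<le> t * (2 * (\<Sum>i. O' i * \<Delta> i) + t * (\<Sum>i. (\<Delta> i)\<^sup>2))"
      by (simp add: power2_eq_square algebra_simps)
    then show ?thesis using t by (simp add: zero_le_mult_iff)
  qed
  have pos: "0 \<le> (\<Sum>i. O' i * \<Delta> i)"
  proof (rule ccontr)
    assume neg: "\<not> 0 \<le> (\<Sum>i. O' i * \<Delta> i)"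
    define A B where "A = - (\<Sum>i. O' i * \<Delta> i)" and "B = (\<Sum>i. (\<Delta> i)\<^sup>2)"
    have A: "A > 0" using neg by (simp add: A_def)
    have B: "B \<ge> 0" unfolding B_def by (intro suminf_nonneg s\<Delta>) auto
    \<comment> \<open>So small that the quadratic term \<open>t * B\<close> is at most
      \<open>A\<close>, half the size of the linear term \<open>- 2 * A\<close>.\<close>
    define t where "t = min (\<epsilon>\<^sup>2) (A / (B + 1))"
    have t: "0 < t" "t \<le> \<epsilon>\<^sup>2" using A B \<epsilon> by (auto simp: t_def)
    have "t * B \<le> A / (B + 1) * B" using B by (intro mult_right_mono) (auto simp: t_def)
    also have "\<dots> \<le> A" using A B by (simp add: field_simps)
    finally show False using var[OF t] A unfolding A_def B_def by linarith
  qed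
  let ?f = "\<lambda>z. ln (u z + \<epsilon>)"
  have fl: "ln (wm i) \<le> ?f z" "?f z \<le> ln (WM i)" if "z \<in> frontier (Q i)" for z i
    using wb[OF that] wpos[of i] unfolding w_def by (auto intro: ln_mono)
  show "fb ?f"
  proof (rule fbI)
    fix i z assume "z \<in> frontier (Q i)"
    from fl[OF this] show "\<bar>?f z\<bar> \<le> max \<bar>ln (wm i)\<bar> \<bar>ln (WM i)\<bar>" by auto
  qed
  then have fbf: "fb ?f" .
  have osf: "(os ?f i)\<^sup>2 \<le> (WM i - wm i)\<^sup>2 / (WM i * wm i)" for i
  proof -
    have "os ?f i \<le> ln (WM i / wm i)"
    proof (rule os_le)
      fix z y assume "z \<in> frontier (Q i)" "y \<in> frontier (Q i)"
      then have "?f z - ?f y \<le> ln (WM i) - ln (wm i)" using fl(2)[of z i] fl(1)[of y i] by linarith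
      then show "?f z - ?f y \<le> ln (WM i / wm i)" using wpos[of i] by (simp add: ln_div)
    qed
    then have "(os ?f i)\<^sup>2 \<le> (ln (WM i / wm i))\<^sup>2" using os_nonneg[OF fbf, of i] by (rule power_mono)
    also have "\<dots> \<le> (WM i / wm i - 1)\<^sup>2 / (WM i / wm i)"
      using wm[of i] wpos[of i] by (intro ln_square_le) auto
    also have "\<dots> = (WM i - wm i)\<^sup>2 / (WM i * wm i)"
      using wpos[of i] by (simp add: power2_eq_square field_simps)
    finally show ?thesis .
  qed
  \<comment> \<open>Twice \<open>caccioppoli_term\<close>. For disks inside the small ball the
    cutoff is 1 on the boundary circle, so the good term dominates the left-hand side; for all
    others the left-hand side is zero.\<close>
  have key: "(os ?f i)\<^sup>2 * indicator {i. Q i \<subseteq> ball x1 r1} i \<le> 6 * ((e i)\<^sup>2 * ?I i) - 2 * (O' i * \<Delta> i)" for i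
  proof (cases "i \<in> meeting Q ?V")
    case True
    have ct: "o' i * \<delta> i \<le> - (1/2) * ((WM i - wm i)\<^sup>2 / (WM i * wm i)) * (em i)\<^sup>2 + 3 * (e i)\<^sup>2"
      unfolding \<delta>_def o'(2) e_def using wpos[of i] wm[of i] em[of i] by (intro caccioppoli_term) auto
    have "(os ?f i)\<^sup>2 * indicator {i. Q i \<subseteq> ball x1 r1} i \<le> (WM i - wm i)\<^sup>2 / (WM i * wm i) * (em i)\<^sup>2"
    proof (cases "Q i \<subseteq> ball x1 r1")
      case True
      have "1 \<le> em i"
        unfolding em_def
      proof (rule mm_greatest)
        fix z assume "z \<in> frontier (Q i)"
        then have "z \<in> closure (ball x1 r1)" using closure_mono[OF True] closure_frontier by blast
        then have "dist x1 z \<le> r1" using r1 by simp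
        then show "1 \<le> \<eta> z" using \<eta>1 by simp
      qed
      then have "em i = 1" using em[of i] by simp
      then show ?thesis using osf[of i] True by simp
    next
      case False
      then show ?thesis using wpos[of i] by simp
    qed
    then show ?thesis using ct True by (simp add: O'_def \<Delta>_def)
  next
    case False
    have "\<not> Q i \<subseteq> ball x1 r1"
    proof
      assume "Q i \<subseteq> ball x1 r1"
      moreover have "ball x1 r1 \<subseteq> ?V" using Rd(3) by (intro subset_ball) simp
      ultimately show False using False Q_nonempty[of i] by (auto simp: meeting_def)
    qed
    then show ?thesis using False by (simp add: O'_def \<Delta>_def)
  qed
  have sk: "summable (\<lambda>i. 6 * ((e i)\<^sup>2 * ?I i) - 2 * (O' i * \<Delta> i))"
    by (intro summable_diff summable_mult se sO\<Delta>)
  have "(\<Sum>i. (ennreal (os ?f i))\<^sup>2 * indicator {i. Q i \<subseteq> ball x1 r1} i) =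
      (\<Sum>i. ennreal ((os ?f i)\<^sup>2 * indicator {i. Q i \<subseteq> ball x1 r1} i))"
    using os_nonneg[OF fbf] by (intro suminf_cong) (auto simp: ennreal_power indicator_def)
  also have "\<dots> \<le> (\<Sum>i. ennreal (6 * ((e i)\<^sup>2 * ?I i) - 2 * (O' i * \<Delta> i)))"
    by (intro suminf_le ennreal_leI key) auto
  also have "\<dots> = ennreal (\<Sum>i. 6 * ((e i)\<^sup>2 * ?I i) - 2 * (O' i * \<Delta> i))"
  proof (rule suminf_ennreal2[OF _ sk])
    fix i show "0 \<le> 6 * ((e i)\<^sup>2 * ?I i) - 2 * (O' i * \<Delta> i)"
      using key[of i] by (rule order_trans[rotated]) (auto simp: indicator_def)
  qed
  also have "(\<Sum>i. 6 * ((e i)\<^sup>2 * ?I i) - 2 * (O' i * \<Delta> i)) = 6 * (\<Sum>i. (e i)\<^sup>2 * ?I i) - 2 * (\<Sum>i. O' i * \<Delta> i)"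
    using suminf_diff[OF summable_mult[OF se, of 6] summable_mult[OF sO\<Delta>, of 2]]
    by (simp add: suminf_mult se sO\<Delta>)
  also have "\<dots> \<le> 6 * (\<Sum>i. (e i)\<^sup>2 * ?I i)" using pos by simp
  \<comment> \<open>Since \<open>e i\<close> is at most 1 and \<open>d \<le> R\<close>, the diameter
    may be truncated at \<open>R\<close>, and \<open>packing\<close> applies; this produces 384 = 6
    * 64.\<close>
  also have "(\<Sum>i. (e i)\<^sup>2 * ?I i) \<le> 64 / K1 * R\<^sup>2 / d\<^sup>2"
  proof -
    have "ennreal (\<Sum>i. (e i)\<^sup>2 * ?I i) = (\<Sum>i. ennreal ((e i)\<^sup>2 * ?I i))"
      using se by (subst suminf_ennreal2) auto
    also have "\<dots> \<le> (\<Sum>i. ennreal (1 / d\<^sup>2) * ((ennreal (min (dm i) R))\<^sup>2 * indicator (meeting Q ?V) i))"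
    proof (intro suminf_le)
      fix i
      have "e i \<le> min (dm i) R / d"
        using e(2,3)[of i] Rd by (auto simp: min_def intro: order_trans[of _ 1])
      then have "(e i)\<^sup>2 \<le> (min (dm i) R / d)\<^sup>2" using e(1)[of i] by (rule power_mono)
      then have "ennreal ((e i)\<^sup>2) \<le> ennreal (1 / d\<^sup>2) * (ennreal (min (dm i) R))\<^sup>2"
        using Rd dm_pos[of i] by (simp add: ennreal_power power_divide ennreal_leI flip: ennreal_mult)
      then show "ennreal ((e i)\<^sup>2 * ?I i) \<le> ennreal (1 / d\<^sup>2) * ((ennreal (min (dm i) R))\<^sup>2 * indicator (meeting Q ?V) i)"
        by (auto simp: indicator_def)
    qed auto
    also have "\<dots> = ennreal (1 / d\<^sup>2) * sum_along Q (\<lambda>i. (ennreal (min (dm i) R))\<^sup>2) ?V"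
      unfolding sum_along_eq by simp
    also have "\<dots> \<le> ennreal (1 / d\<^sup>2) * ennreal (64 / K1 * R\<^sup>2)"
      by (intro mult_left_mono packing Rd) auto
    also have "\<dots> = ennreal (64 / K1 * R\<^sup>2 / d\<^sup>2)" using Rd K1 by (simp flip: ennreal_mult)
    finally show ?thesis using K1 by (simp add: ennreal_le_iff)
  qed
  also have "6 * (64 / K1 * R\<^sup>2 / d\<^sup>2) = 384 / K1 * (c1 / (c1 - 1))\<^sup>2"
  proof -
    have "d = (c1 - 1) * r1" by (simp add: d_def R_def algebra_simps)
    then show ?thesis using r1 by (simp add: R_def power_mult_distrib power_divide)
  qed
  finally show "(\<Sum>i. (ennreal (os ?f i))\<^sup>2 * indicator {i. Q i \<subseteq> ball x1 r1} i) \<le>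
      ennreal (384 / K1 * (c1 / (c1 - 1))\<^sup>2)"
    by (simp add: ennreal_leI)
qed

end

section \<open>The maximum principle\<close>

definition clamp :: "real \<Rightarrow> real \<Rightarrow> real \<Rightarrow> real" where
  "clamp m M t = max m (min t M)"

text \<open>The defect \<open>clamp m M x - x\<close> is the perturbation that turns a function into
  its truncation; being 1-Lipschitz, it inherits upper gradients and oscillation bounds.\<close>

lemma clamp_defect_lipschitz:
  "m \<le> M \<Longrightarrow> \<bar>(clamp m M s - s) - (clamp m M t - t)\<bar> \<le> \<bar>s - t\<bar>"
  by (auto simp: clamp_def max_def min_def)

lemma clamp_id: "m \<le> t \<Longrightarrow> t \<le> M \<Longrightarrow> clamp m M t = t"
  by (auto simp: clamp_def)

lemma clamp_mono: "s \<le> t \<Longrightarrow> clamp m M s \<le> clamp m M t"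
  by (auto simp: clamp_def max_def min_def)

text \<open>The case of equality for truncation: equal energies will force every disk meeting the
  square into this alternative.\<close>

lemma clamp_contracts:
  "m \<le> M \<Longrightarrow> s \<le> t \<Longrightarrow> t - s \<le> clamp m M t - clamp m M s \<Longrightarrow> (m \<le> s \<and> t \<le> M) \<or> s = t"
  by (auto simp: clamp_def max_def min_def split: if_splits)

context sierpinski begin

definition box_at :: "complex \<Rightarrow> real \<Rightarrow> complex set" where
  "box_at p t = {z. \<forall>d. \<bar>al d z - al d p\<bar> < t}"

definition hash_set :: "complex \<Rightarrow> real \<Rightarrow> real \<Rightarrow> complex set" where
  "hash_set p s t = (\<Union>(d, \<tau>)\<in>hash t. trace (hs p s d \<tau>))"

lemma continuous_al: "continuous_on A (al d)"
  by (cases d) (auto simp: al_def[abs_def] intro!: continuous_intros)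

lemma open_box_at: "open (box_at p t)"
proof -
  have "box_at p t = {z. \<bar>al True z - al True p\<bar> < t} \<inter> {z. \<bar>al False z - al False p\<bar> < t}"
    unfolding box_at_def by (auto, (metis (full_types))+)
  moreover have "open {z. \<bar>al d z - al d p\<bar> < t}" for d
    by (intro open_Collect_less continuous_intros continuous_al)
  ultimately show ?thesis by auto
qed

lemma frontier_box_at:
  assumes "t \<le> 2 * s" "z \<in> closure (box_at p t)" "z \<notin> box_at p t"
  shows "z \<in> hash_set p s t"
proof -
  have "closed {z. \<bar>al d z - al d p\<bar> \<le> t}" for d
    by (intro closed_Collect_le continuous_intros continuous_al)
  then have le: "\<bar>al d z - al d p\<bar> \<le> t" for d
    using closure_minimal[of "box_at p t" "{z. \<bar>al d z - al d p\<bar> \<le> t}"] assms(2)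
    by (auto simp: box_at_def less_imp_le subset_iff)
  obtain d where "\<not> \<bar>al d z - al d p\<bar> < t" using assms(3) by (auto simp: box_at_def)
  then have "\<bar>al d z - al d p\<bar> = t" using le[of d] by simp
  then have "al d z = al d p + t \<or> al d z = al d p + - t" by linarith
  moreover have "\<bar>al (\<not> d) z - al (\<not> d) p\<bar> \<le> 2 * s" using le[of "\<not> d"] assms(1) by simp
  ultimately have "z \<in> trace (hs p s (\<not> d) t) \<or> z \<in> trace (hs p s (\<not> d) (-t))"
    by (auto simp: trace_hs)
  then show ?thesis unfolding hash_set_def hash_def by auto
qed

text \<open>A connected set that leaves the square meets its boundary, and
  \<open>t \<le> 2 * s\<close> places that boundary on the four segments.\<close>

lemma crosses_hash:
  assumes T: "connected T" and t: "t \<le> 2 * s" and x: "x \<in> T" "x \<in> box_at p t" and y: "y \<in> T" "y \<notin> box_at p t"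
  shows "\<exists>w\<in>T. w \<in> hash_set p s t"
proof -
  have "T \<inter> frontier (box_at p t) \<noteq> {}"
    using connected_Int_frontier[OF T, of "box_at p t"] x y by blast
  then obtain w where "w \<in> T" "w \<in> frontier (box_at p t)" by blast
  then show ?thesis
    using frontier_box_at[OF t, of w p] open_box_at by (auto simp: frontier_def interior_open)
qed

lemma box_at_ball: "t \<le> 2 * s \<Longrightarrow> box_at p t \<subseteq> ball p (4 * s)"
proof
  fix z assume t: "t \<le> 2 * s" and z: "z \<in> box_at p t"
  have "\<bar>al d p - al d z\<bar> < 2 * s" for d
    using z t by (auto simp: box_at_def abs_minus_commute intro: less_le_trans)
  from this[of True] this[of False] show "z \<in> ball p (4 * s)" using dist_le_al[of p z True] by auto
qed

text \<open>The differences \<open>g i - f i\<close> are nonnegative with sum at most zero;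
  finiteness of the larger sum permits the subtraction.\<close>

lemma sum_along_eq_of_le:
  assumes fg: "\<And>i. i \<in> meeting Q V \<Longrightarrow> f i \<le> g i" "\<And>i. 0 \<le> f i" "\<And>i. 0 \<le> g i"
    and fin: "sum_along Q (\<lambda>i. ennreal (g i)) V < \<infinity>"
    and le: "sum_along Q (\<lambda>i. ennreal (g i)) V \<le> sum_along Q (\<lambda>i. ennreal (f i)) V"
    and i: "i \<in> meeting Q V"
  shows "f i = g i"
proof -
  have "sum_along Q (\<lambda>i. ennreal (f i)) V \<le> sum_along Q (\<lambda>i. ennreal (g i)) V"
    using fg by (intro sum_along_mono) (auto intro: ennreal_leI)
  then have fin': "sum_along Q (\<lambda>i. ennreal (f i)) V < \<infinity>" using fin by (rule le_less_trans)
  let ?I = "indicator (meeting Q V) :: nat \<Rightarrow> real"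
  note F = sum_along_real_summable[OF fg(2) fin'] and G = sum_along_real_summable[OF fg(3) fin]
  have "0 \<le> (\<Sum>i. f i * ?I i)" using F(1) fg(2) by (intro suminf_nonneg) (auto simp: indicator_def)
  then have "(\<Sum>i. g i * ?I i) \<le> (\<Sum>i. f i * ?I i)" using le F(2) G(2) by (simp add: ennreal_le_iff)
  then have "(\<Sum>i. g i * ?I i - f i * ?I i) \<le> 0" using suminf_diff[OF G(1) F(1)] by simp
  moreover have nn: "0 \<le> g i * ?I i - f i * ?I i" for i using fg(1)[of i] by (auto simp: indicator_def)
  ultimately have "(\<Sum>i. g i * ?I i - f i * ?I i) = 0"
    using suminf_nonneg[OF summable_diff[OF G(1) F(1)] nn] by simp
  then have "g i * ?I i - f i * ?I i = 0"
    using suminf_eq_zero_iff[OF summable_diff[OF G(1) F(1)] nn] by simp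
  then show ?thesis using i by simp
qed

text \<open>Truncating at the boundary values does not increase the energy, so a harmonic function can exceed
  them only on disks where it is constant; the difference to the truncation then has zero upper
  gradient and is constant along almost every horizontal segment that leaves the square.\<close>

lemma max_principle:
  assumes u: "carpet_harmonic v \<Omega> Q (\<lambda>z. ereal (u z))" and u0: "\<And>z. z \<in> S \<Longrightarrow> 0 \<le> u z"
    and s: "0 < s" "0 < t" "t < 2 * s" and cpt: "compactly_in (ball p (4 * s)) \<Omega>" and mM: "m \<le> M"
    and bS: "\<And>w. w \<in> hash_set p s t \<Longrightarrow> w \<in> S \<Longrightarrow> m \<le> u w \<and> u w \<le> M"
    and bQ: "\<And>w i z. w \<in> hash_set p s t \<Longrightarrow> w \<in> Q i \<Longrightarrow> z \<in> frontier (Q i) \<Longrightarrow> m \<le> u z \<and> u z \<le> M"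
    and i0: "i0 \<in> meeting Q (box_at p t)"
  shows "m \<le> mm u i0 \<and> MM u i0 \<le> M"
proof (rule ccontr)
  assume contra: "\<not> ?thesis"
  let ?V = "box_at p t"
  have uW: "(\<lambda>z. ereal (u z)) \<in> W12_loc v \<Omega> Q" using u by (simp add: carpet_harmonic_def)
  note uD = W12_locD[OF uW]
  have fbu: "fb u" by (rule uD(1))
  have Vball: "?V \<subseteq> ball p (4 * s)" using s by (intro box_at_ball) auto
  have ballO: "ball p (4 * s) \<subseteq> \<Omega>" using cpt closure_subset unfolding compactly_in_def by blast
  have V: "open ?V" "compactly_in ?V \<Omega>"
  proof -
    show "open ?V" by (rule open_box_at)
    show "compactly_in ?V \<Omega>"
      using closure_mono[OF Vball] cpt bounded_subset[OF bounded_ball Vball]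
      unfolding compactly_in_def by (auto simp: compact_closure)
  qed
  define \<phi> where "\<phi> x = clamp m M x - x" for x
  have \<phi>lip: "\<bar>\<phi> x - \<phi> y\<bar> \<le> \<bar>x - y\<bar>" for x y unfolding \<phi>_def by (rule clamp_defect_lipschitz[OF mM])
  have \<phi>0: "\<phi> x = 0" if "m \<le> x" "x \<le> M" for x using clamp_id[OF that] by (simp add: \<phi>_def)
  define \<zeta> where "\<zeta> z = (if z \<in> ?V then \<phi> (u z) else 0)" for z
  \<comment> \<open>On a disk that reaches the frame, cutting off outside the square changes
    nothing: the boundary values found outside the square already lie in \<open>{m..M}\<close>, by
    \<open>bS\<close> or \<open>bQ\<close>, and there \<open>\<phi>\<close> vanishes.\<close>
  have \<zeta>fr: "\<zeta> z = \<phi> (u z)" if i: "i \<in> meeting Q ?V" and z: "z \<in> frontier (Q i)" for i z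
  proof (cases "z \<in> ?V")
    case False
    have "m \<le> u z \<and> u z \<le> M"
    proof (cases "Q i \<subseteq> ?V")
      case True
      then have "z \<in> closure ?V" using z closure_frontier closure_mono[OF True] by blast
      then have "z \<in> hash_set p s t" using frontier_box_at[of t s z p] False s by auto
      then show ?thesis using bS z frontier_carpet by blast
    next
      case False
      then obtain a b where "a \<in> Q i" "a \<in> ?V" "b \<in> Q i" "b \<notin> ?V" using i by (auto simp: meeting_def)
      then obtain w where "w \<in> Q i" "w \<in> hash_set p s t"
        using crosses_hash[OF Q_connected, of t s a i p b] s by auto
      then show ?thesis using bQ z by blast
    qed
    then show ?thesis using False \<phi>0 by (simp add: \<zeta>_def)
  qed (simp add: \<zeta>_def)
  have \<zeta>out: "\<zeta> z = 0" if "i \<notin> meeting Q ?V" "z \<in> frontier (Q i)" for i z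
    using meeting_of_frontier[OF V(1) that(2)] that(1) by (auto simp: \<zeta>_def)
  define C where "C = \<bar>m\<bar> + \<bar>M\<bar>"
  have \<phi>b: "\<bar>\<phi> x\<bar> \<le> \<bar>x\<bar> + C" for x by (auto simp: \<phi>_def C_def clamp_def max_def min_def)
  have \<zeta>b: "\<bar>\<zeta> z\<bar> \<le> MM u i + C" if z: "z \<in> frontier (Q i)" for i z
  proof -
    have "0 \<le> u z" "u z \<le> MM u i" using u0 le_MM[OF fbu z] z frontier_carpet by blast+
    then show ?thesis using \<phi>b[of "u z"] by (auto simp: \<zeta>_def C_def)
  qed
  have fb\<zeta>: "fb \<zeta>" by (rule fbI) (rule \<zeta>b)
  have fbu\<zeta>: "fb (\<lambda>z. u z + \<zeta> z)"
  proof (rule fbI)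
    fix i z assume z: "z \<in> frontier (Q i)"
    have "0 \<le> u z" "u z \<le> MM u i" using u0 le_MM[OF fbu z] z frontier_carpet by blast+
    then show "\<bar>u z + \<zeta> z\<bar> \<le> MM u i + (MM u i + C)" using \<zeta>b[OF z] by linarith
  qed
  have os\<zeta>: "os \<zeta> i \<le> os u i" for i
  proof (cases "i \<in> meeting Q ?V")
    case True
    show ?thesis
    proof (rule os_le)
      fix z y assume zy: "z \<in> frontier (Q i)" "y \<in> frontier (Q i)"
      show "\<zeta> z - \<zeta> y \<le> os u i"
        using \<phi>lip[of "u z" "u y"] abs_le_os[OF fbu zy] \<zeta>fr[OF True] zy by auto
    qed
  next
    case False
    show ?thesis
      by (rule os_le) (use \<zeta>out[OF False] os_nonneg[OF fbu] in auto)
  qed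
  have os\<zeta>0: "os \<zeta> i = 0" "MM \<zeta> i = 0" if i: "i \<notin> meeting Q ?V" for i
  proof -
    have "os \<zeta> i \<le> 0" using \<zeta>out[OF i] by (intro os_le) auto
    then show "os \<zeta> i = 0" using os_nonneg[OF fb\<zeta>, of i] by simp
    show "MM \<zeta> i = 0"
      unfolding MM_def using \<zeta>out[OF i] frontier_nonempty[of i] by (simp add: image_constant_conv cong: image_cong_simp)
  qed
  have ug\<zeta>: "ug \<zeta> (\<lambda>i. ennreal (os u i))"
  proof -
    obtain \<Gamma>0 where \<Gamma>0: "null \<Gamma>0" "\<And>\<gamma>. \<gamma> \<in> paths_in \<Omega> - \<Gamma>0 \<Longrightarrow> ugood u (\<lambda>i. ennreal (os u i)) \<gamma>"
      using uD(2) unfolding ug_def by blast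
    have "ugood \<zeta> (\<lambda>i. ennreal (os u i)) \<gamma>" if \<gamma>: "\<gamma> \<in> paths_in \<Omega> - \<Gamma>0" for \<gamma>
    proof -
      let ?X = "sum_along Q (\<lambda>i. ennreal (os u i)) (trace \<gamma>)"
      have g: "ennreal \<bar>u x - u y\<bar> \<le> ?X" if "x \<in> trace \<gamma> \<inter> S" "y \<in> trace \<gamma> \<inter> S" for x y
        using \<Gamma>0(2)[OF \<gamma>] that unfolding ugood_def by blast
      have conn: "connected (trace \<gamma>)" using \<gamma> connected_trace by blast
      \<comment> \<open>A path that leaves the square crosses the frame, either in the carpet or
        inside a disk whose boundary it must also meet, since \<open>x\<close> is in the carpet.
        This gives a point \<open>w'\<close> of the path with
        \<open>\<phi> (u w') = 0\<close>.\<close>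
      have out: "ennreal \<bar>\<phi> (u x)\<bar> \<le> ?X" if x: "x \<in> trace \<gamma> \<inter> S" "x \<in> ?V" and y: "y \<in> trace \<gamma>" "y \<notin> ?V" for x y
      proof -
        obtain w where w: "w \<in> trace \<gamma>" "w \<in> hash_set p s t"
          using crosses_hash[OF conn, of t s x p y] x y s by auto
        have "\<exists>w'\<in>trace \<gamma> \<inter> S. m \<le> u w' \<and> u w' \<le> M"
        proof (cases "w \<in> S")
          case True
          then show ?thesis using bS w by blast
        next
          case False
          then obtain i where i: "w \<in> Q i" using not_carpet w(1) \<gamma> by (auto simp: paths_in_def)
          have "x \<notin> Q i" using x carpet_not_Q by blast
          then obtain w' where "w' \<in> trace \<gamma>" "w' \<in> frontier (Q i)"
            using meets_frontier[OF conn w(1) i, of x] x by blast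
          then show ?thesis using bQ[OF w(2) i] frontier_carpet by blast
        qed
        then obtain w' where w': "w' \<in> trace \<gamma> \<inter> S" "m \<le> u w'" "u w' \<le> M" by blast
        have "\<bar>\<phi> (u x)\<bar> \<le> \<bar>u x - u w'\<bar>" using \<phi>lip[of "u x" "u w'"] \<phi>0[OF w'(2,3)] by simp
        then show ?thesis using g[OF x(1) w'(1)] by (meson ennreal_leI order_trans)
      qed
      show ?thesis
        unfolding ugood_def
      proof (intro ballI)
        fix x y assume xy: "x \<in> trace \<gamma> \<inter> S" "y \<in> trace \<gamma> \<inter> S"
        consider "x \<in> ?V" "y \<in> ?V" | "x \<in> ?V" "y \<notin> ?V" | "x \<notin> ?V" "y \<in> ?V" | "x \<notin> ?V" "y \<notin> ?V" by blast
        then show "ennreal \<bar>\<zeta> x - \<zeta> y\<bar> \<le> ?X"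
        proof cases
          case 1
          then have "\<bar>\<zeta> x - \<zeta> y\<bar> \<le> \<bar>u x - u y\<bar>" using \<phi>lip by (simp add: \<zeta>_def)
          then show ?thesis using g[OF xy] by (meson ennreal_leI order_trans)
        next
          case 2 then show ?thesis using out[OF xy(1) _ _ 2(2)] xy by (simp add: \<zeta>_def)
        next
          case 3 then show ?thesis using out[OF xy(2) _ _ 3(1)] xy by (simp add: \<zeta>_def)
        next
          case 4 then show ?thesis by (simp add: \<zeta>_def)
        qed
      qed
    qed
    then show ?thesis using \<Gamma>0(1) unfolding ug_def by blast
  qed
  have ball: "0 < 4 * s" using s by simp
  have finV: "sum_along Q (\<lambda>i. ennreal ((os u i)\<^sup>2)) ?V < \<infinity>"
  proof -
    have "sum_along Q (\<lambda>i. (ennreal (os u i))\<^sup>2) (ball p (4 * s)) < \<infinity>"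
      using uD(3) cpt ball unfolding loc_l2_def by blast
    then show ?thesis
      using le_less_trans[OF sum_along_mono[OF Vball order_refl]] os_nonneg[OF fbu] by (simp add: ennreal_power)
  qed
  have W: "(\<lambda>z. ereal (\<zeta> z)) \<in> W12 v \<Omega> Q"
  proof (rule W12I[OF fb\<zeta> ug\<zeta> uD(3)])
    have "(\<Sum>i. (ennreal (os \<zeta> i))\<^sup>2) \<le> sum_along Q (\<lambda>i. ennreal ((os u i)\<^sup>2)) ?V"
      unfolding sum_along_eq
    proof (intro suminf_le)
      fix i
      show "(ennreal (os \<zeta> i))\<^sup>2 \<le> ennreal ((os u i)\<^sup>2) * indicator (meeting Q ?V) i"
      proof (cases "i \<in> meeting Q ?V")
        case True
        have "(os \<zeta> i)\<^sup>2 \<le> (os u i)\<^sup>2" using os\<zeta>[of i] os_nonneg[OF fb\<zeta>, of i] by (rule power_mono)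
        then show ?thesis using True os_nonneg[OF fb\<zeta>, of i] by (simp add: ennreal_power ennreal_leI)
      qed (simp add: os\<zeta>0)
    qed auto
    then show "(\<Sum>i. (ennreal (os \<zeta> i))\<^sup>2) < \<infinity>" using finV by (rule le_less_trans)
    have "(\<Sum>i. ennreal ((MM \<zeta> i * dm i)\<^sup>2)) \<le>
        sum_along Q (\<lambda>i. 2 * ennreal ((MM u i * dm i)\<^sup>2) + ennreal (2 * C\<^sup>2) * (ennreal (dm i))\<^sup>2) ?V"
      unfolding sum_along_eq
    proof (intro suminf_le)
      fix i
      show "ennreal ((MM \<zeta> i * dm i)\<^sup>2) \<le> (2 * ennreal ((MM u i * dm i)\<^sup>2) + ennreal (2 * C\<^sup>2) * (ennreal (dm i))\<^sup>2) * indicator (meeting Q ?V) i"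
      proof (cases "i \<in> meeting Q ?V")
        case True
        obtain z where z: "z \<in> frontier (Q i)" using frontier_nonempty by blast
        have "\<bar>MM \<zeta> i\<bar> \<le> MM u i + C"
        proof (rule abs_leI)
          show "MM \<zeta> i \<le> MM u i + C" using \<zeta>b by (intro MM_least) (auto simp: abs_le_iff)
          have "- (MM u i + C) \<le> \<zeta> z" using \<zeta>b[OF z] by linarith
          also have "\<dots> \<le> MM \<zeta> i" by (rule le_MM[OF fb\<zeta> z])
          finally show "- MM \<zeta> i \<le> MM u i + C" by simp
        qed
        then have "(MM \<zeta> i)\<^sup>2 \<le> (MM u i + C)\<^sup>2" by (intro iffD1[OF abs_le_square_iff]) auto
        also have "\<dots> \<le> 2 * (MM u i)\<^sup>2 + 2 * C\<^sup>2"
          using sum_squares_bound[of "MM u i" C] by (simp only: power2_sum)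
        finally have "(MM \<zeta> i)\<^sup>2 * (dm i)\<^sup>2 \<le> (2 * (MM u i)\<^sup>2 + 2 * C\<^sup>2) * (dm i)\<^sup>2" by (rule mult_right_mono) simp
        then have "(MM \<zeta> i * dm i)\<^sup>2 \<le> 2 * (MM u i * dm i)\<^sup>2 + 2 * C\<^sup>2 * (dm i)\<^sup>2"
          by (simp add: power_mult_distrib distrib_right)
        then have "ennreal ((MM \<zeta> i * dm i)\<^sup>2) \<le> ennreal (2 * (MM u i * dm i)\<^sup>2 + 2 * C\<^sup>2 * (dm i)\<^sup>2)" by (rule ennreal_leI)
        also have "\<dots> = 2 * ennreal ((MM u i * dm i)\<^sup>2) + ennreal (2 * C\<^sup>2) * (ennreal (dm i))\<^sup>2"
          using dm_pos[of i] by (simp add: ennreal_mult ennreal_power less_imp_le)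
        finally show ?thesis using True by simp
      qed (simp add: os\<zeta>0)
    qed auto
    also have "\<dots> = 2 * sum_along Q (\<lambda>i. ennreal ((MM u i * dm i)\<^sup>2)) ?V + ennreal (2 * C\<^sup>2) * sum_along Q (\<lambda>i. (ennreal (dm i))\<^sup>2) ?V"
      by (simp add: sum_along_add sum_along_cmult)
    also have "\<dots> < \<infinity>"
    proof -
      have "sum_along Q (\<lambda>i. ennreal ((MM u i * dm i)\<^sup>2)) ?V < \<infinity>"
        using le_less_trans[OF sum_along_mono[OF Vball order_refl] uD(4)[OF ball cpt]] .
      moreover have "sum_along Q (\<lambda>i. (ennreal (dm i))\<^sup>2) ?V < \<infinity>"
        using bounded_subset[OF bounded_ball Vball] by (rule sum_diam_square_finite)
      ultimately show ?thesis by (simp add: ennreal_mult_less_top)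
    qed
    finally show "(\<Sum>i. ennreal ((MM \<zeta> i * dm i)\<^sup>2)) < \<infinity>" .
  qed
  have ucl: "u z + \<zeta> z = clamp m M (u z)" if "i \<in> meeting Q ?V" "z \<in> frontier (Q i)" for i z
    using \<zeta>fr[OF that] by (simp add: \<phi>_def)
  have oscl: "os (\<lambda>z. u z + \<zeta> z) i \<le> clamp m M (MM u i) - clamp m M (mm u i)" if i: "i \<in> meeting Q ?V" for i
  proof (rule os_le)
    fix z y assume zy: "z \<in> frontier (Q i)" "y \<in> frontier (Q i)"
    show "u z + \<zeta> z - (u y + \<zeta> y) \<le> clamp m M (MM u i) - clamp m M (mm u i)"
      using clamp_mono[OF le_MM[OF fbu zy(1)], of m M] clamp_mono[OF mm_le[OF fbu zy(2)], of m M] ucl[OF i] zy by auto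
  qed
  have oscle: "clamp m M (MM u i) - clamp m M (mm u i) \<le> os u i" for i
    using mm_le_MM[OF fbu, of i] by (auto simp: clamp_def os_def max_def min_def)
  have oseq: "(os (\<lambda>z. u z + \<zeta> z) i)\<^sup>2 = (os u i)\<^sup>2" if i: "i \<in> meeting Q ?V" for i
  proof (rule sum_along_eq_of_le[OF _ _ _ finV _ i])
    show "(os (\<lambda>z. u z + \<zeta> z) i)\<^sup>2 \<le> (os u i)\<^sup>2" if "i \<in> meeting Q ?V" for i
      using order_trans[OF oscl[OF that] oscle] os_nonneg[OF fbu\<zeta>, of i] by (rule power_mono)
    show "sum_along Q (\<lambda>i. ennreal ((os u i)\<^sup>2)) ?V \<le> sum_along Q (\<lambda>i. ennreal ((os (\<lambda>z. u z + \<zeta> z) i)\<^sup>2)) ?V"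
      using harmonicD[OF u V W _ fbu fbu\<zeta>] os_nonneg[OF fbu] os_nonneg[OF fbu\<zeta>]
      by (auto simp: ennreal_power \<zeta>_def)
  qed auto
  \<comment> \<open>Minimality excludes a loss of oscillation on any disk, so truncation leaves the
    values on a circle unchanged unless \<open>u\<close> is constant there.\<close>
  have dich: "(m \<le> mm u i \<and> MM u i \<le> M) \<or> mm u i = MM u i" if i: "i \<in> meeting Q ?V" for i
  proof (rule clamp_contracts[OF mM mm_le_MM[OF fbu]])
    have "os (\<lambda>z. u z + \<zeta> z) i = os u i"
      using oseq[OF i] os_nonneg[OF fbu, of i] os_nonneg[OF fbu\<zeta>, of i] by (simp add: power2_eq_iff_nonneg)
    then show "MM u i - mm u i \<le> clamp m M (MM u i) - clamp m M (mm u i)"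
      using oscl[OF i] by (simp add: os_def)
  qed
  have os0: "os \<zeta> i = 0" for i
  proof (cases "i \<in> meeting Q ?V")
    case True
    have "os \<zeta> i \<le> 0"
    proof (rule os_le)
      fix z y assume zy: "z \<in> frontier (Q i)" "y \<in> frontier (Q i)"
      have b: "mm u i \<le> u z" "u z \<le> MM u i" "mm u i \<le> u y" "u y \<le> MM u i"
        using mm_le[OF fbu] le_MM[OF fbu] zy by auto
      show "\<zeta> z - \<zeta> y \<le> 0"
      proof (cases "m \<le> mm u i \<and> MM u i \<le> M")
        case True
        then show ?thesis using \<zeta>fr[OF \<open>i \<in> meeting Q ?V\<close>] zy b \<phi>0 by auto
      next
        case False
        then have "u z = u y" using dich[OF \<open>i \<in> meeting Q ?V\<close>] b by auto
        then show ?thesis using \<zeta>fr[OF \<open>i \<in> meeting Q ?V\<close>] zy by auto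
      qed
    qed
    then show ?thesis using os_nonneg[OF fb\<zeta>, of i] by simp
  qed (rule os\<zeta>0)
  have ci0: "mm u i0 = MM u i0" using dich[OF i0] contra by blast
  have noQ: "w \<notin> Q i0" if w: "w \<in> hash_set p s t" for w
  proof
    assume "w \<in> Q i0"
    then have "m \<le> u z \<and> u z \<le> M" if "z \<in> frontier (Q i0)" for z using bQ[OF w] that by blast
    then have "m \<le> mm u i0 \<and> MM u i0 \<le> M" by (intro conjI mm_greatest MM_least) auto
    then show False using contra by blast
  qed
  have Qi0V: "Q i0 \<subseteq> ?V"
  proof
    fix b assume b: "b \<in> Q i0"
    obtain a where a: "a \<in> Q i0" "a \<in> ?V" using i0 by (auto simp: meeting_def)
    have t2: "t \<le> 2 * s" using s by simp
    show "b \<in> ?V"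
    proof (rule ccontr)
      assume "b \<notin> ?V"
      from crosses_hash[OF Q_connected t2 a b this] show False using noQ by blast
    qed
  qed
  \<comment> \<open>The constant value of \<open>u\<close> on this circle lies outside
    \<open>{m..M}\<close>, so truncation moves it.\<close>
  have \<zeta>i0: "\<zeta> z \<noteq> 0" if z: "z \<in> frontier (Q i0)" for z
  proof -
    have "u z = MM u i0" using mm_le[OF fbu z] le_MM[OF fbu z] ci0 by simp
    then show ?thesis using \<zeta>fr[OF i0 z] contra ci0 mM
      by (auto simp: \<phi>_def clamp_def max_def min_def split: if_splits)
  qed
  have "ug \<zeta> (\<lambda>i. ennreal (os \<zeta> i))" by (rule ug_osc[OF fb\<zeta> ug\<zeta> uD(3)])
  then obtain \<Gamma>0 where \<Gamma>0: "null \<Gamma>0" "\<And>\<gamma>. \<gamma> \<in> paths_in \<Omega> - \<Gamma>0 \<Longrightarrow> ugood \<zeta> (\<lambda>i. ennreal (os \<zeta> i)) \<gamma>"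
    unfolding ug_def by blast
  obtain z0 where z0: "z0 \<in> Q i0" using Q_nonempty by blast
  obtain e where e: "e > 0" "ball z0 e \<subseteq> Q i0" using Q_open z0 openE by blast
  have "AE y in lborel. y \<in> {Im p - t..Im p + t} \<longrightarrow> seg True (Re p - t) (Re p + t) y \<notin> \<Gamma>0"
    by (rule AE_seg_not_null[OF \<Gamma>0(1)])
  then obtain N where N: "N \<in> null_sets lborel" "{y. \<not> (y \<in> {Im p - t..Im p + t} \<longrightarrow> seg True (Re p - t) (Re p + t) y \<notin> \<Gamma>0)} \<subseteq> N"
    by (auto simp: eventually_ae_filter)
  \<comment> \<open>The heights of horizontal lines through the disk \<open>i0\<close> include an
    interval of positive length, so one of them has its segment outside
    \<open>\<Gamma>0\<close>.\<close>
  have "\<not> {Im z0 <..< Im z0 + e} \<subseteq> N"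
  proof
    assume "{Im z0 <..< Im z0 + e} \<subseteq> N"
    then have "emeasure lborel {Im z0 <..< Im z0 + e} \<le> emeasure lborel N" using N by (intro emeasure_mono) auto
    then show False using N e by (auto simp: null_sets_def)
  qed
  then obtain y where y: "Im z0 < y" "y < Im z0 + e" "y \<notin> N"
    unfolding subset_iff greaterThanLessThan_iff by blast
  define a where "a = Complex (Re z0) y"
  define b where "b = Complex (Re p + t) y"
  have "dist z0 a < e" using y by (simp add: a_def dist_norm cmod_def)
  then have aQ: "a \<in> Q i0" using e by auto
  then have aV: "a \<in> ?V" using Qi0V by blast
  have aV': "\<bar>Re z0 - Re p\<bar> < t" "\<bar>y - Im p\<bar> < t"
    using aV unfolding box_at_def by (auto simp: a_def al_def dest: spec[of _ True] spec[of _ False])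
  let ?\<gamma> = "seg True (Re p - t) (Re p + t) y"
  have "y \<in> {Im p - t..Im p + t}" using aV'(2) by auto
  then have "?\<gamma> \<notin> \<Gamma>0" using N(2) y(3) by blast
  have trb: "z \<in> trace ?\<gamma> \<longleftrightarrow> \<bar>Re z - Re p\<bar> \<le> t \<and> Im z = y" for z
    unfolding trace_seg by (auto simp: sg_def abs_le_iff image_iff complex_eq_iff intro!: bexI[of _ "Re z"])
  have ab: "a \<in> trace ?\<gamma>" "b \<in> trace ?\<gamma>" unfolding trb using aV' s by (auto simp: a_def b_def)
  have "trace ?\<gamma> \<subseteq> ball p (4 * s)"
  proof
    fix z assume "z \<in> trace ?\<gamma>"
    then have "\<bar>al True p - al True z\<bar> \<le> t" "\<bar>al False p - al False z\<bar> < t" using aV' by (auto simp: trb al_def)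
    then show "z \<in> ball p (4 * s)" using dist_le_al[of p z True] s by auto
  qed
  then have \<gamma>P: "?\<gamma> \<in> paths_in \<Omega>"
    using ballO s continuous_on_sg by (auto simp: paths_in_def is_cpath_def seg_def is_interval_cc)
  have ug0: "\<zeta> x = \<zeta> y" if "x \<in> trace ?\<gamma> \<inter> S" "y \<in> trace ?\<gamma> \<inter> S" for x y
  proof -
    have "ugood \<zeta> (\<lambda>i. ennreal (os \<zeta> i)) ?\<gamma>" using \<Gamma>0(2) \<gamma>P \<open>?\<gamma> \<notin> \<Gamma>0\<close> by blast
    then have "ennreal \<bar>\<zeta> x - \<zeta> y\<bar> \<le> sum_along Q (\<lambda>i. ennreal (os \<zeta> i)) (trace ?\<gamma>)"
      using that unfolding ugood_def by blast
    also have "\<dots> = 0" by (simp add: os0 sum_along_eq)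
    finally show ?thesis by simp
  qed
  have conn: "connected (trace ?\<gamma>)" by (rule connected_trace[OF \<gamma>P])
  have "b \<in> trace (hs p s False t)" using aV' s by (auto simp: trace_hs al_def b_def)
  then have bH: "b \<in> hash_set p s t" by (auto simp: hash_set_def hash_def)
  have bV: "b \<notin> ?V" using s by (auto simp: box_at_def al_def b_def intro!: exI[of _ True])
  obtain q where q: "q \<in> trace ?\<gamma>" "q \<in> frontier (Q i0)"
    using meets_frontier[OF conn ab(1) aQ ab(2) noQ[OF bH]] by blast
  \<comment> \<open>The right end \<open>b\<close> lies on the frame. It is in the carpet and
    outside the square, or in a disk whose boundary values are in range; either way
    \<open>\<zeta>\<close> vanishes at a carpet point of the segment, against its nonzero value at
    \<open>q\<close>.\<close>
  have "\<exists>q'\<in>trace ?\<gamma> \<inter> S. \<zeta> q' = 0"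
  proof (cases "b \<in> S")
    case True
    then show ?thesis using ab bV by (intro bexI[of _ b]) (auto simp: \<zeta>_def)
  next
    case False
    have "b \<in> \<Omega>" using ab \<gamma>P by (auto simp: paths_in_def)
    then obtain j where j: "b \<in> Q j" using not_carpet False by blast
    have "a \<notin> Q j" using Q_unique[OF aQ, of j] j noQ[OF bH] by blast
    then obtain q' where q': "q' \<in> trace ?\<gamma>" "q' \<in> frontier (Q j)"
      using meets_frontier[OF conn ab(2) j ab(1)] by blast
    then have "\<zeta> q' = 0" using bQ[OF bH j q'(2)] \<phi>0 by (auto simp: \<zeta>_def)
    then show ?thesis using q' frontier_carpet by blast
  qed
  then show False using ug0[of q] q \<zeta>i0 frontier_carpet by (metis IntI subsetD)
qed

end

section \<open>Normalized functions\<close>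

text \<open>An empty index set would make the inner infimum infinite. Finiteness of the limit thus
  provides disks along the path arbitrarily close to \<open>x\<close>, on which the upper bound
  rests.\<close>

lemma liminf_along_bounds:
  assumes fin: "\<bar>liminf_along Q g \<gamma> x\<bar> \<noteq> \<infinity>" and e: "0 < \<epsilon>0"
    and b: "\<And>k. Q k \<inter> trace \<gamma> \<noteq> {} \<Longrightarrow> Q k \<subseteq> ball x \<epsilon>0 \<Longrightarrow> A \<le> Mx Q g k \<and> Mx Q g k \<le> B"
  shows "A \<le> liminf_along Q g \<gamma> x" "liminf_along Q g \<gamma> x \<le> B"
proof -
  define I where "I \<epsilon> = {i. Q i \<inter> trace \<gamma> \<noteq> {} \<and> Q i \<subseteq> ball x \<epsilon>}" for \<epsilon>
  have L: "liminf_along Q g \<gamma> x = (SUP \<epsilon>\<in>{0<..}. INF i\<in>I \<epsilon>. Mx Q g i)"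
    unfolding liminf_along_def I_def ..
  have ne: "I \<epsilon> \<noteq> {}" if "\<epsilon> > 0" for \<epsilon>
  proof
    assume "I \<epsilon> = {}"
    then have "(INF i\<in>I \<epsilon>. Mx Q g i) = \<infinity>" by (simp add: top_ereal_def)
    moreover have "(INF i\<in>I \<epsilon>. Mx Q g i) \<le> liminf_along Q g \<gamma> x"
      unfolding L using that by (intro SUP_upper) auto
    ultimately show False using fin by auto
  qed
  have "A \<le> (INF i\<in>I \<epsilon>0. Mx Q g i)" using b by (intro INF_greatest) (auto simp: I_def)
  also have "\<dots> \<le> liminf_along Q g \<gamma> x" unfolding L using e by (intro SUP_upper) auto
  finally show "A \<le> liminf_along Q g \<gamma> x" .
  show "liminf_along Q g \<gamma> x \<le> B"
    unfolding L
  proof (rule SUP_least)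
    fix \<epsilon> :: real assume "\<epsilon> \<in> {0<..}"
    then have "0 < min \<epsilon> \<epsilon>0" using e by simp
    from ne[OF this] obtain k where k: "k \<in> I (min \<epsilon> \<epsilon>0)" by blast
    then have "k \<in> I \<epsilon>" "k \<in> I \<epsilon>0" by (auto simp: I_def subset_iff)
    then have "(INF i\<in>I \<epsilon>. Mx Q g i) \<le> Mx Q g k" "Mx Q g k \<le> B"
      using b by (auto simp: I_def intro: INF_lower)
    then show "(INF i\<in>I \<epsilon>. Mx Q g i) \<le> B" by (rule order_trans)
  qed
qed

text \<open>Over the trivial filter the value is the top element. Applied to
  \<open>normalized_version\<close>, finiteness shows that accessible points accumulate at the point
  in question.\<close>

lemma Liminf_finite_not_bot:
  fixes f :: "'a \<Rightarrow> ereal"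
  assumes "Liminf F f \<noteq> \<infinity>"
  shows "F \<noteq> bot"
proof
  assume "F = bot"
  then have "top \<le> Liminf F f"
    unfolding Liminf_def by (intro SUP_upper2[of "\<lambda>_. False"]) auto
  then show False using assms by (simp add: top_ereal_def top_unique)
qed

context sierpinski begin

text \<open>Infinite values of \<open>g\<close> can occur only off the peripheral circles; replacing
  them by the default of \<open>real_of_ereal\<close> changes neither the discrete data nor the
  upper gradient inequality, since \<open>g\<close> is finite on the carpet along almost every
  path.\<close>

lemma W12_loc_finite_part:
  assumes g: "g \<in> W12_loc v \<Omega> Q"
  defines "h \<equiv> \<lambda>z. real_of_ereal (g z)"
  shows "fb h" "\<And>i. Mx Q g i = ereal (MM h i)" "\<And>i. osc Q g i = ennreal (os h i)"
    "ug h (\<lambda>i. ennreal (os h i))" "loc_l2 (\<lambda>i. ennreal (os h i))"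
proof -
  have fin: "\<bar>Mx Q g i\<bar> \<noteq> \<infinity>" "\<bar>mn Q g i\<bar> \<noteq> \<infinity>" for i
    using g unfolding W12_loc_def by auto
  have gh: "g z = ereal (h z)" if z: "z \<in> frontier (Q i)" for z i
  proof -
    have "mn Q g i \<le> g z" "g z \<le> Mx Q g i" unfolding mn_def Mx_def using z by (auto intro: INF_lower SUP_upper)
    then have "\<bar>g z\<bar> \<noteq> \<infinity>" using fin[of i] by auto
    then show ?thesis by (simp add: h_def ereal_real)
  qed
  have Mx: "Mx Q g i = Mx Q (\<lambda>z. ereal (h z)) i" and mn: "mn Q g i = mn Q (\<lambda>z. ereal (h z)) i" for i
    unfolding Mx_def mn_def using gh by (auto intro!: SUP_cong INF_cong)
  show fb: "fb h" using fin unfolding Mx mn by (rule fb_of_finite)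
  show "\<And>i. Mx Q g i = ereal (MM h i)" unfolding Mx by (rule Mx_real[OF fb])
  have osc: "osc Q g = (\<lambda>i. ennreal (os h i))"
    using osc_real[OF fb] unfolding osc_def Mx mn by auto
  then show "\<And>i. osc Q g i = ennreal (os h i)" by simp
  show "loc_l2 (\<lambda>i. ennreal (os h i))"
    using g unfolding W12_loc_def mem_Collect_eq osc loc_l2_def by blast
  define G where "G \<gamma> \<longleftrightarrow> (\<forall>x\<in>trace \<gamma> \<inter> S. \<forall>y\<in>trace \<gamma> \<inter> S. \<bar>g x\<bar> \<noteq> \<infinity> \<and> \<bar>g y\<bar> \<noteq> \<infinity> \<and>
     \<bar>g x - g y\<bar> \<le> enn2ereal (sum_along Q (\<lambda>i. ennreal (os h i)) (trace \<gamma>)))" for \<gamma>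
  have "\<exists>\<Gamma>0\<subseteq>paths_in \<Omega>. carpet_mod v \<Omega> Q \<Gamma>0 = 0 \<and> (\<forall>\<gamma>\<in>paths_in \<Omega> - \<Gamma>0. G \<gamma>)"
    using g unfolding W12_loc_def mem_Collect_eq osc upper_gradient_def G_def by (simp only: simp_thms)
  then obtain \<Gamma>0 where \<Gamma>0: "carpet_mod v \<Omega> Q \<Gamma>0 = 0" "\<And>\<gamma>. \<gamma> \<in> paths_in \<Omega> - \<Gamma>0 \<Longrightarrow> G \<gamma>" by blast
  show "ug h (\<lambda>i. ennreal (os h i))"
    unfolding ug_def
  proof (intro exI conjI ballI)
    show "null \<Gamma>0" using \<Gamma>0(1) by (simp add: null_def)
    fix \<gamma> assume \<gamma>: "\<gamma> \<in> paths_in \<Omega> - \<Gamma>0"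
    show "ugood h (\<lambda>i. ennreal (os h i)) \<gamma>"
      unfolding ugood_def
    proof (intro ballI)
      fix x y assume xy: "x \<in> trace \<gamma> \<inter> S" "y \<in> trace \<gamma> \<inter> S"
      have le: "\<bar>g x - g y\<bar> \<le> enn2ereal (sum_along Q (\<lambda>i. ennreal (os h i)) (trace \<gamma>))"
        using \<Gamma>0(2)[OF \<gamma>] xy unfolding G_def by blast
      have gxy: "g x = ereal (h x)" "g y = ereal (h y)" using \<Gamma>0(2)[OF \<gamma>] xy unfolding G_def by (auto simp: h_def ereal_real)
      have "ereal \<bar>h x - h y\<bar> \<le> enn2ereal (sum_along Q (\<lambda>i. ennreal (os h i)) (trace \<gamma>))"
        using le unfolding gxy by simp
      then show "ennreal \<bar>h x - h y\<bar> \<le> sum_along Q (\<lambda>i. ennreal (os h i)) (trace \<gamma>)"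
        by (subst (asm) ereal_le_enn2ereal) auto
    qed
  qed
qed

text \<open>A point on one circle has positive distance from each of finitely many other closed
  disks, and the remaining ones carry only a tail of the sum. The disk \<open>i0\<close> must be
  left out, being met by every ball about \<open>y\<close>.\<close>

lemma small_sum_near_frontier:
  assumes l2: "loc_l2 a" and y: "y \<in> frontier (Q i0)" and e: "0 < e"
  shows "\<exists>s0>0. \<forall>s. 0 < s \<and> s < s0 \<longrightarrow> compactly_in (ball y (4 * s)) \<Omega> \<and>
     sum_along Q (\<lambda>i. (if i = i0 then 0 else a i)\<^sup>2) (ball y (4 * s)) \<le> ennreal e"
proof -
  have "y \<in> \<Omega>" using y frontier_carpet by (auto simp: carpet_def)
  then obtain r where r: "r > 0" "cball y r \<subseteq> \<Omega>" using open_Omega open_contains_cball by meson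
  have cpt: "compactly_in (ball y r') \<Omega>" if "0 < r'" "r' \<le> r" for r'
  proof -
    have "closure (ball y r') = cball y r'" using that by simp
    moreover have "cball y r' \<subseteq> cball y r" using that by auto
    ultimately show ?thesis using r unfolding compactly_in_def by auto
  qed
  let ?b = "\<lambda>i. (if i = i0 then 0 else a i)\<^sup>2"
  let ?I = "indicator (meeting Q (ball y r)) :: nat \<Rightarrow> ennreal"
  have "sum_along Q ?b (ball y r) \<le> sum_along Q (\<lambda>i. (a i)\<^sup>2) (ball y r)"
    by (intro sum_along_mono) auto
  also have "\<dots> < \<infinity>" using l2 cpt[of r] r unfolding loc_l2_def by auto
  finally have "(\<Sum>i. ?b i * ?I i) < \<infinity>" unfolding sum_along_eq .
  from ennreal_suminf_tail[OF this e] obtain N where N: "(\<Sum>i. if i < N then 0 else ?b i * ?I i) \<le> ennreal e" by blast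
  have "\<forall>i\<in>{..<N} - {i0}. eventually (\<lambda>d. ball y d \<inter> Q i = {}) (at_right 0)"
  proof
    fix i assume "i \<in> {..<N} - {i0}"
    then have "y \<notin> closure (Q i)" using closure_unique[of y i i0] y closure_frontier by blast
    then obtain d where d: "d > 0" "ball y d \<subseteq> - closure (Q i)"
      using open_contains_ball[of "- closure (Q i)"] by auto
    then have "\<forall>d'. 0 < d' \<and> d' < d \<longrightarrow> ball y d' \<inter> Q i = {}"
      using closure_subset[of "Q i"] by (auto simp: subset_iff)
    then show "eventually (\<lambda>d. ball y d \<inter> Q i = {}) (at_right 0)"
      unfolding eventually_at_right_field using d(1) by auto
  qed
  then have "eventually (\<lambda>d. \<forall>i\<in>{..<N} - {i0}. ball y d \<inter> Q i = {}) (at_right 0)"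
    by (intro eventually_ball_finite) auto
  then obtain d where d: "d > 0" "\<And>d' i. 0 < d' \<Longrightarrow> d' < d \<Longrightarrow> i \<in> {..<N} - {i0} \<Longrightarrow> ball y d' \<inter> Q i = {}"
    unfolding eventually_at_right_field by blast
  define s0 where "s0 = min (r / 4) (d / 4)"
  have "sum_along Q ?b (ball y (4 * s)) \<le> ennreal e" if s: "0 < s" "s < s0" for s
  proof -
    have "sum_along Q ?b (ball y (4 * s)) \<le> (\<Sum>i. if i < N then 0 else ?b i * ?I i)"
      unfolding sum_along_eq
    proof (intro suminf_le)
      fix i
      have "ball y (4 * s) \<subseteq> ball y r" using s by (intro subset_ball) (auto simp: s0_def)
      then have "meeting Q (ball y (4 * s)) \<subseteq> meeting Q (ball y r)" by (rule meeting_mono)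
      moreover have "i \<notin> meeting Q (ball y (4 * s))" if "i < N" "i \<noteq> i0"
        using d(2)[of "4 * s" i] that s by (auto simp: meeting_def s0_def)
      ultimately show "?b i * indicator (meeting Q (ball y (4 * s))) i \<le> (if i < N then 0 else ?b i * ?I i)"
        by (auto simp: indicator_def)
    qed auto
    then show ?thesis using N by (rule order_trans)
  qed
  moreover have "compactly_in (ball y (4 * s)) \<Omega>" if "0 < s" "s < s0" for s
    using that by (intro cpt) (auto simp: s0_def)
  moreover have "0 < s0" using r d by (simp add: s0_def)
  ultimately show ?thesis by blast
qed

lemma not_in_box_at: "w \<noteq> y \<Longrightarrow> \<exists>\<rho>>0. \<forall>t\<le>\<rho>. w \<notin> box_at y t"
proof -
  assume "w \<noteq> y"
  then obtain d where "al d w \<noteq> al d y" by (metis sg_al)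
  then show ?thesis
    by (intro exI[of _ "\<bar>al d w - al d y\<bar>"]) (auto simp: box_at_def not_less)
qed

lemma center_in_box_at: "0 < t \<Longrightarrow> y \<in> box_at y t"
  by (simp add: box_at_def)

text \<open>A good path ending on a peripheral circle crosses small square frames around its endpoint, and it
  does so inside a peripheral disk because it meets the carpet in a set of length zero; the frame also
  meets the peripheral disk at the endpoint.\<close>

lemma good_path_end:
  fixes g :: "complex \<Rightarrow> ereal"
  assumes g: "g \<in> W12_loc v \<Omega> Q" and h: "h = (\<lambda>z. real_of_ereal (g z))"
    and y: "y \<in> frontier (Q i0)" and \<gamma>0: "\<gamma>0 \<in> good_paths \<Omega> Q g"
    and J: "J \<subseteq> fst \<gamma>0" "is_interval J" and c: "c = snd \<gamma>0"
    and Q0: "c ` J \<inter> Q i0 = {}" and yc: "y \<notin> c ` J"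
    and e: "e \<in> closure J" "c e = y" and \<eta>: "0 < \<eta>"
  shows "\<exists>\<delta>>0. \<forall>t\<in>J. \<bar>t - e\<bar> < \<delta> \<longrightarrow> (\<forall>k. c t \<in> Q k \<longrightarrow> \<bar>MM h k - MM h i0\<bar> \<le> 36 * os h i0 + 10 * \<eta>)"
proof -
  note G = W12_loc_finite_part[OF g, folded h]
  have \<gamma>P: "is_interval (fst \<gamma>0)" "bounded (fst \<gamma>0)" "continuous_on (closure (fst \<gamma>0)) c" "c ` fst \<gamma>0 \<subseteq> \<Omega>"
    and H1: "hausdorff1 (trace \<gamma>0 \<inter> S) = 0"
    and gd: "\<And>\<gamma>' i1 i2. \<gamma>' \<in> subpaths \<gamma>0 \<Longrightarrow> i1 \<in> meeting Q (trace \<gamma>') \<Longrightarrow> i2 \<in> meeting Q (trace \<gamma>') \<Longrightarrow>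
        \<bar>Mx Q g i1 - Mx Q g i2\<bar> \<le> enn2ereal (sum_along Q (osc Q g) (trace \<gamma>'))"
    and gs: "\<And>\<gamma>'. \<gamma>' \<in> subpaths \<gamma>0 \<Longrightarrow> compactly_in (trace \<gamma>') \<Omega> \<Longrightarrow> sum_along Q (osc Q g) (trace \<gamma>') < \<infinity>"
    using \<gamma>0 unfolding good_paths_def paths_in_def is_cpath_def trace_def c by auto
  have osc: "osc Q g = (\<lambda>i. ennreal (os h i))" using G(3) by auto
  have contJ: "continuous_on (closure J) c"
    using \<gamma>P(3) closure_mono[OF J(1)] by (rule continuous_on_subset)
  have ends: "\<exists>d>0. \<forall>t\<in>closure J. \<bar>t - e\<bar> < d \<longrightarrow> c t \<in> U" if U: "open U" "y \<in> U" for U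
  proof -
    obtain r where r: "r > 0" "ball y r \<subseteq> U" using U openE by blast
    obtain d where "d > 0" "\<forall>t\<in>closure J. dist t e < d \<longrightarrow> dist (c t) (c e) < r"
      using contJ e(1) r(1) unfolding continuous_on_iff by blast
    then show ?thesis using r(2) e(2) by (intro exI[of _ d]) (auto simp: dist_real_def dist_commute subset_iff)
  qed
  have Jcl: "t \<in> closure J" if "t \<in> J" for t using that closure_subset by blast
  have near: "\<exists>t\<in>J. \<bar>t - e\<bar> < d" if "d > 0" for d
    using e(1) that unfolding closure_approachable dist_real_def by blast
  have yO: "y \<in> \<Omega>" using y frontier_carpet by (auto simp: carpet_def)
  obtain r where r: "r > 0" "cball y r \<subseteq> \<Omega>" using yO open_Omega open_contains_cball by meson
  obtain d0 where d0: "d0 > 0" "\<And>t. t \<in> closure J \<Longrightarrow> \<bar>t - e\<bar> < d0 \<Longrightarrow> c t \<in> ball y r"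
    using ends[of "ball y r"] r by auto
  define Jd where "Jd d = J \<inter> {e - d<..<e + d}" for d
  have Jdt: "t \<in> Jd d \<longleftrightarrow> t \<in> J \<and> \<bar>t - e\<bar> < d" for t d by (auto simp: Jd_def)
  have sub: "(Jd d, c) \<in> subpaths \<gamma>0" if "d > 0" for d
  proof -
    have "is_interval (Jd d)" unfolding Jd_def by (intro is_interval_Int J is_interval_oo)
    moreover have "Jd d \<noteq> {}" using near[OF that] Jdt by blast
    moreover have "Jd d \<subseteq> fst \<gamma>0" using J(1) by (auto simp: Jd_def)
    ultimately show ?thesis unfolding subpaths_def c by blast
  qed
  have "trace (Jd d0, c) \<subseteq> ball y r" using d0(2) Jcl by (auto simp: trace_def Jdt)
  then have "bounded (trace (Jd d0, c))" "closure (trace (Jd d0, c)) \<subseteq> closure (ball y r)"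
    using bounded_subset[OF bounded_ball] closure_mono by blast+
  then have "compactly_in (trace (Jd d0, c)) \<Omega>"
    using r unfolding compactly_in_def compact_closure by auto
  from gs[OF sub[OF d0(1)] this]
  have "(\<Sum>i. ennreal (os h i) * indicator (meeting Q (trace (Jd d0, c))) i) < \<infinity>"
    unfolding osc sum_along_eq .
  from ennreal_suminf_tail[OF this \<eta>] obtain N where
    N: "(\<Sum>i. if i < N then 0 else ennreal (os h i) * indicator (meeting Q (trace (Jd d0, c))) i) \<le> ennreal \<eta>" by blast
  \<comment> \<open>Near the endpoint the path avoids the first \<open>N\<close> disks:
    \<open>i0\<close> by assumption and the others by distance. What remains is the tail of the
    sum.\<close>
  define U where "U = - (\<Union>i\<in>{..<N} - {i0}. closure (Q i))"
  have "open U" unfolding U_def by (intro open_Compl closed_UN) auto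
  moreover have "y \<in> U" using y closure_unique[of y _ i0] closure_frontier unfolding U_def by blast
  ultimately obtain d1' where d1': "d1' > 0" "\<And>t. t \<in> closure J \<Longrightarrow> \<bar>t - e\<bar> < d1' \<Longrightarrow> c t \<in> U"
    using ends by blast
  define d1 where "d1 = min d0 d1'"
  have d1: "d1 > 0" using d0 d1' by (simp add: d1_def)
  have J10: "Jd d1 \<subseteq> Jd d0" by (auto simp: Jd_def d1_def)
  let ?T = "trace (Jd d1, c)"
  have sumT: "sum_along Q (\<lambda>i. ennreal (os h i)) ?T \<le> ennreal \<eta>"
  proof -
    have "sum_along Q (\<lambda>i. ennreal (os h i)) ?T \<le>
        (\<Sum>i. if i < N then 0 else ennreal (os h i) * indicator (meeting Q (trace (Jd d0, c))) i)"
      unfolding sum_along_eq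
    proof (intro suminf_le)
      fix i
      have "meeting Q ?T \<subseteq> meeting Q (trace (Jd d0, c))"
        using J10 by (intro meeting_mono) (auto simp: trace_def)
      moreover have "i \<notin> meeting Q ?T" if "i < N"
      proof
        assume "i \<in> meeting Q ?T"
        then obtain t where t: "t \<in> Jd d1" "c t \<in> Q i" by (auto simp: meeting_def trace_def)
        then have "t \<in> J" "\<bar>t - e\<bar> < d1'" by (auto simp: Jdt d1_def)
        then have "c t \<in> U" using d1'(2) Jcl by blast
        moreover have "i \<noteq> i0" using Q0 t(2) \<open>t \<in> J\<close> by blast
        ultimately show False using t(2) closure_subset[of "Q i"] that unfolding U_def by blast
      qed
      ultimately show "ennreal (os h i) * indicator (meeting Q ?T) i \<le>
          (if i < N then 0 else ennreal (os h i) * indicator (meeting Q (trace (Jd d0, c))) i)"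
        by (auto simp: indicator_def)
    qed auto
    then show ?thesis using N by (rule order_trans)
  qed
  have close: "\<bar>MM h k - MM h l\<bar> \<le> \<eta>" if kl: "k \<in> meeting Q ?T" "l \<in> meeting Q ?T" for k l
  proof -
    have "\<bar>Mx Q g k - Mx Q g l\<bar> \<le> enn2ereal (sum_along Q (\<lambda>i. ennreal (os h i)) ?T)"
      using gd[OF sub[OF d1] kl] unfolding osc .
    then have "ereal \<bar>MM h k - MM h l\<bar> \<le> enn2ereal (sum_along Q (\<lambda>i. ennreal (os h i)) ?T)"
      unfolding G(2) by simp
    then have "ennreal \<bar>MM h k - MM h l\<bar> \<le> sum_along Q (\<lambda>i. ennreal (os h i)) ?T"
      by (subst (asm) ereal_le_enn2ereal) auto
    also have "\<dots> \<le> ennreal \<eta>" by (rule sumT)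
    finally show ?thesis using \<eta> by (simp add: ennreal_le_iff)
  qed
  obtain t1 where t1: "t1 \<in> Jd d1" using near[OF d1] Jdt by blast
  then have "c t1 \<noteq> y" using yc by (auto simp: Jd_def)
  then obtain \<rho>0 where \<rho>0: "\<rho>0 > 0" "\<And>t. t \<le> \<rho>0 \<Longrightarrow> c t1 \<notin> box_at y t" using not_in_box_at by blast
  \<comment> \<open>A point of the disk \<open>i0\<close> outside all small squares about
    \<open>y\<close>; since the disk also accumulates at \<open>y\<close>, it must cross the
    frame.\<close>
  obtain z1 where z1: "z1 \<in> Q i0" using Q_nonempty by blast
  then have "z1 \<noteq> y" using frontier_not_Q[OF y] by blast
  then obtain \<rho>1 where \<rho>1: "\<rho>1 > 0" "\<And>t. t \<le> \<rho>1 \<Longrightarrow> z1 \<notin> box_at y t" using not_in_box_at by blast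
  \<comment> \<open>With the energy bound \<open>\<eta> / (64 * k)\<close> below, both terms of
    \<open>good_hash\<close> are at most \<open>\<eta> / 64\<close>, and 32 times their sum is at
    most \<open>\<eta>\<close>.\<close>
  define k where "k = 64 * 64 / K1 / \<eta>"
  have k: "k > 0" using K1 \<eta> by (simp add: k_def)
  \<comment> \<open>The oscillation on \<open>i0\<close> does not become small near
    \<open>y\<close>. It is removed here and put back once for each of the four segments, which
    gives \<open>4 * os h i0\<close>.\<close>
  define a where "a i = (if i = i0 then 0 else ennreal (os h i))" for i
  obtain s0 where s0: "s0 > 0" "\<And>s. 0 < s \<Longrightarrow> s < s0 \<Longrightarrow> compactly_in (ball y (4 * s)) \<Omega>"
      "\<And>s. 0 < s \<Longrightarrow> s < s0 \<Longrightarrow> sum_along Q (\<lambda>i. (a i)\<^sup>2) (ball y (4 * s)) \<le> ennreal (\<eta> / (64 * k))"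
    using small_sum_near_frontier[OF G(5) y, of "\<eta> / (64 * k)"] \<eta> k unfolding a_def by auto
  define s where "s = min s0 (min \<rho>0 \<rho>1) / 4"
  have s: "0 < s" "s < s0" "2 * s \<le> \<rho>0" "2 * s \<le> \<rho>1" using s0(1) \<rho>0(1) \<rho>1(1) by (auto simp: s_def)
  have ballO: "ball y (4 * s) \<subseteq> \<Omega>" using s0(2)[OF s(1,2)] closure_subset unfolding compactly_in_def by blast
  obtain \<Gamma> where \<Gamma>: "null \<Gamma>" "\<And>\<gamma>. \<gamma> \<in> paths_in \<Omega> - \<Gamma> \<Longrightarrow> ugood h (\<lambda>i. ennreal (os h i)) \<gamma>"
    using G(4) unfolding ug_def by blast
  \<comment> \<open>The half-sides for which the frame could meet the path in the carpet. They form
    a null set, because the path meets the carpet in length zero.\<close>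
  define B where "B d = (\<lambda>w. \<bar>al d w - al d y\<bar>) ` (trace \<gamma>0 \<inter> S)" for d
  have "B d \<in> null_sets lebesgue" for d
    unfolding B_def
  proof (rule null_projection_of_hausdorff1_null[OF H1])
    fix z w show "\<bar>\<bar>al d z - al d y\<bar> - \<bar>al d w - al d y\<bar>\<bar> \<le> dist z w"
      using abs_al_le_dist[of d z w] by linarith
  qed
  then have "AE t in lebesgue. t \<notin> B d" for d by (rule AE_not_in)
  then have "AE t in lborel. t \<notin> B d" for d by (simp add: AE_completion_iff)
  then have "AE t in lborel. \<forall>d. t \<notin> B d" by (simp add: AE_all_countable)
  moreover have fin: "sum_along Q (\<lambda>i. (a i)\<^sup>2) (ball y (4 * s)) < \<infinity>"
    by (rule le_less_trans[OF s0(3)[OF s(1,2)]]) simp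
  ultimately obtain t where
    t: "s < t" "t < 2 * s" "\<And>d. t \<notin> B d" "\<And>d \<tau>. (d, \<tau>) \<in> hash t \<Longrightarrow> hs y s d \<tau> \<notin> \<Gamma>"
    "hash_sum y s a t \<le> 32 * (ennreal k * sum_along Q (\<lambda>i. (a i)\<^sup>2) (ball y (4 * s)) + ennreal (64 / K1 / k))"
    using good_hash[OF s(1) k fin \<Gamma>(1), of "\<lambda>t. \<forall>d. t \<notin> B d"] by blast
  have t0: "0 < t" "t \<le> 2 * s" using t s by auto
  have hsum: "hash_sum y s a t \<le> ennreal \<eta>"
  proof -
    have "hash_sum y s a t \<le> 32 * (ennreal k * ennreal (\<eta> / (64 * k)) + ennreal (64 / K1 / k))"
      by (rule order_trans[OF t(5)]) (intro mult_left_mono add_mono s0(3) s order_refl, auto)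
    also have "ennreal k * ennreal (\<eta> / (64 * k)) + ennreal (64 / K1 / k) = ennreal (k * (\<eta> / (64 * k)) + 64 / K1 / k)"
      using k \<eta> K1 by (subst ennreal_plus) (simp_all add: ennreal_mult[symmetric])
    also have "32 * \<dots> = ennreal (32 * (k * (\<eta> / (64 * k)) + 64 / K1 / k))"
      using k \<eta> K1 by (subst ennreal_mult) simp_all
    also have "32 * (k * (\<eta> / (64 * k)) + 64 / K1 / k) = \<eta>"
      using k \<eta> K1 by (simp add: k_def field_simps)
    finally show ?thesis .
  qed
  have hsum': "hash_sum y s (\<lambda>i. ennreal (os h i)) t \<le> ennreal (\<eta> + 4 * os h i0)"
  proof -
    have one: "sum_along Q (\<lambda>i. ennreal (os h i)) W \<le> sum_along Q a W + ennreal (os h i0)" for W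
    proof -
      have "sum_along Q (\<lambda>i. ennreal (os h i)) W \<le> sum_along Q (\<lambda>i. a i + (if i = i0 then ennreal (os h i0) else 0)) W"
        by (intro sum_along_mono) (auto simp: a_def)
      also have "\<dots> = sum_along Q a W + sum_along Q (\<lambda>i. if i = i0 then ennreal (os h i0) else 0) W"
        by (rule sum_along_add)
      also have "sum_along Q (\<lambda>i. if i = i0 then ennreal (os h i0) else 0) W \<le> (\<Sum>i. if i = i0 then ennreal (os h i0) else 0)"
        by (rule sum_along_le_suminf)
      also have "\<dots> = (\<Sum>i\<in>{i0}. if i = i0 then ennreal (os h i0) else 0)" by (rule suminf_finite) auto
      finally show ?thesis by (simp add: add_left_mono)
    qed
    have "hash_sum y s (\<lambda>i. ennreal (os h i)) t \<le>
       (sum_along Q a (trace (hs y s True t)) + ennreal (os h i0)) + (sum_along Q a (trace (hs y s True (-t))) + ennreal (os h i0)) +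
       (sum_along Q a (trace (hs y s False t)) + ennreal (os h i0)) + (sum_along Q a (trace (hs y s False (-t))) + ennreal (os h i0))"
      unfolding hash_sum_def by (intro add_mono one)
    also have "\<dots> = hash_sum y s a t + (ennreal (os h i0) + ennreal (os h i0) + ennreal (os h i0) + ennreal (os h i0))"
      unfolding hash_sum_def by (simp add: ac_simps)
    also have "\<dots> \<le> ennreal \<eta> + (ennreal (os h i0) + ennreal (os h i0) + ennreal (os h i0) + ennreal (os h i0))"
      by (intro add_right_mono hsum)
    also have "\<dots> = ennreal (\<eta> + 4 * os h i0)"
      using \<eta> os_nonneg[OF G(1), of i0] by (simp flip: ennreal_plus)
    finally show ?thesis .
  qed
  have hash_g: "ugood h (\<lambda>i. ennreal (os h i)) (hs y s d \<tau>)" if "(d, \<tau>) \<in> hash t" for d \<tau>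
  proof -
    have "\<bar>\<tau>\<bar> < 2 * s" using that t0 t by (auto simp: hash_def)
    then have "hs y s d \<tau> \<in> paths_in \<Omega>" using trace_hs_ball ballO s(1) by (intro hs_paths_in) blast+
    then show ?thesis using \<Gamma>(2) t(4)[OF that] by blast
  qed
  have contJd: "continuous_on (Jd d1) c"
    by (rule continuous_on_subset[OF contJ]) (use Jcl in \<open>auto simp: Jd_def\<close>)
  have "is_interval (Jd d1)" unfolding Jd_def by (intro is_interval_Int J is_interval_oo)
  then have connT: "connected ?T"
    unfolding trace_def by (auto intro!: connected_continuous_image contJd simp: is_interval_connected_1)
  obtain d2 where d2: "d2 > 0" "\<And>t'. t' \<in> closure J \<Longrightarrow> \<bar>t' - e\<bar> < d2 \<Longrightarrow> c t' \<in> box_at y t"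
    using ends[OF open_box_at center_in_box_at[OF t0(1)]] by blast
  obtain t2 where t2: "t2 \<in> J" "\<bar>t2 - e\<bar> < min d1 d2" using near[of "min d1 d2"] d1 d2 by auto
  have x2: "c t2 \<in> ?T" "c t2 \<in> box_at y t" using t2 d2(2)[of t2] Jcl by (auto simp: trace_def Jdt)
  have x1: "c t1 \<in> ?T" "c t1 \<notin> box_at y t" using t1 \<rho>0(2)[of t] t0 s by (auto simp: trace_def)
  obtain w where w: "w \<in> ?T" "w \<in> hash_set y s t" using crosses_hash[OF connT t0(2) x2 x1] by blast
  obtain d \<tau> where wd: "(d, \<tau>) \<in> hash t" "w \<in> trace (hs y s d \<tau>)" using w(2) unfolding hash_set_def by blast
  have "\<bar>al (\<not> d) w - al (\<not> d) y\<bar> = t" using wd t0 by (auto simp: trace_hs hash_def)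
  moreover have wT: "w \<in> trace \<gamma>0" using w(1) J(1) by (auto simp: trace_def Jd_def c)
  ultimately have "w \<notin> S" using t(3)[of "\<not> d"] unfolding B_def by blast
  moreover have "w \<in> \<Omega>" using wT \<gamma>P(4) by (auto simp: trace_def c)
  ultimately obtain l where l: "w \<in> Q l" using not_carpet by blast
  then have lT: "l \<in> meeting Q ?T" using w(1) by (auto simp: meeting_def)
  have "y \<in> closure (Q i0)" using y closure_frontier by blast
  then obtain z2 where z2: "z2 \<in> Q i0" "z2 \<in> box_at y t"
    using open_Int_closure_eq_empty[OF open_box_at, of y t "Q i0"] center_in_box_at[OF t0(1)] by blast
  have "z1 \<notin> box_at y t" using \<rho>1(2)[of t] t0 s by auto
  then obtain w' where w': "w' \<in> Q i0" "w' \<in> hash_set y s t"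
    using crosses_hash[OF Q_connected t0(2) z2 z1] by blast
  obtain d' \<tau>' where wd': "(d', \<tau>') \<in> hash t" "w' \<in> trace (hs y s d' \<tau>')" using w'(2) unfolding hash_set_def by blast
  \<comment> \<open>The factor 9 of \<open>hash_ext\<close> turns \<open>4 * os h i0\<close> into
    the 36 of the statement; the tenth \<open>\<eta>\<close> comes from moving along the
    path.\<close>
  have "\<bar>ext h w - ext h w'\<bar> \<le> 9 * (\<eta> + 4 * os h i0)"
    by (rule hash_ext[OF G(1) s(1) t0(1) t(2) ballO hash_g hsum' _ wd wd']) (use \<eta> os_nonneg[OF G(1), of i0] in auto)
  then have li0: "\<bar>MM h l - MM h i0\<bar> \<le> 36 * os h i0 + 9 * \<eta>" using ext_Q[OF l, of h] ext_Q[OF w'(1), of h] by simp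
  show ?thesis
  proof (intro exI[of _ d1] conjI ballI impI allI)
    fix t' k assume t': "t' \<in> J" "\<bar>t' - e\<bar> < d1" "c t' \<in> Q k"
    then have "k \<in> meeting Q ?T" by (auto simp: meeting_def trace_def Jdt)
    from close[OF this lT] li0 show "\<bar>MM h k - MM h i0\<bar> \<le> 36 * os h i0 + 10 * \<eta>" by linarith
  qed (rule d1)
qed

text \<open>If disks along the path arbitrarily near \<open>y\<close> violated the estimate,
  parameters in them would accumulate at some \<open>e\<close> with \<open>c e = y\<close>,
  contradicting \<open>good_path_end\<close>. Compactness is needed since points of the path near
  \<open>y\<close> need not have parameters near one fixed end.\<close>

lemma access_value_compare:
  fixes g :: "complex \<Rightarrow> ereal"
  assumes g: "g \<in> W12_loc v \<Omega> Q" and h: "h = (\<lambda>z. real_of_ereal (g z))"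
    and y: "y \<in> frontier (Q i0)" and acc: "accessible \<Omega> Q g y" and r: "access_value \<Omega> Q g y = ereal r"
  shows "\<bar>r - MM h i0\<bar> \<le> 36 * os h i0"
proof -
  note G = W12_loc_finite_part[OF g, folded h]
  define \<gamma> where "\<gamma> = (SOME \<gamma>. \<exists>\<gamma>0 \<in> good_paths \<Omega> Q g. access_via \<Omega> Q y \<gamma>0 \<gamma>)"
  have "\<exists>\<gamma>. \<exists>\<gamma>0 \<in> good_paths \<Omega> Q g. access_via \<Omega> Q y \<gamma>0 \<gamma>" using acc by (auto simp: accessible_def)
  then have "\<exists>\<gamma>0 \<in> good_paths \<Omega> Q g. access_via \<Omega> Q y \<gamma>0 \<gamma>" unfolding \<gamma>_def by (rule someI_ex)
  then obtain \<gamma>0 where \<gamma>0: "\<gamma>0 \<in> good_paths \<Omega> Q g" "access_via \<Omega> Q y \<gamma>0 \<gamma>" by blast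
  have "y \<notin> carpet_core \<Omega> Q" using y by (auto simp: carpet_core_def)
  then have av: "\<gamma> \<in> open_subpaths \<gamma>0" "y \<in> closure (trace \<gamma>)" "y \<notin> trace \<gamma>" "trace \<gamma> \<inter> Q i0 = {}"
    using \<gamma>0(2) y by (auto simp: access_via_def)
  define J c where "J = fst \<gamma>" and "c = snd \<gamma>0"
  have J: "J \<subseteq> fst \<gamma>0" "is_interval J" "\<gamma> = (J, c)"
    using av(1) by (auto simp: open_subpaths_def subpaths_def J_def c_def)
  have tr: "trace \<gamma> = c ` J" by (simp add: J(3) trace_def)
  have cp: "is_cpath \<gamma>0" using \<gamma>0(1) by (auto simp: good_paths_def paths_in_def)
  have cont: "continuous_on (closure J) c"
    using cp closure_mono[OF J(1)] unfolding is_cpath_def c_def by (blast intro: continuous_on_subset)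
  have cJ: "compact (closure J)"
    using cp bounded_subset[OF _ J(1)] unfolding is_cpath_def by (auto simp: compact_closure)
  have bound: "\<bar>r - MM h i0\<bar> \<le> 36 * os h i0 + 10 * \<eta>" if \<eta>: "\<eta> > 0" for \<eta>
  proof -
    have "\<exists>\<epsilon>0>0. \<forall>k. Q k \<inter> trace \<gamma> \<noteq> {} \<longrightarrow> Q k \<subseteq> ball y \<epsilon>0 \<longrightarrow> \<bar>MM h k - MM h i0\<bar> \<le> 36 * os h i0 + 10 * \<eta>"
    proof (rule ccontr)
      assume no: "\<not> ?thesis"
      have "\<exists>k t. t \<in> J \<and> c t \<in> Q k \<and> Q k \<subseteq> ball y (1 / Suc n) \<and> \<not> \<bar>MM h k - MM h i0\<bar> \<le> 36 * os h i0 + 10 * \<eta>" for n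
      proof -
        have "0 < 1 / real (Suc n)" by simp
        then obtain k where k: "Q k \<inter> trace \<gamma> \<noteq> {}" "Q k \<subseteq> ball y (1 / Suc n)" "\<not> \<bar>MM h k - MM h i0\<bar> \<le> 36 * os h i0 + 10 * \<eta>"
          using no by blast
        then show ?thesis unfolding tr by blast
      qed
      then obtain k t where kt: "\<And>n::nat. t n \<in> J" "\<And>n. c (t n) \<in> Q (k n)" "\<And>n. Q (k n) \<subseteq> ball y (1 / Suc n)"
          "\<And>n. \<not> \<bar>MM h (k n) - MM h i0\<bar> \<le> 36 * os h i0 + 10 * \<eta>" by metis
      have tJ: "t n \<in> closure J" for n using kt(1) closure_subset by blast
      then obtain e \<sigma> where e: "e \<in> closure J" "strict_mono \<sigma>" "(t \<circ> \<sigma>) \<longlonglongrightarrow> e"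
        using cJ unfolding compact_def by blast
      have d: "dist (c (t n)) y \<le> inverse (real (Suc n))" for n
        using subsetD[OF kt(3) kt(2), of n] by (simp add: dist_commute inverse_eq_divide less_imp_le)
      have "(\<lambda>n. dist (c (t n)) y) \<longlonglongrightarrow> 0"
        by (rule tendsto_sandwich[OF _ _ tendsto_const LIMSEQ_inverse_real_of_nat]) (use d in \<open>simp_all del: of_nat_Suc\<close>)
      then have "(\<lambda>n. c (t n)) \<longlonglongrightarrow> y" by (rule iffD2[OF tendsto_dist_iff])
      from LIMSEQ_subseq_LIMSEQ[OF this e(2)] have "(\<lambda>n. c ((t \<circ> \<sigma>) n)) \<longlonglongrightarrow> y" by (simp add: comp_def)
      moreover have "(\<lambda>n. c ((t \<circ> \<sigma>) n)) \<longlonglongrightarrow> c e"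
        using cont e(1,3) tJ by (intro continuous_on_tendsto_compose[OF cont e(3) e(1)]) (auto intro!: always_eventually)
      ultimately have ce: "c e = y" using LIMSEQ_unique by blast
      have "c ` J \<inter> Q i0 = {}" "y \<notin> c ` J" using av(3,4) tr by auto
      from good_path_end[OF g h y \<gamma>0(1) J(1,2) c_def this e(1) ce \<eta>] obtain \<delta> where
        \<delta>: "\<delta> > 0" "\<And>t k. t \<in> J \<Longrightarrow> \<bar>t - e\<bar> < \<delta> \<Longrightarrow> c t \<in> Q k \<Longrightarrow> \<bar>MM h k - MM h i0\<bar> \<le> 36 * os h i0 + 10 * \<eta>" by blast
      obtain n where "dist ((t \<circ> \<sigma>) n) e < \<delta>" using metric_LIMSEQ_D[OF e(3) \<delta>(1)] by blast
      then show False using \<delta>(2)[of "t (\<sigma> n)" "k (\<sigma> n)"] kt by (auto simp: dist_real_def)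
    qed
    then obtain \<epsilon>0 where \<epsilon>0: "\<epsilon>0 > 0" "\<And>k. Q k \<inter> trace \<gamma> \<noteq> {} \<Longrightarrow> Q k \<subseteq> ball y \<epsilon>0 \<Longrightarrow> \<bar>MM h k - MM h i0\<bar> \<le> 36 * os h i0 + 10 * \<eta>"
      by blast
    have L: "liminf_along Q g \<gamma> y = ereal r" using r unfolding access_value_def \<gamma>_def .
    then have fin: "\<bar>liminf_along Q g \<gamma> y\<bar> \<noteq> \<infinity>" by simp
    have "ereal (MM h i0 - (36 * os h i0 + 10 * \<eta>)) \<le> Mx Q g k \<and> Mx Q g k \<le> ereal (MM h i0 + (36 * os h i0 + 10 * \<eta>))"
      if "Q k \<inter> trace \<gamma> \<noteq> {}" "Q k \<subseteq> ball y \<epsilon>0" for k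
      using \<epsilon>0(2)[OF that] by (auto simp: G(2) abs_le_iff)
    from liminf_along_bounds[OF fin \<epsilon>0(1) this] show ?thesis unfolding L by auto
  qed
  show ?thesis
  proof (rule field_le_epsilon)
    fix e :: real assume "e > 0"
    then show "\<bar>r - MM h i0\<bar> \<le> 36 * os h i0 + e" using bound[of "e / 10"] by simp
  qed
qed

section \<open>Passing from peripheral circles to points of the carpet\<close>

context
  fixes g :: "complex \<Rightarrow> ereal" and u h :: "complex \<Rightarrow> real"
  assumes g: "g \<in> W12_loc v \<Omega> Q" and norm: "\<And>x. x \<in> S \<Longrightarrow> ereal (u x) = normalized_version \<Omega> Q g x"
    and h: "h = (\<lambda>z. real_of_ereal (g z))" and fbu: "fb u"
begin

lemma accessible_value: "accessible \<Omega> Q g x \<Longrightarrow> access_value \<Omega> Q g x = ereal (u x)"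
  using norm[of x] by (simp add: accessible_def normalized_version_def)

text \<open>A boundary point that is not accessible receives its finite value as a lower limit over
  accessible points of the same circle, so there are some.\<close>

lemma accessible_exists: "\<exists>y\<in>frontier (Q i). accessible \<Omega> Q g y"
proof -
  obtain x where x: "x \<in> frontier (Q i)" using frontier_nonempty by blast
  then have xS: "x \<in> S" using frontier_carpet by blast
  show ?thesis
  proof (cases "accessible \<Omega> Q g x")
    case False
    let ?A = "{y. accessible \<Omega> Q g y \<and> (\<exists>i. x \<in> frontier (Q i) \<and> y \<in> frontier (Q i))}"
    have "normalized_version \<Omega> Q g x = Liminf (at x within ?A) (access_value \<Omega> Q g)"
      using False x unfolding normalized_version_def by auto
    then have "Liminf (at x within ?A) (access_value \<Omega> Q g) = ereal (u x)" using norm[OF xS] by simp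
    then have "at x within ?A \<noteq> bot" by (intro Liminf_finite_not_bot[of _ "access_value \<Omega> Q g"]) simp
    then have "?A \<noteq> {}" by (metis at_within_empty)
    then obtain y j where "accessible \<Omega> Q g y" "x \<in> frontier (Q j)" "y \<in> frontier (Q j)" by blast
    moreover then have "j = i" using x closure_unique[of x j i] closure_frontier by blast
    ultimately show ?thesis by blast
  qed (use x in blast)
qed

text \<open>Links the maxima of \<open>g\<close>, which define the normalized values, to the extreme
  values of \<open>u\<close>, on which the maximum principle acts.\<close>

lemma compare_MM: "mm u i - 36 * os h i \<le> MM h i" "MM h i \<le> MM u i + 36 * os h i"
proof -
  obtain y where y: "y \<in> frontier (Q i)" "accessible \<Omega> Q g y" using accessible_exists by blast
  have "\<bar>u y - MM h i\<bar> \<le> 36 * os h i"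
    by (rule access_value_compare[OF g h y accessible_value[OF y(2)]])
  then show "mm u i - 36 * os h i \<le> MM h i" "MM h i \<le> MM u i + 36 * os h i"
    using mm_le[OF fbu y(1)] le_MM[OF fbu y(1)] by linarith+
qed

text \<open>The value at \<open>x\<close> is a lower limit of maxima of \<open>g\<close> over small
  disks. By square summability all sufficiently small disks near \<open>x\<close> have small
  oscillation, so the error in \<open>compare_MM\<close> disappears.\<close>

lemma accessible_bounds:
  assumes V: "open V" and x: "x \<in> V" and acc: "accessible \<Omega> Q g x"
    and b: "\<And>i. i \<in> meeting Q V \<Longrightarrow> m \<le> mm u i \<and> MM u i \<le> M"
  shows "m \<le> u x \<and> u x \<le> M"
proof -
  note G = W12_loc_finite_part[OF g, folded h]
  have "x \<in> S" using acc by (simp add: accessible_def)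
  then have xO: "x \<in> \<Omega>" by (simp add: carpet_def)
  obtain \<gamma> where L: "access_value \<Omega> Q g x = liminf_along Q g \<gamma> x" unfolding access_value_def by blast
  have Lu: "liminf_along Q g \<gamma> x = ereal (u x)" using accessible_value[OF acc] L by simp
  then have fin: "\<bar>liminf_along Q g \<gamma> x\<bar> \<noteq> \<infinity>" by simp
  have "open (V \<inter> \<Omega>)" using V open_Omega by auto
  then obtain r where r: "r > 0" "cball x r \<subseteq> V \<inter> \<Omega>" using x xO open_contains_cball by (metis IntI)
  have "compactly_in (ball x r) \<Omega>" unfolding compactly_in_def using r by auto
  then have fs: "(\<Sum>i. (ennreal (os h i))\<^sup>2 * indicator (meeting Q (ball x r)) i) < \<infinity>"
    using G(5) r(1) unfolding loc_l2_def sum_along_eq by blast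
  have bound: "m - 36 * e \<le> u x \<and> u x \<le> M + 36 * e" if e: "e > 0" for e
  proof -
    let ?F = "{i. ennreal (e\<^sup>2) \<le> (ennreal (os h i))\<^sup>2 * indicator (meeting Q (ball x r)) i}"
    have fF: "finite ?F" using fs e by (intro finite_of_suminf_finite) auto
    \<comment> \<open>A disk contained in a ball of radius \<open>dm i / 3\<close> has diameter at
      most two thirds of \<open>dm i\<close>, so the finitely many disks of large oscillation do not
      fit into the ball of radius \<open>\<epsilon>0\<close>.\<close>
    define \<epsilon>0 where "\<epsilon>0 = Min (insert r ((\<lambda>i. dm i / 3) ` ?F))"
    have fI: "finite (insert r ((\<lambda>i. dm i / 3) ` ?F))" by (intro finite.insertI finite_imageI fF)
    have "\<epsilon>0 \<in> insert r ((\<lambda>i. dm i / 3) ` ?F)" unfolding \<epsilon>0_def by (rule Min_in[OF fI]) blast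
    then have "\<epsilon>0 = r \<or> (\<exists>i. \<epsilon>0 = dm i / 3)" by blast
    then have \<epsilon>0_pos: "\<epsilon>0 > 0"
    proof (elim disjE exE)
      fix i assume "\<epsilon>0 = dm i / 3"
      then show ?thesis using dm_pos[of i] by simp
    qed (use r(1) in simp)
    have \<epsilon>0_r: "\<epsilon>0 \<le> r" unfolding \<epsilon>0_def by (rule Min_le[OF fI]) blast
    have \<epsilon>0_dm: "\<epsilon>0 \<le> dm i / 3" if "i \<in> ?F" for i
      unfolding \<epsilon>0_def by (rule Min_le[OF fI]) (use that in blast)
    note \<epsilon>0 = \<epsilon>0_pos \<epsilon>0_r \<epsilon>0_dm
    have "ereal (m - 36 * e) \<le> Mx Q g k \<and> Mx Q g k \<le> ereal (M + 36 * e)"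
      if k: "Q k \<inter> trace \<gamma> \<noteq> {}" "Q k \<subseteq> ball x \<epsilon>0" for k
    proof -
      have sub: "Q k \<subseteq> ball x r" using k(2) \<epsilon>0(2) subset_ball[of \<epsilon>0 r x] by blast
      then have mk: "k \<in> meeting Q (ball x r)" using Q_nonempty[of k] by (auto simp: meeting_def)
      have "Q k \<subseteq> V" using sub r(2) ball_subset_cball[of x r] by blast
      then have "k \<in> meeting Q V" using Q_nonempty[of k] by (auto simp: meeting_def)
      from b[OF this] have mM: "m \<le> mm u k" "MM u k \<le> M" by auto
      have "k \<notin> ?F"
      proof
        assume "k \<in> ?F"
        then have "\<epsilon>0 \<le> dm k / 3" by (rule \<epsilon>0(3))
        moreover have "dm k \<le> 2 * \<epsilon>0"
        proof -
          have "dm k \<le> diameter (ball x \<epsilon>0)" using k(2) by (intro diameter_subset) auto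
          then show ?thesis using \<epsilon>0(1) by simp
        qed
        ultimately show False using dm_pos[of k] by linarith
      qed
      then have "\<not> ennreal (e\<^sup>2) \<le> ennreal ((os h k)\<^sup>2)" using mk os_nonneg[OF G(1), of k] by (simp add: ennreal_power)
      then have "(os h k)\<^sup>2 < e\<^sup>2" by (meson ennreal_leI not_le_imp_less)
      then have "os h k < e" by (rule power2_less_imp_less) (use e in simp)
      then show ?thesis using compare_MM[of k] mM unfolding G(2) by auto
    qed
    from liminf_along_bounds[OF fin \<epsilon>0(1) this] show ?thesis unfolding Lu by auto
  qed
  have "m \<le> u x"
  proof (rule field_le_epsilon)
    fix e :: real assume "e > 0"
    then show "m \<le> u x + e" using bound[of "e / 36"] by simp
  qed
  moreover have "u x \<le> M"
  proof (rule field_le_epsilon)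
    fix e :: real assume "e > 0"
    then show "u x \<le> M + e" using bound[of "e / 36"] by simp
  qed
  ultimately show ?thesis by blast
qed

text \<open>The remaining values are lower limits of values at accessible points, which eventually
  lie in the open set \<open>V\<close>.\<close>

lemma normalized_bounds:
  assumes V: "open V" and x: "x \<in> V" "x \<in> S"
    and b: "\<And>i. i \<in> meeting Q V \<Longrightarrow> m \<le> mm u i \<and> MM u i \<le> M"
  shows "m \<le> u x \<and> u x \<le> M"
proof (cases "accessible \<Omega> Q g x")
  case True
  show ?thesis by (rule accessible_bounds[OF V x(1) True b])
next
  case False
  obtain A where A: "normalized_version \<Omega> Q g x = Liminf (at x within A) (access_value \<Omega> Q g)"
    "\<And>y. y \<in> A \<Longrightarrow> accessible \<Omega> Q g y"
  proof (cases "\<exists>i. x \<in> frontier (Q i)")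
    case True
    show ?thesis
      by (rule that[of "{y. accessible \<Omega> Q g y \<and> (\<exists>i. x \<in> frontier (Q i) \<and> y \<in> frontier (Q i))}"])
         (use True False in \<open>auto simp: normalized_version_def\<close>)
  next
    case F: False
    show ?thesis
      by (rule that[of "{y. accessible \<Omega> Q g y}"]) (use F False in \<open>auto simp: normalized_version_def\<close>)
  qed
  let ?F = "at x within A"
  have L: "Liminf ?F (access_value \<Omega> Q g) = ereal (u x)" using A(1) norm[OF x(2)] by simp
  then have nb: "?F \<noteq> bot" by (intro Liminf_finite_not_bot[of _ "access_value \<Omega> Q g"]) simp
  have ev: "eventually (\<lambda>y. ereal m \<le> access_value \<Omega> Q g y \<and> access_value \<Omega> Q g y \<le> ereal M) ?F"
  proof -
    have "eventually (\<lambda>y. y \<in> V) (nhds x)" using V x(1) by (rule eventually_nhds_in_open)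
    then have "eventually (\<lambda>y. y \<in> V \<and> y \<in> A) ?F"
      unfolding eventually_at_filter by (rule eventually_mono) auto
    then show ?thesis
    proof (rule eventually_mono)
      fix y assume "y \<in> V \<and> y \<in> A"
      then have y: "y \<in> V" "accessible \<Omega> Q g y" using A(2) by auto
      show "ereal m \<le> access_value \<Omega> Q g y \<and> access_value \<Omega> Q g y \<le> ereal M"
        using accessible_bounds[OF V y b] accessible_value[OF y(2)] by simp
    qed
  qed
  have lower: "ereal m \<le> Liminf ?F (access_value \<Omega> Q g)"
    by (rule Liminf_bounded) (use ev in \<open>auto elim: eventually_mono\<close>)
  have "Limsup ?F (access_value \<Omega> Q g) \<le> ereal M"
    by (rule Limsup_bounded) (use ev in \<open>auto elim: eventually_mono\<close>)
  with Liminf_le_Limsup[OF nb] have "Liminf ?F (access_value \<Omega> Q g) \<le> ereal M" by (rule order_trans)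
  with lower show ?thesis unfolding L ereal_less_eq by (rule conjI)
qed

end

section \<open>The Harnack inequality\<close>

text \<open>A frame of half-side \<open>t > s\<close> surrounds the square of half-side
  \<open>s\<close>. On the carpet points of the frame, and on the circles of disks it crosses,
  \<open>f\<close> stays within \<open>9 * D + (E + 1)\<close> of one value; the maximum principle
  is applied to \<open>u\<close> after undoing the logarithm.\<close>

lemma local_oscillation:
  assumes u: "carpet_harmonic v \<Omega> Q (\<lambda>z. ereal (u z))" and u0: "\<And>z. z \<in> S \<Longrightarrow> 0 \<le> u z"
    and nm: "normalized v \<Omega> Q (\<lambda>z. ereal (u z))"
    and f: "f = (\<lambda>z. ln (u z + \<epsilon>))" and \<epsilon>: "0 < \<epsilon>" and fbf: "fb f"
    and s: "0 < s" and cpt: "compactly_in (ball p (4 * s)) \<Omega>"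
    and E: "sum_along Q (\<lambda>i. (ennreal (os f i))\<^sup>2) (ball p (4 * s)) \<le> ennreal E" "0 \<le> E"
    and zw: "z \<in> S" "z \<in> box_at p s" "w \<in> S" "w \<in> box_at p s"
  shows "\<bar>f z - f w\<bar> \<le> 2 * (9 * (32 * (E + 64 / K1)) + (E + 1))"
proof -
  \<comment> \<open>The frame bound of \<open>good_hash\<close> with weight
    \<open>k = 1\<close>.\<close>
  define D where "D = 32 * (E + 64 / K1)"
  have D0: "0 \<le> D" using E K1 by (simp add: D_def)
  have ballO: "ball p (4 * s) \<subseteq> \<Omega>" using cpt closure_subset unfolding compactly_in_def by blast
  have uW: "(\<lambda>z. ereal (u z)) \<in> W12_loc v \<Omega> Q" using u by (simp add: carpet_harmonic_def)
  note uD = W12_locD[OF uW]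
  have "ug f (\<lambda>i. ennreal (1 / \<epsilon>) * ennreal (os u i))"
  proof (rule ug_compose[OF uD(2)])
    fix x y assume xy: "x \<in> S" "y \<in> S"
    have ln_le: "ln a - ln b \<le> 1 / \<epsilon> * \<bar>a - b\<bar>" if "\<epsilon> \<le> a" "\<epsilon> \<le> b" for a b
    proof -
      have ab: "0 < a" "0 < b" using that \<epsilon> by auto
      have "ln a - ln b = ln (a / b)" using ab by (simp add: ln_div)
      also have "\<dots> \<le> a / b - 1" using ab by (intro ln_le_minus_one) auto
      also have "\<dots> = (a - b) / b" using ab by (simp add: field_simps)
      also have "\<dots> \<le> \<bar>a - b\<bar> / \<epsilon>" using ab that \<epsilon> by (intro frac_le) auto
      finally show ?thesis by simp
    qed
    have "\<epsilon> \<le> u x + \<epsilon>" "\<epsilon> \<le> u y + \<epsilon>" using u0 xy by auto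
    from ln_le[OF this] ln_le[OF this(2,1)] show "\<bar>f x - f y\<bar> \<le> 1 / \<epsilon> * \<bar>u x - u y\<bar>"
      by (auto simp: f abs_le_iff abs_minus_commute)
  qed (use \<epsilon> in auto)
  then have ugf: "ug f (\<lambda>i. ennreal (os f i))"
    by (rule ug_osc[OF fbf]) (intro loc_l2_cmult uD(3))
  obtain \<Gamma> where \<Gamma>: "null \<Gamma>" "\<And>\<gamma>. \<gamma> \<in> paths_in \<Omega> - \<Gamma> \<Longrightarrow> ugood f (\<lambda>i. ennreal (os f i)) \<gamma>"
    using ugf unfolding ug_def by blast
  have fin: "sum_along Q (\<lambda>i. (ennreal (os f i))\<^sup>2) (ball p (4 * s)) < \<infinity>"
    by (rule le_less_trans[OF E(1)]) simp
  have "AE t in lborel. True" by simp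
  from good_hash[OF s zero_less_one fin \<Gamma>(1) this] obtain t where t: "s < t" "t < 2 * s"
    "\<And>d \<tau>. (d, \<tau>) \<in> hash t \<Longrightarrow> hs p s d \<tau> \<notin> \<Gamma>"
    "hash_sum p s (\<lambda>i. ennreal (os f i)) t \<le> 32 * (ennreal 1 * sum_along Q (\<lambda>i. (ennreal (os f i))\<^sup>2) (ball p (4 * s)) + ennreal (64 / K1 / 1))"
    by blast
  have t0: "0 < t" using s t by simp
  have hsum: "hash_sum p s (\<lambda>i. ennreal (os f i)) t \<le> ennreal D"
  proof -
    have "hash_sum p s (\<lambda>i. ennreal (os f i)) t \<le> 32 * (ennreal 1 * ennreal E + ennreal (64 / K1 / 1))"
      by (rule order_trans[OF t(4)]) (intro mult_left_mono add_mono E order_refl, auto)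
    also have "ennreal 1 * ennreal E + ennreal (64 / K1 / 1) = ennreal (E + 64 / K1)" using E K1 by simp
    also have "32 * ennreal (E + 64 / K1) = ennreal D" unfolding D_def using E K1 by (subst ennreal_mult) simp_all
    finally show ?thesis .
  qed
  have hash_g: "ugood f (\<lambda>i. ennreal (os f i)) (hs p s d \<tau>)" if "(d, \<tau>) \<in> hash t" for d \<tau>
  proof -
    have "\<bar>\<tau>\<bar> < 2 * s" using that t0 t by (auto simp: hash_def)
    then have "hs p s d \<tau> \<in> paths_in \<Omega>" using trace_hs_ball ballO s by (intro hs_paths_in) blast+
    then show ?thesis using \<Gamma>(2) t(3)[OF that] by blast
  qed
  \<comment> \<open>\<open>E + 1\<close> stands in for the square root of \<open>E\<close>.\<close>
  have osE: "os f i \<le> E + 1" if i: "i \<in> meeting Q (ball p (4 * s))" for i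
  proof -
    have "ennreal ((os f i)\<^sup>2) \<le> ennreal E"
      using order_trans[OF sum_along_ge_term[OF i, of "\<lambda>i. (ennreal (os f i))\<^sup>2"] E(1)] os_nonneg[OF fbf, of i]
      by (simp add: ennreal_power)
    then have "(os f i)\<^sup>2 \<le> E" using E(2) by (simp add: ennreal_le_iff)
    moreover have "E * 1 \<le> (E + 1)\<^sup>2" using E(2) by (simp add: power2_eq_square algebra_simps)
    ultimately have "(os f i)\<^sup>2 \<le> (E + 1)\<^sup>2" by linarith
    then show ?thesis by (rule power2_le_imp_le) (use E(2) in simp)
  qed
  have near: "\<bar>ext f x - ext f y\<bar> \<le> 9 * D" if xy: "x \<in> hash_set p s t" "y \<in> hash_set p s t" for x y
  proof -
    obtain d \<tau> where 1: "(d, \<tau>) \<in> hash t" "x \<in> trace (hs p s d \<tau>)" using xy(1) unfolding hash_set_def by blast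
    obtain d' \<tau>' where 2: "(d', \<tau>') \<in> hash t" "y \<in> trace (hs p s d' \<tau>')" using xy(2) unfolding hash_set_def by blast
    show ?thesis by (rule hash_ext[OF fbf s t0 t(2) ballO hash_g hsum D0 1 2])
  qed
  define b where "b = sg True (Re p) (Im p + t)"
  have "(True, t) \<in> hash t" "b \<in> trace (hs p s True t)"
    using s by (auto simp: hash_def trace_hs b_def sg_def al_def)
  then have b: "b \<in> hash_set p s t" unfolding hash_set_def by blast
  define C where "C = 9 * D + (E + 1)"
  define lo hi where "lo = ext f b - C" and "hi = ext f b + C"
  have C0: "0 \<le> C" using D0 E by (simp add: C_def)
  have sub: "hash_set p s t \<subseteq> ball p (4 * s)"
  proof
    fix x assume "x \<in> hash_set p s t"
    then obtain d \<tau> where x: "(d, \<tau>) \<in> hash t" "x \<in> trace (hs p s d \<tau>)" unfolding hash_set_def by blast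
    have "\<bar>\<tau>\<bar> < 2 * s" using x(1) t0 t by (auto simp: hash_def)
    from trace_hs_ball[OF this] x(2) show "x \<in> ball p (4 * s)" by blast
  qed
  define m M where "m = exp lo - \<epsilon>" and "M = exp hi - \<epsilon>"
  have mM: "m \<le> M" using C0 by (simp add: m_def M_def lo_def hi_def)
  have uf: "m \<le> u x \<and> u x \<le> M" if "lo \<le> f x" "f x \<le> hi" "x \<in> S" for x
  proof -
    have pos: "0 < u x + \<epsilon>" using u0[OF that(3)] \<epsilon> by simp
    have "exp lo \<le> u x + \<epsilon>" "u x + \<epsilon> \<le> exp hi"
      using that pos by (simp_all add: f ln_ge_iff ln_le_cancel_iff flip: ln_le_cancel_iff[of _ "exp hi"])
    then show ?thesis by (simp add: m_def M_def)
  qed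
  have bS: "m \<le> u x \<and> u x \<le> M" if x: "x \<in> hash_set p s t" "x \<in> S" for x
  proof (rule uf)
    have "\<bar>f x - ext f b\<bar> \<le> 9 * D" using near[OF x(1) b] ext_S[OF x(2)] by simp
    then show "lo \<le> f x" "f x \<le> hi" using E(2) by (auto simp: lo_def hi_def C_def abs_le_iff)
  qed (rule x)
  have bQ: "m \<le> u y \<and> u y \<le> M" if x: "x \<in> hash_set p s t" "x \<in> Q i" and y: "y \<in> frontier (Q i)" for x i y
  proof (rule uf)
    have "\<bar>MM f i - ext f b\<bar> \<le> 9 * D" using near[OF x(1) b] ext_Q[OF x(2)] by simp
    moreover have "i \<in> meeting Q (ball p (4 * s))" using x sub by (auto simp: meeting_def)
    then have "MM f i - mm f i \<le> E + 1" using osE by (simp add: os_def)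
    moreover have "mm f i \<le> f y" "f y \<le> MM f i" using mm_le[OF fbf y] le_MM[OF fbf y] by auto
    ultimately show "lo \<le> f y" "f y \<le> hi" using E(2) by (auto simp: lo_def hi_def C_def abs_le_iff)
  qed (use y frontier_carpet in blast)
  have mp: "m \<le> mm u i \<and> MM u i \<le> M" if "i \<in> meeting Q (box_at p t)" for i
    by (rule max_principle[OF u u0 s t0 t(2) cpt mM bS bQ that])
  obtain g where g: "g \<in> W12_loc v \<Omega> Q" "\<And>x. x \<in> S \<Longrightarrow> ereal (u x) = normalized_version \<Omega> Q g x"
    using nm unfolding normalized_def by blast
  have fin_bound: "lo \<le> f x \<and> f x \<le> hi" if x: "x \<in> S" "x \<in> box_at p s" for x
  proof -
    have "x \<in> box_at p t" using x(2) t(1) by (auto simp: box_at_def intro: less_trans)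
    from normalized_bounds[OF g refl uD(1) open_box_at this x(1) mp] have "m \<le> u x" "u x \<le> M" by auto
    moreover have pos: "0 < u x + \<epsilon>" using u0[OF x(1)] \<epsilon> by simp
    ultimately show ?thesis
      by (auto simp: f m_def M_def ln_ge_iff) (metis diff_add_cancel add_le_cancel_right ln_exp ln_mono pos le_diff_eq)
  qed
  have "\<bar>f z - f w\<bar> \<le> 2 * C" using fin_bound[OF zw(1,2)] fin_bound[OF zw(3,4)] by (auto simp: lo_def hi_def abs_le_iff)
  then show ?thesis by (simp add: C_def D_def)
qed

text \<open>A part of the ball in \<Omega> outside \<open>K\<close> would be an open subset of the
  carpet, which has empty interior. The ball is then the disjoint union of its parts in \<Omega> and
  outside \<open>K\<close>, so connectedness keeps it inside \<Omega> and \<open>K\<close>, although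
  the enlarged ball is not assumed to lie in \<Omega>.\<close>

lemma ball_subset_of_disks:
  assumes c: "x0 \<in> \<Omega>" "0 < r" and K: "closed K" "K \<subseteq> \<Omega>"
    and sub: "\<And>i. i \<in> meeting Q (ball x0 r) \<Longrightarrow> Q i \<subseteq> K"
  shows "ball x0 r \<subseteq> K"
proof -
  let ?B = "ball x0 r"
  have BO: "?B \<inter> \<Omega> \<subseteq> K"
  proof
    fix z assume z: "z \<in> ?B \<inter> \<Omega>"
    show "z \<in> K"
    proof (rule ccontr)
      assume "z \<notin> K"
      let ?U = "?B \<inter> \<Omega> \<inter> - K"
      have "open ?U" using open_Omega K by auto
      moreover have "?U \<subseteq> S"
      proof
        fix y assume y: "y \<in> ?U"
        have "y \<notin> Q i" for i
        proof
          assume yQ: "y \<in> Q i"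
          then have "i \<in> meeting Q ?B" unfolding meeting_def using y by blast
          then show False using sub yQ y by blast
        qed
        then show "y \<in> S" using y by (auto simp: carpet_def)
      qed
      ultimately have "?U \<subseteq> interior S" by (rule interior_maximal[rotated])
      then show False using z \<open>z \<notin> K\<close> carpet_interior by auto
    qed
  qed
  have "?B - K = {}"
  proof (rule ccontr)
    assume ne: "?B - K \<noteq> {}"
    have "connected ?B" by simp
    moreover have "open (?B \<inter> \<Omega>)" "open (?B - K)" using open_Omega K by (auto intro: open_Diff)
    moreover have "(?B \<inter> \<Omega>) \<inter> (?B - K) \<inter> ?B = {}" using BO by blast
    moreover have "?B \<subseteq> (?B \<inter> \<Omega>) \<union> (?B - K)" using K(2) by blast
    moreover have "(?B \<inter> \<Omega>) \<inter> ?B \<noteq> {}" using c centre_in_ball by blast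
    moreover have "(?B - K) \<inter> ?B \<noteq> {}" using ne by blast
    ultimately show False using connectedD by blast
  qed
  then show ?thesis by blast
qed

text \<open>The segment from \<open>z\<close> to \<open>w\<close> is cut into \<open>n\<close>
  pieces, each inside a square to which \<open>local_oscillation\<close> applies; the term
  \<open>2 * (E + 1)\<close> pays for division points inside peripheral disks, where
  \<open>ext f\<close> replaces \<open>f\<close>.\<close>

lemma harnack_chain:
  assumes u: "carpet_harmonic v \<Omega> Q (\<lambda>z. ereal (u z))" and u0: "\<And>z. z \<in> S \<Longrightarrow> 0 \<le> u z"
    and nm: "normalized v \<Omega> Q (\<lambda>z. ereal (u z))"
    and c: "1 < c0" "1 < c1" and r0: "0 < r0" "ball x0 r0 \<subseteq> \<Omega>" and r1: "0 < r1"
    and B: "(\<Union>i\<in>meeting Q (ball x0 (c0 * r0)). Q i) \<subseteq> ball x1 r1" and cpt: "compactly_in (ball x1 (c1 * r1)) \<Omega>"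
    and E: "E = 384 / K1 * (c1 / (c1 - 1))\<^sup>2" and n: "16 / (c0 - 1) < real n"
    and zw: "z \<in> S" "z \<in> ball x0 r0" "w \<in> S" "w \<in> ball x0 r0"
  shows "u z \<le> exp (n * (2 * (9 * (32 * (E + 64 / K1)) + (E + 1)) + 2 * (E + 1))) * u w"
proof -
  define C2 where "C2 = 2 * (9 * (32 * (E + 64 / K1)) + (E + 1)) + 2 * (E + 1)"
  have E0: "0 \<le> E" using K1 by (simp add: E)
  let ?B = "ball x0 (c0 * r0)"
  have cb: "cball x1 r1 \<subseteq> \<Omega>"
  proof -
    have "r1 < c1 * r1" using c r1 by simp
    then have "cball x1 r1 \<subseteq> ball x1 (c1 * r1)" by auto
    then show ?thesis using cpt closure_subset unfolding compactly_in_def by blast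
  qed
  have rr: "0 < c0 * r0" using c r0 by simp
  have BK: "?B \<subseteq> cball x1 r1"
  proof (rule ball_subset_of_disks[OF _ rr _ cb])
    show "x0 \<in> \<Omega>" using r0 by auto
    show "Q i \<subseteq> cball x1 r1" if "i \<in> meeting Q ?B" for i
      using B that ball_subset_cball[of x1 r1] by blast
  qed simp
  have QB: "Q i \<subseteq> ball x1 r1" if "i \<in> meeting Q ?B" for i using B that by blast
  have main: "ln (u z + \<epsilon>) - ln (u w + \<epsilon>) \<le> n * C2" if \<epsilon>: "\<epsilon> > 0" for \<epsilon>
  proof -
    define f where "f = (\<lambda>z. ln (u z + \<epsilon>))"
    have cac: "fb f" "(\<Sum>i. (ennreal (os f i))\<^sup>2 * indicator {i. Q i \<subseteq> ball x1 r1} i) \<le> ennreal E"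
      unfolding f_def E by (rule caccioppoli[OF u _ \<epsilon> r1 c(2) cpt], erule u0)+
    have fbf: "fb f" by (rule cac(1))
    have sumB: "sum_along Q (\<lambda>i. (ennreal (os f i))\<^sup>2) W \<le> ennreal E" if "W \<subseteq> ?B" for W
    proof -
      have "sum_along Q (\<lambda>i. (ennreal (os f i))\<^sup>2) W \<le> (\<Sum>i. (ennreal (os f i))\<^sup>2 * indicator {i. Q i \<subseteq> ball x1 r1} i)"
        unfolding sum_along_eq using QB meeting_mono[OF that, of Q]
        by (intro suminf_le) (auto simp: indicator_def)
      then show ?thesis using cac(2) by (rule order_trans)
    qed
    have osE: "os f i \<le> E + 1" if i: "i \<in> meeting Q ?B" for i
    proof -
      have "ennreal ((os f i)\<^sup>2) \<le> ennreal E"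
        using order_trans[OF sum_along_ge_term[OF i, of "\<lambda>i. (ennreal (os f i))\<^sup>2"] sumB[OF order_refl]] os_nonneg[OF fbf, of i]
        by (simp add: ennreal_power)
      then have "(os f i)\<^sup>2 \<le> E" using E0 by (simp add: ennreal_le_iff)
      moreover have "E * 1 \<le> (E + 1)\<^sup>2" using E0 by (simp add: power2_eq_square algebra_simps)
      ultimately have "(os f i)\<^sup>2 \<le> (E + 1)\<^sup>2" by linarith
      then show ?thesis by (rule power2_le_imp_le) (use E0 in simp)
    qed
    \<comment> \<open>A ball of radius \<open>4 * s\<close> about a point of
      \<open>ball x0 r0\<close> uses only half the room up to the enlarged ball, and
      \<open>n > 16 / (c0 - 1)\<close> gives \<open>n * s > 2 * r0\<close>, so that \<open>n\<close>
      steps shorter than \<open>s\<close> reach from \<open>z\<close> to \<open>w\<close>.\<close>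
    define s where "s = (c0 - 1) * r0 / 8"
    have s: "0 < s" using c r0 by (simp add: s_def)
    have n0: "0 < real n" by (rule less_trans[OF _ n]) (use c in simp)
    have "16 < n * (c0 - 1)" using n c by (simp add: pos_divide_less_eq)
    then have "16 * (r0 / 8) < n * (c0 - 1) * (r0 / 8)" using r0 by (intro mult_strict_right_mono) auto
    then have ns: "2 * r0 < n * s" by (simp add: s_def mult.assoc)
    define p where "p j = z + of_real (real j / n) * (w - z)" for j :: nat
    have p0: "p 0 = z" and pn: "p n = w" using n0 by (auto simp: p_def)
    have pB: "p j \<in> ball x0 r0" if "j \<le> n" for j
    proof -
      have "p j = (1 - real j / n) *\<^sub>R z + (real j / n) *\<^sub>R w"
        by (simp add: p_def scaleR_conv_of_real algebra_simps add_divide_distrib diff_divide_distrib)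
      moreover have "0 \<le> real j / n" "real j / n \<le> 1" using that n0 by auto
      ultimately show ?thesis using convexD_alt[OF convex_ball zw(2,4)] by simp
    qed
    have dpp: "dist (p j) (p (Suc j)) < s" for j
    proof -
      have "p j - p (Suc j) = of_real (- 1 / n) * (w - z)"
        using n0 by (simp add: p_def field_simps)
      then have "dist (p j) (p (Suc j)) = \<bar>- 1 / real n\<bar> * dist w z"
        by (simp only: dist_norm norm_mult norm_of_real)
      then have "dist (p j) (p (Suc j)) = dist w z / n" using n0 by simp
      moreover have "dist w z < 2 * r0" using zw dist_triangle3[of w z x0] by (simp add: dist_commute)
      then have "dist w z < s * n" using ns by (simp add: mult.commute)
      then have "dist w z / n < s" using n0 by (simp add: pos_divide_less_eq)
      ultimately show ?thesis by simp
    qed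
    have ballp: "ball q (4 * s) \<subseteq> ?B" if "q \<in> ball x0 r0" for q
    proof
      fix y assume "y \<in> ball q (4 * s)"
      then have "dist x0 y < r0 + 4 * s" using that dist_triangle[of x0 y q] by auto
      also have "\<dots> \<le> c0 * r0"
      proof -
        have "0 < (c0 - 1) * r0" using c r0 by simp
        moreover have "4 * s = (c0 - 1) * r0 / 2" by (simp add: s_def)
        moreover have "(c0 - 1) * r0 = c0 * r0 - r0" by (simp add: left_diff_distrib)
        ultimately show ?thesis by linarith
      qed
      finally show "y \<in> ?B" by simp
    qed
    have step: "\<bar>ext f (p j) - ext f (p (Suc j))\<bar> \<le> C2" if j: "j < n" for j
    proof -
      let ?T = "closed_segment (p j) (p (Suc j))"
      have qB: "p j \<in> ball x0 r0" using pB j by simp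
      have Tbox: "?T \<subseteq> box_at (p j) s"
      proof
        fix y assume "y \<in> ?T"
        then have "dist (p j) y \<le> dist (p j) (p (Suc j))" using dist_in_closed_segment[of y "p j" "p (Suc j)"] by (simp add: dist_commute)
        then have "dist (p j) y < s" using dpp[of j] by linarith
        then show "y \<in> box_at (p j) s"
          unfolding box_at_def using abs_al_le_dist[of _ y "p j"] by (auto simp: dist_commute intro: le_less_trans)
      qed
      have Tball: "?T \<subseteq> ?B" using Tbox box_at_ball[of s s "p j"] ballp[OF qB] s by auto
      have TO: "?T \<subseteq> \<Omega>" using Tball BK cb by blast
      have cpt4: "compactly_in (ball (p j) (4 * s)) \<Omega>"
      proof -
        have "closure (ball (p j) (4 * s)) \<subseteq> cball x1 r1"
          using closure_minimal[OF order_trans[OF ballp[OF qB] BK]] by simp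
        then show ?thesis using cb unfolding compactly_in_def by (auto simp: compact_closure)
      qed
      have "\<bar>ext f (p j) - ext f (p (Suc j))\<bar> \<le> 2 * (9 * (32 * (E + 64 / K1)) + (E + 1)) + 2 * (E + 1)"
      proof (rule ext_diff_le[OF fbf _ TO])
        show "\<bar>f x - f y\<bar> \<le> 2 * (9 * (32 * (E + 64 / K1)) + (E + 1))" if "x \<in> ?T \<inter> S" "y \<in> ?T \<inter> S" for x y
          using that Tbox by (intro local_oscillation[OF u u0 nm f_def \<epsilon> fbf s cpt4 sumB[OF ballp[OF qB]] E0]) auto
        show "os f i \<le> E + 1" if "i \<in> meeting Q ?T" for i using osE meeting_mono[OF Tball, of Q] that by blast
      qed (use E0 K1 in auto)
      then show ?thesis by (simp add: C2_def)
    qed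
    have "\<bar>ext f (p 0) - ext f (p j)\<bar> \<le> j * C2" if "j \<le> n" for j
      using that
    proof (induction j)
      case (Suc j)
      then have "\<bar>ext f (p 0) - ext f (p j)\<bar> \<le> j * C2" "\<bar>ext f (p j) - ext f (p (Suc j))\<bar> \<le> C2" using step by auto
      then show ?case by (simp add: algebra_simps)
    qed simp
    from this[of n] have "\<bar>f z - f w\<bar> \<le> n * C2" using ext_S[OF zw(1)] ext_S[OF zw(3)] by (simp add: p0 pn)
    then show ?thesis by (simp add: f_def)
  qed
  have "u z \<le> exp (n * C2) * u w"
  proof (rule field_le_epsilon)
    fix e :: real assume e: "e > 0"
    \<comment> \<open>Chosen so that the error \<open>exp (n * C2) * \<epsilon>\<close> is exactly
      \<open>e\<close>.\<close>
    define \<epsilon> where "\<epsilon> = e / exp (n * C2)"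
    have \<epsilon>: "\<epsilon> > 0" using e by (simp add: \<epsilon>_def)
    have pos: "0 < u z + \<epsilon>" "0 < u w + \<epsilon>" using u0[OF zw(1)] u0[OF zw(3)] \<epsilon> by auto
    have "ln (u z + \<epsilon>) \<le> n * C2 + ln (u w + \<epsilon>)" using main[OF \<epsilon>] by simp
    then have "exp (ln (u z + \<epsilon>)) \<le> exp (n * C2 + ln (u w + \<epsilon>))" by simp
    then have "u z + \<epsilon> \<le> exp (n * C2) * (u w + \<epsilon>)" using pos by (simp add: exp_add)
    then have "u z \<le> exp (n * C2) * (u w + \<epsilon>)" using \<epsilon> by linarith
    also have "\<dots> = exp (n * C2) * u w + e" by (simp add: \<epsilon>_def distrib_left)
    finally show "u z \<le> exp (n * C2) * u w + e" .
  qed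
  then show ?thesis by (simp add: C2_def)
qed

end

text \<open>The topological properties of the disks come from the Jordan curve theorem.\<close>

lemma sierpinski_of_standing_carpet:
  assumes "standing_carpet K0 K1 \<Omega> Q" "K1 > 0"
  shows "sierpinski K1 \<Omega> Q"
proof -
  have rc: "relative_carpet \<Omega> Q" "emeasure lborel (carpet \<Omega> Q) = 0" "fat K1 Q"
    using assms(1) by (auto simp: standing_carpet_def)
  have J: "open (Q i) \<and> connected (Q i) \<and> bounded (Q i) \<and> Q i \<noteq> {}" for i
  proof -
    obtain c where c: "simple_path c" "pathfinish c = pathstart c" "Q i = inside (path_image c)"
      using rc(1) unfolding relative_carpet_def open_Jordan_region_def by blast
    then show ?thesis using Jordan_inside_outside[OF c(1,2)] by simp
  qed
  show ?thesis
    using rc J assms(2) by unfold_locales (auto simp: relative_carpet_def compactly_in_def)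
qed

theorem theorem2p77:
  fixes v :: version and c0 c1 K0 K1 :: real
  assumes "c0 > 1" and "c1 > 1" and "K0 \<ge> 1" and "K1 > 0"
  shows "\<exists>H :: real. H > 1 \<and>
    (\<forall>(\<Omega> :: complex set) (Q :: nat \<Rightarrow> complex set) (u :: complex \<Rightarrow> real).
       standing_carpet K0 K1 \<Omega> Q \<longrightarrow>
       (\<forall>z \<in> carpet \<Omega> Q. u z \<ge> 0) \<longrightarrow>
       carpet_harmonic v \<Omega> Q (\<lambda>z. ereal (u z)) \<longrightarrow>
       normalized v \<Omega> Q (\<lambda>z. ereal (u z)) \<longrightarrow>
       (\<forall>x0 r0. 0 < r0 \<and> ball x0 r0 \<subseteq> \<Omega> \<and>
          (\<exists>x1 r1. 0 < r1 \<and> ball x1 r1 \<subseteq> \<Omega> \<and>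
             (\<Union>i\<in>meeting Q (ball x0 (c0 * r0)). Q i) \<subseteq> ball x1 r1 \<and>
             ball x1 r1 \<subseteq> ball x1 (c1 * r1) \<and>
             compactly_in (ball x1 (c1 * r1)) \<Omega>) \<longrightarrow>
          (SUP z \<in> carpet \<Omega> Q \<inter> ball x0 r0. ereal (u z))
            \<le> ereal H * (INF z \<in> carpet \<Omega> Q \<inter> ball x0 r0. ereal (u z))))"
proof -
  define E where "E = 384 / K1 * (c1 / (c1 - 1))\<^sup>2"
  obtain n :: nat where n: "16 / (c0 - 1) < real n" using reals_Archimedean2 by blast
  define H where "H = exp (n * (2 * (9 * (32 * (E + 64 / K1)) + (E + 1)) + 2 * (E + 1)))"
  have E0: "0 \<le> E" using assms(4) by (simp add: E_def)
  have n0: "0 < real n" by (rule less_trans[OF _ n]) (use assms(1) in simp)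
  have "0 < 2 * (9 * (32 * (E + 64 / K1)) + (E + 1)) + 2 * (E + 1)"
    using E0 assms(4) by (intro add_nonneg_pos) auto
  then have H1: "H > 1" using n0 by (simp add: H_def)
  show ?thesis
  proof (intro exI conjI allI impI)
    show "H > 1" by (rule H1)
    fix \<Omega> :: "complex set" and Q :: "nat \<Rightarrow> complex set" and u :: "complex \<Rightarrow> real" and x0 :: complex and r0 :: real
    assume sc: "standing_carpet K0 K1 \<Omega> Q" and u0: "\<forall>z \<in> carpet \<Omega> Q. u z \<ge> 0"
      and u: "carpet_harmonic v \<Omega> Q (\<lambda>z. ereal (u z))" and nm: "normalized v \<Omega> Q (\<lambda>z. ereal (u z))"
      and B: "0 < r0 \<and> ball x0 r0 \<subseteq> \<Omega> \<and>
          (\<exists>x1 r1. 0 < r1 \<and> ball x1 r1 \<subseteq> \<Omega> \<and>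
             (\<Union>i\<in>meeting Q (ball x0 (c0 * r0)). Q i) \<subseteq> ball x1 r1 \<and>
             ball x1 r1 \<subseteq> ball x1 (c1 * r1) \<and>
             compactly_in (ball x1 (c1 * r1)) \<Omega>)"
    interpret sierpinski v K1 \<Omega> Q by (rule sierpinski_of_standing_carpet[OF sc assms(4)])
    let ?A = "carpet \<Omega> Q \<inter> ball x0 r0"
    have har: "u z \<le> H * u w" if "z \<in> ?A" "w \<in> ?A" for z w
      using B that u0 unfolding H_def
      by (elim conjE exE) (rule harnack_chain[OF u _ nm assms(1,2) _ _ _ _ _ E_def n]; auto)
    show "(SUP z \<in> ?A. ereal (u z)) \<le> ereal H * (INF z \<in> ?A. ereal (u z))"
    \<comment> \<open>For an empty intersection the supremum is minus infinity.\<close>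
    proof (cases "?A = {}")
      case True
      then show ?thesis by (simp add: bot_ereal_def)
    next
      case False
      have bb: "bdd_below (u ` ?A)" using u0 by (intro bdd_belowI[of _ 0]) auto
      \<comment> \<open>A real infimum, so that division by \<open>H\<close> takes place in the
        reals.\<close>
      define I where "I = Inf (u ` ?A)"
      have "ereal I \<le> (INF z\<in>?A. ereal (u z))"
        unfolding I_def using bb by (intro INF_greatest) (auto intro!: cINF_lower)
      then have "ereal H * ereal I \<le> ereal H * (INF z\<in>?A. ereal (u z))"
        using H1 by (intro ereal_mult_left_mono) auto
      moreover have "(SUP z \<in> ?A. ereal (u z)) \<le> ereal H * ereal I"
      proof (rule SUP_least)
        fix z assume z: "z \<in> ?A"
        have "u z / H \<le> I"
          unfolding I_def using False har[OF z] H1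
          by (intro cINF_greatest) (auto simp: divide_le_eq mult.commute)
        then have "u z \<le> H * I" using H1 by (simp add: divide_le_eq mult.commute)
        then show "ereal (u z) \<le> ereal H * ereal I" by simp
      qed
      ultimately show ?thesis by (rule order_trans[rotated])
    qed
  qed
qed

end
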